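(* Let $(\mathcal M,\delta)\models T_g^\delta$, let $B\subseteq M$, and fix $p\in\mathbb N$. For every finite collection $\mathcal A=\{A_1,\ldots,A_l\}$ of $\mathcal L^\delta(B)$-definable subsets of $M^k$, there is a finite $\delta$-decomposition $\mathcal D$ of $M^k$, definable over $B$, compatible with $\mathcal A$, such that every $D\in\mathcal D$ admits a source formula $\varphi$ whose source cell $D_\varphi^{\mathcal L}$ is of class $\mathcal C^p$.
   Context: $T$ is a complete o-minimal theory expanding the theory of real closed ordered fields in a language $\mathcal L$, with quantifier elimination and universally axiomatizable. $\mathcal L^\delta=\mathcal L\cup\{\delta\}$ with $\delta$ a unary function symbol. A $T$-derivation on $\mathcal M\models T$ is a map $\delta:M\to M$ such that $\delta f(u)=\mathbf J_f(u)\,\delta u$ for every $\mathcal L(\varnothing)$-definable $\mathcal C^1$-function $f:U\to M$ with $U\subseteq M^n$ open and every $u\in U$ ($\mathbf J_f$ is the Jacobian). $T_g^\delta$ is the theory of pairs $(\mathcal M,\delta)$ with $\mathcal M\models T$ and $\delta$ a $T$-derivation that is generic: for every $n\in\mathbb N$ and every $\mathcal L(M)$-definable $A\subseteq M^{n+1}$, if the projection of $A$ to the first $n$ coordinates has dimension $n$, then there is $a\in M$ with $(a,\delta a,\ldots,\delta^n a)\in A$. Jets: for $n=(n_1,\ldots,n_k)\in\mathbb N^k$, $E_n=\prod_{i=1}^k M^{n_i+1}$ (Euclidean topology) and $\operatorname{Jet}_n(a)=(a_1,\delta a_1,\ldots,\delta^{n_1}a_1,\ldots,a_k,\ldots,\delta^{n_k}a_k)\in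 E_n$ for $a\in M^k$. Source formulas: let $\varphi(x)$, $x=(x_1,\ldots,x_k)$, be a quantifier-free $\mathcal L^\delta(B)$-formula (in which $\delta$ is applied to variables in the form $\delta^jx_i$). $\operatorname{ord}(\varphi)=(n_1,\ldots,n_k)$, where $n_i$ is the largest integer such that $\delta^{n_i}x_i$ occurs in $\varphi$ ($n_i=0$ if no derivative of $x_i$ occurs). If $\varphi$ defines $C\subseteq M^k$ and $n=\operatorname{ord}(\varphi)$, $C_\varphi^{\mathcal L}\subseteq E_n$ is the set defined by the $\mathcal L$-formula obtained by replacing each $\delta^jx_i$ by the coordinate $x_i^{(j)}$ of $E_n$. $\varphi$ is a source formula for $C$ if it defines $C$, $C_\varphi^{\mathcal L}$ is an o-minimal cell, and $\operatorname{Jet}_n(C)$ is Euclidean dense in $C_\varphi^{\mathcal L}$; then $C_\varphi^{\mathcal L}$ is the source cell of $C$ with respect to $\varphi$. A $\delta$-cell is a set admitting a source formula. A cell is of class $\mathcal C^p$ if the functions defining it are of class $\mathcal C^p$. A finite collection $\mathcal D$ of $\delta$-cells in $M^k$ is a $\delta$-decomposition of $M^k$ if it is a partition of $M^k$ and, when $k>1$, the collection $\{\Pi_{k-1}(D):D\in\mathcal D\}$ (repetitions removed), where $\Pi_{k-1}$ is the projection to the first $k-1$ coordinates, is a $\delta$-decomposition of $M^{k-1}$. It is compatible with $A_1,\ldots,A_l$ if for every $D\in\mathcal D$ and every $i$, either $D\subseteq A_i$ or $D\cap A_i=\varnothing$. *)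

theory Defs
  imports "HOL-Algebra.Polynomials" "HOL-Library.Disjoint_Sets"
begin

section \<open>First-order syntax\<close>

text \<open>
  All elements of \<open>'f\<close> are function symbols (constants are the symbols of arity 0) and all elements
  of \<open>'r\<close> are relation symbols. Variables are natural numbers.
\<close>

datatype (syms_tm: 'f) tm = Var nat | Fn 'f "'f tm list"

datatype (syms_fm: 'f, rels_fm: 'r) fm =
  Eq "'f tm" "'f tm"
| Rel 'r "'f tm list"
| Neg "('f, 'r) fm"
| Conj "('f, 'r) fm" "('f, 'r) fm"
| All nat "('f, 'r) fm"

record ('f, 'r) lang =
  farity :: "'f \<Rightarrow> nat"
  rarity :: "'r \<Rightarrow> nat"

record ('f, 'r) ord_ring_lang = "('f, 'r) lang" +
  zero_sym :: 'f
  one_sym :: 'f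
  plus_sym :: 'f
  times_sym :: 'f
  minus_sym :: 'f \<comment> \<open>unary minus\<close>
  less_sym :: 'r

definition expands_ord_ring_lang :: "('f, 'r, 'z) ord_ring_lang_scheme \<Rightarrow> bool" where
  "expands_ord_ring_lang L \<longleftrightarrow>
     farity L (zero_sym L) = 0 \<and> farity L (one_sym L) = 0 \<and>
     farity L (plus_sym L) = 2 \<and> farity L (times_sym L) = 2 \<and>
     farity L (minus_sym L) = 1 \<and> rarity L (less_sym L) = 2"

primrec wf_tm :: "('f, 'r, 'z) lang_scheme \<Rightarrow> 'f tm \<Rightarrow> bool" where
  "wf_tm L (Var i) \<longleftrightarrow> True"
| "wf_tm L (Fn f ts) \<longleftrightarrow> length ts = farity L f \<and> (\<forall>b \<in> set (map (wf_tm L) ts). b)"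

primrec wf_fm :: "('f, 'r, 'z) lang_scheme \<Rightarrow> ('f, 'r) fm \<Rightarrow> bool" where
  "wf_fm L (Eq s t) \<longleftrightarrow> wf_tm L s \<and> wf_tm L t"
| "wf_fm L (Rel r ts) \<longleftrightarrow> length ts = rarity L r \<and> (\<forall>t \<in> set ts. wf_tm L t)"
| "wf_fm L (Neg \<phi>) \<longleftrightarrow> wf_fm L \<phi>"
| "wf_fm L (Conj \<phi> \<psi>) \<longleftrightarrow> wf_fm L \<phi> \<and> wf_fm L \<psi>"
| "wf_fm L (All v \<phi>) \<longleftrightarrow> wf_fm L \<phi>"

primrec fv_tm :: "'f tm \<Rightarrow> nat set" where
  "fv_tm (Var i) = {i}"
| "fv_tm (Fn f ts) = \<Union> (set (map fv_tm ts))"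

primrec fv_fm :: "('f, 'r) fm \<Rightarrow> nat set" where
  "fv_fm (Eq s t) = fv_tm s \<union> fv_tm t"
| "fv_fm (Rel r ts) = (\<Union>t \<in> set ts. fv_tm t)"
| "fv_fm (Neg \<phi>) = fv_fm \<phi>"
| "fv_fm (Conj \<phi> \<psi>) = fv_fm \<phi> \<union> fv_fm \<psi>"
| "fv_fm (All v \<phi>) = fv_fm \<phi> - {v}"

primrec quantifier_free :: "('f, 'r) fm \<Rightarrow> bool" where
  "quantifier_free (Eq s t) \<longleftrightarrow> True"
| "quantifier_free (Rel r ts) \<longleftrightarrow> True"
| "quantifier_free (Neg \<phi>) \<longleftrightarrow> quantifier_free \<phi>"
| "quantifier_free (Conj \<phi> \<psi>) \<longleftrightarrow> quantifier_free \<phi> \<and> quantifier_free \<psi>"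
| "quantifier_free (All v \<phi>) \<longleftrightarrow> False"

definition sentence :: "('f, 'r, 'z) lang_scheme \<Rightarrow> ('f, 'r) fm \<Rightarrow> bool" where
  "sentence L \<phi> \<longleftrightarrow> wf_fm L \<phi> \<and> fv_fm \<phi> = {}"

inductive universal :: "('f, 'r) fm \<Rightarrow> bool" where
  "quantifier_free \<phi> \<Longrightarrow> universal \<phi>"
| "universal \<phi> \<Longrightarrow> universal (All v \<phi>)"


section \<open>Structures and theories\<close>

record ('u, 'f, 'r) struct =
  univ :: "'u set"
  fint :: "'f \<Rightarrow> 'u list \<Rightarrow> 'u"
  rint :: "'r \<Rightarrow> 'u list \<Rightarrow> bool"

definition is_struct :: "('f, 'r, 'z) lang_scheme \<Rightarrow> ('u, 'f, 'r) struct \<Rightarrow> bool" where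
  "is_struct L S \<longleftrightarrow> univ S \<noteq> {} \<and>
     (\<forall>f xs. length xs = farity L f \<and> set xs \<subseteq> univ S \<longrightarrow> fint S f xs \<in> univ S)"

primrec eval_tm :: "('u, 'f, 'r) struct \<Rightarrow> (nat \<Rightarrow> 'u) \<Rightarrow> 'f tm \<Rightarrow> 'u" where
  "eval_tm S e (Var i) = e i"
| "eval_tm S e (Fn f ts) = fint S f (map (eval_tm S e) ts)"

primrec sat :: "('u, 'f, 'r) struct \<Rightarrow> (nat \<Rightarrow> 'u) \<Rightarrow> ('f, 'r) fm \<Rightarrow> bool" where
  "sat S e (Eq s t) \<longleftrightarrow> eval_tm S e s = eval_tm S e t"
| "sat S e (Rel r ts) \<longleftrightarrow> rint S r (map (eval_tm S e) ts)"
| "sat S e (Neg \<phi>) \<longleftrightarrow> \<not> sat S e \<phi>"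
| "sat S e (Conj \<phi> \<psi>) \<longleftrightarrow> sat S e \<phi> \<and> sat S e \<psi>"
| "sat S e (All v \<phi>) \<longleftrightarrow> (\<forall>a \<in> univ S. sat S (e(v := a)) \<phi>)"

text \<open>Truth of the universal closure; for a sentence this is truth in \<open>S\<close>.\<close>

definition valid :: "('u, 'f, 'r) struct \<Rightarrow> ('f, 'r) fm \<Rightarrow> bool" where
  "valid S \<phi> \<longleftrightarrow> (\<forall>e. range e \<subseteq> univ S \<longrightarrow> sat S e \<phi>)"

definition is_model ::
  "('f, 'r, 'z) lang_scheme \<Rightarrow> ('f, 'r) fm set \<Rightarrow> ('u, 'f, 'r) struct \<Rightarrow> bool" where
  "is_model L T S \<longleftrightarrow> is_struct L S \<and> (\<forall>\<phi> \<in> T. valid S \<phi>)"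

text \<open>
  HOL cannot quantify over structures of all types at once, so notions about ``all models of \<open>T\<close>''
  take a type argument \<open>'u\<close> and range over the models whose universe is a subset of \<open>'u\<close>.
  By the downward Loewenheim--Skolem theorem this loses nothing for consequence, completeness,
  quantifier elimination, universal axiomatizability and membership of all models in an elementary
  class as soon as \<open>'u\<close> has at least as many elements as there are formulas. For o-minimality one
  uses in addition that it passes between elementarily equivalent structures (Knight, Pillay and
  Steinhorn). The type \<open>'a + ('f, 'r) fm\<close> is always large enough, and it contains a copy of every
  structure with universe in \<open>'a\<close>.
\<close>

definition entails ::
  "'u itself \<Rightarrow> ('f, 'r, 'z) lang_scheme \<Rightarrow> ('f, 'r) fm set \<Rightarrow> ('f, 'r) fm \<Rightarrow> bool" where
  "entails u L T \<phi> \<longleftrightarrow> (\<forall>S :: ('u, 'f, 'r) struct. is_model L T S \<longrightarrow> valid S \<phi>)"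

definition complete_theory ::
  "'u itself \<Rightarrow> ('f, 'r, 'z) lang_scheme \<Rightarrow> ('f, 'r) fm set \<Rightarrow> bool" where
  "complete_theory u L T \<longleftrightarrow>
     (\<forall>\<phi> \<in> T. sentence L \<phi>) \<and>
     (\<exists>S :: ('u, 'f, 'r) struct. is_model L T S) \<and>
     (\<forall>\<phi>. sentence L \<phi> \<longrightarrow> entails u L T \<phi> \<or> entails u L T (Neg \<phi>))"

definition has_QE ::
  "'u itself \<Rightarrow> ('f, 'r, 'z) lang_scheme \<Rightarrow> ('f, 'r) fm set \<Rightarrow> bool" where
  "has_QE u L T \<longleftrightarrow>
     (\<forall>\<phi>. wf_fm L \<phi> \<longrightarrow>
       (\<exists>\<psi>. wf_fm L \<psi> \<and> quantifier_free \<psi> \<and> fv_fm \<psi> \<subseteq> fv_fm \<phi> \<and>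
         (\<forall>S :: ('u, 'f, 'r) struct. is_model L T S \<longrightarrow>
           (\<forall>e. range e \<subseteq> univ S \<longrightarrow> (sat S e \<phi> \<longleftrightarrow> sat S e \<psi>)))))"

definition universally_axiomatizable ::
  "'u itself \<Rightarrow> ('f, 'r, 'z) lang_scheme \<Rightarrow> ('f, 'r) fm set \<Rightarrow> bool" where
  "universally_axiomatizable u L T \<longleftrightarrow>
     (\<exists>U. (\<forall>\<phi> \<in> U. sentence L \<phi> \<and> universal \<phi>) \<and>
          (\<forall>S :: ('u, 'f, 'r) struct. is_model L T S \<longleftrightarrow> is_model L U S))"


subsection \<open>Parameters and definable sets\<close>

datatype ('f, 'u) psym = Sym 'f | Par 'u

definition param_lang :: "('f, 'r, 'z) lang_scheme \<Rightarrow> (('f, 'u) psym, 'r) lang" where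
  "param_lang L = \<lparr>farity = (\<lambda>s. case s of Sym f \<Rightarrow> farity L f | Par a \<Rightarrow> 0), rarity = rarity L\<rparr>"

definition param_struct :: "('u, 'f, 'r) struct \<Rightarrow> ('u, ('f, 'u) psym, 'r) struct" where
  "param_struct S = \<lparr>univ = univ S,
     fint = (\<lambda>s xs. case s of Sym f \<Rightarrow> fint S f xs | Par a \<Rightarrow> a), rint = rint S\<rparr>"

definition params :: "(('f, 'u) psym, 'r) fm \<Rightarrow> 'u set" where
  "params \<phi> = {a. Par a \<in> syms_fm \<phi>}"

definition tuples :: "'u set \<Rightarrow> nat \<Rightarrow> 'u list set" where
  "tuples A n = {xs. length xs = n \<and> set xs \<subseteq> A}"

definition defined_set ::
  "('u, 'f, 'r) struct \<Rightarrow> nat \<Rightarrow> (('f, 'u) psym, 'r) fm \<Rightarrow> 'u list set" where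
  "defined_set S n \<phi> = {xs \<in> tuples (univ S) n. sat (param_struct S) ((!) xs) \<phi>}"

definition definable ::
  "('f, 'r, 'z) lang_scheme \<Rightarrow> ('u, 'f, 'r) struct \<Rightarrow> 'u set \<Rightarrow> nat \<Rightarrow> 'u list set \<Rightarrow> bool" where
  "definable L S B n Z \<longleftrightarrow>
     (\<exists>\<phi>. wf_fm (param_lang L :: (('f, 'u) psym, 'r) lang) \<phi> \<and> params \<phi> \<subseteq> B \<and>
          fv_fm \<phi> \<subseteq> {..<n} \<and> Z = defined_set S n \<phi>)"

definition definable_fun ::
  "('f, 'r, 'z) lang_scheme \<Rightarrow> ('u, 'f, 'r) struct \<Rightarrow> 'u set \<Rightarrow> nat \<Rightarrow>
    'u list set \<Rightarrow> ('u list \<Rightarrow> 'u) \<Rightarrow> bool" where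
  "definable_fun L S B n Z f \<longleftrightarrow>
     Z \<subseteq> tuples (univ S) n \<and> definable L S B (Suc n) {x @ [f x] | x. x \<in> Z}"


subsection \<open>O-minimal expansions of real closed ordered fields\<close>

definition ring_reduct ::
  "('f, 'r, 'z) ord_ring_lang_scheme \<Rightarrow> ('u, 'f, 'r) struct \<Rightarrow> 'u ring" where
  "ring_reduct L S = \<lparr>carrier = univ S,
     mult = (\<lambda>x y. fint S (times_sym L) [x, y]), one = fint S (one_sym L) [],
     zero = fint S (zero_sym L) [], add = (\<lambda>x y. fint S (plus_sym L) [x, y])\<rparr>"

definition less_in ::
  "('f, 'r, 'z) ord_ring_lang_scheme \<Rightarrow> ('u, 'f, 'r) struct \<Rightarrow> 'u \<Rightarrow> 'u \<Rightarrow> bool" where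
  "less_in L S x y \<longleftrightarrow> rint S (less_sym L) [x, y]"

definition real_closed_ordered_field ::
  "('f, 'r, 'z) ord_ring_lang_scheme \<Rightarrow> ('u, 'f, 'r) struct \<Rightarrow> bool" where
  "real_closed_ordered_field L S \<longleftrightarrow>
     (let R = ring_reduct L S; M = univ S in
       field R \<and>
       (\<forall>x\<in>M. fint S (minus_sym L) [x] = \<ominus>\<^bsub>R\<^esub> x) \<and>
       strict_linear_order_on M {(x, y). x \<in> M \<and> y \<in> M \<and> less_in L S x y} \<and>
       (\<forall>x\<in>M. \<forall>y\<in>M. \<forall>z\<in>M. less_in L S x y \<longrightarrow> less_in L S (x \<oplus>\<^bsub>R\<^esub> z) (y \<oplus>\<^bsub>R\<^esub> z)) \<and>
       (\<forall>x\<in>M. \<forall>y\<in>M. less_in L S \<zero>\<^bsub>R\<^esub> x \<and> less_in L S \<zero>\<^bsub>R\<^esub> y \<longrightarrow> less_in L S \<zero>\<^bsub>R\<^esub> (x \<otimes>\<^bsub>R\<^esub> y)) \<and>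
       (\<forall>x\<in>M. less_in L S \<zero>\<^bsub>R\<^esub> x \<longrightarrow> (\<exists>y\<in>M. y \<otimes>\<^bsub>R\<^esub> y = x)) \<and>
       (\<forall>q. polynomial\<^bsub>R\<^esub> M q \<and> odd (length q - 1) \<longrightarrow> (\<exists>x\<in>M. ring.eval R q x = \<zero>\<^bsub>R\<^esub>)))"

text \<open>The endpoint \<open>None\<close> stands for \<open>-\<infinity>\<close> (left) or \<open>+\<infinity>\<close> (right).\<close>

definition open_interval ::
  "('f, 'r, 'z) ord_ring_lang_scheme \<Rightarrow> ('u, 'f, 'r) struct \<Rightarrow> 'u option \<Rightarrow> 'u option \<Rightarrow> 'u set" where
  "open_interval L S lo hi =
     {x \<in> univ S. (\<forall>a. lo = Some a \<longrightarrow> less_in L S a x) \<and> (\<forall>b. hi = Some b \<longrightarrow> less_in L S x b)}"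

definition o_minimal ::
  "('f, 'r, 'z) ord_ring_lang_scheme \<Rightarrow> ('u, 'f, 'r) struct \<Rightarrow> bool" where
  "o_minimal L S \<longleftrightarrow>
     (\<forall>Z. Z \<subseteq> univ S \<and> definable L S (univ S) 1 {[x] | x. x \<in> Z} \<longrightarrow>
       (\<exists>I. finite I \<and> Z = \<Union> I \<and>
         (\<forall>J\<in>I. (\<exists>a \<in> univ S. J = {a}) \<or>
                (\<exists>lo hi. set_option lo \<subseteq> univ S \<and> set_option hi \<subseteq> univ S \<and>
                         J = open_interval L S lo hi))))"

definition o_minimal_rcf_theory ::
  "'u itself \<Rightarrow> ('f, 'r, 'z) ord_ring_lang_scheme \<Rightarrow> ('f, 'r) fm set \<Rightarrow> bool" where
  "o_minimal_rcf_theory u L T \<longleftrightarrow>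
     (\<forall>S :: ('u, 'f, 'r) struct. is_model L T S \<longrightarrow>
        real_closed_ordered_field L S \<and> o_minimal L S)"


section \<open>Euclidean topology, differentiability, cells\<close>

text \<open>
  From here on the universe of the structure under consideration is a whole type of class
  linordered_field, whose operations interpret the ordered ring symbols. A point of \<open>M\<^sup>n\<close> is a list
  of length \<open>n\<close>.
\<close>

definition on_ordered_field ::
  "('f, 'r, 'z) ord_ring_lang_scheme \<Rightarrow> ('a::linordered_field, 'f, 'r) struct \<Rightarrow> bool" where
  "on_ordered_field L S \<longleftrightarrow> univ S = UNIV \<and>
     fint S (zero_sym L) [] = 0 \<and> fint S (one_sym L) [] = 1 \<and>
     (\<forall>x y. fint S (plus_sym L) [x, y] = x + y) \<and>
     (\<forall>x y. fint S (times_sym L) [x, y] = x * y) \<and>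
     (\<forall>x. fint S (minus_sym L) [x] = - x) \<and>
     (\<forall>x y. rint S (less_sym L) [x, y] \<longleftrightarrow> x < y)"

abbreviation pow :: "nat \<Rightarrow> 'a list set" where
  "pow n \<equiv> tuples UNIV n"

definition near :: "'a::linordered_field \<Rightarrow> 'a list \<Rightarrow> 'a list \<Rightarrow> bool" where
  "near \<epsilon> x y \<longleftrightarrow> length x = length y \<and> (\<forall>i < length x. \<bar>x ! i - y ! i\<bar> < \<epsilon>)"

definition euclidean_open :: "nat \<Rightarrow> 'a::linordered_field list set \<Rightarrow> bool" where
  "euclidean_open n U \<longleftrightarrow> U \<subseteq> pow n \<and> (\<forall>x\<in>U. \<exists>\<epsilon>>0. \<forall>y. near \<epsilon> x y \<longrightarrow> y \<in> U)"

definition euclidean_dense :: "'a::linordered_field list set \<Rightarrow> 'a list set \<Rightarrow> bool" where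
  "euclidean_dense D Z \<longleftrightarrow> D \<subseteq> Z \<and> (\<forall>x\<in>Z. \<forall>\<epsilon>>0. \<exists>y\<in>D. near \<epsilon> x y)"

definition cont_on :: "'a::linordered_field list set \<Rightarrow> ('a list \<Rightarrow> 'a) \<Rightarrow> bool" where
  "cont_on Z f \<longleftrightarrow> (\<forall>x\<in>Z. \<forall>\<epsilon>>0. \<exists>\<eta>>0. \<forall>y\<in>Z. near \<eta> x y \<longrightarrow> \<bar>f y - f x\<bar> < \<epsilon>)"

definition has_partial :: "('a::linordered_field list \<Rightarrow> 'a) \<Rightarrow> nat \<Rightarrow> 'a list \<Rightarrow> 'a \<Rightarrow> bool" where
  "has_partial f i u d \<longleftrightarrow>
     (\<forall>\<epsilon>>0. \<exists>\<eta>>0. \<forall>h. h \<noteq> 0 \<and> \<bar>h\<bar> < \<eta> \<longrightarrow> \<bar>(f (u[i := u ! i + h]) - f u) / h - d\<bar> < \<epsilon>)"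

text \<open>Functions of class \<open>C\<^sup>p\<close> on an open set \<open>U\<close> of \<open>M\<^sup>n\<close>.\<close>

primrec Cp_open :: "nat \<Rightarrow> nat \<Rightarrow> 'a::linordered_field list set \<Rightarrow> ('a list \<Rightarrow> 'a) \<Rightarrow> bool" where
  "Cp_open n 0 U f \<longleftrightarrow> cont_on U f"
| "Cp_open n (Suc p) U f \<longleftrightarrow> cont_on U f \<and>
     (\<exists>g. \<forall>i<n. (\<forall>u\<in>U. has_partial f i u (g i u)) \<and> Cp_open n p U (g i))"

text \<open>
  On a set that need not be open, \<open>C\<^sup>p\<close> means having a definable \<open>C\<^sup>p\<close> extension to a definable open
  neighbourhood.
\<close>

definition Cp_on ::
  "('f, 'r, 'z) lang_scheme \<Rightarrow> ('a::linordered_field, 'f, 'r) struct \<Rightarrow> nat \<Rightarrow> nat \<Rightarrow>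
    'a list set \<Rightarrow> ('a list \<Rightarrow> 'a) \<Rightarrow> bool" where
  "Cp_on L S p n Z f \<longleftrightarrow>
     (\<exists>U F. euclidean_open n U \<and> Z \<subseteq> U \<and> definable_fun L S UNIV n U F \<and> Cp_open n p U F \<and>
            (\<forall>x\<in>Z. F x = f x))"

text \<open>
  Cells in \<open>M\<^sup>n\<close> of dimension \<open>d\<close> whose defining functions satisfy \<open>P\<close>; the bounds \<open>None\<close> in
  \<open>band\<close> stand for \<open>\<plusminus>\<infinity>\<close>. The cells in \<open>M\<^sup>1\<close> are built over the one-point space \<open>M\<^sup>0\<close>.
\<close>

inductive gen_cell ::
  "(nat \<Rightarrow> 'a::linordered_field list set \<Rightarrow> ('a list \<Rightarrow> 'a) \<Rightarrow> bool) \<Rightarrow> nat \<Rightarrow> nat \<Rightarrow> 'a list set \<Rightarrow> bool"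
  for P where
  point: "gen_cell P 0 0 {[]}"
| graph: "gen_cell P n d Z \<Longrightarrow> P n Z f \<Longrightarrow> gen_cell P (Suc n) d {x @ [f x] | x. x \<in> Z}"
| band: "gen_cell P n d Z \<Longrightarrow>
     (\<And>f. lo = Some f \<Longrightarrow> P n Z f) \<Longrightarrow> (\<And>g. hi = Some g \<Longrightarrow> P n Z g) \<Longrightarrow>
     (\<And>f g x. lo = Some f \<Longrightarrow> hi = Some g \<Longrightarrow> x \<in> Z \<Longrightarrow> f x < g x) \<Longrightarrow>
     gen_cell P (Suc n) (Suc d)
       {x @ [y] | x y. x \<in> Z \<and> (\<forall>f. lo = Some f \<longrightarrow> f x < y) \<and> (\<forall>g. hi = Some g \<longrightarrow> y < g x)}"

definition cell_dim ::
  "('f, 'r, 'z) lang_scheme \<Rightarrow> ('a::linordered_field, 'f, 'r) struct \<Rightarrow> nat \<Rightarrow> nat \<Rightarrow> 'a list set \<Rightarrow> bool"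
  where "cell_dim L S = gen_cell (\<lambda>n Z f. definable_fun L S UNIV n Z f \<and> cont_on Z f)"

definition cell ::
  "('f, 'r, 'z) lang_scheme \<Rightarrow> ('a::linordered_field, 'f, 'r) struct \<Rightarrow> nat \<Rightarrow> 'a list set \<Rightarrow> bool"
  where "cell L S n Z \<longleftrightarrow> (\<exists>d. cell_dim L S n d Z)"

definition Cp_cell ::
  "('f, 'r, 'z) lang_scheme \<Rightarrow> ('a::linordered_field, 'f, 'r) struct \<Rightarrow> nat \<Rightarrow> nat \<Rightarrow> 'a list set \<Rightarrow> bool"
  where "Cp_cell L S p n Z \<longleftrightarrow>
    (\<exists>d. gen_cell (\<lambda>n Z f. definable_fun L S UNIV n Z f \<and> cont_on Z f \<and> Cp_on L S p n Z f) n d Z)"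

text \<open>The o-minimal dimension, as a relation; the empty set has no dimension in \<open>\<nat>\<close>.\<close>

definition has_dim ::
  "('f, 'r, 'z) lang_scheme \<Rightarrow> ('a::linordered_field, 'f, 'r) struct \<Rightarrow> nat \<Rightarrow> 'a list set \<Rightarrow> nat \<Rightarrow> bool"
  where "has_dim L S n Z d \<longleftrightarrow>
    (\<exists>C \<subseteq> Z. cell_dim L S n d C) \<and> (\<forall>d'. (\<exists>C \<subseteq> Z. cell_dim L S n d' C) \<longrightarrow> d' \<le> d)"


section \<open>Generic derivations\<close>

definition T_derivation ::
  "('f, 'r, 'z) lang_scheme \<Rightarrow> ('a::linordered_field, 'f, 'r) struct \<Rightarrow> ('a \<Rightarrow> 'a) \<Rightarrow> bool" where
  "T_derivation L S \<delta> \<longleftrightarrow>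
     (\<forall>n U f. euclidean_open n U \<and> definable_fun L S {} n U f \<and> Cp_open n 1 U f \<longrightarrow>
       (\<forall>u\<in>U. \<forall>J. (\<forall>i<n. has_partial f i u (J i)) \<longrightarrow> \<delta> (f u) = (\<Sum>i<n. J i * \<delta> (u ! i))))"

definition generic_derivation ::
  "('f, 'r, 'z) lang_scheme \<Rightarrow> ('a::linordered_field, 'f, 'r) struct \<Rightarrow> ('a \<Rightarrow> 'a) \<Rightarrow> bool" where
  "generic_derivation L S \<delta> \<longleftrightarrow>
     (\<forall>n A. definable L S UNIV (Suc n) A \<and> has_dim L S n (take n ` A) n \<longrightarrow>
       (\<exists>a. map (\<lambda>j. (\<delta> ^^ j) a) [0..<Suc n] \<in> A))"

definition model_Tg_delta ::
  "('f, 'r, 'z) ord_ring_lang_scheme \<Rightarrow> ('f, 'r) fm set \<Rightarrow>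
    ('a::linordered_field, 'f, 'r) struct \<Rightarrow> ('a \<Rightarrow> 'a) \<Rightarrow> bool" where
  "model_Tg_delta L T S \<delta> \<longleftrightarrow>
     is_model L T S \<and> on_ordered_field L S \<and> T_derivation L S \<delta> \<and> generic_derivation L S \<delta>"

datatype 'f dsym = Base 'f | Delta

definition delta_lang :: "('f, 'r, 'z) lang_scheme \<Rightarrow> ('f dsym, 'r) lang" where
  "delta_lang L = \<lparr>farity = (\<lambda>s. case s of Base f \<Rightarrow> farity L f | Delta \<Rightarrow> 1), rarity = rarity L\<rparr>"

definition delta_struct ::
  "('u, 'f, 'r) struct \<Rightarrow> ('u \<Rightarrow> 'u) \<Rightarrow> ('u, 'f dsym, 'r) struct" where
  "delta_struct S \<delta> = \<lparr>univ = univ S,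
     fint = (\<lambda>s xs. case s of Base f \<Rightarrow> fint S f xs | Delta \<Rightarrow> \<delta> (hd xs)), rint = rint S\<rparr>"


section \<open>Jets and source formulas\<close>

definition jet_space :: "nat list \<Rightarrow> 'a list set" where
  "jet_space ns = pow (sum_list (map Suc ns))"

definition jet :: "('a \<Rightarrow> 'a) \<Rightarrow> nat list \<Rightarrow> 'a list \<Rightarrow> 'a list" where
  "jet \<delta> ns a = concat (map (\<lambda>i. map (\<lambda>j. (\<delta> ^^ j) (a ! i)) [0..<Suc (ns ! i)]) [0..<length ns])"

definition jet_index :: "nat list \<Rightarrow> nat \<Rightarrow> nat \<Rightarrow> nat" where
  "jet_index ns i j = (\<Sum>l<i. Suc (ns ! l)) + j"

definition delta_pow :: "nat \<Rightarrow> ('f dsym, 'a) psym tm \<Rightarrow> ('f dsym, 'a) psym tm" where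
  "delta_pow j t = ((\<lambda>s. Fn (Sym Delta) [s]) ^^ j) t"

text \<open>
  Terms in which the symbol \<open>\<delta>\<close> occurs only in the form \<open>\<delta>\<^sup>j x\<^sub>i\<close> or, for a parameter \<open>b\<close>, in the
  form of a constant \<open>\<delta>\<^sup>j b\<close>.
\<close>

inductive delta_normal_tm :: "('f dsym, 'a) psym tm \<Rightarrow> bool" where
  "delta_normal_tm (delta_pow j (Var i))"
| "delta_normal_tm (delta_pow j (Fn (Par b) []))"
| "(\<And>t. t \<in> set ts \<Longrightarrow> delta_normal_tm t) \<Longrightarrow> delta_normal_tm (Fn (Sym (Base f)) ts)"

primrec subterms :: "'f tm \<Rightarrow> 'f tm set" where
  "subterms (Var i) = {Var i}"
| "subterms (Fn f ts) = insert (Fn f ts) (\<Union> (set (map subterms ts)))"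

primrec atom_terms :: "('f, 'r) fm \<Rightarrow> 'f tm set" where
  "atom_terms (Eq s t) = {s, t}"
| "atom_terms (Rel r ts) = set ts"
| "atom_terms (Neg \<phi>) = atom_terms \<phi>"
| "atom_terms (Conj \<phi> \<psi>) = atom_terms \<phi> \<union> atom_terms \<psi>"
| "atom_terms (All v \<phi>) = atom_terms \<phi>"

definition delta_ord :: "nat \<Rightarrow> (('f dsym, 'a) psym, 'r) fm \<Rightarrow> nat list" where
  "delta_ord k \<phi> =
     map (\<lambda>i. Max ({0} \<union> {j. \<exists>t \<in> atom_terms \<phi>. delta_pow j (Var i) \<in> subterms t})) [0..<k]"

text \<open>
  The translation replaces \<open>\<delta>\<^sup>j x\<^sub>i\<close> by the coordinate \<open>x\<^sub>i\<^sup>(\<^sup>j\<^sup>)\<close> of the jet space, and \<open>\<delta>\<^sup>j b\<close> by the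
  element of \<open>M\<close> it denotes. The argument \<open>j\<close> counts the applications of \<open>\<delta>\<close> already read; it is 0
  at the symbols of the base language when the term is \<open>\<delta>\<close>-normal.
\<close>

fun replace_tm ::
  "('a \<Rightarrow> 'a) \<Rightarrow> nat list \<Rightarrow> nat \<Rightarrow> ('f dsym, 'a) psym tm \<Rightarrow> ('f, 'a) psym tm" where
  "replace_tm \<delta> ns j (Var i) = Var (jet_index ns i j)"
| "replace_tm \<delta> ns j (Fn (Par b) ts) = Fn (Par ((\<delta> ^^ j) b)) []"
| "replace_tm \<delta> ns j (Fn (Sym Delta) [t]) = replace_tm \<delta> ns (Suc j) t"
| "replace_tm \<delta> ns j (Fn (Sym (Base f)) ts) = Fn (Sym f) (map (replace_tm \<delta> ns j) ts)"

primrec replace_fm ::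
  "('a \<Rightarrow> 'a) \<Rightarrow> nat list \<Rightarrow> (('f dsym, 'a) psym, 'r) fm \<Rightarrow> (('f, 'a) psym, 'r) fm" where
  "replace_fm \<delta> ns (Eq s t) = Eq (replace_tm \<delta> ns 0 s) (replace_tm \<delta> ns 0 t)"
| "replace_fm \<delta> ns (Rel r ts) = Rel r (map (replace_tm \<delta> ns 0) ts)"
| "replace_fm \<delta> ns (Neg \<phi>) = Neg (replace_fm \<delta> ns \<phi>)"
| "replace_fm \<delta> ns (Conj \<phi> \<psi>) = Conj (replace_fm \<delta> ns \<phi>) (replace_fm \<delta> ns \<psi>)"
| "replace_fm \<delta> ns (All v \<phi>) = All v (replace_fm \<delta> ns \<phi>)"
    \<comment> \<open>never used: only quantifier-free formulas are translated\<close>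

definition source_dim :: "nat \<Rightarrow> (('f dsym, 'a) psym, 'r) fm \<Rightarrow> nat" where
  "source_dim k \<phi> = sum_list (map Suc (delta_ord k \<phi>))"

definition source_set ::
  "('a, 'f, 'r) struct \<Rightarrow> ('a \<Rightarrow> 'a) \<Rightarrow> nat \<Rightarrow> (('f dsym, 'a) psym, 'r) fm \<Rightarrow> 'a list set" where
  "source_set S \<delta> k \<phi> =
     {u \<in> jet_space (delta_ord k \<phi>). sat (param_struct S) ((!) u) (replace_fm \<delta> (delta_ord k \<phi>) \<phi>)}"

definition source_formula ::
  "('f, 'r, 'z) lang_scheme \<Rightarrow> ('a::linordered_field, 'f, 'r) struct \<Rightarrow> ('a \<Rightarrow> 'a) \<Rightarrow> 'a set \<Rightarrow>
    nat \<Rightarrow> (('f dsym, 'a) psym, 'r) fm \<Rightarrow> 'a list set \<Rightarrow> bool" where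
  "source_formula L S \<delta> B k \<phi> C \<longleftrightarrow>
     wf_fm (param_lang (delta_lang L) :: (('f dsym, 'a) psym, 'r) lang) \<phi> \<and> params \<phi> \<subseteq> B \<and>
     fv_fm \<phi> \<subseteq> {..<k} \<and> quantifier_free \<phi> \<and> (\<forall>t \<in> atom_terms \<phi>. delta_normal_tm t) \<and>
     C = defined_set (delta_struct S \<delta>) k \<phi> \<and>
     cell L S (source_dim k \<phi>) (source_set S \<delta> k \<phi>) \<and>
     euclidean_dense (jet \<delta> (delta_ord k \<phi>) ` C) (source_set S \<delta> k \<phi>)"

definition delta_cell ::
  "('f, 'r, 'z) lang_scheme \<Rightarrow> ('a::linordered_field, 'f, 'r) struct \<Rightarrow> ('a \<Rightarrow> 'a) \<Rightarrow> 'a set \<Rightarrow>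
    nat \<Rightarrow> 'a list set \<Rightarrow> bool" where
  "delta_cell L S \<delta> B k C \<longleftrightarrow> (\<exists>\<phi>. source_formula L S \<delta> B k \<phi> C)"

fun delta_decomposition ::
  "('f, 'r, 'z) lang_scheme \<Rightarrow> ('a::linordered_field, 'f, 'r) struct \<Rightarrow> ('a \<Rightarrow> 'a) \<Rightarrow> 'a set \<Rightarrow>
    nat \<Rightarrow> 'a list set set \<Rightarrow> bool" where
  "delta_decomposition L S \<delta> B k \<D> \<longleftrightarrow>
     finite \<D> \<and> (\<forall>D\<in>\<D>. delta_cell L S \<delta> B k D) \<and> partition_on (pow k) \<D> \<and>
     (k > 1 \<longrightarrow> delta_decomposition L S \<delta> B (k - 1) ((\<lambda>D. take (k - 1) ` D) ` \<D>))"

declare delta_decomposition.simps [simp del]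

end

theory Submission
  imports Defs
begin

text \<open>
  The definable sets of an o-minimal field with parameters in a set \<open>B'\<close> closed under \<open>\<delta>\<close> are treated
  through their closure properties. Monotonicity, mean value and partition arguments give generic
  \<open>C\<^sup>p\<close>-smoothness, local uniform finiteness and \<open>C\<^sup>p\<close>-cell decomposition over \<open>B'\<close>; smoothness on a
  large open set and induction on cells turn the rule for \<open>T\<close>-derivations into
  \<open>\<delta> (F u) = G (u, \<delta> u)\<close> with \<open>G\<close> definable, for every definable \<open>F\<close>.

  Fix a jet space and look at the block of coordinates \<open>(a, \<delta> a, \<dots>, \<delta>\<^sup>N a)\<close> of the last variable. A
  cell that is open in the first \<open>m\<close> of them and a graph in the next one prescribes \<open>\<delta>\<^sup>m a\<close>, hence all
  further derivatives, so that it may be replaced by its part on which the remaining coordinates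
  agree with the prescribed ones, at the price of raising the order in the earlier variables;
  by genericity the jets are dense in the fibres of that part. This yields at once a quantifier
  elimination for the pair in terms of jets, where the projection of such a set is a condition on
  jets of the remaining variables, and, by induction on the number of variables, the decomposition:
  the projections of the sets obtained for the last variable are decomposed first, and continuity
  of the bounding functions makes the jets dense in the resulting cells over the decomposition.
\<close>

section \<open>Definable sets\<close>

text \<open>Two parameter sets are in play. Cells and their bounds must be definable over
  \<open>B'\<close>, as a source formula may only mention elements of \<open>B\<close> and their
  derivatives; o-minimality and genericity, however, are applied to fibres over arbitrary points of
  M. Hence the families \<open>D\<close> and \<open>DM\<close>: smoothness near a point, for
  instance, is a predicate definable over \<open>B'\<close>, but that it holds generically is proved
  with all parameters. \<open>B'\<close> consists of all derivatives of elements of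
  \<open>B\<close>, because differentiating a function with a parameter b brings in the derivative
  of b. The obstacle is that jets need not be dense in a cell which is a graph in the coordinate of
  \<open>\<delta>^m a\<close>: the relation has consequences for the later derivatives that the cell
  does not record. Imposing them leaves a smaller set, whose cells may be graphs in yet another
  coordinate. The process stops because only the first m coordinates of the block remain to be
  decomposed, so a new relation is about some m' < m. Density comes only in fibres over actual jets
  of the earlier variables; it reaches the whole cell once jets are dense in the base.\<close>

lemma pow_iff [simp]: "x \<in> tuples UNIV n \<longleftrightarrow> length x = n"
  by (simp add: tuples_def)

lemma map_nth_upt_take: "n \<le> length z ==> map ((!) z) [0..<n] = take n z"
  by (rule nth_equalityI) auto

lemma take_snoc_nth: "length z = Suc n ==> take n z @ [z ! n] = z"
  by (metis lessI order_refl take_Suc_conv_app_nth take_all)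

text \<open>Total by the default 0, which is definable without parameters, so that
  \<open>the1\<close> of a definable relation is a definable function whether or not the value
  exists uniquely everywhere.\<close>

definition the1 :: "('a::zero => bool) => 'a" where
  "the1 Q = (if \<exists>!y. Q y then THE y. Q y else 0)"

lemma the1_eq: "Q y ==> (\<And>z. Q z ==> z = y) ==> the1 Q = y"
  unfolding the1_def by (smt (verit, best) the_equality)

text \<open>One introduction rule for each logical or arithmetic operation, so that the definability
  of a set written as a HOL term is derived along its syntax.\<close>

named_theorems dintros

text \<open>The sets definable over some fixed parameters, seen only through their closure
  properties; formulas return when a model is shown to satisfy them. Reindexing covers permuting,
  repeating and adding coordinates. No constants are assumed, as the parameter set may be
  empty.\<close>

locale dstruct =
  fixes D :: "nat => 'a::linordered_field list set => bool"
  assumes D_sub: "D n Z ==> Z \<subseteq> pow n"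
    and D_pow: "D n (pow n)"
    and D_Int: "D n Z ==> D n Y ==> D n (Z \<inter> Y)"
    and D_compl: "D n Z ==> D n (pow n - Z)"
    and D_reindex: "D n Z ==> set I \<subseteq> {..<N} ==> length I = n ==>
                    D N {x \<in> pow N. map ((!) x) I \<in> Z}"
    and D_proj: "D (Suc n) Z ==> D n {x \<in> pow n. \<exists>y. x @ [y] \<in> Z}"
    and D_less: "D 2 {[x, y] | x y. x < y}"
    and D_plus: "D 3 {[x, y, x + y] | x y. True}"
    and D_times: "D 3 {[x, y, x * y] | x y. True}"
begin

text \<open>Predicates, functions and tuple-valued functions of n variables. A bound variable is the
  last entry \<open>z ! n\<close> of a list of length n + 1, whose other entries
  \<open>take n z\<close> are the free variables; \<open>dp_ex\<close>, \<open>dp_all\<close> and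
  \<open>df_the1\<close> follow this convention.\<close>

definition "dp n P \<longleftrightarrow> D n {x. length x = n \<and> P x}"
definition "df n f \<longleftrightarrow> dp (Suc n) (\<lambda>z. z ! n = f (take n z))"
definition "dl n m l \<longleftrightarrow> (\<forall>x. length x = n --> length (l x) = m) \<and> (\<forall>i<m. df n (\<lambda>x. l x ! i))"

lemma D_length: "D n Z ==> x \<in> Z ==> length x = n"
  using D_sub by fastforce

lemma dp_cong: "(\<And>x. length x = n ==> P x = Q x) ==> dp n P = dp n Q"
  unfolding dp_def by (intro arg_cong[where f = "D n"] Collect_cong) auto

lemma dp_memI: "D n Z ==> dp n (\<lambda>x. x \<in> Z)"
proof -
  assume a: "D n Z"
  then have "{x. length x = n \<and> x \<in> Z} = Z" by (auto dest: D_length)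
  then show ?thesis using a unfolding dp_def by simp
qed

lemma D_eq_dp: "Z \<subseteq> pow n ==> D n Z = dp n (\<lambda>x. x \<in> Z)"
  unfolding dp_def by (rule arg_cong[where f = "D n"]) auto

lemma dp_True [dintros]: "dp n (\<lambda>x. True)"
  using D_pow[of n] unfolding dp_def by (simp add: tuples_def)

lemma dp_not [dintros]: assumes "dp n P" shows "dp n (\<lambda>x. \<not> P x)"
proof -
  have "pow n - {x. length x = n \<and> P x} = {x. length x = n \<and> \<not> P x}" by auto
  then show ?thesis using D_compl[of n "{x. length x = n \<and> P x}"] assms unfolding dp_def by simp
qed

lemma dp_conj [dintros]: assumes "dp n P" "dp n Q" shows "dp n (\<lambda>x. P x \<and> Q x)"
proof -
  have "{x. length x = n \<and> P x} \<inter> {x. length x = n \<and> Q x} = {x. length x = n \<and> P x \<and> Q x}" by auto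
  then show ?thesis using D_Int assms unfolding dp_def by fastforce
qed

lemma dp_False [dintros]: "dp n (\<lambda>x. False)"
  using dp_not[OF dp_True] by simp

lemma dp_const [dintros]: "dp n (\<lambda>x. C)"
  by (cases C) (simp_all add: dp_True dp_False)

lemma dp_disj [dintros]: assumes "dp n P" "dp n Q" shows "dp n (\<lambda>x. P x \<or> Q x)"
  using dp_not[OF dp_conj[OF dp_not[OF assms(1)] dp_not[OF assms(2)]]] by simp

lemma dp_imp [dintros]: assumes "dp n P" "dp n Q" shows "dp n (\<lambda>x. P x --> Q x)"
  unfolding imp_conv_disj by (intro dp_disj dp_not assms)

lemma dp_iff [dintros]: assumes "dp n P" "dp n Q" shows "dp n (\<lambda>x. P x \<longleftrightarrow> Q x)"
  unfolding iff_conv_conj_imp by (intro dp_conj dp_imp assms)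

lemma dp_reindex:
  assumes "dp n P" "set I \<subseteq> {..<N}" "length I = n"
  shows "dp N (\<lambda>x. P (map ((!) x) I))"
  using D_reindex[OF assms(1)[unfolded dp_def] assms(2,3)] assms(3) unfolding dp_def by simp

lemma dp_ex [dintros]:
  assumes "dp (Suc n) (\<lambda>z. Q (take n z) (z ! n))"
  shows "dp n (\<lambda>x. \<exists>y. Q x y)"
proof -
  have "{x \<in> pow n. \<exists>y. x @ [y] \<in> {z. length z = Suc n \<and> Q (take n z) (z ! n)}}
      = {x. length x = n \<and> (\<exists>y. Q x y)}"
    by (auto simp: nth_append)
  then show ?thesis using D_proj[OF assms[unfolded dp_def]] unfolding dp_def by simp
qed

lemma dp_all [dintros]:
  assumes "dp (Suc n) (\<lambda>z. Q (take n z) (z ! n))"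
  shows "dp n (\<lambda>x. \<forall>y. Q x y)"
  using dp_not[OF dp_ex[of n "\<lambda>x y. \<not> Q x y"], OF dp_not[OF assms]] by simp

lemma dp_ex_list [dintros]:
  assumes "dp (n + m) (\<lambda>z. Q (take n z) (drop n z))"
  shows "dp n (\<lambda>x. \<exists>y. length y = m \<and> Q x y)"
  using assms
proof (induction m arbitrary: Q)
  case 0
  then show ?case by (subst dp_cong[where Q = "\<lambda>z. Q (take n z) (drop n z)"]) auto
next
  case (Suc m)
  have "dp (Suc (n + m)) (\<lambda>w. Q (take n (take (n + m) w)) (drop n (take (n + m) w) @ [w ! (n + m)]))"
    using Suc.prems
  proof (subst dp_cong[where Q = "\<lambda>w. Q (take n w) (drop n w)"])
    fix w :: "'a list" assume w: "length w = Suc (n + m)"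
    have "drop n (take (n + m) w) @ [w ! (n + m)] = drop n w"
      using take_snoc_nth[OF w] w
      by (metis drop_append diff_is_0_eq' drop0 le_add1 length_take less_eq_Suc_le min.absorb4 lessI)
    then show "Q (take n (take (n + m) w)) (drop n (take (n + m) w) @ [w ! (n + m)])
       \<longleftrightarrow> Q (take n w) (drop n w)" by (simp add: min_def)
  qed simp
  then have "dp (n + m) (\<lambda>z. \<exists>t. Q (take n z) (drop n z @ [t]))" by (rule dp_ex)
  from Suc.IH[OF this] have "dp n (\<lambda>x. \<exists>y. length y = m \<and> (\<exists>t. Q x (y @ [t])))" .
  moreover have "(\<exists>y. length y = m \<and> (\<exists>t. Q x (y @ [t]))) \<longleftrightarrow> (\<exists>y. length y = Suc m \<and> Q x y)" for x
    by (metis length_append_singleton length_Suc_conv_rev)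
  ultimately show ?case by simp
qed

lemma dp_all_list [dintros]:
  assumes "dp (n + m) (\<lambda>z. Q (take n z) (drop n z))"
  shows "dp n (\<lambda>x. \<forall>y. length y = m --> Q x y)"
  using dp_not[OF dp_ex_list[of n m "\<lambda>x y. \<not> Q x y"], OF dp_not[OF assms]] by simp

lemma dp_finite_Ball [dintros]:
  "finite A ==> (\<And>a. a \<in> A ==> dp n (P a)) ==> dp n (\<lambda>x. \<forall>a\<in>A. P a x)"
  by (induction A rule: finite_induct) (auto intro: dintros)

lemma dp_finite_Bex [dintros]:
  "finite A ==> (\<And>a. a \<in> A ==> dp n (P a)) ==> dp n (\<lambda>x. \<exists>a\<in>A. P a x)"
  by (induction A rule: finite_induct) (auto intro: dintros)

lemma dp_all_less [dintros]:
  "(\<And>a. a < m ==> dp n (P a)) ==> dp n (\<lambda>x. \<forall>a<m::nat. P a x)"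
  using dp_finite_Ball[of "{..<m}" n P] by (simp add: Ball_def)

lemma dp_nth_less: "i < n ==> j < n ==> dp n (\<lambda>x. x ! i < x ! j)"
proof -
  assume "i < n" "j < n"
  have "dp 2 (\<lambda>x. x ! 0 < x ! 1)"
    using D_less unfolding dp_def
    by (rule back_subst[where P = "D 2"]) (auto simp: numeral_2_eq_2 length_Suc_conv)
  from dp_reindex[OF this, of "[i, j]" n] show ?thesis using \<open>i < n\<close> \<open>j < n\<close> by simp
qed

lemma dp_nth_eq: "i < n ==> j < n ==> dp n (\<lambda>x. x ! i = x ! j)"
proof -
  assume "i < n" "j < n"
  then have "dp n (\<lambda>x. \<not> x ! i < x ! j \<and> \<not> x ! j < x ! i)" by (intro dintros dp_nth_less)
  then show ?thesis by (subst dp_cong[where Q = "\<lambda>x. \<not> x ! i < x ! j \<and> \<not> x ! j < x ! i"]) auto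
qed

lemma df_reindex:
  assumes "df n f" "set I \<subseteq> {..<N}" "length I = n"
  shows "df N (\<lambda>x. f (map ((!) x) I))"
proof -
  have "dp (Suc N) (\<lambda>x. map ((!) x) (I @ [N]) ! n = f (take n (map ((!) x) (I @ [N]))))"
    by (rule dp_reindex[OF assms(1)[unfolded df_def]]) (use assms in auto)
  then show ?thesis unfolding df_def
  proof (subst dp_cong)
    fix x :: "'a list" assume "length x = Suc N"
    have *: "map ((!) (take N x)) I = map ((!) x) I"
      using assms(2) by auto
    then show "(x ! N = f (map ((!) (take N x)) I)) \<longleftrightarrow> map ((!) x) (I @ [N]) ! n = f (take n (map ((!) x) (I @ [N])))"
      unfolding * using assms(3) by (simp add: nth_append)
  qed
qed

lemma df_unique:
  assumes "dp (Suc n) (\<lambda>z. Q (take n z) (z ! n))" "\<And>x y. length x = n ==> Q x y \<longleftrightarrow> y = f x"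
  shows "df n f"
  using assms unfolding df_def by (simp cong: dp_cong)

lemma df_cong: "(\<And>x. length x = n ==> f x = g x) ==> df n f = df n g"
  unfolding df_def by (rule dp_cong) simp

lemma df_graph: "df n f = D (Suc n) {x @ [f x] | x. length x = n}"
proof -
  have "{z. length z = Suc n \<and> z ! n = f (take n z)} = {x @ [f x] | x. length x = n}"
    by (auto simp: nth_append) (metis length_take lessI less_imp_le_nat min.absorb2 take_snoc_nth)
  then show ?thesis unfolding df_def dp_def by simp
qed

lemma df_nth0: "i < n ==> df n (\<lambda>x. x ! i)"
  unfolding df_def using dp_nth_eq[of n "Suc n" i] by (simp cong: dp_cong)

lemma dlI: "(\<And>x. length x = n ==> length (l x) = m) ==> (\<And>i. i < m ==> df n (\<lambda>x. l x ! i)) ==> dl n m l"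
  unfolding dl_def by blast

lemma dl_length: "dl n m l ==> length x = n ==> length (l x) = m"
  unfolding dl_def by blast

lemma df_nth [dintros]: "dl n m l ==> i < m ==> df n (\<lambda>x. l x ! i)"
  unfolding dl_def by blast

lemma dl_id [dintros]: "dl n n (\<lambda>x. x)"
  by (auto intro: dlI df_nth0)

text \<open>\<open>P (l x)\<close> says that some y satisfies \<open>P\<close> and has the entries
  of \<open>l x\<close>; so substitution reduces to reindexing, conjunction and projection.\<close>

lemma dp_comp:
  assumes P: "dp m P" and l: "dl n m l" shows "dp n (\<lambda>x. P (l x))"
proof -
  have "dp n (\<lambda>x. \<exists>y. length y = m \<and> ((\<forall>i<m. y ! i = l x ! i) \<and> P y))"
  proof (intro dp_ex_list dp_conj dp_all_less)
    fix i assume i: "i < m"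
    then have "dp (Suc n) (\<lambda>z. z ! n = l (take n z) ! i)" using l unfolding dl_def df_def by blast
    from dp_reindex[OF this, of "[0..<n] @ [n + i]" "n + m"] i
    have "dp (n + m) (\<lambda>x. map ((!) x) ([0..<n] @ [n + i]) ! n =
       l (take n (map ((!) x) ([0..<n] @ [n + i]))) ! i)" by (simp add: subset_iff)
    then show "dp (n + m) (\<lambda>z. drop n z ! i = l (take n z) ! i)"
      by (subst dp_cong[where Q = "\<lambda>x. map ((!) x) ([0..<n] @ [n + i]) ! n =
       l (take n (map ((!) x) ([0..<n] @ [n + i]))) ! i"]) (auto simp: nth_append map_nth_upt_take)
  next
    from dp_reindex[OF P, of "[n..<n+m]" "n + m"]
    have "dp (n + m) (\<lambda>x. P (map ((!) x) [n..<n + m]))" by (simp add: subset_iff)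
    moreover have "map ((!) x) [n..<n + m] = drop n x" if "length x = n + m" for x :: "'a list"
      by (rule nth_equalityI) (use that in auto)
    ultimately show "dp (n + m) (\<lambda>z. P (drop n z))" by (simp cong: dp_cong)
  qed
  then show ?thesis
  proof (subst dp_cong)
    fix x :: "'a list" assume "length x = n"
    then have "length (l x) = m" using l dl_length by blast
    then show "P (l x) \<longleftrightarrow> (\<exists>y. length y = m \<and> ((\<forall>i<m. y ! i = l x ! i) \<and> P y))"
      by (metis nth_equalityI)
  qed
qed

lemma dl_map_nth: "set I \<subseteq> {..<n} ==> length I = m ==> dl n m (\<lambda>x. map ((!) x) I)"
proof (rule dlI)
  fix i assume "set I \<subseteq> {..<n}" "length I = m" "i < m"
  then have "df n (\<lambda>x. x ! (I ! i))" by (intro df_nth0) (auto simp: subset_iff)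
  then show "df n (\<lambda>x. map ((!) x) I ! i)" using \<open>i < m\<close> \<open>length I = m\<close> by simp
qed simp

lemma dl_take0: "k \<le> n ==> dl n k (\<lambda>x. take k x)"
  by (rule dlI) (auto intro: df_nth0)

lemma dl_append [dintros]:
  assumes "dl n m1 l1" "dl n m2 l2" "m = m1 + m2" shows "dl n m (\<lambda>x. l1 x @ l2 x)"
proof (rule dlI)
  fix i assume "i < m"
  show "df n (\<lambda>x. (l1 x @ l2 x) ! i)"
  proof (cases "i < m1")
    case True
    then show ?thesis using assms df_nth[OF assms(1), of i] by (simp add: nth_append dl_length cong: df_cong)
  next
    case False
    then show ?thesis using assms df_nth[OF assms(2), of "i - m1"] \<open>i < m\<close> by (simp add: nth_append dl_length cong: df_cong)
  qed
qed (use assms dl_length in auto)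

lemma dl_Nil [dintros]: "dl n 0 (\<lambda>x. [])"
  by (rule dlI) auto

lemma dl_Cons [dintros]:
  assumes "df n f" "dl n m l" "m' = Suc m" shows "dl n m' (\<lambda>x. f x # l x)"
proof (rule dlI)
  fix i assume "i < m'"
  then show "df n (\<lambda>x. (f x # l x) ! i)" using assms by (cases i) (auto intro: df_nth)
qed (use assms dl_length in auto)

lemma df_comp:
  assumes f: "df m f" and l: "dl n m l" shows "df n (\<lambda>x. f (l x))"
proof -
  have l': "dl (Suc n) m (\<lambda>z. l (take n z))"
  proof (rule dlI)
    fix i assume "i < m"
    from df_reindex[OF df_nth[OF l this], of "[0..<n]" "Suc n"]
    have "df (Suc n) (\<lambda>x. l (map ((!) x) [0..<n]) ! i)" by (simp add: subset_iff)
    then show "df (Suc n) (\<lambda>x. l (take n x) ! i)"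
      by (subst df_cong[where g = "\<lambda>x. l (map ((!) x) [0..<n]) ! i"]) (auto simp: map_nth_upt_take)
  qed (use l dl_length in auto)
  have "dp (Suc n) (\<lambda>z. (l (take n z) @ [z ! n]) ! m = f (take m (l (take n z) @ [z ! n])))"
    by (rule dp_comp[OF f[unfolded df_def]]) (auto intro!: dintros l' df_nth0)
  then show ?thesis unfolding df_def
    using dl_length[OF l] by (subst dp_cong) (auto simp: nth_append)
qed

lemma dl_comp: "dl m k h ==> dl n m l ==> dl n k (\<lambda>x. h (l x))"
  by (rule dlI) (auto simp: dl_length intro: df_comp[of m "\<lambda>x. h x ! _"] df_nth)

lemma dl_take [dintros]: "dl n m l ==> k \<le> m ==> dl n k (\<lambda>x. take k (l x))"
  by (rule dl_comp[OF dl_take0])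

lemma dl_drop [dintros]: "dl n m l ==> j + k = m ==> dl n j (\<lambda>x. drop k (l x))"
proof -
  assume l: "dl n m l" and "j + k = m"
  have "dl m j (drop k)"
  proof (rule dlI)
    fix i assume "i < j"
    have "df m (\<lambda>x. drop k x ! i) = df m (\<lambda>x. x ! (k + i))" using \<open>j + k = m\<close> by (intro df_cong) simp
    then show "df m (\<lambda>x. drop k x ! i)" using \<open>i < j\<close> \<open>j + k = m\<close> by (simp add: df_nth0)
  qed (use \<open>j + k = m\<close> in auto)
  then show ?thesis by (rule dl_comp[OF _ l])
qed

lemma dl_update [dintros]:
  assumes "dl n m l" "df n f" shows "dl n m (\<lambda>x. (l x)[i := f x])"
proof (rule dlI)
  fix j assume "j < m"
  show "df n (\<lambda>x. (l x)[i := f x] ! j)"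
    using assms df_nth[OF assms(1) \<open>j < m\<close>] \<open>j < m\<close> by (cases "i = j") (auto simp: dl_length cong: df_cong)
qed (use assms dl_length in auto)

lemma dl_map [dintros]: "m = length js ==> (\<And>j. j \<in> set js ==> df n (f j)) ==> dl n m (\<lambda>x. map (\<lambda>j. f j x) js)"
  by (rule dlI) auto

lemma dp_mem [dintros]: "D m Z ==> dl n m l ==> dp n (\<lambda>x. l x \<in> Z)"
  by (rule dp_comp[OF dp_memI])

lemma dp_less [dintros]: assumes "df n f" "df n g" shows "dp n (\<lambda>x. f x < g x)"
proof -
  have "dp n (\<lambda>x. [f x, g x] ! 0 < [f x, g x] ! 1)"
    by (rule dp_comp[OF dp_nth_less[of 0 2 1]]) (auto intro!: dintros assms)
  then show ?thesis by simp
qed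

lemma dp_le [dintros]: assumes "df n f" "df n g" shows "dp n (\<lambda>x. f x \<le> g x)"
  using dp_not[OF dp_less[OF assms(2,1)]] by (simp add: not_less)

lemma dp_eq [dintros]: assumes "df n f" "df n g" shows "dp n (\<lambda>x. f x = g x)"
  using dp_conj[OF dp_le[OF assms] dp_le[OF assms(2,1)]] by (simp add: eq_iff)

lemma df_add [dintros]: assumes "df n f" "df n g" shows "df n (\<lambda>x. f x + g x)"
proof -
  have "df 2 (\<lambda>x. x ! 0 + x ! 1)"
  proof -
    have "{z::'a list. length z = Suc 2 \<and> z ! 2 = take 2 z ! 0 + take 2 z ! 1} = {[x, y, x + y] | x y. True}"
      by (auto simp: numeral_2_eq_2 length_Suc_conv)
    then show ?thesis using D_plus unfolding df_def dp_def by (simp only: numeral_3_eq_3 numeral_2_eq_2)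
  qed
  moreover have "dl n 2 (\<lambda>x. [f x, g x])"
    using dl_Cons[OF assms(1) dl_Cons[OF assms(2) dl_Nil refl] refl] by (simp add: numeral_2_eq_2)
  ultimately show ?thesis using df_comp[of 2 _ n "\<lambda>x. [f x, g x]"] by fastforce
qed

lemma df_mult [dintros]: assumes "df n f" "df n g" shows "df n (\<lambda>x. f x * g x)"
proof -
  have "df 2 (\<lambda>x. x ! 0 * x ! 1)"
  proof -
    have "{z::'a list. length z = Suc 2 \<and> z ! 2 = take 2 z ! 0 * take 2 z ! 1} = {[x, y, x * y] | x y. True}"
      by (auto simp: numeral_2_eq_2 length_Suc_conv)
    then show ?thesis using D_times unfolding df_def dp_def by (simp only: numeral_3_eq_3 numeral_2_eq_2)
  qed
  moreover have "dl n 2 (\<lambda>x. [f x, g x])"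
    using dl_Cons[OF assms(1) dl_Cons[OF assms(2) dl_Nil refl] refl] by (simp add: numeral_2_eq_2)
  ultimately show ?thesis using df_comp[of 2 _ n "\<lambda>x. [f x, g x]"] by fastforce
qed

lemma dp_lift: "dp n P ==> dp (Suc n) (\<lambda>z. P (take n z))"
  by (rule dp_comp) (auto intro: dl_take0)

lemma df_lift: "df n f ==> df (Suc n) (\<lambda>z. f (take n z))"
  by (rule df_comp) (auto intro: dl_take0)

lemma df_last: "df (Suc n) (\<lambda>z. z ! n)"
  by (rule df_nth0) simp

text \<open>Without parameters a constant has to be defined by a condition that it alone
  satisfies.\<close>

lemma df_zero [dintros]: "df n (\<lambda>x. 0)"
  by (rule df_unique[where Q = "\<lambda>x y. y + y = y"], intro dp_eq df_add df_last) auto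

lemma df_one [dintros]: "df n (\<lambda>x. 1)"
  by (rule df_unique[where Q = "\<lambda>x y. y * y = y \<and> \<not> y = 0"],
      intro dp_conj dp_not dp_eq df_mult df_last df_zero) auto

lemma df_uminus [dintros]: assumes "df n f" shows "df n (\<lambda>x. - f x)"
  by (rule df_unique[where Q = "\<lambda>x y. y + f x = 0"])
    (intro dp_eq df_add df_last df_zero df_lift assms, simp add: eq_neg_iff_add_eq_0)

lemma df_minus [dintros]: assumes "df n f" "df n g" shows "df n (\<lambda>x. f x - g x)"
  using df_add[OF assms(1) df_uminus[OF assms(2)]] by simp

lemma df_if [dintros]: assumes "dp n P" "df n f" "df n g" shows "df n (\<lambda>x. if P x then f x else g x)"
  by (rule df_unique[where Q = "\<lambda>x y. (P x \<and> y = f x) \<or> (\<not> P x \<and> y = g x)"])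
    (auto intro!: dp_conj dp_disj dp_not dp_eq df_last df_lift dp_lift assms)

lemma df_divide [dintros]: assumes "df n f" "df n g" shows "df n (\<lambda>x. f x / g x)"
  by (rule df_unique[where Q = "\<lambda>x y. (g x = 0 \<and> y = 0) \<or> (\<not> g x = 0 \<and> y * g x = f x)"])
    (intro dp_conj dp_disj dp_not dp_eq df_last df_lift df_mult df_zero assms, auto simp: field_simps split: if_splits)

lemma df_abs [dintros]: assumes "df n f" shows "df n (\<lambda>x. \<bar>f x\<bar>)"
  unfolding abs_if by (intro dintros assms)

lemma df_numeral [dintros]: "df n (\<lambda>x. numeral k)"
proof (induction k)
  case (Bit0 k) then show ?case unfolding numeral_Bit0 by (intro dintros)
next
  case (Bit1 k) then show ?case unfolding numeral_Bit1 by (intro dintros)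
qed (simp add: df_one)

lemma dp_ex1 [dintros]:
  assumes "dp (Suc n) (\<lambda>z. Q (take n z) (z ! n))"
  shows "dp n (\<lambda>x. \<exists>!y. Q x y)"
proof -
  have 1: "dp (Suc (Suc n)) (\<lambda>w. Q (take n w) (w ! Suc n))"
  proof -
    have "dl (Suc (Suc n)) (Suc n) (\<lambda>w. take n w @ [w ! Suc n])"
      by (intro dl_append[of _ n _ 1] dl_take0 dl_Cons[of _ _ 0] dl_Nil df_nth0) auto
    from dp_comp[OF assms this] show ?thesis
      by (subst dp_cong[where Q = "\<lambda>x. Q (take n (take n x @ [x ! Suc n])) ((take n x @ [x ! Suc n]) ! n)"]) (auto simp: nth_append)
  qed
  have "dp n (\<lambda>x. \<exists>y. Q x y \<and> (\<forall>z. Q x z --> z = y))"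
    by (intro dp_ex dp_conj dp_all dp_imp dp_eq df_last assms) (auto intro!: dintros 1 simp: min_def)
  then show ?thesis by (simp add: Ex1_def)
qed

lemma df_the1 [dintros]:
  assumes "dp (Suc n) (\<lambda>z. Q (take n z) (z ! n))"
  shows "df n (\<lambda>x. the1 (Q x))"
proof (rule df_unique[where Q = "\<lambda>x y. ((\<exists>!y. Q x y) \<and> Q x y) \<or> (\<not> (\<exists>!y. Q x y) \<and> y = 0)"])
  show "dp (Suc n) (\<lambda>z. (\<exists>!y. Q (take n z) y) \<and> Q (take n z) (z ! n) \<or> \<not> (\<exists>!y. Q (take n z) y) \<and> z ! n = 0)"
    by (intro dp_conj dp_disj dp_not dp_eq df_last df_zero assms dp_lift[of n "\<lambda>x. \<exists>!y. Q x y"] dp_ex1)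
  show "(((\<exists>!y. Q x y) \<and> Q x y) \<or> (\<not> (\<exists>!y. Q x y) \<and> y = 0)) = (y = the1 (Q x))" for x y
    unfolding the1_def by (smt (verit, best) theI')
qed

lemma dp_near [dintros]:
  assumes "df n e" "dl n m l1" "dl n m l2" shows "dp n (\<lambda>x. near (e x) (l1 x) (l2 x))"
proof -
  have "dp n (\<lambda>x. \<forall>i<m. \<bar>l1 x ! i - l2 x ! i\<bar> < e x)"
    by (intro dp_all_less dp_less df_abs df_minus df_nth[OF assms(2)] df_nth[OF assms(3)] assms(1))
  then show ?thesis unfolding near_def using assms by (simp add: dl_length cong: dp_cong)
qed

text \<open>\<open>near\<close> forces the length of \<open>y\<close>, so the unrestricted
  quantifier is really one over tuples of length m.\<close>

lemma dp_all_near [dintros]: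
  assumes "dl n m l" "df n e" "dp (n + m) (\<lambda>z. Q (take n z) (drop n z))"
  shows "dp n (\<lambda>x. \<forall>y. near (e x) (l x) y --> Q x y)"
proof -
  have 1: "dl (n + m) m (\<lambda>z. l (take n z))" "df (n + m) (\<lambda>z. e (take n z))"
    by (rule dl_comp[OF assms(1) dl_take0] df_comp[OF assms(2) dl_take0], simp)+
  have "dp n (\<lambda>x. \<forall>y. length y = m --> (near (e x) (l x) y --> Q x y))"
    by (intro dp_all_list dp_imp dp_near[where m = m] 1 assms(3) dl_drop[OF dl_id]) simp
  then show ?thesis using assms(1) by (subst dp_cong) (auto simp: near_def dl_length)
qed

lemma D_Collect: "dp n P ==> D n {x. length x = n \<and> P x}"
  unfolding dp_def .

lemma D_Union: "finite V ==> (\<And>Z. Z \<in> V ==> D n Z) ==> D n (\<Union>V)"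
  by (subst D_eq_dp) (use D_sub in \<open>auto intro!: dintros simp: Union_iff\<close>)

end

section \<open>O-minimal structures\<close>

context dstruct
begin

lemma dl_single: "df n t ==> dl n 1 (\<lambda>x. [t x])"
  using dl_Cons[OF _ dl_Nil refl] by simp

lemma dl_pair: "df n s ==> df n t ==> dl n 2 (\<lambda>x. [s x, t x])"
  using dl_Cons[OF _ dl_Cons[OF _ dl_Nil refl] refl] by (simp add: numeral_2_eq_2)

lemma dp_rel:
  assumes "dp (Suc n) (\<lambda>z. Q (take n z) (z ! n))" "dl N n l" "df N t"
  shows "dp N (\<lambda>z. Q (l z) (t z))"
proof -
  have "dl N (Suc n) (\<lambda>z. l z @ [t z])"
    by (rule dl_append[OF assms(2) dl_single[OF assms(3)]]) simp
  from dp_comp[OF assms(1) this] show ?thesis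
    by (subst dp_cong[where Q = "\<lambda>z. Q (take n (l z @ [t z])) ((l z @ [t z]) ! n)"])
      (use dl_length[OF assms(2)] in \<open>auto simp: nth_append\<close>)
qed

end

locale omin = dstruct D for D :: "nat => 'a::linordered_field list set => bool" +
  assumes D_const: "D 1 {[a]}"
    and o_min: "D 1 {[x] | x. x \<in> Z} ==> \<exists>I. finite I \<and> Z = \<Union>I \<and>
      (\<forall>J\<in>I. (\<exists>a. J = {a}) \<or>
        (\<exists>lo hi. J = {x. (\<forall>a. lo = Some a --> a < x) \<and> (\<forall>b. hi = Some b --> x < b)}))"
begin

definition "d1 P \<longleftrightarrow> dp 1 (\<lambda>x. P (x ! 0))"
definition "f1 f \<longleftrightarrow> df 1 (\<lambda>x. f (x ! 0))"
definition "r2 R \<longleftrightarrow> dp 2 (\<lambda>x. R (x ! 0) (x ! 1))"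

lemma df_const [dintros]: "df n (\<lambda>x. a)"
proof -
  have "dp (Suc n) (\<lambda>z. [z ! n] \<in> {[a]})"
    by (rule dp_mem[OF D_const]) (intro dl_single df_last)
  then show ?thesis unfolding df_def by simp
qed

lemma dl_const [dintros]: "length u = m ==> dl n m (\<lambda>x. u)"
  by (rule dlI) (auto intro: df_const)

lemma d1_app: "d1 P ==> df n t ==> dp n (\<lambda>x. P (t x))"
  unfolding d1_def using dp_comp[of 1 "\<lambda>x. P (x ! 0)" n "\<lambda>x. [t x]"]
  dl_single by auto

lemma f1_app: "f1 f ==> df n t ==> df n (\<lambda>x. f (t x))"
  unfolding f1_def using df_comp[of 1 "\<lambda>x. f (x ! 0)" n "\<lambda>x. [t x]"]
  dl_single by auto

lemma r2_app: "r2 R ==> df n s ==> df n t ==> dp n (\<lambda>x. R (s x) (t x))"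
  unfolding r2_def using dp_comp[of 2 "\<lambda>x. R (x ! 0) (x ! 1)" n "\<lambda>x. [s x, t x]"] dl_pair by auto

lemma d1_rel: "dp (Suc n) (\<lambda>z. Q (take n z) (z ! n)) ==> length x = n ==> d1 (Q x)"
  unfolding d1_def by (rule dp_rel) (auto intro: dl_const df_nth0)

lemma d1_D:
  assumes "d1 P"
  obtains I where "finite I" "{t. P t} = \<Union>I"
    "\<And>J. J \<in> I ==> (\<exists>a. J = {a}) \<or>
      (\<exists>lo hi. J = {x. (\<forall>a. lo = Some a --> a < x) \<and> (\<forall>b. hi = Some b --> x < b)})"
proof -
  have "{x. length x = 1 \<and> P (x ! 0)} = {[t] | t. t \<in> {t. P t}}"
    by (auto simp: length_Suc_conv)
  then have "D 1 {[t] | t. t \<in> {t. P t}}" using assms unfolding d1_def dp_def by simp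
  from o_min[OF this] obtain I where "finite I \<and> {t. P t} = \<Union>I \<and> (\<forall>J\<in>I. (\<exists>a. J = {a}) \<or>
      (\<exists>lo hi. J = {x. (\<forall>a. lo = Some a --> a < x) \<and> (\<forall>b. hi = Some b --> x < b)}))" ..
  then show ?thesis by (intro that[of I]) simp_all
qed

text \<open>Just to the right of \<open>a\<close>, each of the finitely many points and intervals
  making up the set contains everything or nothing; the least of the radii serves the union. In this
  local form o-minimality enters most arguments about one variable.\<close>

lemma germ_right:
  assumes "d1 P"
  shows "\<exists>e>0. (\<forall>t. a < t \<and> t < a + e --> P t) \<or> (\<forall>t. a < t \<and> t < a + e --> \<not> P t)"
proof -
  obtain I where I: "finite I" "{t. P t} = \<Union>I" "\<And>J. J \<in> I ==> (\<exists>a. J = {a}) \<or>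
      (\<exists>lo hi. J = {x. (\<forall>a. lo = Some a --> a < x) \<and> (\<forall>b. hi = Some b --> x < b)})"
    using d1_D[OF assms] by blast
  have "\<exists>e>0. (\<forall>t. a < t \<and> t < a + e --> t \<in> J) \<or> (\<forall>t. a < t \<and> t < a + e --> t \<notin> J)" if "J \<in> I" for J
    using I(3)[OF that]
  proof (elim disjE exE)
    fix b assume J: "J = {b}"
    show ?thesis
    proof (cases "a < b")
      case True then show ?thesis unfolding J by (intro exI[of _ "b - a"]) auto
    next
      case False then show ?thesis unfolding J by (intro exI[of _ 1]) auto
    qed
  next
    fix lo hi assume J: "J = {x. (\<forall>a. lo = Some a --> a < x) \<and> (\<forall>b. hi = Some b --> x < b)}"
    have "\<exists>e>0. (\<forall>t. a < t \<and> t < a + e --> (\<forall>c. lo = Some c --> c < t)) \<or> (\<forall>t. a < t \<and> t < a + e --> \<not> (\<forall>c. lo = Some c --> c < t))"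
    proof (cases lo)
      case None then show ?thesis by (intro exI[of _ 1]) auto
    next
      case (Some c)
      show ?thesis
      proof (cases "c \<le> a")
        case True then show ?thesis using Some by (intro exI[of _ 1]) auto
      next
        case False then show ?thesis using Some by (intro exI[of _ "c - a"]) auto
      qed
    qed
    then obtain e1 where e1: "e1 > 0" "(\<forall>t. a < t \<and> t < a + e1 --> (\<forall>c. lo = Some c --> c < t)) \<or> (\<forall>t. a < t \<and> t < a + e1 --> \<not> (\<forall>c. lo = Some c --> c < t))" by blast
    have "\<exists>e>0. (\<forall>t. a < t \<and> t < a + e --> (\<forall>c. hi = Some c --> t < c)) \<or> (\<forall>t. a < t \<and> t < a + e --> \<not> (\<forall>c. hi = Some c --> t < c))"
    proof (cases hi)
      case None then show ?thesis by (intro exI[of _ 1]) auto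
    next
      case (Some c)
      show ?thesis
      proof (cases "c \<le> a")
        case True then show ?thesis using Some by (intro exI[of _ 1]) auto
      next
        case False then show ?thesis using Some by (intro exI[of _ "c - a"]) auto
      qed
    qed
    then obtain e2 where e2: "e2 > 0" "(\<forall>t. a < t \<and> t < a + e2 --> (\<forall>c. hi = Some c --> t < c)) \<or> (\<forall>t. a < t \<and> t < a + e2 --> \<not> (\<forall>c. hi = Some c --> t < c))" by blast
    have "(\<forall>t. a < t \<and> t < a + min e1 e2 --> t \<in> J) \<or> (\<forall>t. a < t \<and> t < a + min e1 e2 --> t \<notin> J)"
      unfolding J mem_Collect_eq using e1(2) e2(2) by (simp add: min_def) (smt (verit) less_trans add_le_cancel_left le_less_trans less_le_trans not_le)
    then show ?thesis using e1(1) e2(1) by (intro exI[of _ "min e1 e2"]) auto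
  qed
  then have "\<forall>J\<in>I. \<exists>e>0. (\<forall>t. a < t \<and> t < a + e --> t \<in> J) \<or> (\<forall>t. a < t \<and> t < a + e --> t \<notin> J)" by blast
  with I(1) have "\<exists>e>0. (\<forall>t. a < t \<and> t < a + e --> t \<in> \<Union>I) \<or> (\<forall>t. a < t \<and> t < a + e --> t \<notin> \<Union>I)"
  proof (induction I rule: finite_induct)
    case empty then show ?case by (intro exI[of _ 1]) auto
  next
    case (insert J I)
    then obtain e1 e2 where e: "e1 > 0" "e2 > 0"
      "(\<forall>t. a < t \<and> t < a + e1 --> t \<in> \<Union>I) \<or> (\<forall>t. a < t \<and> t < a + e1 --> t \<notin> \<Union>I)"
      "(\<forall>t. a < t \<and> t < a + e2 --> t \<in> J) \<or> (\<forall>t. a < t \<and> t < a + e2 --> t \<notin> J)" by auto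
    have m: "t < a + e1 \<and> t < a + e2" if "t < a + min e1 e2" for t
      using that by (auto simp: min_def split: if_splits)
    show ?case using e(1,2) by (intro exI[of _ "min e1 e2"] conjI) (use e(3,4) m in \<open>auto 4 4\<close>)
  qed
  moreover have "P t \<longleftrightarrow> t \<in> \<Union>I" for t using I(2) by blast
  ultimately show ?thesis by simp
qed

lemma d1_uminus: "d1 P ==> d1 (\<lambda>t. P (- t))"
  unfolding d1_def[of "\<lambda>t. P (- t)"] by (intro d1_app df_uminus df_nth0) auto

text \<open>Of finitely many points and intervals with infinite union one is infinite, hence an
  interval, and two of its points span the required piece.\<close>

lemma infinite_interval:
  assumes "d1 P" "infinite {t. P t}"
  shows "\<exists>a b. a < b \<and> (\<forall>t. a < t \<and> t < b --> P t)"
proof -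
  obtain I where I: "finite I" "{t. P t} = \<Union>I" "\<And>J. J \<in> I ==> (\<exists>a. J = {a}) \<or>
      (\<exists>lo hi. J = {x. (\<forall>a. lo = Some a --> a < x) \<and> (\<forall>b. hi = Some b --> x < b)})"
    using d1_D[OF assms(1)] by blast
  then obtain J where J: "J \<in> I" "infinite J" using assms(2) by (metis finite_Union)
  then obtain x where x: "x \<in> J" by fastforce
  have "infinite (J - {x})" using J by simp
  then obtain y where y: "y \<in> J" "y \<noteq> x" by (metis Diff_iff finite.emptyI insertCI subsetI subset_empty all_not_in_conv)
  have conv: "t \<in> J" if "min x y < t" "t < max x y" for t
    using I(3)[OF J(1)] x y that J(2) by (auto simp: min_def max_def split: if_splits)
  show ?thesis
  proof (rule exI[of _ "min x y"], rule exI[of _ "max x y"], intro conjI allI impI)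
    show "min x y < max x y" using y by (simp add: min_def max_def)
    fix t assume "min x y < t \<and> t < max x y"
    then have "t \<in> \<Union>I" using conv J(1) by blast
    then show "P t" using I(2) by auto
  qed
qed

text \<open>All the germs at \<open>a\<close> on the right are constant; if every one were false,
  finitely many radii would leave a common stretch that no \<open>P s\<close> meets.\<close>

lemma cover:
  assumes "finite S" "\<And>s. s \<in> S ==> d1 (P s)" "a < b" "\<And>t. a < t ==> t < b ==> \<exists>s\<in>S. P s t"
  shows "\<exists>s\<in>S. \<exists>c>a. c \<le> b \<and> (\<forall>t. a < t \<and> t < c --> P s t)"
proof (rule ccontr)
  assume n: "\<not> ?thesis"
  have "\<forall>s\<in>S. \<exists>e>0. \<forall>t. a < t \<and> t < a + e --> \<not> P s t"
  proof
    fix s assume s: "s \<in> S"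
    obtain e where e: "e > 0" "(\<forall>t. a < t \<and> t < a + e --> P s t) \<or> (\<forall>t. a < t \<and> t < a + e --> \<not> P s t)"
      using germ_right[OF assms(2)[OF s]] by blast
    have "\<not> (\<forall>t. a < t \<and> t < a + e --> P s t)"
    proof
      assume *: "\<forall>t. a < t \<and> t < a + e --> P s t"
      have "a < min (a + e) b" "min (a + e) b \<le> b" using assms(3) e(1) by auto
      then show False using n s * by (meson min_less_iff_conj)
    qed
    then show "\<exists>e>0. \<forall>t. a < t \<and> t < a + e --> \<not> P s t" using e by blast
  qed
  then obtain e where e: "\<And>s. s \<in> S ==> e s > 0" "\<And>s t. s \<in> S ==> a < t ==> t < a + e s ==> \<not> P s t" by metis
  define m where "m = Min (insert b ((\<lambda>s. a + e s) ` S))"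
  have "a < m" unfolding m_def using assms(1,3) e(1) by auto
  then obtain t where t: "a < t" "t < m" using dense by blast
  then have "t < b" "\<And>s. s \<in> S ==> t < a + e s" unfolding m_def using assms(1) by auto
  then show False using assms(4) t e(2) by blast
qed

text \<open>The order of M need not be complete, but a bounded finite union of points and intervals
  has the largest right end point of its nonempty pieces as supremum.\<close>

lemma sup_ex:
  assumes "d1 P" "P t0" "\<And>t. P t ==> t \<le> u"
  obtains s where "\<And>t. P t ==> t \<le> s" "\<And>v. (\<And>t. P t ==> t \<le> v) ==> s \<le> v"
proof -
  define sp where "sp J s \<longleftrightarrow> (\<forall>t\<in>J. t \<le> s) \<and> (\<forall>v. (\<forall>t\<in>J. t \<le> v) --> s \<le> v)" for J :: "'a set" and s
  obtain I where I: "finite I" "{t. P t} = \<Union>I" "\<And>J. J \<in> I ==> (\<exists>a. J = {a}) \<or>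
      (\<exists>lo hi. J = {x. (\<forall>a. lo = Some a --> a < x) \<and> (\<forall>b. hi = Some b --> x < b)})"
    using d1_D[OF assms(1)] by blast
  have 1: "\<exists>s. sp J s" if "J \<in> I" "J \<noteq> {}" for J
    using I(3)[OF that(1)]
  proof (elim disjE exE)
    fix a assume "J = {a}" then show ?thesis unfolding sp_def by blast
  next
    fix lo hi assume J: "J = {x. (\<forall>a. lo = Some a --> a < x) \<and> (\<forall>b. hi = Some b --> x < b)}"
    obtain x where x: "x \<in> J" using \<open>J \<noteq> {}\<close> by blast
    have bd: "t \<le> u" if "t \<in> J" for t using that assms(3) I(2) \<open>J \<in> I\<close> by blast
    have "hi \<noteq> None"
    proof
      assume "hi = None"
      then have "max x u + 1 \<in> J" using x unfolding J by (auto simp: max_def intro: less_trans order.strict_trans1)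
      from bd[OF this] show False by (meson less_add_one max.cobounded2 not_le order.strict_trans1)
    qed
    then obtain b where b: "hi = Some b" by blast
    have "sp J b" unfolding sp_def
    proof (intro conjI ballI allI impI)
      fix t assume "t \<in> J" then show "t \<le> b" unfolding J using b by auto
    next
      fix v assume v: "\<forall>t\<in>J. t \<le> v"
      show "b \<le> v"
      proof (rule ccontr)
        assume "\<not> b \<le> v"
        then have "max v x < b" using x b unfolding J by auto
        then obtain t where t: "max v x < t" "t < b" using dense by blast
        then have "t \<in> J" using x b unfolding J by auto
        then show False using v t by fastforce
      qed
    qed
    then show ?thesis by blast
  qed
  have "\<exists>s. sp (\<Union>K) s" if "finite K" "K \<subseteq> I" "\<Union>K \<noteq> {}" for K
    using that
  proof (induction K rule: finite_induct)
    case (insert J K)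
    show ?case
    proof (cases "\<Union>K = {} \<or> J = {}")
      case True
      then consider "\<Union>K = {}" "\<Union>(insert J K) = J" | "J = {}" "\<Union>(insert J K) = \<Union>K" by auto
      then show ?thesis
      proof cases
        case 1
        then show ?thesis using \<open>\<And>J. J \<in> I ==> J \<noteq> {} ==> \<exists>s. sp J s\<close>[of J] insert.prems by simp
      next
        case 2
        then show ?thesis using insert.IH insert.prems by simp
      qed
    next
      case False
      then obtain s1 s2 where "sp (\<Union>K) s1" "sp J s2" using insert 1[of J] by auto
      then have "sp (\<Union>(insert J K)) (max s1 s2)" unfolding sp_def Union_insert by (intro conjI ballI allI impI) (metis UnE le_max_iff_disj, metis UnCI max.bounded_iff)
      then show ?thesis by blast
    qed
  qed auto
  moreover have "\<Union>I \<noteq> {}" using assms(2) I(2) by (metis empty_iff mem_Collect_eq)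
  ultimately obtain s where "sp {t. P t} s" using I(1,2) by auto
  then show ?thesis using that unfolding sp_def by blast
qed

text \<open>The supremum of the points up to which the value at \<open>x\<close> persists must be
  \<open>y\<close>, as local constancy would carry the value past any smaller point. This takes the
  place of topological connectedness, which M lacks in general.\<close>

lemma interval_connected:
  assumes "d1 P" "x \<le> y" "\<And>t. x \<le> t ==> t \<le> y ==> \<exists>e>0. \<forall>u. \<bar>u - t\<bar> < e --> (P u \<longleftrightarrow> P t)"
  shows "P x = P y"
proof -
  have *: "Q y" if d: "d1 Q" and lc: "\<And>t. x \<le> t ==> t \<le> y ==> \<exists>e>0. \<forall>u. \<bar>u - t\<bar> < e --> (Q u \<longleftrightarrow> Q t)" and Qx: "Q x" for Q
  proof -
    define A where "A t \<longleftrightarrow> x \<le> t \<and> t \<le> y \<and> Q t \<and> (\<forall>u. x \<le> u \<and> u \<le> t --> Q u)" for t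
    have "d1 A" unfolding d1_def A_def by (rule dintros d1_app[OF d] | simp)+
    moreover have "A x" unfolding A_def using Qx assms(2) by (auto dest: order.antisym)
    moreover have "A t ==> t \<le> y" for t unfolding A_def by blast
    ultimately obtain s where s: "\<And>t. A t ==> t \<le> s" "\<And>v. (\<And>t. A t ==> t \<le> v) ==> s \<le> v"
      using sup_ex[of A x y] by blast
    have sx: "x \<le> s" "s \<le> y" using s \<open>A x\<close> A_def by auto
    obtain e where e: "e > 0" "\<And>u. \<bar>u - s\<bar> < e ==> Q u = Q s" using lc[OF sx] by blast
    obtain t where t: "A t" "s - e < t" using s(2)[of "s - e"] e(1) by (metis diff_less_eq less_add_same_cancel1 not_le)
    have "t \<le> s" using s t by blast
    then have "Q s" using e(2)[of t] t e(1) unfolding A_def by (auto simp: abs_if)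
    then have Qe: "Q u" if "\<bar>u - s\<bar> < e" for u using e(2) that by blast
    have "A (min y (s + e / 2))"
    proof -
      have "Q u" if "x \<le> u" "u \<le> min y (s + e/2)" for u
      proof (cases "u \<le> t")
        case True then show ?thesis using t that unfolding A_def by blast
      next
        case False
        have "e/2 < e" using e(1) by simp
        moreover have "u \<le> s + e / 2" "s - e < u" using that False t by auto
        ultimately show ?thesis by (intro Qe, unfold abs_less_iff, linarith)
      qed
      moreover have "x \<le> min y (s + e/2)" using sx e(1) by (simp add: add_increasing2 assms(2))
      ultimately show ?thesis unfolding A_def by auto
    qed
    then have "min y (s + e/2) \<le> s" using s by blast
    then have "y \<le> s" using e(1) by (auto simp: min_def split: if_splits)
    then show "Q y" using \<open>A (min y (s + e / 2))\<close> \<open>Q s\<close> sx by simp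
  qed
  show ?thesis
  proof (cases "P x")
    case True then show ?thesis using *[OF assms(1,3)] by blast
  next
    case False
    have "d1 (\<lambda>t. \<not> P t)" unfolding d1_def by (rule dintros d1_app[OF assms(1)] | simp)+
    then show ?thesis using *[of "\<lambda>t. \<not> P t"] assms(3) False by blast
  qed
qed

section \<open>Definable choice\<close>

definition "isinf P a \<longleftrightarrow> (\<forall>t. 0 \<le> t \<and> P t --> a \<le> t) \<and> (\<forall>c. (\<forall>t. 0 \<le> t \<and> P t --> c \<le> t) --> c \<le> (a::'a))"
definition "issup P a \<longleftrightarrow> (\<forall>t. P t --> t \<le> a) \<and> (\<forall>c. (\<forall>t. P t --> t \<le> c) --> a \<le> (c::'a))"
definition "infty P = the1 (isinf P)"
definition "initial P b \<longleftrightarrow> infty P < b \<and> (\<forall>t. infty P < t \<and> t < b --> P t)"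
text \<open>A canonical element of a set with nonnegative elements. Let a be the infimum of its
  nonnegative part: take a if it belongs to the set; otherwise the set contains an interval starting
  at a, and one takes a + 1 if it is unbounded, else the midpoint of the longest one.
  \<open>pick\<close> reflects sets of negative numbers. As the rule is explicit, the chosen element
  depends definably on the set.\<close>

definition "pick0 P = (if P (infty P) then infty P
   else if (\<forall>t. infty P < t --> P t) then infty P + 1 else (infty P + the1 (issup (initial P))) / 2)"
definition "pick P = (if \<exists>t. 0 \<le> t \<and> P t then pick0 P else - pick0 (\<lambda>t. P (- t)))"

lemma pick0:
  assumes "d1 P" "0 \<le> t0" "P t0" shows "P (pick0 P)"
proof -
  have "d1 (\<lambda>t. 0 \<le> - t \<and> P (- t))" unfolding d1_def by (rule dintros d1_app[OF assms(1)] | simp)+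
  from sup_ex[OF this, of "- t0" 0] obtain s where
    s: "\<And>t. 0 \<le> - t \<and> P (- t) ==> t \<le> s" "\<And>v. (\<And>t. 0 \<le> - t \<and> P (- t) ==> t \<le> v) ==> s \<le> v"
    using assms by auto
  have "isinf P (- s)" unfolding isinf_def
  proof (intro conjI allI impI)
    fix t assume "0 \<le> t \<and> P t" then show "- s \<le> t" using s(1)[of "- t"] by (simp add: minus_le_iff)
  next
    fix c assume "\<forall>t. 0 \<le> t \<and> P t --> c \<le> t"
    then have "s \<le> - c" by (intro s(2)) (metis le_minus_iff)
    then show "c \<le> - s" by (simp add: le_minus_iff)
  qed
  then have inf: "isinf P (infty P)" unfolding infty_def
    by (subst the1_eq[where y = "- s"]) (auto simp: isinf_def intro: order.antisym)
  let ?a = "infty P"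
  have a0: "0 \<le> ?a" using inf unfolding isinf_def by blast
  show ?thesis
  proof (cases "P ?a")
    case True then show ?thesis unfolding pick0_def by simp
  next
    case nP: False
    obtain e where e: "e > 0" "(\<forall>t. ?a < t \<and> t < ?a + e --> P t) \<or> (\<forall>t. ?a < t \<and> t < ?a + e --> \<not> P t)"
      using germ_right[OF assms(1)] by blast
    have "\<not> (\<forall>t. ?a < t \<and> t < ?a + e --> \<not> P t)"
    proof
      assume n: "\<forall>t. ?a < t \<and> t < ?a + e --> \<not> P t"
      have "?a + e \<le> t" if "0 \<le> t \<and> P t" for t
      proof -
        have "?a \<le> t" "t \<noteq> ?a" using inf that nP unfolding isinf_def by auto
        then show ?thesis using n that by force
      qed
      then have "?a + e \<le> ?a" using inf unfolding isinf_def by blast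
      then show False using e(1) by simp
    qed
    then have ini: "initial P (?a + e)" unfolding initial_def using e by auto
    show ?thesis
    proof (cases "\<forall>t. ?a < t --> P t")
      case True then show ?thesis unfolding pick0_def using nP by simp
    next
      case False
      then obtain u where u: "?a < u" "\<not> P u" by blast
      have "d1 (initial P)" unfolding d1_def initial_def by (rule dintros d1_app[OF assms(1)] | simp)+
      moreover have "t \<le> u" if "initial P t" for t using that u unfolding initial_def by (meson not_le)
      ultimately obtain s where "\<And>t. initial P t ==> t \<le> s" "\<And>v. (\<And>t. initial P t ==> t \<le> v) ==> s \<le> v"
        using sup_ex[of "initial P" "?a + e" u] ini by blast
      then have s: "issup (initial P) s" unfolding issup_def by blast
      then have S: "the1 (issup (initial P)) = s"
        by (intro the1_eq) (auto simp: issup_def intro: order.antisym)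
      have "?a + e \<le> s" using s ini unfolding issup_def by blast
      then have as: "?a < s" using e(1) by (meson less_add_same_cancel1 order.strict_trans2)
      then have "(?a + s) / 2 < s" "?a < (?a + s) / 2" by (simp_all add: field_simps)
      then obtain b where "initial P b" "(?a + s) / 2 < b" using s unfolding issup_def by (meson not_le)
      then have "P ((?a + s) / 2)" using \<open>?a < (?a + s) / 2\<close> unfolding initial_def by blast
      then show ?thesis unfolding pick0_def using nP False S by auto
    qed
  qed
qed

lemma pick: assumes "d1 P" "P t0" shows "P (pick P)"
proof (cases "\<exists>t. 0 \<le> t \<and> P t")
  case True then show ?thesis unfolding pick_def using pick0[OF assms(1)] by auto
next
  case False
  then have "0 \<le> - t0" using assms(2) by (metis le_cases neg_0_le_iff_le)
  then show ?thesis using pick0[OF d1_uminus[OF assms(1)], of "- t0"] assms(2) unfolding pick_def if_not_P[OF False] by simp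
qed

lemma df_pick:
  assumes Q: "dp (Suc n) (\<lambda>z. Q (take n z) (z ! n))"
  shows "df n (\<lambda>x. pick (Q x))"
proof -
  \<comment> \<open>The factor \<open>s\<close> is 1 or -1; the latter treats the reflected
    set.\<close>
  have inf: "df n (\<lambda>x. infty (\<lambda>t. Q x (s * t)))" for s
    unfolding infty_def isinf_def by (rule dintros dp_rel[OF Q] | simp)+
  have inf': "df N (\<lambda>x. infty (\<lambda>t. Q (l x) (s * t)))" if "dl N n l" for N l s
    by (rule df_comp[OF inf that])
  have "df n (\<lambda>x. pick0 (\<lambda>t. Q x (s * t)))" for s
    unfolding pick0_def initial_def issup_def
    by (rule dintros inf' dp_rel[OF Q] | simp)+
  from this[of 1] this[of "-1"] have p: "df n (\<lambda>x. pick0 (Q x))" "df n (\<lambda>x. pick0 (\<lambda>t. Q x (- t)))"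
    by simp_all
  show ?thesis unfolding pick_def
    by (rule dintros p dp_rel[OF Q] | simp)+
qed

text \<open>Definable Skolem functions: each fibre is a definable set in one variable, so
  \<open>pick\<close> finds a member of it, and \<open>df_pick\<close> makes the choice definable in
  \<open>x\<close>.\<close>

lemma choice:
  assumes "dp (Suc n) (\<lambda>z. Q (take n z) (z ! n))"
  obtains f where "df n f" "\<And>x y. length x = n ==> Q x y ==> Q x (f x)"
  by (rule that[OF df_pick[OF assms]], rule pick[OF d1_rel[OF assms]])

end

section \<open>Monotonicity and differentiability\<close>

context omin
begin

lemma infinite_image_interval:
  assumes f: "f1 f" and P: "d1 P" and inf: "infinite (f ` {t. P t})"
  shows "\<exists>p q. p < q \<and> (\<forall>y. p < y \<and> y < q --> (\<exists>t. P t \<and> y = f t))"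
proof -
  have "d1 (\<lambda>y. \<exists>t. P t \<and> y = f t)" unfolding d1_def
    by (rule dintros d1_app[OF P] f1_app[OF f] | simp)+
  moreover have "{y. \<exists>t. P t \<and> y = f t} = f ` {t. P t}" by auto
  ultimately show ?thesis using infinite_interval[of "\<lambda>y. \<exists>t. P t \<and> y = f t"] inf by simp
qed

text \<open>The image of \<open>r\<close> either has an infinite fibre or contains an interval of positive values.\<close>

lemma uniform_radius:
  assumes R: "r2 R" and ab: "a < b" and ex: "\<And>t. a < t ==> t < b ==> \<exists>e>0. R t e"
    and anti: "\<And>t e e'. R t e ==> 0 < e' ==> e' \<le> e ==> R t e'"
  obtains c d e where "a \<le> c" "c < d" "d \<le> b" "e > 0" "\<And>t. c < t ==> t < d ==> R t e"
proof -
  have "dp (Suc 1) (\<lambda>z. 0 < z ! 1 \<and> R (take 1 z ! 0) (z ! 1))"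
    by (rule dintros r2_app[OF R] | simp)+
  then obtain f where f: "df 1 f" "\<And>x y. length x = 1 ==> 0 < y \<and> R (x ! 0) y ==> 0 < f x \<and> R (x ! 0) (f x)"
    using choice[of 1 "\<lambda>x y. 0 < y \<and> R (x ! 0) y"] by auto
  define r where "r t = f [t]" for t
  have r1: "f1 r" unfolding f1_def r_def
    by (rule df_comp[OF f(1)]) (rule dintros | simp)+
  have r: "0 < r t \<and> R t (r t)" if t: "a < t" "t < b" for t
    using ex[OF t] f(2)[of "[t]"] unfolding r_def by auto
  define A where "A t \<longleftrightarrow> a < t \<and> t < b" for t
  have A: "d1 A" unfolding d1_def A_def by (rule dintros | simp)+
  have infA: "infinite {t. A t}" unfolding A_def using infinite_Ioo[OF ab] by (simp add: greaterThanLessThan_def greaterThan_def lessThan_def Int_def)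
  have "\<exists>v>0. infinite {t. A t \<and> v \<le> r t}"
  proof (cases "finite (r ` {t. A t})")
    case True
    then obtain t0 where t0: "A t0" "infinite {t. A t \<and> r t = r t0}"
      using pigeonhole_infinite[OF infA True] by auto
    have "infinite {t. A t \<and> r t0 \<le> r t}" by (rule infinite_super[OF _ t0(2)]) auto
    then show ?thesis using t0(1) r unfolding A_def by blast
  next
    case False
    then obtain p q where pq: "p < q" "\<And>y. p < y ==> y < q ==> \<exists>t. A t \<and> y = r t"
      using infinite_image_interval[OF r1 A] by blast
    define m where "m = (p + q) / 2"
    have m: "p < m" "m < q" unfolding m_def using pq(1) by (simp_all add: field_simps)
    then have "0 < m" using pq(2)[of m] r unfolding A_def by auto
    have "{m<..<q} \<subseteq> r ` {t. A t \<and> m \<le> r t}"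
    proof
      fix y assume "y \<in> {m<..<q}"
      then show "y \<in> r ` {t. A t \<and> m \<le> r t}" using pq(2)[of y] m by auto
    qed
    then have "infinite {t. A t \<and> m \<le> r t}" using infinite_Ioo[OF m(2)] finite_surj by blast
    then show ?thesis using \<open>0 < m\<close> by blast
  qed
  then obtain v where v: "v > 0" "infinite {t. A t \<and> v \<le> r t}" by blast
  have "d1 (\<lambda>t. A t \<and> v \<le> r t)" unfolding d1_def
    by (rule dintros d1_app[OF A] f1_app[OF r1] | simp)+
  from infinite_interval[OF this v(2)] obtain c d where
    cd: "c < d" "\<And>t. c < t ==> t < d ==> A t \<and> v \<le> r t" by blast
  have "a \<le> c" by (rule dense_ge_bounded[OF cd(1)]) (use cd(2) A_def in fastforce)
  have "d \<le> b" by (rule dense_le_bounded[OF cd(1)]) (use cd(2) A_def in fastforce)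
  with \<open>a \<le> c\<close> show ?thesis using that[of c d v] cd v r anti unfolding A_def by blast
qed

definition "cont1 f t \<longleftrightarrow> (\<forall>\<epsilon>>0. \<exists>\<eta>>0. \<forall>u. \<bar>u - t\<bar> < \<eta> --> \<bar>f u - f t :: 'a\<bar> < \<epsilon>)"

definition "mono_type s f x y \<longleftrightarrow> (case s of None => f y = f x | Some True => f x < f y | Some False => f y < (f x::'a))"

lemma mono_type_df:
  assumes "df n (\<lambda>z. f z (s z))" "df n (\<lambda>z. f z (t z))"
  shows "dp n (\<lambda>z. mono_type \<tau> (f z) (s z) (t z))"
proof (cases \<tau>)
  case None
  then show ?thesis unfolding mono_type_def by (simp add: dp_eq assms)
next
  case (Some b)
  then show ?thesis unfolding mono_type_def by (cases b) (simp_all add: dp_less assms)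
qed

text \<open>The image of an increasing function is infinite, hence contains an interval; over a
  smaller interval of values everything near \<open>f t\<close> is attained, and monotonicity
  confines \<open>f\<close> between two attained values.\<close>

lemma incr_cont:
  assumes f: "f1 f" and ab: "a < b" and inc: "\<And>x y. a < x ==> x < y ==> y < b ==> f x < f y"
  obtains c d where "a \<le> c" "c < d" "d \<le> b" "\<And>t. c < t ==> t < d ==> cont1 f t"
proof -
  have A: "d1 (\<lambda>t. a < t \<and> t < b)" unfolding d1_def by (rule dintros | simp)+
  have inf: "infinite {t. a < t \<and> t < b}" using infinite_Ioo[OF ab] by (simp add: greaterThanLessThan_def greaterThan_def lessThan_def Int_def)
  have inj: "inj_on f {t. a < t \<and> t < b}" by (rule linorder_inj_onI') (use inc in fastforce)
  then have "infinite (f ` {t. a < t \<and> t < b})" using inf finite_imageD by blast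
  then obtain p q where pq: "p < q" "\<And>y. p < y ==> y < q ==> \<exists>t. (a < t \<and> t < b) \<and> y = f t"
    using infinite_image_interval[OF f A] by blast
  obtain p' where p': "p < p'" "p' < q" using dense[OF pq(1)] by blast
  obtain q' where q': "p' < q'" "q' < q" using dense[OF p'(2)] by blast
  obtain c where c: "a < c" "c < b" "p' = f c" using pq(2)[of p'] p' by blast
  obtain d where d: "a < d" "d < b" "q' = f d" using pq(2)[of q'] p' q' by auto
  have cd: "c < d"
  proof (rule ccontr)
    assume "\<not> c < d"
    then have "d < c \<or> d = c" by auto
    then show False using inc[of d c] c d q' by auto
  qed
  have "cont1 f t" if t: "c < t" "t < d" for t
    unfolding cont1_def
  proof (intro allI impI)
    fix e :: 'a assume e: "0 < e"
    have ft: "p' < f t" "f t < q'" using inc[of c t] inc[of t d] c d t by auto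
    then obtain y1 where y1: "max p' (f t - e) < y1" "y1 < f t" using dense[of "max p' (f t - e)" "f t"] e by auto
    obtain y2 where y2: "f t < y2" "y2 < min q' (f t + e)" using dense[of "f t" "min q' (f t + e)"] ft e by auto
    obtain u1 where u1: "a < u1" "u1 < b" "y1 = f u1" using pq(2)[of y1] y1 p' q' ft by auto
    obtain u2 where u2: "a < u2" "u2 < b" "y2 = f u2" using pq(2)[of y2] y2 p' q' ft by auto
    have ut: "u1 < t" "t < u2"
    proof -
      show "u1 < t" using inc[of t u1] y1 u1 t c d by (metis not_less_iff_gr_or_eq less_trans)
      show "t < u2" using inc[of u2 t] y2 u2 t c d by (metis not_less_iff_gr_or_eq less_trans)
    qed
    show "\<exists>\<eta>>0. \<forall>u. \<bar>u - t\<bar> < \<eta> --> \<bar>f u - f t\<bar> < e"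
    proof (intro exI[of _ "min (t - u1) (u2 - t)"] conjI allI impI)
      show "0 < min (t - u1) (u2 - t)" using ut by simp
      fix u assume "\<bar>u - t\<bar> < min (t - u1) (u2 - t)"
      then have u: "u1 < u" "u < u2" by (auto simp: abs_less_iff)
      then have "f u1 < f u" "f u < f u2" using inc u1 u2 by auto
      then show "\<bar>f u - f t\<bar> < e" using y1 y2 u1 u2 by (auto simp: abs_less_iff algebra_simps)
    qed
  qed
  then show ?thesis using that[of c d] c d cd by auto
qed

lemma f1_minus: "f1 f ==> f1 (\<lambda>t. - f t)"
  unfolding f1_def by (rule df_uminus)

lemma cont1_minus: "cont1 (\<lambda>t. - f t) t ==> cont1 f t"
  unfolding cont1_def by (simp add: abs_minus_commute)

text \<open>The monotonicity theorem on some subinterval, which is all that generic arguments need.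
  At each point the comparison of \<open>f\<close> with its value there has a constant germ on the
  right; \<open>cover\<close> makes its type the same for all points of a subinterval, and
  \<open>uniform_radius\<close> gives them a common radius.\<close>

lemma monotonicity:
  assumes f: "f1 f" and ab: "a < b"
  shows "\<exists>c d \<tau>. a \<le> c \<and> c < d \<and> d \<le> b \<and> (\<forall>t. c < t \<and> t < d --> cont1 f t) \<and>
    (\<forall>x y. c < x \<and> x < y \<and> y < d --> mono_type \<tau> f x y)"
proof -
  define P where "P \<tau> t \<longleftrightarrow> (\<exists>e. 0 < e \<and> (\<forall>u. t < u \<and> u < t + e --> mono_type \<tau> f t u))" for \<tau> t
  define S :: "bool option set" where "S = {None, Some True, Some False}"
  have g: "d1 (mono_type \<tau> f t)" for \<tau> t unfolding d1_def by (rule dintros mono_type_df f1_app[OF f] | simp)+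
  have "\<exists>\<tau>\<in>S. P \<tau> t" for t
  proof (rule ccontr)
    assume n: "\<not> ?thesis"
    have "\<exists>e>0. \<forall>u. t < u \<and> u < t + e --> \<not> mono_type \<tau> f t u" if "\<tau> \<in> S" for \<tau>
      using germ_right[OF g[of \<tau> t], of t] n that unfolding P_def by blast
    then obtain e1 e2 e3 where e: "e1 > 0" "e2 > 0" "e3 > 0"
      "\<And>u. t < u ==> u < t + e1 ==> \<not> mono_type None f t u"
      "\<And>u. t < u ==> u < t + e2 ==> \<not> mono_type (Some True) f t u"
      "\<And>u. t < u ==> u < t + e3 ==> \<not> mono_type (Some False) f t u" unfolding S_def by (metis insertCI)
    obtain u where "t < u" "u < t + min e1 (min e2 e3)" using dense[of t "t + min e1 (min e2 e3)"] e(1-3) by auto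
    then have "t < u" "u < t + e1" "u < t + e2" "u < t + e3" by (auto simp: min_def split: if_splits)
    then show False using e(4-6)[of u] unfolding mono_type_def by auto
  qed
  moreover have "d1 (P \<tau>)" for \<tau> unfolding d1_def P_def
    by (rule dintros mono_type_df f1_app[OF f] | simp)+
  ultimately obtain \<tau> c where tc: "c > a" "c \<le> b" "\<And>t. a < t ==> t < c ==> P \<tau> t"
    using cover[of S P a b] ab unfolding S_def by (metis finite.emptyI finite_insert)
  have "r2 (\<lambda>t e. \<forall>u. t < u \<and> u < t + e --> mono_type \<tau> f t u)" unfolding r2_def
    by (rule dintros mono_type_df f1_app[OF f] | simp)+
  then obtain c1 d1 e where 1: "a \<le> c1" "c1 < d1" "d1 \<le> c" "e > 0"
    "\<And>t. c1 < t ==> t < d1 ==> \<forall>u. t < u \<and> u < t + e --> mono_type \<tau> f t u"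
    by (rule uniform_radius[OF _ tc(1)]) (use tc(3) in \<open>auto simp: P_def\<close>)
  \<comment> \<open>Of length at most the common radius \<open>e\<close>, so that every point of the
    interval controls all later ones.\<close>
  define d2 where "d2 = min d1 (c1 + e)"
  have m: "mono_type \<tau> f x y" if "c1 < x" "x < y" "y < d2" for x y
    using 1(5)[of x] that unfolding d2_def by (auto simp: algebra_simps)
  have cd2: "c1 < d2" "d2 \<le> b" unfolding d2_def using 1 tc by auto
  have "\<exists>c d. c1 \<le> c \<and> c < d \<and> d \<le> d2 \<and> (\<forall>t. c < t \<and> t < d --> cont1 f t)"
  proof (cases \<tau>)
    case None
    have "cont1 f t" if t: "c1 < t" "t < d2" for t unfolding cont1_def
    proof (intro allI impI)
      fix e :: 'a assume "0 < e"
      have eq: "f u = f t" if "c1 < u" "u < d2" for u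
        using m[of u t] m[of t u] t that None unfolding mono_type_def by (cases "u < t"; cases "t < u") auto
      show "\<exists>\<eta>>0. \<forall>u. \<bar>u - t\<bar> < \<eta> --> \<bar>f u - f t\<bar> < e"
      proof (intro exI[of _ "min (t - c1) (d2 - t)"] conjI allI impI)
        show "0 < min (t - c1) (d2 - t)" using t by simp
        fix u assume "\<bar>u - t\<bar> < min (t - c1) (d2 - t)"
        then have "c1 < u" "u < d2" by (auto simp: abs_less_iff)
        then show "\<bar>f u - f t\<bar> < e" using eq \<open>0 < e\<close> by simp
      qed
    qed
    then show ?thesis using cd2 by blast
  next
    case (Some b)
    show ?thesis
    proof (cases b)
      case True
      then have "f x < f y" if "c1 < x" "x < y" "y < d2" for x y
        using m[OF that] Some by (simp add: mono_type_def)
      then show ?thesis by (rule incr_cont[OF f cd2(1)]) blast+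
    next
      case False
      obtain c d where "c1 \<le> c" "c < d" "d \<le> d2" "\<And>t. c < t ==> t < d ==> cont1 (\<lambda>t. - f t) t"
        by (rule incr_cont[OF f1_minus[OF f] cd2(1)]) (use m Some False in \<open>auto simp: mono_type_def\<close>)
      then show ?thesis using cont1_minus by blast
    qed
  qed
  then obtain c d where "c1 \<le> c" "c < d" "d \<le> d2" "\<forall>t. c < t \<and> t < d --> cont1 f t" by blast
  moreover have "mono_type \<tau> f x y" if "c < x" "x < y" "y < d" for x y
    using m[of x y] that \<open>c1 \<le> c\<close> \<open>d \<le> d2\<close> by simp
  moreover have "a \<le> c" "d \<le> b" using 1(1) cd2 calculation by simp_all
  ultimately show ?thesis by blast
qed

text \<open>Only lower bounds for right difference quotients are assumed. The supremum of the points
  satisfying the inequality satisfies it by continuity, and it equals \<open>b\<close>, since the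
  quotient bound at a smaller point would carry the inequality further.\<close>

lemma mean_value_le:
  assumes f: "f1 f" and ab: "a \<le> b" and cont: "\<And>t. a \<le> t ==> t \<le> b ==> cont1 f t"
    and der: "\<And>t. a \<le> t ==> t < b ==> \<exists>e>0. \<forall>h. 0 < h \<and> h < e --> K * h \<le> f (t + h) - f t"
  shows "K * (b - a) \<le> f b - f a"
proof -
  define A where "A t \<longleftrightarrow> a \<le> t \<and> t \<le> b \<and> K * (t - a) \<le> f t - f a" for t
  have "d1 A" unfolding d1_def A_def by (rule dintros f1_app[OF f] | simp)+
  moreover have "A a" using ab unfolding A_def by simp
  moreover have "A t ==> t \<le> b" for t unfolding A_def by blast
  ultimately obtain s where s: "\<And>t. A t ==> t \<le> s" "\<And>v. (\<And>t. A t ==> t \<le> v) ==> s \<le> v"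
    using sup_ex[of A a b] by blast
  have sab: "a \<le> s" "s \<le> b" using s \<open>A a\<close> A_def by auto
  have aux: "False" if "R \<le> ft - fa" "R = P + Q" "ft - fs < (Q - (fs - fa)) / 2" "- P \<le> (Q - (fs - fa)) / 2" for R P Q ft fs fa :: 'a
    using that by (simp add: field_simps)
  have "A s"
  proof (rule ccontr)
    assume "\<not> A s"
    then have "0 < K * (s - a) - (f s - f a)" (is "0 < ?g") using sab unfolding A_def by auto
    then obtain e where e: "e > 0" "\<And>u. \<bar>u - s\<bar> < e ==> \<bar>f u - f s\<bar> < ?g / 2"
      using cont[OF sab] unfolding cont1_def by (meson half_gt_zero)
    \<comment> \<open>So small that within distance \<open>h\<close> both \<open>f\<close> and the
      linear term change by at most half of the supposed gap; adding 1 to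
      \<open>\<bar>K\<bar>\<close> keeps the divisor positive.\<close>
    define h where "h = min e (?g / 2 / (\<bar>K\<bar> + 1))"
    have h: "h > 0" unfolding h_def using e \<open>0 < ?g\<close> by (auto intro!: divide_pos_pos simp: add_nonneg_pos)
    have "\<not> s \<le> s - h" using h by simp
    then obtain t where t: "A t" "s - h < t" using s(2) by (meson not_le)
    have "t \<le> s" using s t by blast
    then have ts: "\<bar>t - s\<bar> < h" using t by (auto simp: abs_less_iff)
    then have 1: "\<bar>f t - f s\<bar> < ?g / 2" using e unfolding h_def by auto
    have "\<bar>t - s\<bar> \<le> ?g / 2 / (\<bar>K\<bar> + 1)" using ts unfolding h_def by auto
    then have "(\<bar>K\<bar> + 1) * \<bar>t - s\<bar> \<le> ?g / 2" by (subst mult.commute, subst (asm) pos_le_divide_eq) (auto simp: add_nonneg_pos)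
    moreover have "\<bar>K * (t - s)\<bar> \<le> (\<bar>K\<bar> + 1) * \<bar>t - s\<bar>" unfolding abs_mult by (intro mult_right_mono) auto
    ultimately have 2: "\<bar>K * (t - s)\<bar> \<le> ?g / 2" by simp
    have "K * (t - a) \<le> f t - f a" using t unfolding A_def by simp
    moreover have "K * (t - a) = K * (t - s) + K * (s - a)" by (simp add: algebra_simps)
    moreover have "f t - f s < ?g / 2" by (rule le_less_trans[OF abs_ge_self 1])
    moreover have "- (K * (t - s)) \<le> ?g / 2" by (rule order.trans[OF abs_ge_minus_self 2])
    ultimately show False using aux by blast
  qed
  have "s = b"
  proof (rule ccontr)
    assume "s \<noteq> b"
    then have sb: "s < b" using sab by simp
    then obtain e where e: "e > 0" "\<And>h. 0 < h ==> h < e ==> K * h \<le> f (s + h) - f s" using der sab by blast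
    obtain h where h: "0 < h" "h < min e (b - s)" using dense[of 0 "min e (b - s)"] e sb by auto
    have "K * h \<le> f (s + h) - f s" using e h by auto
    moreover have "K * (s - a) \<le> f s - f a" using \<open>A s\<close> unfolding A_def by simp
    ultimately have "K * (s + h - a) \<le> f (s + h) - f a" by (simp add: algebra_simps)
    then have "A (s + h)" using h sab unfolding A_def by auto
    then show False using s(1)[of "s + h"] h by simp
  qed
  then show ?thesis using \<open>A s\<close> unfolding A_def by simp
qed

definition "deriv1 f t d \<longleftrightarrow> (\<forall>\<epsilon>>0. \<exists>\<eta>>0. \<forall>h. h \<noteq> 0 \<and> \<bar>h\<bar> < \<eta> --> \<bar>(f (t + h) - f t) / h - (d::'a)\<bar> < \<epsilon>)"

text \<open>\<open>G x K\<close> says that the difference quotients just to the right of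
  \<open>x\<close> are at least \<open>K\<close>, so the supremum \<open>l x\<close> of such K is
  the right derivative. The mean value inequality rules out that it is infinite along an interval,
  and at a point near which \<open>l\<close> is continuous the same inequality makes it the
  two-sided derivative.\<close>

lemma differentiable_somewhere:
  assumes f: "f1 f" and ab: "a < b"
  shows "\<exists>t d. a < t \<and> t < b \<and> deriv1 f t d"
proof -
  obtain a0 b0 where 0: "a \<le> a0" "a0 < b0" "b0 \<le> b" "\<And>t. a0 < t ==> t < b0 ==> cont1 f t"
    using monotonicity[OF f ab] by metis
  define G where "G x K \<longleftrightarrow> (\<exists>e. 0 < e \<and> (\<forall>h. 0 < h \<and> h < e --> K * h \<le> f (x + h) - f x))" for x K
  have G: "r2 G" unfolding r2_def G_def by (rule dintros f1_app[OF f] | simp)+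
  have Gmono: "G x K'" if "G x K" "K' \<le> K" for x K K'
  proof -
    obtain e where e: "0 < e" "\<And>h. 0 < h ==> h < e ==> K * h \<le> f (x + h) - f x" using \<open>G x K\<close> unfolding G_def by blast
    have "K' * h \<le> f (x + h) - f x" if "0 < h" "h < e" for h
      using mult_right_mono[OF \<open>K' \<le> K\<close>, of h] e(2)[OF that] that by linarith
    then show ?thesis unfolding G_def using e(1) by blast
  qed
  have nG: "\<exists>e>0. \<forall>h. 0 < h \<and> h < e --> - K * h \<le> - f (x + h) - - f x" if "\<not> G x K" for x K
  proof -
    have "d1 (\<lambda>h. K * h \<le> f (x + h) - f x)" unfolding d1_def by (rule dintros f1_app[OF f] | simp)+
    from germ_right[OF this, of 0] that obtain e where "e > 0" "\<forall>h. 0 < h \<and> h < 0 + e --> \<not> K * h \<le> f (x + h) - f x"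
      unfolding G_def by auto
    then show ?thesis by (intro exI[of _ e]) (auto simp: algebra_simps)
  qed
  \<comment> \<open>The right derivative is +infinity (0), -infinity (1) or finite (2).\<close>
  define P where "P i x \<longleftrightarrow> (if i = (0::nat) then \<forall>K. G x K else if i = 1 then \<forall>K. \<not> G x K else \<not> (\<forall>K. G x K) \<and> \<not> (\<forall>K. \<not> G x K))" for i x
  have P: "d1 (P i)" for i unfolding d1_def P_def
    by (cases "i = 0"; cases "i = 1"; simp) (rule dintros r2_app[OF G] | simp)+
  obtain i c where ic: "c > a0" "c \<le> b0" "\<And>t. a0 < t ==> t < c ==> P i t" "i \<in> {0,1,2}"
  proof -
    have "\<exists>s\<in>{0,1,2}. P s t" for t unfolding P_def by auto
    from cover[of "{0,1,2}" P a0 b0, OF _ P 0(2) this] show ?thesis using that by blast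
  qed
  define p where "p = (2 * a0 + c) / 3"
  define q where "q = (a0 + 2 * c) / 3"
  have pq: "a0 < p" "p < q" "q < c" unfolding p_def q_def using ic by (simp_all add: field_simps)
  have cpq: "cont1 f t" "cont1 (\<lambda>t. - f t) t" if "p \<le> t" "t \<le> q" for t
  proof -
    show "cont1 f t" using 0(4) that pq ic by (meson order.strict_trans1 order.strict_trans2)
    then show "cont1 (\<lambda>t. - f t) t" using cont1_minus[of "\<lambda>t. - f t" t] by simp
  qed
  have Ppq: "P i t" if "p \<le> t" "t \<le> q" for t using ic(3) that pq by (meson order.strict_trans1 order.strict_trans2)
  \<comment> \<open>The slope of the chord: right quotients bounded below by \<open>K + 1\<close>,
    or above by \<open>K - 1\<close>, along the whole interval contradict the mean value
    inequality.\<close>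
  define K where "K = (f q - f p) / (q - p)"
  have K: "K * (q - p) = f q - f p" unfolding K_def using pq by simp
  have "i \<noteq> 0"
  proof
    assume "i = 0"
    then have "G t (K + 1)" if "p \<le> t" "t < q" for t using Ppq[of t] that unfolding P_def by simp
    then have "(K + 1) * (q - p) \<le> f q - f p"
      unfolding G_def by (intro mean_value_le[OF f] cpq) (use pq in auto)
    then show False using K pq by (simp add: algebra_simps)
  qed
  moreover have "i \<noteq> 1"
  proof
    assume i: "i = 1"
    have "\<not> G t (K - 1)" if "p \<le> t" "t < q" for t using Ppq[of t] that unfolding P_def i by simp
    then have "- (K - 1) * (q - p) \<le> - f q - - f p"
      by (intro mean_value_le[OF f1_minus[OF f]] cpq nG) (use pq in auto)
    then show False using K pq by (simp add: algebra_simps)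
  qed
  ultimately have P2: "\<not> (\<forall>K. G t K)" "\<not> (\<forall>K. \<not> G t K)" if "p \<le> t" "t \<le> q" for t
    using Ppq[OF that] ic(4) unfolding P_def by auto
  define l where "l x = the1 (issup (G x))" for x
  have l: "issup (G x) (l x)" if x: "p \<le> x" "x \<le> q" for x
  proof -
    obtain K0 K1 where k: "G x K0" "\<not> G x K1" using P2[OF x] by blast
    have "t \<le> K1" if "G x t" for t using Gmono[OF that] k(2) by (meson linear)
    moreover have "d1 (G x)" unfolding d1_def by (rule r2_app[OF G] dintros | simp)+
    ultimately obtain s where "\<And>t. G x t ==> t \<le> s" "\<And>v. (\<And>t. G x t ==> t \<le> v) ==> s \<le> v"
      using sup_ex[of "G x" K0 K1] k(1) by blast
    then have "issup (G x) s" unfolding issup_def by blast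
    then show ?thesis unfolding l_def by (subst the1_eq[where y = s]) (auto simp: issup_def intro: order.antisym)
  qed
  have "f1 l" unfolding f1_def l_def issup_def by (rule dintros r2_app[OF G] | simp)+
  from monotonicity[OF this pq(2)] obtain c1 c2 where c: "p \<le> c1" "c1 < c2" "c2 \<le> q" "\<And>t. c1 < t ==> t < c2 ==> cont1 l t"
    by blast
  obtain x where x: "c1 < x" "x < c2" using dense[OF c(2)] by blast
  \<comment> \<open>By continuity of \<open>l\<close>, the bounds \<open>l x - e / 2\<close> and
    \<open>l x + e / 2\<close> hold for the right quotients at all points near \<open>x\<close>,
    also at those to its left; the mean value inequality turns them into bounds for the quotients on
    both sides of \<open>x\<close>.\<close>
  have "deriv1 f x (l x)" unfolding deriv1_def
  proof (intro allI impI)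
    fix e :: 'a assume e: "0 < e"
    then obtain \<eta>0 where h0: "\<eta>0 > 0" "\<And>u. \<bar>u - x\<bar> < \<eta>0 ==> \<bar>l u - l x\<bar> < e / 3"
      using c(4)[OF x] unfolding cont1_def by (meson divide_pos_pos zero_less_numeral)
    define \<eta> where "\<eta> = min \<eta>0 (min (x - c1) (c2 - x))"
    have eta: "\<eta> > 0" unfolding \<eta>_def using h0 x by simp
    have in_pq: "p \<le> u" "u \<le> q" "\<bar>l u - l x\<bar> < e / 3" if "\<bar>u - x\<bar> < \<eta>" for u
      using that c h0(2)[of u] unfolding \<eta>_def by (auto simp: abs_less_iff)
    have 1: "G u (l x - e / 2)" if u: "\<bar>u - x\<bar> < \<eta>" for u
    proof -
      have "\<not> l u \<le> l x - e / 2" using in_pq(3)[OF u] e by (auto simp: abs_less_iff field_simps)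
      then obtain K where "G u K" "\<not> K \<le> l x - e / 2" using l[OF in_pq(1)[OF u] in_pq(2)[OF u]] unfolding issup_def by blast
      then show ?thesis using Gmono by (meson linear)
    qed
    have 2: "\<not> G u (l x + e / 2)" if "\<bar>u - x\<bar> < \<eta>" for u
    proof
      assume "G u (l x + e / 2)"
      then have "l x + e / 2 \<le> l u" using l[of u] in_pq(1,2)[of u] that unfolding issup_def by blast
      then show False using in_pq(3)[OF that] e by (auto simp: abs_less_iff field_simps)
    qed
    have lower: "(l x - e / 2) * (v - u) \<le> f v - f u" if uv: "u \<le> v" "\<bar>u - x\<bar> < \<eta>" "\<bar>v - x\<bar> < \<eta>" for u v
    proof (rule mean_value_le[OF f uv(1)])
      fix t assume t: "u \<le> t" "t \<le> v"
      then have "\<bar>t - x\<bar> < \<eta>" using uv by (auto simp: abs_less_iff)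
      then show "cont1 f t" using cpq in_pq by blast
    next
      fix t assume t: "u \<le> t" "t < v"
      then have "\<bar>t - x\<bar> < \<eta>" using uv by (auto simp: abs_less_iff)
      then show "\<exists>e'>0. \<forall>h. 0 < h \<and> h < e' --> (l x - e / 2) * h \<le> f (t + h) - f t" using 1 unfolding G_def by blast
    qed
    have "- (l x + e / 2) * (v - u) \<le> - f v - - f u" if uv: "u \<le> v" "\<bar>u - x\<bar> < \<eta>" "\<bar>v - x\<bar> < \<eta>" for u v
    proof (rule mean_value_le[OF f1_minus[OF f] uv(1)])
      fix t assume t: "u \<le> t" "t \<le> v"
      then have "\<bar>t - x\<bar> < \<eta>" using uv by (auto simp: abs_less_iff)
      then show "cont1 (\<lambda>t. - f t) t" using cpq in_pq by blast
    next
      fix t assume t: "u \<le> t" "t < v"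
      then have "\<bar>t - x\<bar> < \<eta>" using uv by (auto simp: abs_less_iff)
      then show "\<exists>e'>0. \<forall>h. 0 < h \<and> h < e' --> - (l x + e / 2) * h \<le> - f (t + h) - - f t" using 2 nG by blast
    qed
    then have upper: "f v - f u \<le> (l x + e / 2) * (v - u)" if "u \<le> v" "\<bar>u - x\<bar> < \<eta>" "\<bar>v - x\<bar> < \<eta>" for u v
      using that by (fastforce simp: algebra_simps)
    have "\<bar>(f (x + h) - f x) / h - l x\<bar> < e" if h: "h \<noteq> 0" "\<bar>h\<bar> < \<eta>" for h
    proof -
      have "l x - e / 2 \<le> (f (x + h) - f x) / h \<and> (f (x + h) - f x) / h \<le> l x + e / 2"
      proof (cases "h > 0")
        case True
        then show ?thesis using lower[of x "x + h"] upper[of x "x + h"] h eta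
          by (simp add: pos_le_divide_eq pos_divide_le_eq)
      next
        case False
        then have "h < 0" using h by simp
        have "f (x + h) - f x \<le> (l x - e / 2) * h" "(l x + e / 2) * h \<le> f (x + h) - f x"
          using lower[of "x + h" x] upper[of "x + h" x] h eta \<open>h < 0\<close> by (auto simp: algebra_simps)
        then show ?thesis using \<open>h < 0\<close> by (simp only: neg_le_divide_eq neg_divide_le_eq simp_thms)
      qed
      then show ?thesis using e half_gt_zero[OF e] unfolding abs_less_iff by linarith
    qed
    then show "\<exists>\<eta>>0. \<forall>h. h \<noteq> 0 \<and> \<bar>h\<bar> < \<eta> --> \<bar>(f (x + h) - f x) / h - l x\<bar> < e" using eta by blast
  qed
  moreover have "a < x" "x < b" using x c(1,3) pq 0(1,3) ic(2) by linarith+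
  ultimately show ?thesis by blast
qed

end

section \<open>Generic smoothness\<close>

lemma near_length: "near e x y ==> length x = length y"
  by (simp add: near_def)

lemma near_refl [simp]: "0 < e ==> near e x x"
  by (simp add: near_def)

lemma near_mono: "near e x y ==> e \<le> e' ==> near e' x y"
  unfolding near_def using less_le_trans by blast

lemma near_min [simp]: "near (min a b) x y \<longleftrightarrow> near a x y \<and> near b x y"
  unfolding near_def by auto

lemma near_append [simp]:
  "length x = length x' ==> near e (x @ u) (x' @ u') \<longleftrightarrow> near e x x' \<and> near e u u'"
proof
  assume l: "length x = length x'" and n: "near e (x @ u) (x' @ u')"
  have "\<bar>x ! i - x' ! i\<bar> < e" if "i < length x" for i
    using n that l unfolding near_def by (auto simp: nth_append dest!: spec[of _ i])
  moreover have "\<bar>u ! i - u' ! i\<bar> < e" if "i < length u" for i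
    using n that l unfolding near_def by (auto simp: nth_append dest!: spec[of _ "length x + i"])
  ultimately show "near e x x' \<and> near e u u'" using n l unfolding near_def by simp
next
  assume l: "length x = length x'" and n: "near e x x' \<and> near e u u'"
  then show "near e (x @ u) (x' @ u')" unfolding near_def by (simp add: nth_append)
qed

lemma near_single [simp]: "near e [a] [b] \<longleftrightarrow> \<bar>a - b\<bar> < e"
  by (simp add: near_def)

lemma near_Nil [simp]: "near e [] y \<longleftrightarrow> y = []" "near e y [] \<longleftrightarrow> y = []"
  by (auto simp: near_def)

lemma near_snocE:
  assumes "near e (x @ [t]) z"
  obtains y u where "z = y @ [u]" "near e x y" "\<bar>t - u\<bar> < e"
proof -
  have "length z = Suc (length x)" using near_length[OF assms] by simp
  then obtain y u where "z = y @ [u]" "length y = length x" by (metis length_Suc_conv_rev)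
  then show ?thesis using that assms by (metis near_append near_single)
qed

lemma near_open:
  assumes "near e x y"
  shows "\<exists>d>0. \<forall>z. near d y z --> near e x z"
proof -
  \<comment> \<open>The least slack over the coordinates; the 1 is for the empty tuple.\<close>
  define d where "d = Min (insert 1 ((\<lambda>i. e - \<bar>x ! i - y ! i\<bar>) ` {..<length x}))"
  have "d > 0" unfolding d_def using assms by (auto simp: near_def)
  moreover have "near e x z" if z: "near d y z" for z
    unfolding near_def
  proof (intro conjI allI impI)
    show "length x = length z" using z assms near_length by metis
    fix i assume i: "i < length x"
    then have "\<bar>y ! i - z ! i\<bar> < d" using z near_length[OF assms] unfolding near_def by simp
    also have "d \<le> e - \<bar>x ! i - y ! i\<bar>" unfolding d_def using i by (intro Min_le) auto
    finally show "\<bar>x ! i - z ! i\<bar> < e" by (simp add: abs_less_iff abs_if split: if_splits)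
  qed
  ultimately show ?thesis by blast
qed

lemma near_update: "near e x y ==> \<bar>x ! i - u\<bar> < e ==> near e x (y[i := u])"
  unfolding near_def by (cases "i < length y") (auto simp: nth_list_update list_update_beyond)

text \<open>Nonempty interior stands for full dimension and makes no mention of cells;
  \<open>fat_has_dim\<close> provides the link to dimension that genericity requires.\<close>

definition fat :: "nat => ('a::linordered_field list => bool) => bool" where
  "fat n P \<longleftrightarrow> (\<exists>x e. length x = n \<and> 0 < e \<and> (\<forall>y. near e x y --> P y))"

definition contp :: "('a::linordered_field list => 'a) => 'a list => bool" where
  "contp f x \<longleftrightarrow> (\<forall>\<epsilon>>0. \<exists>\<eta>>0. \<forall>y. near \<eta> x y --> \<bar>f y - f x\<bar> < \<epsilon>)"

lemma fatI: "length x = n ==> 0 < e ==> (\<And>y. near e x y ==> P y) ==> fat n P"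
  unfolding fat_def by blast

lemma fat_mono: "fat n P ==> (\<And>x. length x = n ==> P x ==> Q x) ==> fat n Q"
  unfolding fat_def by (metis near_length)

lemma fat_ex: "fat n P ==> \<exists>x. length x = n \<and> P x"
  unfolding fat_def using near_refl by blast

lemma fat_0: "fat 0 P \<longleftrightarrow> P []"
  unfolding fat_def by (auto intro: exI[of _ 1])

lemma fat_Suc:
  assumes "fat n (\<lambda>y. \<forall>u. \<bar>u - c\<bar> < r --> P (y @ [u]))" "0 < r"
  shows "fat (Suc n) P"
proof -
  obtain x e where x: "length x = n" "0 < e" "\<And>y u. near e x y ==> \<bar>u - c\<bar> < r ==> P (y @ [u])"
    using assms(1) unfolding fat_def by blast
  show ?thesis
  proof (rule fatI[of "x @ [c]" _ "min e r"])
    fix z assume "near (min e r) (x @ [c]) z"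
    then show "P z" by (elim near_snocE) (use x(3) in \<open>auto simp: abs_minus_commute\<close>)
  qed (use x assms in auto)
qed

lemma fat_SucD:
  assumes "fat (Suc n) P"
  shows "\<exists>x t e. length x = n \<and> 0 < e \<and> (\<forall>y u. near e x y \<and> \<bar>t - u\<bar> < e --> P (y @ [u]))"
proof -
  obtain z e where z: "length z = Suc n" "0 < e" "\<And>y. near e z y ==> P y"
    using assms unfolding fat_def by blast
  then obtain x t where x: "z = x @ [t]" "length x = n" by (metis length_Suc_conv_rev)
  have "P (y @ [u])" if "near e x y \<and> \<bar>t - u\<bar> < e" for y u
    using z(3)[of "y @ [u]"] that near_length[of e x y] x by simp
  then show ?thesis using z(2) x(2) by blast
qed

lemma has_partial_unique:
  fixes f :: "'a::linordered_field list => 'a"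
  assumes "has_partial f i x d" "has_partial f i x d'"
  shows "d = d'"
proof (rule ccontr)
  assume "d \<noteq> d'"
  define e where "e = \<bar>d - d'\<bar> / 2"
  have e: "0 < e" unfolding e_def using \<open>d \<noteq> d'\<close> by simp
  obtain \<eta>1 where 1: "\<eta>1 > 0" "\<And>h. h \<noteq> 0 \<and> \<bar>h\<bar> < \<eta>1 ==> \<bar>(f (x[i := x ! i + h]) - f x) / h - d\<bar> < e"
    using assms(1) e unfolding has_partial_def by blast
  obtain \<eta>2 where 2: "\<eta>2 > 0" "\<And>h. h \<noteq> 0 \<and> \<bar>h\<bar> < \<eta>2 ==> \<bar>(f (x[i := x ! i + h]) - f x) / h - d'\<bar> < e"
    using assms(2) e unfolding has_partial_def by blast
  obtain h where h: "0 < h" "h < min \<eta>1 \<eta>2" using dense[of 0 "min \<eta>1 \<eta>2"] 1 2 by auto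
  define q where "q = (f (x[i := x ! i + h]) - f x) / h"
  have "\<bar>q - d\<bar> < e" "\<bar>q - d'\<bar> < e" unfolding q_def using 1(2)[of h] 2(2)[of h] h by auto
  then have "\<bar>d - d'\<bar> < e + e" by (simp add: abs_less_iff)
  then show False unfolding e_def by simp
qed

definition "pd f i x = the1 (has_partial f i x)"

lemma pd_eq: "has_partial f i x d ==> pd f i x = d"
  unfolding pd_def by (rule the1_eq) (auto dest: has_partial_unique)

lemma cont_on_mono: "cont_on U f ==> V \<subseteq> U ==> cont_on V f"
  unfolding cont_on_def by (meson subsetD)

lemma Cp_open_mono: "Cp_open n p U f ==> V \<subseteq> U ==> Cp_open n p V f"
proof (induction p arbitrary: f)
  case (Suc p)
  then obtain g where "\<forall>i<n. (\<forall>u\<in>U. has_partial f i u (g i u)) \<and> Cp_open n p U (g i)" by auto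
  then have "\<forall>i<n. (\<forall>u\<in>V. has_partial f i u (g i u)) \<and> Cp_open n p V (g i)" using Suc by blast
  then show ?case using Suc.prems cont_on_mono by auto
qed (auto intro: cont_on_mono)

lemma Cp_open_cont_on: "Cp_open n p U f ==> cont_on U f"
  by (cases p) auto

text \<open>Being of class \<open>C^p\<close> in a neighbourhood of \<open>x\<close>. Naming the
  derivatives by \<open>pd\<close>, instead of asking for some functions as \<open>Cp_open\<close>
  does, makes this a definable condition on \<open>x\<close>.\<close>

primrec Gp :: "nat => nat => ('a::linordered_field list => 'a) => 'a list => bool" where
  "Gp n 0 f x \<longleftrightarrow> (\<exists>e>0. \<forall>y. near e x y --> contp f y)"
| "Gp n (Suc p) f x \<longleftrightarrow> (\<exists>e>0. \<forall>y. near e x y -->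
     contp f y \<and> (\<forall>i<n. (\<exists>d. has_partial f i y d) \<and> Gp n p (pd f i) y))"

lemma interior_open: "\<exists>e>0. \<forall>y. near e x y --> P y ==> \<exists>e>0. \<forall>y. near e x y --> (\<exists>e>0. \<forall>z. near e y z --> P z)"
  by (meson near_open)

lemma Gp_open: "Gp n p f x ==> \<exists>e>0. \<forall>y. near e x y --> Gp n p f y"
proof (cases p)
  case 0
  show "Gp n p f x ==> \<exists>e>0. \<forall>y. near e x y --> Gp n p f y"
    unfolding 0 Gp.simps by (rule interior_open)
next
  case (Suc q)
  show "Gp n p f x ==> \<exists>e>0. \<forall>y. near e x y --> Gp n p f y"
    unfolding Suc Gp.simps by (rule interior_open)
qed

lemma Gp_contp: "Gp n p f x ==> contp f x"
  by (cases p) auto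

lemma contp_cont_on: "(\<And>x. x \<in> U ==> contp f x) ==> cont_on U f"
  unfolding cont_on_def contp_def by blast

lemma Gp_Cp_open: "Cp_open n p {x. length x = n \<and> Gp n p f x} f"
proof (induction p arbitrary: f)
  case 0
  show ?case unfolding Cp_open.simps by (rule contp_cont_on) (use Gp_contp[of n 0 f] in blast)
next
  case (Suc p)
  let ?U = "{x. length x = n \<and> Gp n (Suc p) f x}"
  have "(\<forall>u\<in>?U. has_partial f i u (pd f i u)) \<and> Cp_open n p ?U (pd f i)" if "i < n" for i
  proof
    show "\<forall>u\<in>?U. has_partial f i u (pd f i u)"
    proof
      fix u assume "u \<in> ?U"
      then obtain e where "0 < e" "\<forall>y. near e u y --> (\<forall>i<n. (\<exists>d. has_partial f i y d))" by auto
      then obtain d where "has_partial f i u d" using \<open>i < n\<close> near_refl by blast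
      then show "has_partial f i u (pd f i u)" using pd_eq by metis
    qed
    have "?U \<subseteq> {x. length x = n \<and> Gp n p (pd f i) x}"
    proof
      fix u assume u: "u \<in> ?U"
      then obtain e where e: "0 < e" "\<forall>y. near e u y --> (\<forall>i<n. Gp n p (pd f i) y)" by auto
      then have "Gp n p (pd f i) u" using \<open>i < n\<close> near_refl[OF e(1)] by blast
      then show "u \<in> {x. length x = n \<and> Gp n p (pd f i) x}" using u by simp
    qed
    then show "Cp_open n p ?U (pd f i)" using Suc.IH Cp_open_mono by blast
  qed
  moreover have "cont_on ?U f" using contp_cont_on[of ?U f] Gp_contp[of n "Suc p" f] by blast
  ultimately show ?case unfolding Cp_open.simps by (intro conjI exI[of _ "\<lambda>i. pd f i"] allI impI) blast+
qed

lemma euclidean_open_Gp: "euclidean_open n {x. length x = n \<and> Gp n p f x}"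
  unfolding euclidean_open_def using Gp_open near_length by fastforce

context dstruct
begin

lemma dp_contp0:
  assumes f: "df n f" shows "dp n (\<lambda>x. contp f x)"
  unfolding contp_def by (rule dintros df_comp[OF f] | simp)+

lemma dp_has_partial:
  assumes f: "df n f" and l: "dl N n l" and t: "df N t" shows "dp N (\<lambda>x. has_partial f i (l x) (t x))"
proof (cases "i < n")
  case True
  have "dp (Suc n) (\<lambda>z. has_partial f i (take n z) (z ! n))"
    unfolding has_partial_def using True by - (rule dintros df_comp[OF f] | simp)+
  from dp_rel[OF this l t] show ?thesis .
next
  case False
  \<comment> \<open>Beyond the last coordinate the update changes nothing, so that all difference
    quotients are 0.\<close>
  have "has_partial f i (l x) (t x) \<longleftrightarrow> (\<forall>\<epsilon>>0. \<exists>\<eta>>0. \<forall>h::'a. h \<noteq> 0 \<and> \<bar>h\<bar> < \<eta> --> \<bar>0 - t x\<bar> < \<epsilon>)" (is "_ = ?R x") if "length x = N" for x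
    using dl_length[OF l that] False unfolding has_partial_def by (simp add: list_update_beyond del: abs_minus_cancel)
  moreover have "dp N (\<lambda>x. \<forall>\<epsilon>>0. \<exists>\<eta>>0. \<forall>h::'a. h \<noteq> 0 \<and> \<bar>h\<bar> < \<eta> --> \<bar>0 - t x\<bar> < \<epsilon>)"
    by (rule dintros df_comp[OF t] | simp)+
  ultimately show ?thesis by (simp cong: dp_cong)
qed

lemma df_pd: "df n f ==> df n (pd f i)"
  unfolding pd_def by (rule df_the1) (rule dintros dp_has_partial | simp | assumption)+

lemma dp_Gp: "df n f ==> dp n (Gp n p f)"
proof (induction p arbitrary: f)
  case 0
  show ?case unfolding Gp.simps by (rule dintros dp_comp[OF dp_contp0[OF 0]] | simp)+
next
  case (Suc p)
  show ?case unfolding Gp.simps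
    by (rule dintros dp_comp[OF dp_contp0[OF Suc.prems]] dp_has_partial[OF Suc.prems] dp_comp[OF Suc.IH[OF df_pd[OF Suc.prems]]] | simp)+
qed

end

section \<open>Partition property and generic continuity\<close>

context omin
begin

text \<open>The two halves of one induction, the partition property and generic continuity:
  \<open>PP_Suc\<close> uses both for n, and \<open>GC_Suc\<close> uses in addition the new
  \<open>PP (Suc n)\<close>.\<close>

definition "PP n \<longleftrightarrow> (\<forall>P Q. dp n P --> dp n Q --> fat n (\<lambda>x. P x \<or> Q x) --> fat n P \<or> fat n Q)"
definition "GC n \<longleftrightarrow> (\<forall>f P. df n f --> dp n P --> fat n P --> fat n (\<lambda>x. P x \<and> contp f x))"

lemma PP_finite:
  assumes "PP n" "finite S" "\<And>s. s \<in> S ==> dp n (P s)" "fat n (\<lambda>x. \<exists>s\<in>S. P s x)"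
  shows "\<exists>s\<in>S. fat n (P s)"
  using assms(2-4)
proof (induction S rule: finite_induct)
  case empty
  then show ?case using fat_ex by fastforce
next
  case (insert s S)
  have "dp n (\<lambda>x. \<exists>s\<in>S. P s x)" by (intro dintros insert) auto
  moreover have "fat n (\<lambda>x. P s x \<or> (\<exists>s\<in>S. P s x))" using insert.prems(2) by simp
  ultimately have "fat n (P s) \<or> fat n (\<lambda>x. \<exists>s\<in>S. P s x)"
    using assms(1) insert.prems(1) unfolding PP_def by blast
  then show ?case using insert by auto
qed

text \<open>Centres and radii are chosen by definable functions, which are continuous on a box by
  \<open>GC n\<close>. Near a point \<open>x\<close> of the box, the interval about
  \<open>fc x\<close> with a quarter of the radius at \<open>x\<close> lies inside all the chosen
  ones, so that \<open>anti\<close> applies.\<close>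

lemma uniform_box:
  assumes "GC n" and R: "dp (Suc (Suc n)) (\<lambda>z. R (take n z) (z ! n) (z ! Suc n))"
    and P: "dp n P" "fat n P" "\<And>y. length y = n ==> P y ==> \<exists>c r. 0 < r \<and> R y c r"
    and anti: "\<And>y c r c' r'. R y c r ==> 0 < r' ==> \<bar>c' - c\<bar> + r' \<le> r ==> R y c' r'"
  shows "\<exists>c r. 0 < r \<and> fat n (\<lambda>y. P y \<and> R y c r)"
proof -
  have R': "dp N (\<lambda>z. R (l z) (s z) (t z))" if "dl N n l" "df N s" "df N t" for N l s t
  proof -
    have 1: "dl N (Suc (Suc n)) (\<lambda>z. l z @ [s z, t z])"
      by (rule dl_append[OF that(1) dl_pair[OF that(2,3)]]) simp
    show ?thesis using dp_comp[OF R 1]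
      by (subst dp_cong[where Q = "\<lambda>z. R (take n (l z @ [s z, t z])) ((l z @ [s z, t z]) ! n) ((l z @ [s z, t z]) ! Suc n)"])
        (use dl_length[OF that(1)] in \<open>auto simp: nth_append\<close>)
  qed
  have "dp (Suc n) (\<lambda>z. \<exists>r. 0 < r \<and> R (take n z) (z ! n) r)" by (rule dintros R' | simp)+
  then obtain fc where fc: "df n fc" "\<And>x y. length x = n ==> \<exists>r. 0 < r \<and> R x y r ==> \<exists>r. 0 < r \<and> R x (fc x) r"
    using choice[of n "\<lambda>x y. \<exists>r. 0 < r \<and> R x y r"] by blast
  have "dp (Suc n) (\<lambda>z. 0 < z ! n \<and> R (take n z) (fc (take n z)) (z ! n))" by (rule dintros R' df_comp[OF fc(1)] | simp)+
  then obtain fr where fr: "df n fr" "\<And>x y. length x = n ==> 0 < y \<and> R x (fc x) y ==> 0 < fr x \<and> R x (fc x) (fr x)"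
    using choice[of n "\<lambda>x y. 0 < y \<and> R x (fc x) y"] by blast
  have R1: "0 < fr y \<and> R y (fc y) (fr y)" if y: "length y = n" "P y" for y
    using P(3)[OF y] fc(2)[OF y(1)] fr(2)[OF y(1)] by blast
  have "fat n (\<lambda>x. P x \<and> contp fc x)" using assms(1) fc(1) P unfolding GC_def by blast
  moreover have "dp n (\<lambda>x. P x \<and> contp fc x)" by (intro dintros P(1) dp_contp0 fc(1))
  ultimately have "fat n (\<lambda>x. (P x \<and> contp fc x) \<and> contp fr x)" using assms(1) fr(1) unfolding GC_def by blast
  then obtain x e where x: "length x = n" "0 < e" "\<And>y. near e x y ==> P y" "\<And>y. near e x y ==> contp fc y" "\<And>y. near e x y ==> contp fr y"
    unfolding fat_def by blast
  \<comment> \<open>Centre and radius each change by less than \<open>r0\<close>; this leaves a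
    radius above 3 \<open>r0\<close>, enough for the shift of the centre and the new radius
    \<open>r0\<close> together.\<close>
  define r0 where "r0 = fr x / 4"
  have r0: "r0 > 0" unfolding r0_def using R1[OF x(1)] x by simp
  obtain \<eta>1 where 1: "\<eta>1 > 0" "\<And>y. near \<eta>1 x y ==> \<bar>fc y - fc x\<bar> < r0"
    using x(4)[of x] x(2) r0 unfolding contp_def by auto
  obtain \<eta>2 where 2: "\<eta>2 > 0" "\<And>y. near \<eta>2 x y ==> \<bar>fr y - fr x\<bar> < r0"
    using x(5)[of x] x(2) r0 unfolding contp_def by auto
  have "fat n (\<lambda>y. P y \<and> R y (fc x) r0)"
  proof (rule fatI[of x _ "min e (min \<eta>1 \<eta>2)"])
    fix y assume y: "near (min e (min \<eta>1 \<eta>2)) x y"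
    then have P: "P y" "length y = n" using x near_length[of e x y] by auto
    have "\<bar>fc y - fc x\<bar> < r0" "\<bar>fr y - fr x\<bar> < r0" using y 1 2 by auto
    then have "\<bar>fc x - fc y\<bar> + r0 \<le> fr y" using r0_def r0 by (simp add: abs_if split: if_splits)
    then show "P y \<and> R y (fc x) r0" using P anti[OF conjunct2[OF R1[OF P(2,1)]] r0] by blast
  qed (use x 1 2 in auto)
  then show ?thesis using r0 by blast
qed

text \<open>Over each point \<open>cover\<close> gives an interval of last coordinates inside one of
  the two sets; \<open>PP n\<close> makes it the same set over a box, and \<open>uniform_box\<close>
  makes it the same interval.\<close>

lemma PP_Suc:
  assumes "GC n" "PP n" shows "PP (Suc n)"
  unfolding PP_def
proof (intro allI impI)
  fix P Q assume P: "dp (Suc n) P" and Q: "dp (Suc n) Q" and "fat (Suc n) (\<lambda>x. P x \<or> Q x)"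
  then obtain x t e where x: "length x = n" "0 < e" "\<And>y u. near e x y ==> \<bar>t - u\<bar> < e ==> P (y @ [u]) \<or> Q (y @ [u])"
    using fat_SucD by blast
  define F where "F b = (if b then P else Q)" for b
  have F: "dp (Suc n) (F b)" for b unfolding F_def using P Q by simp
  have FF: "dp N (\<lambda>z. F b (l z @ [s z]))" if "dl N n l" "df N s" for N b l s
    by (rule dp_comp[OF F dl_append[OF that(1) dl_single[OF that(2)]]]) simp
  define R where "R b y c r \<longleftrightarrow> (\<forall>u. \<bar>u - c\<bar> < r --> F b (y @ [u]))" for b y c r
  have R: "dp (Suc (Suc n)) (\<lambda>z. R b (take n z) (z ! n) (z ! Suc n))" for b
    unfolding R_def by (rule dintros FF | simp)+
  have R': "dp n (\<lambda>y. near e x y \<and> (\<exists>c r. 0 < r \<and> R b y c r))" for b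
    unfolding R_def by (rule dintros FF x(1) | simp)+
  have ex: "\<exists>b\<in>UNIV. near e x y \<and> (\<exists>c r. 0 < r \<and> R b y c r)" if y: "near e x y" for y
  proof -
    have ly: "length y = n" using near_length[OF y] x by simp
    have d: "d1 (\<lambda>u. F b (y @ [u]))" for b
      unfolding d1_def by (rule FF dintros ly | simp)+
    have "t - e < t + e" using x(2) by simp
    moreover have "\<exists>b\<in>UNIV. F b (y @ [u])" if "t - e < u" "u < t + e" for u
    proof -
      have "\<bar>t - u\<bar> < e" using that by (simp add: abs_less_iff algebra_simps)
      from x(3)[OF y this] show ?thesis unfolding F_def by (metis UNIV_I)
    qed
    ultimately have "\<exists>b\<in>UNIV. \<exists>c>t - e. c \<le> t + e \<and> (\<forall>u. t - e < u \<and> u < c --> F b (y @ [u]))"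
      using d by (intro cover) auto
    then obtain b c where b: "t - e < c" "\<And>u. t - e < u ==> u < c ==> F b (y @ [u])" by blast
    define m where "m = (t - e + c) / 2"
    define r where "r = (c - (t - e)) / 2"
    have eq: "m - r = t - e" "m + r = c" unfolding m_def r_def by (simp_all add: field_simps)
    have r: "r > 0" unfolding r_def using b by simp
    have "R b y m r" unfolding R_def
    proof (intro allI impI)
      fix u assume "\<bar>u - m\<bar> < r"
      then have "m - r < u" "u < m + r" by (auto simp: abs_less_iff algebra_simps)
      then show "F b (y @ [u])" using b unfolding eq by blast
    qed
    then show ?thesis using y r by blast
  qed
  have "fat n (\<lambda>y. \<exists>b\<in>UNIV. near e x y \<and> (\<exists>c r. 0 < r \<and> R b y c r))"
    by (rule fatI[OF x(1,2) ex])
  from PP_finite[OF assms(2) _ R' this] obtain b where b: "fat n (\<lambda>y. near e x y \<and> (\<exists>c r. 0 < r \<and> R b y c r))" by auto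
  have "\<exists>c r. 0 < r \<and> fat n (\<lambda>y. (near e x y \<and> (\<exists>c r. 0 < r \<and> R b y c r)) \<and> R b y c r)"
  proof (rule uniform_box[OF assms(1) R R' b])
    fix y c r c' r' assume "R b y c r" "0 < r'" "\<bar>c' - c\<bar> + r' \<le> r"
    moreover have "\<bar>u - c'\<bar> < r' ==> \<bar>u - c\<bar> < r" for u
      using \<open>0 < r'\<close> \<open>\<bar>c' - c\<bar> + r' \<le> r\<close> by (auto simp: abs_if split: if_splits)
    ultimately show "R b y c' r'" unfolding R_def by blast
  qed blast
  then obtain c r where cr: "0 < r" "fat n (\<lambda>y. (near e x y \<and> (\<exists>c r. 0 < r \<and> R b y c r)) \<and> R b y c r)" by blast
  have "fat n (\<lambda>y. R b y c r)" by (rule fat_mono[OF cr(2)]) blast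
  with cr(1)
  have "fat (Suc n) (F b)" unfolding R_def using fat_Suc by blast
  then show "fat (Suc n) P \<or> fat (Suc n) Q" unfolding F_def by (cases b) auto
qed

lemma mono_type_between:
  assumes "mono_type \<tau> f u1 u" "mono_type \<tau> f u u2" "\<bar>f u1 - v\<bar> < e" "\<bar>f u2 - v\<bar> < e"
  shows "\<bar>f u - v\<bar> < e"
  using assms unfolding mono_type_def by (cases \<tau>) (auto simp: abs_less_iff split: bool.splits)

text \<open>On some box \<open>f\<close> is monotone of one type and continuous in the last
  variable; by generic continuity in n variables it is also continuous in the first n variables with
  the last one fixed. Together these give joint continuity, because monotonicity bounds a value by
  those at two fixed heights.\<close>

lemma GC_Suc:
  assumes GC: "GC n" and PP: "PP n" and PPS: "PP (Suc n)" shows "GC (Suc n)"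
  unfolding GC_def
proof (intro allI impI)
  fix f P assume f: "df (Suc n) f" and P: "dp (Suc n) P" and "fat (Suc n) P"
  then obtain x t e where x: "length x = n" "0 < e" "\<And>y u. near e x y ==> \<bar>t - u\<bar> < e ==> P (y @ [u])"
    using fat_SucD by blast
  have ff: "df N (\<lambda>z. f (l z @ [s z]))" if "dl N n l" "df N s" for N l s
    by (rule df_comp[OF f dl_append[OF that(1) dl_single[OF that(2)]]]) simp
  define S :: "bool option set" where "S = {None, Some True, Some False}"
  have S: "finite S" "\<And>\<tau>. \<tau> \<in> S" unfolding S_def by (simp, metis (full_types) insertCI not_Some_eq)
  define R where "R \<tau> y c r \<longleftrightarrow> t - e \<le> c - r \<and> c + r \<le> t + e \<and> (\<forall>u. \<bar>u - c\<bar> < r --> cont1 (\<lambda>v. f (y @ [v])) u) \<and>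
    (\<forall>u v. \<bar>u - c\<bar> < r \<and> \<bar>v - c\<bar> < r \<and> u < v --> mono_type \<tau> (\<lambda>v. f (y @ [v])) u v)" for \<tau> y c r
  have R0: "dp N (\<lambda>z. R \<tau> (l z) (s z) (r z))" if "dl N n l" "df N s" "df N r" for N \<tau> l s r
  proof -
    have "dp (Suc (Suc n)) (\<lambda>z. R \<tau> (take n z) (z ! n) (z ! Suc n))"
      unfolding R_def cont1_def by (rule dintros ff mono_type_df | simp)+
    moreover have "dl N (Suc (Suc n)) (\<lambda>z. l z @ [s z, r z])"
      by (rule dl_append[OF that(1) dl_pair[OF that(2,3)]]) simp
    ultimately have "dp N (\<lambda>z. R \<tau> (take n (l z @ [s z, r z])) ((l z @ [s z, r z]) ! n) ((l z @ [s z, r z]) ! Suc n))"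
      by (rule dp_comp)
    then show ?thesis
      by (subst dp_cong[where Q = "\<lambda>z. R \<tau> (take n (l z @ [s z, r z])) ((l z @ [s z, r z]) ! n) ((l z @ [s z, r z]) ! Suc n)"])
        (use dl_length[OF that(1)] in \<open>auto simp: nth_append\<close>)
  qed
  have R': "dp n (\<lambda>y. near e x y \<and> (\<exists>c r. 0 < r \<and> R \<tau> y c r))" for \<tau>
    by (rule dintros R0 x(1) | simp)+
  have ex: "\<exists>\<tau>\<in>S. near e x y \<and> (\<exists>c r. 0 < r \<and> R \<tau> y c r)" if y: "near e x y" for y
  proof -
    have ly: "length y = n" using near_length[OF y] x by simp
    have "f1 (\<lambda>u. f (y @ [u]))" unfolding f1_def by (rule ff dintros ly | simp)+
    moreover have "t - e < t + e" using x(2) by simp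
    ultimately obtain c d \<tau> where cd: "t - e \<le> c" "c < d" "d \<le> t + e"
      "\<And>u. c < u \<and> u < d ==> cont1 (\<lambda>u. f (y @ [u])) u"
      "\<And>u v. c < u \<and> u < v \<and> v < d ==> mono_type \<tau> (\<lambda>u. f (y @ [u])) u v"
      using monotonicity[of "\<lambda>u. f (y @ [u])" "t - e" "t + e"] by auto
    define m where "m = (c + d) / 2"
    define r where "r = (d - c) / 2"
    have eq: "m - r = c" "m + r = d" unfolding m_def r_def by (simp_all add: field_simps)
    have r: "r > 0" unfolding r_def using cd by simp
    have b: "\<bar>u - m\<bar> < r ==> c < u \<and> u < d" for u using eq by (auto simp: abs_less_iff algebra_simps)
    have "R \<tau> y m r" unfolding R_def eq using cd b by blast
    then show ?thesis using y r S by blast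
  qed
  have "fat n (\<lambda>y. \<exists>\<tau>\<in>S. near e x y \<and> (\<exists>c r. 0 < r \<and> R \<tau> y c r))"
    by (rule fatI[OF x(1,2) ex])
  from PP_finite[OF PP S(1) R' this] obtain \<tau> where \<tau>: "fat n (\<lambda>y. near e x y \<and> (\<exists>c r. 0 < r \<and> R \<tau> y c r))" by auto
  have "\<exists>c r. 0 < r \<and> fat n (\<lambda>y. (near e x y \<and> (\<exists>c r. 0 < r \<and> R \<tau> y c r)) \<and> R \<tau> y c r)"
  proof (rule uniform_box[OF GC _ R' \<tau>])
    show "dp (Suc (Suc n)) (\<lambda>z. R \<tau> (take n z) (z ! n) (z ! Suc n))" by (rule dintros R0 | simp)+
    fix y c r c' r' assume a: "R \<tau> y c r" "0 < r'" "\<bar>c' - c\<bar> + r' \<le> r"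
    have "\<bar>u - c'\<bar> < r' ==> \<bar>u - c\<bar> < r" for u using a(2,3) by (auto simp: abs_if split: if_splits)
    moreover have "c - r \<le> c' - r'" "c' + r' \<le> c + r" using a(2,3) by (auto simp: abs_if split: if_splits)
    ultimately show "R \<tau> y c' r'" using a(1) unfolding R_def by (meson order.trans)
  qed blast
  then obtain c r where cr0: "0 < r" "fat n (\<lambda>y. (near e x y \<and> (\<exists>c r. 0 < r \<and> R \<tau> y c r)) \<and> R \<tau> y c r)" by blast
  have "fat n (\<lambda>y. near e x y \<and> R \<tau> y c r)" by (rule fat_mono[OF cr0(2)]) blast
  note cr = cr0(1) this
  define W where "W z \<longleftrightarrow> near e x (take n z) \<and> R \<tau> (take n z) c r \<and> \<bar>z ! n - c\<bar> < r" for z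
  have W: "dp (Suc n) W" unfolding W_def by (rule dintros R0 x(1) | simp)+
  have "fat n (\<lambda>y. \<forall>u. \<bar>u - c\<bar> < r --> W (y @ [u]))"
    by (rule fat_mono[OF cr(2)]) (auto simp: W_def nth_append)
  then have fW: "fat (Suc n) W" by (rule fat_Suc) (rule cr(1))
  \<comment> \<open>If continuity in the first n variables failed on a whole box, it would fail for
    one fixed last coordinate on a box of M^n, against \<open>GC n\<close>.\<close>
  define A where "A z \<longleftrightarrow> contp (\<lambda>y. f (y @ [z ! n])) (take n z)" for z
  have A: "dp (Suc n) A" unfolding A_def contp_def by (rule dintros ff | simp)+
  have "fat (Suc n) (\<lambda>z. (W z \<and> A z) \<or> (W z \<and> \<not> A z))" by (rule fat_mono[OF fW]) blast
  moreover have "dp (Suc n) (\<lambda>z. W z \<and> A z)" "dp (Suc n) (\<lambda>z. W z \<and> \<not> A z)" by (rule dintros W A)+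
  ultimately consider "fat (Suc n) (\<lambda>z. W z \<and> A z)" | "fat (Suc n) (\<lambda>z. W z \<and> \<not> A z)"
    using PPS unfolding PP_def by blast
  then show "fat (Suc n) (\<lambda>x. P x \<and> contp f x)"
  proof cases
    case 2
    then obtain x2 s2 e2 where 2: "length x2 = n" "0 < e2" "\<And>y u. near e2 x2 y ==> \<bar>s2 - u\<bar> < e2 ==> \<not> A (y @ [u])"
      using fat_SucD by blast
    have "df n (\<lambda>y. f (y @ [s2]))" by (rule ff dintros | simp)+
    moreover have "dp n (near e2 x2)" by (rule dintros 2(1) | simp)+
    moreover have "fat n (near e2 x2)" using 2(1,2) by (rule fatI)
    ultimately obtain y where "near e2 x2 y" "contp (\<lambda>y. f (y @ [s2])) y"
      using GC fat_ex unfolding GC_def by blast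
    moreover have "length y = n" using \<open>near e2 x2 y\<close> 2(1) near_length by metis
    ultimately have "A (y @ [s2])" unfolding A_def by (simp add: nth_append)
    then show ?thesis using 2(2,3) \<open>near e2 x2 y\<close> by auto
  next
    case 1
    then obtain x3 s3 e3 where 3: "length x3 = n" "0 < e3"
      "\<And>y u. near e3 x3 y ==> \<bar>s3 - u\<bar> < e3 ==> W (y @ [u]) \<and> A (y @ [u])"
      using fat_SucD by blast
    show ?thesis
    proof (rule fatI[of "x3 @ [s3]" _ e3])
      fix z assume "near e3 (x3 @ [s3]) z"
      then obtain y u where z: "z = y @ [u]" "near e3 x3 y" "\<bar>s3 - u\<bar> < e3" by (elim near_snocE)
      have ly: "length y = n" using z(2) 3(1) near_length by metis
      have Wz: "near e x y" "R \<tau> y c r" "\<bar>u - c\<bar> < r" using 3(3)[OF z(2,3)] ly unfolding W_def by (auto simp: nth_append)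
      have "\<bar>t - u\<bar> < e" using Wz(2,3) unfolding R_def by (auto simp: abs_less_iff algebra_simps)
      then have "P z" using x(3) Wz(1) z(1) by blast
      moreover have "contp f z" unfolding contp_def
      proof (intro allI impI)
        fix \<epsilon> :: 'a assume "0 < \<epsilon>"
        then have e2: "0 < \<epsilon> / 2" by simp
        obtain \<eta>0 where \<eta>0: "\<eta>0 > 0" "\<And>v. \<bar>v - u\<bar> < \<eta>0 ==> \<bar>f (y @ [v]) - f (y @ [u])\<bar> < \<epsilon> / 2"
          using Wz(2,3) e2 unfolding R_def cont1_def by blast
        obtain h where h: "0 < h" "h < min \<eta>0 (e3 - \<bar>s3 - u\<bar>)" using dense[of 0 "min \<eta>0 (e3 - \<bar>s3 - u\<bar>)"] \<eta>0(1) z(3) by auto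
        \<comment> \<open>Two fixed heights around \<open>u\<close>. Over \<open>y\<close>,
          \<open>f\<close> changes by less than \<open>\<epsilon> / 2\<close> from \<open>u\<close>
          to them; at these heights it changes by less than \<open>\<epsilon> / 2\<close> when
          \<open>y\<close> moves to \<open>y'\<close>; and the value at \<open>u'\<close> lies
          between the two.\<close>
        define u1 where "u1 = u - h"
        define u2 where "u2 = u + h"
        have uu: "\<bar>s3 - v\<bar> < e3" if "\<bar>v - u\<bar> \<le> h" for v
          using h that by (auto simp: abs_if split: if_splits)
        have u12: "\<bar>s3 - u1\<bar> < e3" "\<bar>s3 - u2\<bar> < e3" using uu[of u1] uu[of u2] h(1) unfolding u1_def u2_def by auto
        have f12: "\<bar>f (y @ [u1]) - f (y @ [u])\<bar> < \<epsilon> / 2" "\<bar>f (y @ [u2]) - f (y @ [u])\<bar> < \<epsilon> / 2"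
          using \<eta>0(2)[of u1] \<eta>0(2)[of u2] h unfolding u1_def u2_def by auto
        have A3: "contp (\<lambda>y. f (y @ [v])) y" if "\<bar>s3 - v\<bar> < e3" for v
          using 3(3)[OF z(2) that] ly unfolding A_def by (auto simp: nth_append)
        obtain \<eta>1 where \<eta>1: "\<eta>1 > 0" "\<And>y'. near \<eta>1 y y' ==> \<bar>f (y' @ [u1]) - f (y @ [u1])\<bar> < \<epsilon> / 2"
          using A3[OF u12(1)] e2 unfolding contp_def by blast
        obtain \<eta>2 where \<eta>2: "\<eta>2 > 0" "\<And>y'. near \<eta>2 y y' ==> \<bar>f (y' @ [u2]) - f (y @ [u2])\<bar> < \<epsilon> / 2"
          using A3[OF u12(2)] e2 unfolding contp_def by blast
        obtain \<eta>3 where \<eta>3: "\<eta>3 > 0" "\<And>y'. near \<eta>3 y y' ==> near e3 x3 y'" using near_open[OF z(2)] by blast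
        show "\<exists>\<eta>>0. \<forall>z'. near \<eta> z z' --> \<bar>f z' - f z\<bar> < \<epsilon>"
        proof (intro exI[of _ "min h (min \<eta>1 (min \<eta>2 \<eta>3))"] conjI allI impI)
          show "0 < min h (min \<eta>1 (min \<eta>2 \<eta>3))" using h \<eta>1 \<eta>2 \<eta>3 by simp
          fix z' assume "near (min h (min \<eta>1 (min \<eta>2 \<eta>3))) z z'"
          then obtain y' u' where z': "z' = y' @ [u']" "near h y y'" "near \<eta>1 y y'" "near \<eta>2 y y'" "near \<eta>3 y y'" "\<bar>u - u'\<bar> < h"
            unfolding z(1) by (elim near_snocE) auto
          have ly': "length y' = n" using z'(2) ly near_length by metis
          have "W (y' @ [v])" if "\<bar>v - u\<bar> \<le> h" for v using 3(3)[OF \<eta>3(2)[OF z'(5)] uu[OF that]] by blast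
          then have W': "R \<tau> y' c r \<and> \<bar>v - c\<bar> < r" if "\<bar>v - u\<bar> \<le> h" for v using that ly' unfolding W_def by (auto simp: nth_append)
          have m: "mono_type \<tau> (\<lambda>v. f (y' @ [v])) v w" if "\<bar>v - u\<bar> \<le> h" "\<bar>w - u\<bar> \<le> h" "v < w" for v w
            using W'[OF that(1)] W'[OF that(2)] that(3) unfolding R_def by blast
          have "mono_type \<tau> (\<lambda>v. f (y' @ [v])) u1 u'" "mono_type \<tau> (\<lambda>v. f (y' @ [v])) u' u2"
            by (rule m; use z'(6) h(1) in \<open>auto simp: u1_def u2_def abs_if split: if_splits\<close>)+
          moreover have "\<bar>f (y' @ [u1]) - f z\<bar> < \<epsilon>" "\<bar>f (y' @ [u2]) - f z\<bar> < \<epsilon>"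
            using f12 \<eta>1(2)[OF z'(3)] \<eta>2(2)[OF z'(4)] unfolding z(1) abs_less_iff by (auto simp: field_simps)
          ultimately show "\<bar>f z' - f z\<bar> < \<epsilon>" unfolding z'(1)
            using mono_type_between[of \<tau> "\<lambda>v. f (y' @ [v])" u1 u' u2 "f z" \<epsilon>] by blast
        qed
      qed
      ultimately show "P z \<and> contp f z" ..
    qed (use 3 in auto)
  qed
qed

lemma PP_GC: "PP n \<and> GC n"
proof (induction n)
  case 0
  have "contp f []" for f :: "'a list => 'a" unfolding contp_def by (auto intro: exI[of _ 1])
  then show ?case unfolding PP_def GC_def fat_0 by auto
next
  case (Suc n)
  then show ?case using PP_Suc GC_Suc by blast
qed

lemmas PP = conjunct1[OF PP_GC] and GC = conjunct2[OF PP_GC]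

text \<open>Genericity: the exceptions have empty interior. By the partition property it is stable
  under conjunction of definable conditions.\<close>

definition "gen n P \<longleftrightarrow> \<not> fat n (\<lambda>x. \<not> P x)"

lemma gen_mono: "gen n P ==> (\<And>x. length x = n ==> P x ==> Q x) ==> gen n Q"
  unfolding gen_def using fat_mono by (metis (no_types, lifting))

lemma fat_gen:
  assumes "fat n P" "gen n Q" "dp n P" "dp n Q" shows "fat n (\<lambda>x. P x \<and> Q x)"
proof -
  have "fat n (\<lambda>x. (P x \<and> Q x) \<or> \<not> Q x)" by (rule fat_mono[OF assms(1)]) auto
  moreover have "dp n (\<lambda>x. P x \<and> Q x)" "dp n (\<lambda>x. \<not> Q x)" by (rule dintros assms)+
  ultimately show ?thesis using PP[of n] assms(2) unfolding PP_def gen_def by blast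
qed

lemma gen_conj:
  assumes "gen n P" "gen n Q" "dp n P" "dp n Q" shows "gen n (\<lambda>x. P x \<and> Q x)"
proof (rule ccontr)
  assume "\<not> gen n (\<lambda>x. P x \<and> Q x)"
  then have "fat n (\<lambda>x. \<not> P x \<or> \<not> Q x)" unfolding gen_def by simp
  moreover have "dp n (\<lambda>x. \<not> P x)" "dp n (\<lambda>x. \<not> Q x)" by (rule dintros assms)+
  ultimately show False using PP[of n] assms(1,2) unfolding PP_def gen_def by blast
qed

lemma gen_all_less:
  "(\<And>i. i < m ==> gen n (P i)) ==> (\<And>i. i < m ==> dp n (P i)) ==> gen n (\<lambda>x. \<forall>i<m::nat. P i x)"
proof (induction m)
  case 0
  show ?case unfolding gen_def using fat_ex by fastforce
next
  case (Suc m)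
  have "gen n (\<lambda>x. (\<forall>i<m. P i x) \<and> P m x)"
    by (intro gen_conj Suc dp_all_less) auto
  then show ?case by (rule gen_mono) (auto simp: less_Suc_eq)
qed

text \<open>A box without interior points of \<open>P\<close> would, by \<open>fat_gen\<close>,
  contain a smaller box inside \<open>P\<close>.\<close>

lemma gen_interior:
  assumes "gen n P" "dp n P" shows "gen n (\<lambda>x. \<exists>e>0. \<forall>y. near e x y --> P y)"
  unfolding gen_def
proof
  assume "fat n (\<lambda>x. \<not> (\<exists>e>0. \<forall>y. near e x y --> P y))"
  moreover have "dp n (\<lambda>x. \<not> (\<exists>e>0. \<forall>y. near e x y --> P y))"
    by (rule dintros dp_comp[OF assms(2)] | simp)+
  ultimately have "fat n (\<lambda>x. \<not> (\<exists>e>0. \<forall>y. near e x y --> P y) \<and> P x)" by (intro fat_gen assms)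
  then obtain x e where "0 < e" "\<forall>y. near e x y --> \<not> (\<exists>e>0. \<forall>z. near e y z --> P z) \<and> P y"
    unfolding fat_def by blast
  then show False using near_refl[of e x] by blast
qed

lemma gen_contp: "df n f ==> gen n (contp f)"
  unfolding gen_def
proof
  assume f: "df n f" and "fat n (\<lambda>x. \<not> contp f x)"
  moreover have "dp n (\<lambda>x. \<not> contp f x)" by (intro dintros dp_contp0 f)
  ultimately have "fat n (\<lambda>x. \<not> contp f x \<and> contp f x)" using GC[of n] unfolding GC_def by blast
  then show False using fat_ex by fastforce
qed

text \<open>A box of exceptions contains a segment parallel to the i-th axis, and along it
  \<open>f\<close> is differentiable somewhere.\<close>

lemma gen_partial:
  assumes f: "df n f" and i: "i < n" shows "gen n (\<lambda>x. \<exists>d. has_partial f i x d)"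
  unfolding gen_def
proof
  assume "fat n (\<lambda>x. \<not> (\<exists>d. has_partial f i x d))"
  then obtain x e where x: "length x = n" "0 < e" "\<And>y. near e x y ==> \<not> (\<exists>d. has_partial f i y d)"
    unfolding fat_def by blast
  have "f1 (\<lambda>u. f (x[i := u]))" unfolding f1_def
    by (rule df_comp[OF f] dintros x(1) | simp)+
  moreover have "x ! i - e < x ! i + e" using x(2) by simp
  ultimately obtain t d where t: "x ! i - e < t" "t < x ! i + e" "deriv1 (\<lambda>u. f (x[i := u])) t d"
    using differentiable_somewhere by blast
  have "has_partial f i (x[i := t]) d"
    using t(3) i x(1) unfolding has_partial_def deriv1_def by simp
  moreover have "near e x (x[i := t])"
    by (rule near_update) (use x t in \<open>auto simp: abs_less_iff algebra_simps\<close>)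
  ultimately show False using x(3) by blast
qed

lemma gen_Gp: "df n f ==> gen n (Gp n p f)"
proof (induction p arbitrary: f)
  case 0
  then show ?case unfolding Gp.simps by (intro gen_interior gen_contp dp_contp0)
next
  case (Suc p)
  have 1: "dp n (\<lambda>x. \<exists>d. has_partial f i x d)" for i
    by (rule dintros dp_has_partial[OF Suc.prems] | simp)+
  show ?case unfolding Gp.simps
    by (intro gen_interior gen_conj gen_all_less gen_contp gen_partial Suc dp_contp0 dp_conj dp_all_less 1 dp_Gp df_pd)
qed

end

section \<open>Cells\<close>

definition sel :: "nat list => 'a list => 'a list" where
  "sel I x = map ((!) x) I"

lemma length_sel [simp]: "length (sel I x) = length I"
  by (simp add: sel_def)

lemma near_sel: "near e x y ==> set I \<subseteq> {..<length x} ==> near e (sel I x) (sel I y)"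
  unfolding near_def sel_def by (auto simp: subset_iff)

lemma sel_update_notin: "i \<notin> set I ==> sel I (x[i := v]) = sel I x"
  unfolding sel_def by (metis (mono_tags, lifting) map_eq_conv nth_list_update_neq)

lemma sel_update_nth:
  assumes "distinct I" "set I \<subseteq> {..<length x}" "j < length I"
  shows "sel I (x[I ! j := v]) = (sel I x)[j := v]"
proof (rule nth_equalityI)
  fix k assume "k < length (sel I (x[I ! j := v]))"
  then have k: "k < length I" by simp
  then have "I ! k < length x" using assms(2) nth_mem by blast
  then show "sel I (x[I ! j := v]) ! k = (sel I x)[j := v] ! k"
    using k assms unfolding sel_def by (cases "k = j") (auto simp: nth_list_update nth_eq_iff_index_eq)
qed simp

text \<open>The constant 0 comes first, as it is its own derivative and that of every other
  constant.\<close>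

lemma Cp_open_const: "Cp_open n p U (\<lambda>_. c)"
proof -
  have 0: "Cp_open n p U (\<lambda>_. 0)" for p
  proof (induction p)
    case 0 show ?case by (auto simp: cont_on_def intro: exI[of _ 1])
  next
    case (Suc p)
    have "has_partial (\<lambda>_. 0) i u 0" for i and u :: "'a list"
      unfolding has_partial_def by (auto intro: exI[of _ 1])
    then show ?case using Suc unfolding Cp_open.simps
      by (intro conjI exI[of _ "\<lambda>_ _. 0"]) (auto simp: cont_on_def intro: exI[of _ 1])
  qed
  show ?thesis
  proof (cases p)
    case 0 then show ?thesis by (auto simp: cont_on_def intro: exI[of _ 1])
  next
    case (Suc q)
    have "has_partial (\<lambda>_. c) i u 0" for i and u :: "'a list"
      unfolding has_partial_def by (auto intro: exI[of _ 1])
    then show ?thesis using 0 unfolding Suc Cp_open.simps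
      by (intro conjI exI[of _ "\<lambda>_ _. 0"]) (auto simp: cont_on_def intro: exI[of _ 1])
  qed
qed

lemma cont_on_sel:
  assumes "cont_on U f" "set I \<subseteq> {..<N}" "Z \<subseteq> {x. length x = N \<and> sel I x \<in> U}"
  shows "cont_on Z (\<lambda>x. f (sel I x))"
  unfolding cont_on_def
proof (intro ballI allI impI)
  fix x and e :: 'a assume x: "x \<in> Z" and e: "0 < e"
  then obtain \<eta> where "\<eta> > 0" "\<And>y. y \<in> U ==> near \<eta> (sel I x) y ==> \<bar>f y - f (sel I x)\<bar> < e"
    using assms(1,3) unfolding cont_on_def by blast
  moreover have "near \<eta> (sel I x) (sel I y)" if "near \<eta> x y" for y
    using near_sel[OF that] assms x by auto
  ultimately show "\<exists>\<eta>>0. \<forall>y\<in>Z. near \<eta> x y --> \<bar>f (sel I y) - f (sel I x)\<bar> < e"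
    using assms(3) by (intro exI[of _ \<eta>]) auto
qed

text \<open>Selecting coordinates is the only substitution under which smoothness has to be
  preserved: a partial derivative is that of \<open>f\<close> in the selected variable, or 0 for a
  variable that is not selected.\<close>

lemma Cp_open_sel:
  assumes "Cp_open n p U f" "distinct I" "length I = n" "set I \<subseteq> {..<N}"
  shows "Cp_open N p {x. length x = N \<and> sel I x \<in> U} (\<lambda>x. f (sel I x))"
  using assms(1)
proof (induction p arbitrary: f)
  case 0
  then show ?case using cont_on_sel[OF _ assms(4)] by auto
next
  case (Suc p)
  let ?V = "{x. length x = N \<and> sel I x \<in> U}"
  obtain g where g: "\<And>i u. i < n ==> u \<in> U ==> has_partial f i u (g i u)" "\<And>i. i < n ==> Cp_open n p U (g i)"
    using Suc.prems by auto
  have *: "\<exists>h. (\<forall>u\<in>?V. has_partial (\<lambda>x. f (sel I x)) i u (h u)) \<and> Cp_open N p ?V h" for i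
  proof (cases "i \<in> set I")
    case True
    then obtain j where j: "j < n" "I ! j = i" using assms(3) by (auto simp: in_set_conv_nth)
    have "has_partial (\<lambda>x. f (sel I x)) i u (g j (sel I u))" if "u \<in> ?V" for u
    proof -
      have "sel I (u[i := v]) = (sel I u)[j := v]" for v
        using sel_update_nth[OF assms(2), of u j v] j assms that by auto
      moreover have "u ! i = sel I u ! j" using j assms(3) by (simp add: sel_def)
      ultimately show ?thesis using g(1)[OF j(1), of "sel I u"] that unfolding has_partial_def by simp
    qed
    then show ?thesis using Suc.IH[OF g(2)[OF j(1)]] by (intro exI[of _ "\<lambda>x. g j (sel I x)"]) simp
  next
    case False
    have "has_partial (\<lambda>x. f (sel I x)) i u 0" for u
      unfolding has_partial_def sel_update_notin[OF False] by (auto intro: exI[of _ 1])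
    then show ?thesis using Cp_open_const[of N p ?V 0] by (intro exI[of _ "\<lambda>_. 0"]) simp
  qed
  obtain h where "\<forall>i. (\<forall>u\<in>?V. has_partial (\<lambda>x. f (sel I x)) i u (h i u)) \<and> Cp_open N p ?V (h i)"
  proof -
    have "\<forall>i. \<exists>h. (\<forall>u\<in>?V. has_partial (\<lambda>x. f (sel I x)) i u (h u)) \<and> Cp_open N p ?V h" using * by (intro allI)
    from choice[OF this] that show ?thesis by (elim exE)
  qed
  moreover have "cont_on ?V (\<lambda>x. f (sel I x))" using Suc.prems cont_on_sel[OF _ assms(4)] by auto
  ultimately show ?case unfolding Cp_open.simps by blast
qed

lemma euclidean_open_sel:
  assumes "euclidean_open n U" "length I = n" "set I \<subseteq> {..<N}"
  shows "euclidean_open N {x. length x = N \<and> sel I x \<in> U}"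
  unfolding euclidean_open_def
proof (intro conjI ballI)
  fix x assume x: "x \<in> {x. length x = N \<and> sel I x \<in> U}"
  then obtain e where "0 < e" "\<And>y. near e (sel I x) y ==> y \<in> U" using assms unfolding euclidean_open_def by blast
  then show "\<exists>e>0. \<forall>y. near e x y --> y \<in> {x. length x = N \<and> sel I x \<in> U}"
  proof (intro exI[of _ e] conjI allI impI)
    show "0 < e" by fact
    fix y assume y: "near e x y"
    then have "near e (sel I x) (sel I y)" using near_sel[OF y] x assms(3) by auto
    then show "y \<in> {x. length x = N \<and> sel I x \<in> U}"
      using \<open>\<And>y. near e (sel I x) y ==> y \<in> U\<close> near_length[OF y] x by simp
  qed
qed auto

section \<open>Cells over a base, with the kinds of their steps\<close>

definition graph_over :: "'a list set => ('a list => 'a) => 'a list set" where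
  "graph_over C f = {x @ [f x] | x. x \<in> C}"

definition in_band where
  "in_band lo hi x y \<longleftrightarrow> (\<forall>f. lo = Some f --> f x < y) \<and> (\<forall>g. hi = Some g --> y < (g x :: 'a::linordered_field))"

definition band_over :: "'a::linordered_field list set => ('a list => 'a) option => ('a list => 'a) option => 'a list set" where
  "band_over C lo hi = {x @ [y] | x y. x \<in> C \<and> in_band lo hi x y}"

text \<open>One step in the construction of a cell, as a relation over any base set. Bases other
  than a point are needed because a cell of a jet space is studied through its fibres over the jets
  of the earlier variables.\<close>

definition cell_over :: "(nat => 'a::linordered_field list set => ('a list => 'a) => bool) => nat => bool =>
    'a list set => 'a list set => bool" where
  "cell_over P n b C' C \<longleftrightarrow>
     (if b then \<exists>lo hi. (\<forall>f. lo = Some f --> P n C' f) \<and> (\<forall>g. hi = Some g --> P n C' g) \<and>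
                  (\<forall>f g x. lo = Some f \<and> hi = Some g \<and> x \<in> C' --> f x < g x) \<and> C = band_over C' lo hi
      else \<exists>f. P n C' f \<and> C = graph_over C' f)"

text \<open>The head of the list describes the last coordinate: \<open>True\<close> for a band, \<open>False\<close> for a graph.\<close>

primrec rel_cell :: "(nat => 'a::linordered_field list set => ('a list => 'a) => bool) => nat => 'a list set =>
    bool list => 'a list set => bool" where
  "rel_cell P r Z [] C \<longleftrightarrow> C = Z"
| "rel_cell P r Z (b # bs) C \<longleftrightarrow> (\<exists>C'. rel_cell P r Z bs C' \<and> cell_over P (r + length bs) b C' C)"

lemma cell_over_mono:
  "cell_over P n b C' C ==> (\<And>f. P n C' f ==> P' n C' f) ==> cell_over P' n b C' C"
  unfolding cell_over_def by (cases b; simp) blast+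

lemma cell_over_snocE:
  assumes "cell_over P n b C' C" "z \<in> C" shows "\<exists>x y. z = x @ [y] \<and> x \<in> C'"
  using assms unfolding cell_over_def by (cases b) (auto simp: band_over_def graph_over_def)

lemma rel_cell_gen_cell:
  "rel_cell P 0 {[]} bs C ==> gen_cell P (length bs) (length (filter id bs)) C"
proof (induction bs arbitrary: C)
  case Nil
  then show ?case using gen_cell.point by simp
next
  case (Cons b bs)
  then obtain C' where C': "rel_cell P 0 {[]} bs C'" "cell_over P (length bs) b C' C" by auto
  note g = Cons.IH[OF C'(1)]
  show ?case
  proof (cases b)
    case True
    then obtain lo hi where "\<forall>f. lo = Some f --> P (length bs) C' f" "\<forall>g. hi = Some g --> P (length bs) C' g"
      "\<forall>f g x. lo = Some f \<and> hi = Some g \<and> x \<in> C' --> f x < g x" "C = band_over C' lo hi"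
      using C'(2) unfolding cell_over_def by auto
    then show ?thesis using gen_cell.band[OF g, of lo hi] True unfolding band_over_def in_band_def by simp
  next
    case False
    then show ?thesis using C' gen_cell.graph[OF g] unfolding graph_over_def cell_over_def by auto
  qed
qed

lemma rel_cell_length: "rel_cell P r Z bs C ==> (\<And>z. z \<in> Z ==> length z = r) ==> z \<in> C ==> length z = r + length bs"
proof (induction bs arbitrary: C z)
  case (Cons b bs)
  then obtain C' where C': "rel_cell P r Z bs C'" "cell_over P (r + length bs) b C' C" by auto
  then obtain x y where "z = x @ [y]" "x \<in> C'" using cell_over_snocE Cons.prems(3) by blast
  then show ?case using Cons.IH[OF C'(1)] Cons.prems(2) by simp
qed simp

lemma in_band_ex:
  assumes "\<And>f g. lo = Some f ==> hi = Some g ==> f x < g x"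
  shows "\<exists>y::'a::linordered_field. in_band lo hi x y"
proof (cases lo)
  case None
  show ?thesis
  proof (cases hi)
    case (Some g)
    then show ?thesis unfolding in_band_def None by (intro exI[of _ "g x - 1"]) simp
  qed (simp add: in_band_def None)
next
  case (Some f)
  show ?thesis
  proof (cases hi)
    case None
    then show ?thesis unfolding in_band_def Some by (intro exI[of _ "f x + 1"]) simp
  next
    case (Some g)
    then show ?thesis using assms \<open>lo = Some f\<close> dense[of "f x" "g x"] unfolding in_band_def by auto
  qed
qed

text \<open>Half of the gap to a bound is left for the change of the bound and half for the change
  of the height.\<close>

lemma in_band_near:
  assumes lo: "\<And>f. lo = Some f ==> cont_on C f" and hi: "\<And>f. hi = Some f ==> cont_on C f"
    and x: "x \<in> C" and y: "in_band lo hi x (y::'a::linordered_field)"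
  shows "\<exists>e>0. \<forall>x'\<in>C. \<forall>y'. near e x x' \<and> \<bar>y' - y\<bar> < e --> in_band lo hi x' y'"
proof -
  have "\<exists>e>0. \<forall>x'\<in>C. \<forall>y'. near e x x' \<and> \<bar>y' - y\<bar> < e --> (\<forall>f. lo = Some f --> f x' < y')"
  proof (cases lo)
    case (Some f)
    define d where "d = (y - f x) / 2"
    have d: "0 < d" unfolding d_def using y Some by (simp add: in_band_def)
    then obtain \<eta> where e: "0 < \<eta>" "\<And>x'. x' \<in> C ==> near \<eta> x x' ==> \<bar>f x' - f x\<bar> < d"
      using lo[OF Some] x unfolding cont_on_def by blast
    have "f x' < y'" if "x' \<in> C" "near \<eta> x x'" "\<bar>y' - y\<bar> < d" for x' y'
      using e(2)[OF that(1,2)] that(3) unfolding d_def by (auto simp: abs_if field_simps split: if_splits)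
    then show ?thesis using Some d e(1) by (intro exI[of _ "min \<eta> d"]) auto
  qed (auto intro: exI[of _ 1])
  then obtain e1 where e1: "0 < e1" "\<And>x' y'. x' \<in> C ==> near e1 x x' ==> \<bar>y' - y\<bar> < e1 ==> (\<forall>f. lo = Some f --> f x' < y')" by blast
  have "\<exists>e>0. \<forall>x'\<in>C. \<forall>y'. near e x x' \<and> \<bar>y' - y\<bar> < e --> (\<forall>f. hi = Some f --> y' < f x')"
  proof (cases hi)
    case (Some f)
    define d where "d = (f x - y) / 2"
    have d: "0 < d" unfolding d_def using y Some by (simp add: in_band_def)
    then obtain \<eta> where e: "0 < \<eta>" "\<And>x'. x' \<in> C ==> near \<eta> x x' ==> \<bar>f x' - f x\<bar> < d"
      using hi[OF Some] x unfolding cont_on_def by blast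
    have "y' < f x'" if "x' \<in> C" "near \<eta> x x'" "\<bar>y' - y\<bar> < d" for x' y'
      using e(2)[OF that(1,2)] that(3) unfolding d_def by (auto simp: abs_if field_simps split: if_splits)
    then show ?thesis using Some d e(1) by (intro exI[of _ "min \<eta> d"]) auto
  qed (auto intro: exI[of _ 1])
  then obtain e2 where e2: "0 < e2" "\<And>x' y'. x' \<in> C ==> near e2 x x' ==> \<bar>y' - y\<bar> < e2 ==> (\<forall>f. hi = Some f --> y' < f x')" by blast
  show ?thesis unfolding in_band_def
    using e1 e2 by (intro exI[of _ "min e1 e2"]) auto
qed

lemma cell_over_ex:
  assumes "cell_over P n b C' C" "x \<in> C'" shows "\<exists>y. x @ [y] \<in> C"
proof (cases b)
  case True
  then obtain lo hi where l: "\<forall>f g x. lo = Some f \<and> hi = Some g \<and> x \<in> C' --> f x < g x" "C = band_over C' lo hi"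
    using assms(1) unfolding cell_over_def by auto
  then obtain y where "in_band lo hi x y" using in_band_ex[of lo hi x] assms(2) by auto
  then show ?thesis using assms(2) unfolding l(2) band_over_def by blast
next
  case False
  then show ?thesis using assms unfolding cell_over_def graph_over_def by auto
qed

lemma rel_cell_base_onto:
  "rel_cell P r Z bs C ==> u \<in> Z ==> \<exists>w. length w = length bs \<and> u @ w \<in> C"
proof (induction bs arbitrary: C)
  case (Cons b bs)
  then obtain C' where C': "rel_cell P r Z bs C'" "cell_over P (r + length bs) b C' C" by auto
  then obtain w where w: "length w = length bs" "u @ w \<in> C'" using Cons by blast
  then obtain y where "(u @ w) @ [y] \<in> C" using cell_over_ex[OF C'(2)] by blast
  then show ?case using w by (intro exI[of _ "w @ [y]"]) simp
qed auto

lemma rel_cell_base_into: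
  "rel_cell P r Z bs C ==> (\<And>z. z \<in> Z ==> length z = r) ==> z \<in> C ==> take r z \<in> Z"
proof (induction bs arbitrary: C z)
  case (Cons b bs)
  then obtain C' where C': "rel_cell P r Z bs C'" "cell_over P (r + length bs) b C' C" by auto
  then obtain x y where "z = x @ [y]" "x \<in> C'" using cell_over_snocE Cons.prems(3) by blast
  moreover have "r \<le> length x" using rel_cell_length[OF C'(1) Cons.prems(2) \<open>x \<in> C'\<close>] by simp
  ultimately show ?case using Cons.IH[OF C'(1) Cons.prems(2), of x] by simp
qed auto

lemma rel_cell_base:
  assumes "rel_cell P r Z bs C" "\<And>z. z \<in> Z ==> length z = r"
  shows "take r ` C = Z"
proof (intro equalityI subsetI)
  fix u assume u: "u \<in> Z"
  then obtain w where "u @ w \<in> C" using rel_cell_base_onto[OF assms(1)] by blast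
  then show "u \<in> take r ` C" using assms(2)[OF u] by (intro image_eqI[of _ _ "u @ w"]) auto
qed (use rel_cell_base_into[OF assms] in auto)

lemma rel_cell_split:
  "rel_cell P r Z (bs2 @ bs1) C ==> \<exists>C1. rel_cell P r Z bs1 C1 \<and> rel_cell P (r + length bs1) C1 bs2 C"
proof (induction bs2 arbitrary: C)
  case (Cons b bs2)
  then obtain C' where C': "rel_cell P r Z (bs2 @ bs1) C'" "cell_over P (r + length (bs2 @ bs1)) b C' C" by auto
  from Cons.IH[OF C'(1)] obtain C1 where C1: "rel_cell P r Z bs1 C1" "rel_cell P (r + length bs1) C1 bs2 C'" by blast
  have "r + length (bs2 @ bs1) = r + length bs1 + length bs2" by simp
  then show ?case using C1 C'(2) by (auto simp: ac_simps)
qed simp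

lemma rel_cell_join:
  "rel_cell P r Z bs1 C1 ==> rel_cell P (r + length bs1) C1 bs2 C ==> rel_cell P r Z (bs2 @ bs1) C"
proof (induction bs2 arbitrary: C)
  case (Cons b bs2)
  then obtain C' where C': "rel_cell P (r + length bs1) C1 bs2 C'" "cell_over P (r + length bs1 + length bs2) b C' C" by auto
  have "r + length (bs2 @ bs1) = r + length bs1 + length bs2" by simp
  then show ?case using Cons.IH[OF Cons.prems(1) C'(1)] C'(2) by (auto simp: ac_simps)
qed simp

text \<open>What raising the orders of the earlier variables does to a cell: the base becomes a part
  of its preimage under a selection of coordinates, and the bounding functions ignore the new
  coordinates. \<open>PD_pull\<close> supplies the closure property required of \<open>P\<close> and
  \<open>P'\<close>.\<close>

lemma rel_cell_pull:
  assumes "rel_cell P r Z bs C" "length I = r" "Z1 \<subseteq> {u. length u = r1 \<and> sel I u \<in> Z}"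
    and P: "\<And>m C f Y. P (r + m) C f ==> Y \<subseteq> {u @ w | u w. length u = r1 \<and> length w = m \<and> sel I u @ w \<in> C} ==>
      P' (r1 + m) Y (\<lambda>z. f (sel I (take r1 z) @ drop r1 z))"
  shows "rel_cell P' r1 Z1 bs {u @ w | u w. u \<in> Z1 \<and> length w = length bs \<and> sel I u @ w \<in> C}"
  using assms(1)
proof (induction bs arbitrary: C)
  case Nil
  then show ?case using assms(3) by auto
next
  case (Cons b bs)
  let ?pull = "\<lambda>C m. {u @ w | u w. u \<in> Z1 \<and> length w = m \<and> sel I u @ w \<in> C}"
  let ?f = "\<lambda>f z. f (sel I (take r1 z) @ drop r1 z)"
  from Cons.prems obtain C' where C': "rel_cell P r Z bs C'"
    "cell_over P (r + length bs) b C' C" by auto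
  have Z1: "length u = r1" if "u \<in> Z1" for u using assms(3) that by auto
  have sub: "?pull C' (length bs) \<subseteq> {u @ w | u w. length u = r1 \<and> length w = length bs \<and> sel I u @ w \<in> C'}"
    using Z1 by auto
  have snoc: "x @ [y] = sel I u @ w \<longleftrightarrow> (\<exists>w'. w = w' @ [y] \<and> x = sel I u @ w')" if "length w = Suc (length bs)" for x y u w
    using that by (cases w rule: rev_cases) auto
  show ?case
  proof (cases b)
    case True
    then obtain lo hi where l: "\<forall>f. lo = Some f --> P (r + length bs) C' f" "\<forall>g. hi = Some g --> P (r + length bs) C' g"
      "\<forall>f g x. lo = Some f \<and> hi = Some g \<and> x \<in> C' --> f x < g x" "C = band_over C' lo hi"
      using C'(2) unfolding cell_over_def by auto
    have ib: "in_band (map_option ?f lo) (map_option ?f hi) (u @ w) y \<longleftrightarrow> in_band lo hi (sel I u @ w) y" if "u \<in> Z1" for u w y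
      using Z1[OF that] unfolding in_band_def by auto
    have "?pull C (length (b # bs)) = band_over (?pull C' (length bs)) (map_option ?f lo) (map_option ?f hi)"
    proof (intro equalityI subsetI)
      fix z assume "z \<in> ?pull C (length (b # bs))"
      then obtain u w where z: "z = u @ w" "u \<in> Z1" "length w = Suc (length bs)" "sel I u @ w \<in> C" by auto
      then obtain w' y where w: "w = w' @ [y]" "length w' = length bs" by (metis length_Suc_conv_rev)
      then have "sel I u @ w' \<in> C'" "in_band lo hi (sel I u @ w') y" using z(4) unfolding l(4) band_over_def by auto
      then have "u @ w' \<in> ?pull C' (length bs)" "in_band (map_option ?f lo) (map_option ?f hi) (u @ w') y"
        using z(2) w ib by blast+
      then show "z \<in> band_over (?pull C' (length bs)) (map_option ?f lo) (map_option ?f hi)"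
        unfolding band_over_def z(1) w(1) by (intro CollectI exI[of _ "u @ w'"] exI[of _ y]) simp
    next
      fix z assume "z \<in> band_over (?pull C' (length bs)) (map_option ?f lo) (map_option ?f hi)"
      then obtain u w' y where z: "z = u @ (w' @ [y])" "u \<in> Z1" "length w' = length bs" "sel I u @ w' \<in> C'" "in_band lo hi (sel I u @ w') y"
        unfolding band_over_def using ib by auto
      have "(sel I u @ w') @ [y] \<in> C" unfolding l(4) band_over_def using z(4,5) by blast
      then have "sel I u @ (w' @ [y]) \<in> C" by simp
      then show "z \<in> ?pull C (length (b # bs))" unfolding z(1) using z(2,3) by (intro CollectI exI[of _ u] exI[of _ "w' @ [y]"]) simp
    qed
    moreover have "\<forall>f. map_option ?f lo = Some f --> P' (r1 + length bs) (?pull C' (length bs)) f"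
      using l(1) P[OF _ sub] by auto
    moreover have "\<forall>f. map_option ?f hi = Some f --> P' (r1 + length bs) (?pull C' (length bs)) f"
      using l(2) P[OF _ sub] by auto
    moreover have "\<forall>f g x. map_option ?f lo = Some f \<and> map_option ?f hi = Some g \<and> x \<in> ?pull C' (length bs) --> f x < g x"
      using l(3) Z1 by auto
    ultimately have "cell_over P' (r1 + length bs) b (?pull C' (length bs)) (?pull C (length (b # bs)))"
      unfolding cell_over_def if_P[OF True]
      by (rule_tac exI[of _ "map_option ?f lo"], rule_tac exI[of _ "map_option ?f hi"], intro conjI)
    then show ?thesis unfolding rel_cell.simps using Cons.IH[OF C'(1)] by blast
  next
    case False
    then obtain f where f: "P (r + length bs) C' f" "C = graph_over C' f" using C'(2) unfolding cell_over_def by auto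
    have "?pull C (length (b # bs)) = graph_over (?pull C' (length bs)) (?f f)"
    proof (intro equalityI subsetI)
      fix z assume "z \<in> ?pull C (length (b # bs))"
      then obtain u w where z: "z = u @ w" "u \<in> Z1" "length w = Suc (length bs)" "sel I u @ w \<in> C" by auto
      then obtain w' y where w: "w = w' @ [y]" "length w' = length bs" by (metis length_Suc_conv_rev)
      then have "sel I u @ w' \<in> C'" "y = f (sel I u @ w')" using z(4) unfolding f(2) graph_over_def by auto
      then show "z \<in> graph_over (?pull C' (length bs)) (?f f)"
        unfolding graph_over_def z(1) w(1) using z(2) w(2) Z1[OF z(2)] by (intro CollectI exI[of _ "u @ w'"]) auto
    next
      fix z assume "z \<in> graph_over (?pull C' (length bs)) (?f f)"
      then obtain u w' where z: "z = u @ (w' @ [f (sel I u @ w')])" "u \<in> Z1" "length w' = length bs" "sel I u @ w' \<in> C'"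
        unfolding graph_over_def using Z1 by auto
      have "(sel I u @ w') @ [f (sel I u @ w')] \<in> C" unfolding f(2) graph_over_def using z(4) by blast
      then have "sel I u @ (w' @ [f (sel I u @ w')]) \<in> C" by simp
      then show "z \<in> ?pull C (length (b # bs))" unfolding z(1) using z(2,3) by (intro CollectI exI[of _ u] exI[of _ "w' @ [f (sel I u @ w')]"]) simp
    qed
    moreover have "P' (r1 + length bs) (?pull C' (length bs)) (?f f)" using P[OF f(1) sub] .
    ultimately have "cell_over P' (r1 + length bs) b (?pull C' (length bs)) (?pull C (length (b # bs)))"
      unfolding cell_over_def if_not_P[OF False] by blast
    then show ?thesis unfolding rel_cell.simps using Cons.IH[OF C'(1)] by blast
  qed
qed

lemma rel_cell_mono:
  assumes "rel_cell P r Z bs C" "\<And>m C f. P m C f ==> P' m C f"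
  shows "rel_cell P' r Z bs C"
  using assms(1)
proof (induction bs arbitrary: C)
  case (Cons b bs)
  from Cons.prems obtain C' where C': "rel_cell P r Z bs C'"
    "cell_over P (r + length bs) b C' C" by auto
  then show ?case unfolding rel_cell.simps using Cons.IH[OF C'(1)] cell_over_mono[OF C'(2)] assms(2) by blast
qed simp

lemma rel_cell_open:
  assumes "rel_cell P r Z bs C" "\<And>m C f. P m C f ==> cont_on C f" "\<And>z. z \<in> Z ==> length z = r" "set bs \<subseteq> {True}" "z \<in> C"
  shows "\<exists>e>0. \<forall>z'. near e z z' \<and> take r z' \<in> Z --> z' \<in> C"
  using assms(1,4,5)
proof (induction bs arbitrary: C z)
  case Nil
  have "take r z' = z'" if "near 1 z z'" for z' using near_length[OF that] Nil assms(3)[of z] by simp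
  then show ?case using Nil by (intro exI[of _ 1]) auto
next
  case (Cons b bs)
  then obtain C' lo hi where C': "rel_cell P r Z bs C'" "\<forall>f. lo = Some f --> P (r + length bs) C' f" "\<forall>g. hi = Some g --> P (r + length bs) C' g"
    "C = band_over C' lo hi" unfolding rel_cell.simps cell_over_def by auto
  then obtain x y where z: "z = x @ [y]" "x \<in> C'" "in_band lo hi x y" using Cons.prems(3) unfolding band_over_def by blast
  obtain e1 where e1: "0 < e1" "\<And>z'. near e1 x z' ==> take r z' \<in> Z ==> z' \<in> C'"
    using Cons.IH[OF C'(1) _ z(2)] Cons.prems(2) by auto
  obtain e2 where e2: "0 < e2" "\<And>x' y'. x' \<in> C' ==> near e2 x x' ==> \<bar>y' - y\<bar> < e2 ==> in_band lo hi x' y'"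
    using in_band_near[of lo C' hi x y] C'(2,3) assms(2) z(2,3) by blast
  have lx: "r \<le> length x" using rel_cell_length[OF C'(1) assms(3) z(2)] by simp
  show ?case
  proof (intro exI[of _ "min e1 e2"] conjI allI impI)
    fix z' assume a: "near (min e1 e2) z z' \<and> take r z' \<in> Z"
    then obtain x' y' where z': "z' = x' @ [y']" "near e1 x x'" "near e2 x x'" "\<bar>y - y'\<bar> < e2"
      unfolding z(1) by (elim conjE near_snocE) auto
    have "take r x' \<in> Z" using a z' near_length[OF z'(2)] lx by simp
    then have "x' \<in> C'" using e1 z' by blast
    then show "z' \<in> C" unfolding C'(4) band_over_def z'(1) using e2(2) z' by (auto simp: abs_minus_commute)
  qed (use e1 e2 in auto)
qed

text \<open>Moving the base point a little moves the fibre a little: in a band the height itself can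
  be kept, on a graph it follows the continuous function. This carries density from the base to the
  whole cell.\<close>

lemma rel_cell_near_base:
  assumes "rel_cell P r Z bs C" "\<And>m C f. P m C f ==> cont_on C f" "\<And>z. z \<in> Z ==> length z = r"
    "u \<in> Z" "u @ w \<in> C" "0 < e"
  shows "\<exists>\<eta>>0. \<forall>u'\<in>Z. near \<eta> u u' --> (\<exists>w'. u' @ w' \<in> C \<and> near e w w')"
  using assms(1,5,6)
proof (induction bs arbitrary: C w e)
  case Nil
  have "length (u @ w) = length u" using Nil(1,2) assms(3)[of "u @ w"] assms(3)[OF assms(4)] by simp
  then have "w = []" by simp
  then show ?case using Nil(1,3) by (intro exI[of _ 1] conjI ballI impI exI[of _ "[]"]) auto
next
  case (Cons b bs)
  have lw: "length w = Suc (length bs)" using rel_cell_length[OF Cons.prems(1) assms(3) Cons.prems(2)] assms(3,4) by simp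
  then obtain v y where w: "w = v @ [y]" "length v = length bs" by (metis length_Suc_conv_rev)
  from Cons.prems(1) obtain C' where C': "rel_cell P r Z bs C'"
    "cell_over P (r + length bs) b C' C" by auto
  have v: "u @ v \<in> C'" using cell_over_snocE[OF C'(2) Cons.prems(2)] unfolding w(1) by (simp flip: append_assoc)
  have "\<exists>d>0. \<forall>x'\<in>C'. near d (u @ v) x' --> (\<exists>y'. x' @ [y'] \<in> C \<and> \<bar>y - y'\<bar> < e)"
  proof (cases b)
    case True
    then obtain lo hi where l: "\<forall>f. lo = Some f --> P (r + length bs) C' f" "\<forall>g. hi = Some g --> P (r + length bs) C' g"
      "C = band_over C' lo hi" using C'(2) unfolding cell_over_def by auto
    then have "in_band lo hi (u @ v) y" using Cons.prems(2) unfolding w(1) band_over_def by (auto simp flip: append_assoc)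
    then obtain d where "0 < d" "\<And>x' y'. x' \<in> C' ==> near d (u @ v) x' ==> \<bar>y' - y\<bar> < d ==> in_band lo hi x' y'"
      using in_band_near[of lo C' hi "u @ v" y] l assms(2) v by blast
    then show ?thesis using Cons.prems(3) unfolding l(3) band_over_def
      by (intro exI[of _ d] conjI ballI impI exI[of _ y]) auto
  next
    case False
    then obtain f where f: "P (r + length bs) C' f" "C = graph_over C' f" using C'(2) unfolding cell_over_def by auto
    have "y = f (u @ v)" using Cons.prems(2) unfolding w(1) f(2) graph_over_def by (auto simp flip: append_assoc)
    moreover obtain d where "0 < d" "\<And>x'. x' \<in> C' ==> near d (u @ v) x' ==> \<bar>f x' - f (u @ v)\<bar> < e"
      using assms(2)[OF f(1)] v Cons.prems(3) unfolding cont_on_def by blast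
    ultimately have "x' @ [f x'] \<in> C \<and> \<bar>y - f x'\<bar> < e" if "x' \<in> C'" "near d (u @ v) x'" for x'
      using that unfolding f(2) graph_over_def by (auto simp: abs_minus_commute)
    then show ?thesis using \<open>0 < d\<close> by blast
  qed
  then obtain d where d: "0 < d" "\<And>x'. x' \<in> C' ==> near d (u @ v) x' ==> (\<exists>y'. x' @ [y'] \<in> C \<and> \<bar>y - y'\<bar> < e)" by blast
  then obtain \<eta> where \<eta>: "0 < \<eta>" "\<And>u'. u' \<in> Z ==> near \<eta> u u' ==> \<exists>w'. u' @ w' \<in> C' \<and> near (min d e) v w'"
    using Cons.IH[OF C'(1) v, of "min d e"] Cons.prems(3) by auto
  show ?case
  proof (intro exI[of _ "min \<eta> d"] conjI ballI impI)
    fix u' assume u': "u' \<in> Z" "near (min \<eta> d) u u'"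
    then obtain v' where v': "u' @ v' \<in> C'" "near d v v'" "near e v v'" using \<eta>(2)[of u'] by auto
    have "near d (u @ v) (u' @ v')" using u' v' near_length[of d u u'] by simp
    from d(2)[OF v'(1) this] obtain y' where "(u' @ v') @ [y'] \<in> C" "\<bar>y - y'\<bar> < e" by blast
    then show "\<exists>w'. u' @ w' \<in> C \<and> near e w w'" unfolding w(1)
      using v'(3) near_length[OF v'(3)] by (intro exI[of _ "v' @ [y']"]) simp
  qed (use \<eta> d in auto)
qed

section \<open>Uniform finiteness, locally\<close>

text \<open>The normal points of the classical proof of uniform finiteness: near (x, y) the set is
  empty (\<open>nrm0\<close>), or it has exactly one point over each nearby \<open>x'\<close>,
  tending to y (\<open>nrm1\<close>). Over a \<open>good\<close> point all heights are normal and no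
  points escape to infinity (\<open>bnd\<close>).\<close>

definition "nrm0 Q x y \<longleftrightarrow> (\<exists>\<epsilon>. 0 < \<epsilon> \<and> (\<forall>x'. near \<epsilon> x x' --> (\<forall>y'. \<bar>y' - y\<bar> < \<epsilon> --> \<not> Q x' y')))"
definition "nrm1 Q x y \<longleftrightarrow> Q x y \<and> (\<exists>\<epsilon>0. 0 < \<epsilon>0 \<and> (\<forall>\<epsilon>. 0 < \<epsilon> \<and> \<epsilon> < \<epsilon>0 -->
   (\<exists>\<zeta>. 0 < \<zeta> \<and> (\<forall>x'. near \<zeta> x x' --> (\<exists>!y'. \<bar>y' - y\<bar> < \<epsilon> \<and> Q x' y')))))"
definition "bnd Q x \<longleftrightarrow> (\<exists>K \<epsilon>. 0 < \<epsilon> \<and> (\<forall>x'. near \<epsilon> x x' --> (\<forall>y'. Q x' y' --> \<bar>y'\<bar> < K)))"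
definition "good Q x \<longleftrightarrow> bnd Q x \<and> (\<forall>y. nrm0 Q x y \<or> nrm1 Q x y)"

context dstruct
begin

lemma dp_bnd:
  assumes Q: "dp (Suc n) (\<lambda>z. Q (take n z) (z ! n))" shows "dp n (bnd Q)"
  unfolding bnd_def by (rule dintros dp_rel[OF Q] | simp)+

lemma dp_nrm:
  assumes Q: "dp (Suc n) (\<lambda>z. Q (take n z) (z ! n))" and l: "dl N n l" and t: "df N t"
  shows "dp N (\<lambda>z. nrm0 Q (l z) (t z) \<or> nrm1 Q (l z) (t z))"
proof -
  have "dp (Suc n) (\<lambda>z. nrm0 Q (take n z) (z ! n) \<or> nrm1 Q (take n z) (z ! n))"
    unfolding nrm0_def nrm1_def by (rule dintros dp_rel[OF Q] | simp)+
  from dp_rel[OF this l t] show ?thesis .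
qed

lemma dp_good:
  assumes Q: "dp (Suc n) (\<lambda>z. Q (take n z) (z ! n))" shows "dp n (good Q)"
  unfolding good_def by (rule dintros dp_bnd[OF Q] dp_nrm[OF Q] | simp)+

end

context omin
begin

text \<open>If bad points filled a box, a bad height \<open>\<beta> x\<close> could be chosen
  definably, and on a smaller box it would be continuous, with a continuous isolating radius and a
  fixed answer to the question whether it belongs to the fibre. There the set is locally empty or
  the graph of \<open>\<beta>\<close>, so the height is normal after all. Unboundedness is excluded
  in the same way by a continuous choice of bounds.\<close>

lemma gen_good:
  assumes Q: "dp (Suc n) (\<lambda>z. Q (take n z) (z ! n))" and fin: "\<And>x. length x = n ==> finite {y. Q x y}"
  shows "gen n (good Q)"
proof (rule ccontr)
  assume "\<not> gen n (good Q)"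
  then have "fat n (\<lambda>x. \<not> bnd Q x \<or> (\<exists>y. \<not> (nrm0 Q x y \<or> nrm1 Q x y)))" unfolding gen_def good_def by simp
  moreover have dB: "dp n (\<lambda>x. \<not> bnd Q x)" by (rule dintros dp_bnd[OF Q])+
  moreover have dN: "dp n (\<lambda>x. \<exists>y. \<not> (nrm0 Q x y \<or> nrm1 Q x y))" by (rule dintros dp_nrm[OF Q] | simp)+
  ultimately consider "fat n (\<lambda>x. \<not> bnd Q x)" | "fat n (\<lambda>x. \<exists>y. \<not> (nrm0 Q x y \<or> nrm1 Q x y))"
    using PP[of n] unfolding PP_def by blast
  then show False
  proof cases
    case 1
    have "dp (Suc n) (\<lambda>z. \<forall>y. Q (take n z) y --> \<bar>y\<bar> < z ! n)" by (rule dintros dp_rel[OF Q] | simp)+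
    then obtain K where K: "df n K" "\<And>x k. length x = n ==> \<forall>y. Q x y --> \<bar>y\<bar> < k ==> \<forall>y. Q x y --> \<bar>y\<bar> < K x"
      using choice[of n "\<lambda>x k. \<forall>y. Q x y --> \<bar>y\<bar> < k"] by blast
    have K2: "\<bar>y\<bar> < K x" if "length x = n" "Q x y" for x y
    proof -
      define k where "k = Max (insert 0 (abs ` {y. Q x y})) + 1"
      have "\<bar>y\<bar> < k" if "Q x y" for y
        unfolding k_def using that fin[OF \<open>length x = n\<close>] by (intro le_less_trans[OF Max_ge less_add_one]) auto
      then show ?thesis using K(2)[OF that(1)] that(2) by blast
    qed
    have "fat n (\<lambda>x. \<not> bnd Q x \<and> contp K x)" using 1 dB K(1) GC[of n] unfolding GC_def by blast
    then obtain x where x: "length x = n" "\<not> bnd Q x" "contp K x" using fat_ex by blast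
    obtain \<eta> where \<eta>: "\<eta> > 0" "\<And>x'. near \<eta> x x' ==> \<bar>K x' - K x\<bar> < 1" using x(3) zero_less_one unfolding contp_def by blast
    have "\<bar>y'\<bar> < K x + 1" if "near \<eta> x x'" "Q x' y'" for x' y'
      using K2[of x' y'] \<eta>(2)[OF that(1)] near_length[OF that(1)] x(1) that(2) by (auto simp: abs_less_iff algebra_simps)
    then have "bnd Q x" unfolding bnd_def using \<eta>(1) by blast
    then show False using x by blast
  next
    case 2
    have "dp (Suc n) (\<lambda>z. \<not> (nrm0 Q (take n z) (z ! n) \<or> nrm1 Q (take n z) (z ! n)))" by (rule dintros dp_nrm[OF Q] | simp)+
    then obtain \<beta> where \<beta>: "df n \<beta>" "\<And>x y. length x = n ==> \<not> (nrm0 Q x y \<or> nrm1 Q x y) ==> \<not> (nrm0 Q x (\<beta> x) \<or> nrm1 Q x (\<beta> x))"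
      using choice[of n "\<lambda>x y. \<not> (nrm0 Q x y \<or> nrm1 Q x y)"] by blast
    have "dp (Suc n) (\<lambda>z. 0 < z ! n \<and> (\<forall>y. \<bar>y - \<beta> (take n z)\<bar> < z ! n \<and> Q (take n z) y --> y = \<beta> (take n z)))"
      by (rule dintros dp_rel[OF Q] df_comp[OF \<beta>(1)] | simp)+
    then obtain r where r: "df n r" "\<And>x k. length x = n ==> 0 < k \<and> (\<forall>y. \<bar>y - \<beta> x\<bar> < k \<and> Q x y --> y = \<beta> x)
       ==> 0 < r x \<and> (\<forall>y. \<bar>y - \<beta> x\<bar> < r x \<and> Q x y --> y = \<beta> x)"
      using choice[of n "\<lambda>x k. 0 < k \<and> (\<forall>y. \<bar>y - \<beta> x\<bar> < k \<and> Q x y --> y = \<beta> x)"] by blast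
    have r2: "0 < r x \<and> (\<forall>y. \<bar>y - \<beta> x\<bar> < r x \<and> Q x y --> y = \<beta> x)" if l: "length x = n" for x
    proof -
      define k where "k = Min (insert 1 ((\<lambda>y. \<bar>y - \<beta> x\<bar>) ` ({y. Q x y} - {\<beta> x})))"
      have "0 < k" unfolding k_def using fin[OF l] by auto
      moreover have "y = \<beta> x" if y: "\<bar>y - \<beta> x\<bar> < k" "Q x y" for y
      proof (rule ccontr)
        assume "y \<noteq> \<beta> x"
        then have "k \<le> \<bar>y - \<beta> x\<bar>" unfolding k_def using fin[OF l] y(2) by (intro Min_le) auto
        then show False using y(1) by simp
      qed
      ultimately show ?thesis using r(2)[OF l] by blast
    qed
    define P where "P x \<longleftrightarrow> \<not> (nrm0 Q x (\<beta> x) \<or> nrm1 Q x (\<beta> x))" for x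
    have P: "dp n P" unfolding P_def by (rule dintros dp_nrm[OF Q] df_comp[OF \<beta>(1)] | simp)+
    have dQ: "dp n (\<lambda>x. Q x (\<beta> x))" by (rule dintros dp_rel[OF Q] df_comp[OF \<beta>(1)] | simp)+
    have fP: "fat n P" by (rule fat_mono[OF 2]) (use \<beta>(2) in \<open>auto simp: P_def\<close>)
    have "fat n (\<lambda>x. (P x \<and> Q x (\<beta> x)) \<or> (P x \<and> \<not> Q x (\<beta> x)))" by (rule fat_mono[OF fP]) blast
    moreover have d: "dp n (\<lambda>x. P x \<and> Q x (\<beta> x))" "dp n (\<lambda>x. P x \<and> \<not> Q x (\<beta> x))" by (rule dintros P dQ)+
    ultimately consider "fat n (\<lambda>x. P x \<and> Q x (\<beta> x))" | "fat n (\<lambda>x. P x \<and> \<not> Q x (\<beta> x))"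
      using PP[of n] unfolding PP_def by blast
    then have "\<exists>b. fat n (\<lambda>x. P x \<and> Q x (\<beta> x) = b)"
    proof cases
      case 1 then show ?thesis by (intro exI[of _ True]) simp
    next
      case 2 then show ?thesis by (intro exI[of _ False]) simp
    qed
    then obtain b where b: "fat n (\<lambda>x. P x \<and> Q x (\<beta> x) = b)" by blast
    have db: "dp n (\<lambda>x. P x \<and> Q x (\<beta> x) = b)" by (rule dintros P dQ)+
    have "fat n (\<lambda>x. (P x \<and> Q x (\<beta> x) = b) \<and> contp \<beta> x)" using b db \<beta>(1) GC[of n] unfolding GC_def by blast
    moreover have "dp n (\<lambda>x. (P x \<and> Q x (\<beta> x) = b) \<and> contp \<beta> x)" by (rule dp_conj[OF db dp_contp0[OF \<beta>(1)]])
    ultimately have "fat n (\<lambda>x. ((P x \<and> Q x (\<beta> x) = b) \<and> contp \<beta> x) \<and> contp r x)" using r(1) GC[of n] unfolding GC_def by blast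
    then obtain x e where x: "length x = n" "0 < e" "\<And>y. near e x y ==> P y \<and> Q y (\<beta> y) = b \<and> contp \<beta> y \<and> contp r y"
      unfolding fat_def by blast
    \<comment> \<open>A quarter, so that after changes of \<open>\<beta>\<close> and
      \<open>r\<close> by less than \<open>r0\<close> the interval about \<open>\<beta> x\<close>
      still lies in the isolating interval about \<open>\<beta> x'\<close>.\<close>
    define r0 where "r0 = r x / 4"
    have r0: "0 < r0" unfolding r0_def using r2[OF x(1)] by simp
    have xx: "P x" "Q x (\<beta> x) = b" "contp \<beta> x" "contp r x" using x(2,3) by auto
    obtain \<eta>1 where 1: "\<eta>1 > 0" "\<And>y. near \<eta>1 x y ==> \<bar>\<beta> y - \<beta> x\<bar> < r0"
      using xx(3) r0 unfolding contp_def by blast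
    obtain \<eta>2 where 2: "\<eta>2 > 0" "\<And>y. near \<eta>2 x y ==> \<bar>r y - r x\<bar> < r0"
      using xx(4) r0 unfolding contp_def by blast
    define \<eta> where "\<eta> = min e (min \<eta>1 \<eta>2)"
    have \<eta>: "\<eta> > 0" unfolding \<eta>_def using x(2) 1 2 by simp
    have only: "y' = \<beta> x'" if "near \<eta> x x'" "\<bar>y' - \<beta> x\<bar> < r0" "Q x' y'" for x' y'
    proof -
      have "\<bar>\<beta> x' - \<beta> x\<bar> < r0" "\<bar>r x' - r x\<bar> < r0" using that 1 2 unfolding \<eta>_def by auto
      then have "\<bar>y' - \<beta> x'\<bar> < r x'" using that(2) r0 unfolding r0_def by (auto simp: abs_if field_simps split: if_splits)
      then show ?thesis using r2[of x'] near_length[OF that(1)] x(1) that(3) by auto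
    qed
    have ne: "near e x x'" if "near \<eta> x x'" for x' using that unfolding \<eta>_def by simp
    show False
    proof (cases b)
      case False
      have "nrm0 Q x (\<beta> x)" unfolding nrm0_def
      proof (intro exI[of _ "min \<eta> r0"] conjI allI impI)
        fix x' y' assume a: "near (min \<eta> r0) x x'" "\<bar>y' - \<beta> x\<bar> < min \<eta> r0"
        then show "\<not> Q x' y'" using only[of x' y'] x(3)[OF ne, of x'] False by auto
      qed (use \<eta> r0 in auto)
      then show False using xx(1) unfolding P_def by blast
    next
      case True
      have "nrm1 Q x (\<beta> x)" unfolding nrm1_def
      proof (rule conjI, goal_cases)
        case 1
        show "Q x (\<beta> x)" using xx(2) True by simp
      next
        case 2
        show ?case
      proof (rule exI[of _ r0], rule conjI[OF r0], rule allI, rule impI)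
        fix \<epsilon> assume \<epsilon>: "0 < \<epsilon> \<and> \<epsilon> < r0"
        then obtain \<eta>3 where 3: "\<eta>3 > 0" "\<And>y. near \<eta>3 x y ==> \<bar>\<beta> y - \<beta> x\<bar> < \<epsilon>"
          using xx(3) unfolding contp_def by blast
        show "\<exists>\<zeta>>0. \<forall>x'. near \<zeta> x x' --> (\<exists>!y'. \<bar>y' - \<beta> x\<bar> < \<epsilon> \<and> Q x' y')"
        proof (intro exI[of _ "min \<eta> \<eta>3"] conjI allI impI)
          fix x' assume a: "near (min \<eta> \<eta>3) x x'"
          then have "Q x' (\<beta> x')" "\<bar>\<beta> x' - \<beta> x\<bar> < \<epsilon>" using x(3)[OF ne, of x'] 3 True by auto
          moreover have "y' = \<beta> x'" if "\<bar>y' - \<beta> x\<bar> < \<epsilon>" "Q x' y'" for y'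
            using only[of x' y'] a that \<epsilon> by auto
          ultimately show "\<exists>!y'. \<bar>y' - \<beta> x\<bar> < \<epsilon> \<and> Q x' y'" by blast
        qed (use \<eta> 3 in auto)
      qed
      qed
      then show False using xx(1) unfolding P_def by blast
    qed
  qed
qed

text \<open>A definable form of the Heine--Borel theorem for intervals.\<close>

lemma definable_compactness:
  assumes R: "r2 R" and anti: "\<And>t z z'. R t z ==> 0 < z' ==> z' \<le> z ==> R t z'"
    and loc: "\<And>t. c \<le> t ==> t \<le> d ==> \<exists>z>0. \<forall>u. \<bar>u - t\<bar> < z --> R u z"
  shows "\<exists>z>0. \<forall>t. c \<le> t \<and> t \<le> d --> R t z"
proof (cases "c \<le> d")
  case False
  then show ?thesis by (intro exI[of _ 1]) auto
next
  case True
  define A where "A s \<longleftrightarrow> c \<le> s \<and> s \<le> d \<and> (\<exists>z. 0 < z \<and> (\<forall>t. c \<le> t \<and> t \<le> s --> R t z))" for s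
  have dA: "d1 A" unfolding d1_def A_def by (rule dintros r2_app[OF R] | simp)+
  obtain z0 where z0: "0 < z0" "\<And>u. \<bar>u - c\<bar> < z0 ==> R u z0" using loc[of c] True by blast
  have "R t z0" if "c \<le> t" "t \<le> c" for t using z0(2)[of t] z0(1) that by simp
  then have "A c" unfolding A_def using True z0(1) by auto
  moreover have "A t ==> t \<le> d" for t unfolding A_def by blast
  ultimately obtain s where s: "\<And>t. A t ==> t \<le> s" "\<And>v. (\<And>t. A t ==> t \<le> v) ==> s \<le> v"
    using sup_ex[of A c d] dA by blast
  have cs: "c \<le> s" "s \<le> d" using s \<open>A c\<close> A_def by auto
  obtain z1 where z1: "0 < z1" "\<And>u. \<bar>u - s\<bar> < z1 ==> R u z1" using loc[OF cs] by blast
  have "\<not> s \<le> s - z1" using z1(1) by simp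
  then obtain t where t: "A t" "s - z1 < t" using s(2)[of "s - z1"] by (meson not_le)
  obtain z2 where z2: "0 < z2" "\<And>u. c \<le> u ==> u \<le> t ==> R u z2" using t(1) unfolding A_def by blast
  have "t \<le> s" using s t by blast
  have *: "A (min d (s + z1 / 2))"
  proof -
    have "R u (min z1 z2)" if u: "c \<le> u" "u \<le> min d (s + z1 / 2)" for u
    proof (cases "u \<le> t")
      case True
      then show ?thesis using z2(2)[OF u(1) True] anti[of u z2 "min z1 z2"] z1 z2 by simp
    next
      case False
      have "s - z1 < u" using False t(2) by simp
      moreover have "u \<le> s + z1 / 2" using u(2) by simp
      moreover have "z1 / 2 < z1" using z1(1) by simp
      ultimately have "\<bar>u - s\<bar> < z1" unfolding abs_less_iff by linarith
      then show ?thesis using z1 z2 anti[of u z1 "min z1 z2"] by simp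
    qed
    moreover have "c \<le> min d (s + z1 / 2)" using cs True z1(1) by (simp add: add_increasing2)
    ultimately show ?thesis unfolding A_def using z1(1) z2(1) by (auto intro!: exI[of _ "min z1 z2"])
  qed
  then have "min d (s + z1 / 2) \<le> s" using s by blast
  then have "d \<le> s" using z1(1) by (auto simp: min_def split: if_splits)
  then have "A d" using * cs z1(1) by (simp add: min_def split: if_splits)
  then show ?thesis unfolding A_def by blast
qed

text \<open>Each point of the fibre persists, exactly once, by normality. No others appear: they
  would lie in a bounded interval, on which definable compactness gives one neighbourhood of
  \<open>x\<close> over which all heights away from the fibre stay empty.\<close>

lemma good_locally_const:
  assumes Q: "dp (Suc n) (\<lambda>z. Q (take n z) (z ! n))" and fin: "\<And>x. length x = n ==> finite {y. Q x y}"
    and good: "good Q x" and x: "length x = n"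
  shows "\<exists>\<epsilon>>0. \<forall>x'. near \<epsilon> x x' --> card {y. Q x' y} = card {y. Q x y}"
proof -
  define A where "A = {y. Q x y}"
  have A: "finite A" unfolding A_def using fin[OF x] .
  have "nrm1 Q x y" if "y \<in> A" for y
  proof (rule ccontr)
    assume "\<not> nrm1 Q x y"
    then have "nrm0 Q x y" using good unfolding good_def by blast
    then obtain e where "0 < e" "\<forall>x'. near e x x' --> (\<forall>y'. \<bar>y' - y\<bar> < e --> \<not> Q x' y')" unfolding nrm0_def by blast
    then show False using that unfolding A_def by auto
  qed
  then have "\<forall>y\<in>A. \<exists>\<epsilon>0. 0 < \<epsilon>0 \<and> (\<forall>\<epsilon>. 0 < \<epsilon> \<and> \<epsilon> < \<epsilon>0 -->
   (\<exists>\<zeta>. 0 < \<zeta> \<and> (\<forall>x'. near \<zeta> x x' --> (\<exists>!y'. \<bar>y' - y\<bar> < \<epsilon> \<and> Q x' y'))))" unfolding nrm1_def by blast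
  then obtain e0 where e0: "\<And>y. y \<in> A ==> 0 < e0 y" "\<And>y \<epsilon>. y \<in> A ==> 0 < \<epsilon> \<and> \<epsilon> < e0 y ==>
     \<exists>\<zeta>. 0 < \<zeta> \<and> (\<forall>x'. near \<zeta> x x' --> (\<exists>!y'. \<bar>y' - y\<bar> < \<epsilon> \<and> Q x' y'))"
    by (elim exE[OF bchoice]) blast
  \<comment> \<open>The distances are halved so that the intervals around different points of the
    fibre are disjoint; the 1 keeps the minimum defined for an empty fibre.\<close>
  define m where "m = Min (insert 1 (e0 ` A \<union> (\<lambda>(y, y'). \<bar>y - y'\<bar> / 2) ` (A \<times> A - Id)))"
  have "finite (A \<times> A - Id)" using A by auto
  then have m: "0 < m" "\<And>y. y \<in> A ==> m \<le> e0 y"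
    unfolding m_def using A e0(1) by (auto intro!: Min_le)
  have m3: "m \<le> \<bar>y - y'\<bar> / 2" if "y \<in> A" "y' \<in> A" "y \<noteq> y'" for y y'
  proof -
    have "\<bar>y - y'\<bar> / 2 \<in> (\<lambda>(y, y'). \<bar>y - y'\<bar> / 2) ` (A \<times> A - Id)"
      using that by (intro image_eqI[of _ _ "(y, y')"]) auto
    then show ?thesis unfolding m_def using A \<open>finite (A \<times> A - Id)\<close> by (intro Min_le) auto
  qed
  obtain \<epsilon> where \<epsilon>: "0 < \<epsilon>" "\<epsilon> < m" using dense[OF m(1)] by blast
  have "\<forall>y\<in>A. \<exists>\<zeta>. 0 < \<zeta> \<and> (\<forall>x'. near \<zeta> x x' --> (\<exists>!y'. \<bar>y' - y\<bar> < \<epsilon> \<and> Q x' y'))"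
    using e0(2) m(2) \<epsilon> by (meson less_le_trans)
  then obtain z where z: "\<And>y. y \<in> A ==> 0 < z y" "\<And>y x'. y \<in> A ==> near (z y) x x' ==> \<exists>!y'. \<bar>y' - y\<bar> < \<epsilon> \<and> Q x' y'" by metis
  define z1 where "z1 = Min (insert 1 (z ` A))"
  have z1: "0 < z1" "\<And>y. y \<in> A ==> z1 \<le> z y" unfolding z1_def using A z(1) by auto
  obtain K eb where K: "0 < eb" "\<And>x' y'. near eb x x' ==> Q x' y' ==> \<bar>y'\<bar> < K"
    using good unfolding good_def bnd_def by blast
  \<comment> \<open>Heights close to \<open>A\<close> satisfy this by themselves, the others by
    local emptiness; so it holds locally in \<open>t\<close>, as compactness requires.\<close>
  define R where "R t \<zeta> \<longleftrightarrow> (\<forall>x'. near \<zeta> x x' --> (Q x' t --> (\<exists>y\<in>A. \<bar>t - y\<bar> < \<epsilon>)))" for t \<zeta>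
  have "\<exists>\<zeta>>0. \<forall>t. - K \<le> t \<and> t \<le> K --> R t \<zeta>"
  proof (rule definable_compactness)
    show "r2 R" unfolding r2_def R_def by (rule dintros dp_rel[OF Q] A x | simp)+
    show "R t z'" if "R t z" "0 < z'" "z' \<le> z" for t z z'
      using that unfolding R_def by (meson near_mono)
    fix t
    consider "nrm0 Q x t" | "t \<in> A" using good unfolding good_def nrm1_def A_def by blast
    then show "\<exists>z>0. \<forall>u. \<bar>u - t\<bar> < z --> R u z"
    proof cases
      case 1
      then show ?thesis unfolding nrm0_def R_def by blast
    next
      case 2
      then show ?thesis using \<epsilon>(1) unfolding R_def by (intro exI[of _ \<epsilon>]) auto
    qed
  qed
  then obtain z2 where z2: "0 < z2" "\<And>t. - K \<le> t ==> t \<le> K ==> R t z2" by blast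
  show ?thesis
  proof (intro exI[of _ "min z1 (min z2 eb)"] conjI allI impI)
    fix x' assume nx: "near (min z1 (min z2 eb)) x x'"
    define g where "g y = (THE y'. \<bar>y' - y\<bar> < \<epsilon> \<and> Q x' y')" for y
    have ex1: "\<exists>!y'. \<bar>y' - y\<bar> < \<epsilon> \<and> Q x' y'" if "y \<in> A" for y
      using z(2)[OF that] nx near_mono[OF _ z1(2)[OF that]] by auto
    have g: "\<bar>g y - y\<bar> < \<epsilon>" "Q x' (g y)" if "y \<in> A" for y
      using theI'[OF ex1[OF that]] unfolding g_def by blast+
    have "bij_betw g A {y. Q x' y}" unfolding bij_betw_def
    proof
      show "inj_on g A"
      proof (rule inj_onI, rule ccontr)
        fix y y' assume a: "y \<in> A" "y' \<in> A" "g y = g y'" "y \<noteq> y'"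
        then have "\<bar>g y - y\<bar> < \<epsilon>" "\<bar>g y - y'\<bar> < \<epsilon>" "2 * m \<le> \<bar>y - y'\<bar>" using g[of y] g[of y'] m3[of y y'] by auto
        then show False using \<epsilon> by (auto simp: abs_if split: if_splits)
      qed
      show "g ` A = {y. Q x' y}"
      proof (intro equalityI subsetI)
        fix y' assume y': "y' \<in> {y. Q x' y}"
        then have "\<bar>y'\<bar> < K" using K(2)[of x' y'] nx by simp
        then have "R y' z2" using z2(2)[of y'] by (auto simp: abs_less_iff)
        then obtain y where "y \<in> A" "\<bar>y' - y\<bar> < \<epsilon>" using nx y' unfolding R_def by auto
        then have "y' = g y" using ex1 g y' by blast
        then show "y' \<in> g ` A" using \<open>y \<in> A\<close> by blast
      qed (use g in auto)
    qed
    then show "card {y. Q x' y} = card {y. Q x y}" using bij_betw_same_card unfolding A_def by metis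
  qed (use z1 z2 K in auto)
qed

end

section \<open>Cell decomposition\<close>

definition rank_in :: "'a::linorder set => 'a => nat" where
  "rank_in A y = card {t \<in> A. t < y}"

lemma rank_in_less:
  assumes "finite A" "y \<in> A" shows "y < z \<longleftrightarrow> rank_in A y < rank_in A z"
proof
  assume "y < z"
  then have "{t \<in> A. t < y} \<subset> {t \<in> A. t < z}" using assms by auto
  then show "rank_in A y < rank_in A z" unfolding rank_in_def using assms by (intro psubset_card_mono) auto
next
  assume "rank_in A y < rank_in A z"
  moreover have "rank_in A z \<le> rank_in A y" if "z \<le> y" unfolding rank_in_def using that assms by (intro card_mono) auto
  ultimately show "y < z" by (meson not_le)
qed

lemma rank_in_bij: assumes "finite A" shows "bij_betw (rank_in A) A {..<card A}"
proof -
  have i: "inj_on (rank_in A) A"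
  proof (rule inj_onI)
    fix x y assume "x \<in> A" "y \<in> A" "rank_in A x = rank_in A y"
    then show "x = y" using rank_in_less[OF assms, of x y] rank_in_less[OF assms, of y x] by auto
  qed
  have "rank_in A y < card A" if "y \<in> A" for y
    unfolding rank_in_def using that assms by (intro psubset_card_mono) auto
  then have "rank_in A ` A \<subseteq> {..<card A}" by auto
  moreover have "card (rank_in A ` A) = card {..<card A}" using card_image[OF i] by simp
  ultimately have "rank_in A ` A = {..<card A}" by (intro card_subset_eq) auto
  then show ?thesis using i unfolding bij_betw_def by blast
qed

lemma rank_in_le_card: "finite A ==> rank_in A y \<le> card A"
  unfolding rank_in_def by (intro card_mono) auto

context dstruct
begin

lemma dl_sel [dintros]: "dl N m l ==> set I \<subseteq> {..<m} ==> length I = n ==> dl N n (\<lambda>x. sel I (l x))"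
  unfolding sel_def by (rule dl_comp[OF dl_map_nth])

lemma dp_card_ge:
  assumes Q: "dp (Suc n) (\<lambda>z. Q (take n z) (z ! n))" and fin: "\<And>x. length x = n ==> finite {y. Q x y}"
  shows "dp n (\<lambda>x. j \<le> card {y. Q x y})"
proof -
  have "dp n (\<lambda>x. \<exists>s. length s = j \<and> ((\<forall>i<j. Q x (s ! i)) \<and> (\<forall>i<j. \<forall>k<j. i = k \<or> \<not> s ! i = s ! k)))"
    by (rule dintros dp_rel[OF Q] | simp)+
  moreover have "(\<exists>s. length s = j \<and> ((\<forall>i<j. Q x (s ! i)) \<and> (\<forall>i<j. \<forall>k<j. i = k \<or> \<not> s ! i = s ! k))) \<longleftrightarrow> j \<le> card {y. Q x y}" (is "?L \<longleftrightarrow> ?R")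
    if "length x = n" for x
  proof
    assume ?L
    then obtain s where s: "length s = j" "\<forall>i<j. Q x (s ! i)" "\<forall>i<j. \<forall>k<j. i = k \<or> \<not> s ! i = s ! k" by blast
    then have "distinct s" "set s \<subseteq> {y. Q x y}" by (auto simp: distinct_conv_nth in_set_conv_nth)
    then show ?R using card_mono[OF fin[OF that], of "set s"] s(1) by (simp add: distinct_card)
  next
    assume ?R
    then obtain A where A: "A \<subseteq> {y. Q x y}" "card A = j" "finite A" using obtain_subset_with_card_n by metis
    then obtain s where s: "set s = A" "distinct s" using finite_distinct_list by blast
    then have "length s = j" using A(2) distinct_card by metis
    moreover have "\<forall>i<j. Q x (s ! i)" using s(1) A(1) \<open>length s = j\<close> nth_mem[of _ s] by blast
    moreover have "\<forall>i<j. \<forall>k<j. i = k \<or> \<not> s ! i = s ! k" using s(2) \<open>length s = j\<close> by (auto simp: distinct_conv_nth)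
    ultimately show ?L by blast
  qed
  ultimately show ?thesis by (simp cong: dp_cong)
qed

lemma dp_card_eq:
  assumes Q: "dp (Suc n) (\<lambda>z. Q (take n z) (z ! n))" and fin: "\<And>x. length x = n ==> finite {y. Q x y}"
  shows "dp n (\<lambda>x. card {y. Q x y} = j)"
proof -
  have "dp n (\<lambda>x. j \<le> card {y. Q x y} \<and> \<not> Suc j \<le> card {y. Q x y})"
    by (intro dp_conj dp_not dp_card_ge[OF Q fin])
  moreover have "j \<le> c \<and> \<not> Suc j \<le> c \<longleftrightarrow> c = j" for c by auto
  ultimately show ?thesis by simp
qed

end

locale omin_pair = B: dstruct D + M: omin DM for D DM :: "nat => 'a::linordered_field list set => bool" +
  fixes p :: nat
  assumes sub: "D n Z ==> DM n Z"
begin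

lemma dp_sub: "B.dp n P ==> M.dp n P"
  unfolding B.dp_def M.dp_def by (rule sub)

lemma df_sub: "B.df n f ==> M.df n f"
  unfolding B.df_def M.df_def by (rule dp_sub)

text \<open>As in \<open>Cp_on\<close>, the smooth extension may use any parameters;
  \<open>PD\<close> requires only the function itself, as a total function on M^n, to be definable
  over the smaller set.\<close>

definition "CpX n Z f \<longleftrightarrow> (\<exists>U F. euclidean_open n U \<and> DM n U \<and> Z \<subseteq> U \<and> M.df n F \<and> Cp_open n p U F \<and> (\<forall>x\<in>Z. F x = f x))"
definition "PD n Z f \<longleftrightarrow> B.df n f \<and> CpX n Z f"
definition "cellp n C \<longleftrightarrow> (\<exists>bs. length bs = n \<and> rel_cell PD 0 {[]} bs C)"

lemma CpX_mono: "CpX n Z f ==> Y \<subseteq> Z ==> CpX n Y f"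
  unfolding CpX_def by blast

lemma CpX_cong: "CpX n Z f ==> (\<And>x. x \<in> Z ==> f x = g x) ==> CpX n Z g"
  unfolding CpX_def by metis

lemma CpX_cont_on: assumes "CpX n Z f" shows "cont_on Z f"
proof -
  obtain U F where U: "Z \<subseteq> U" "Cp_open n p U F" "\<forall>x\<in>Z. F x = f x" using assms unfolding CpX_def by blast
  then have "cont_on Z F" using Cp_open_cont_on cont_on_mono by blast
  then show ?thesis using U(3) unfolding cont_on_def by simp
qed

lemma CpX_sel:
  assumes "CpX n Z f" "distinct I" "length I = n" "set I \<subseteq> {..<N}" "Y \<subseteq> {x. length x = N \<and> sel I x \<in> Z}"
  shows "CpX N Y (\<lambda>x. f (sel I x))"
proof -
  obtain U F where U: "euclidean_open n U" "DM n U" "Z \<subseteq> U" "M.df n F" "Cp_open n p U F" "\<forall>x\<in>Z. F x = f x"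
    using assms(1) unfolding CpX_def by blast
  let ?V = "{x. length x = N \<and> sel I x \<in> U}"
  have "DM N ?V" by (rule M.D_Collect) (rule M.dp_mem[OF U(2)] M.dl_sel M.dl_id assms)+
  moreover have "M.df N (\<lambda>x. F (sel I x))" by (rule M.df_comp[OF U(4)] M.dl_sel M.dl_id assms)+
  ultimately show ?thesis unfolding CpX_def
    using Cp_open_sel[OF U(5) assms(2-4)] euclidean_open_sel[OF U(1) assms(3,4)] U(3,6) assms(5)
    by (intro exI[of _ ?V] exI[of _ "\<lambda>x. F (sel I x)"]) auto
qed

lemma CpX_Gp: assumes "M.df n f" "Z \<subseteq> {x. length x = n \<and> Gp n p f x}" shows "CpX n Z f"
proof -
  have "DM n {x. length x = n \<and> Gp n p f x}" by (rule M.D_Collect[OF M.dp_Gp[OF assms(1)]])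
  then show ?thesis unfolding CpX_def using euclidean_open_Gp Gp_Cp_open assms by blast
qed

lemma PD_cont_on: "PD n Z f ==> cont_on Z f"
  unfolding PD_def using CpX_cont_on by blast

lemma graph_over_iff: "C \<subseteq> pow n ==> z \<in> graph_over C f \<longleftrightarrow> length z = Suc n \<and> take n z \<in> C \<and> z ! n = f (take n z)"
  unfolding graph_over_def by (auto simp: nth_append subset_iff) (metis take_snoc_nth)

lemma band_over_iff: "C \<subseteq> pow n ==> z \<in> band_over C lo hi \<longleftrightarrow> length z = Suc n \<and> take n z \<in> C \<and> in_band lo hi (take n z) (z ! n)"
  unfolding band_over_def by (auto simp: nth_append subset_iff) (metis take_snoc_nth)

lemma D_rel_cell: "rel_cell PD r Z bs C ==> D r Z ==> D (r + length bs) C"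
proof (induction bs arbitrary: C)
  case (Cons b bs)
  then obtain C' where C': "rel_cell PD r Z bs C'" "cell_over PD (r + length bs) b C' C" by auto
  let ?n = "r + length bs"
  have D: "D ?n C'" using Cons C' by blast
  have s: "C' \<subseteq> pow ?n" using B.D_sub[OF D] .
  have "D (Suc ?n) C"
  proof (cases b)
    case True
    then obtain lo hi where l: "\<forall>f. lo = Some f --> PD ?n C' f" "\<forall>g. hi = Some g --> PD ?n C' g" "C = band_over C' lo hi"
      using C'(2) unfolding cell_over_def by auto
    have lo: "B.dp (Suc ?n) (\<lambda>z. \<forall>f. lo = Some f --> f (take ?n z) < z ! ?n)"
    proof (cases lo)
      case (Some f)
      then have f: "B.df ?n f" using l(1) unfolding PD_def by blast
      have "B.dp (Suc ?n) (\<lambda>z. f (take ?n z) < z ! ?n)" by (rule dintros B.df_comp[OF f] | simp)+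
      then show ?thesis using Some by simp
    qed (simp add: B.dp_True)
    have hi: "B.dp (Suc ?n) (\<lambda>z. \<forall>f. hi = Some f --> z ! ?n < f (take ?n z))"
    proof (cases hi)
      case (Some f)
      then have f: "B.df ?n f" using l(2) unfolding PD_def by blast
      have "B.dp (Suc ?n) (\<lambda>z. z ! ?n < f (take ?n z))" by (rule dintros B.df_comp[OF f] | simp)+
      then show ?thesis using Some by simp
    qed (simp add: B.dp_True)
    have "B.dp (Suc ?n) (\<lambda>z. take ?n z \<in> C' \<and> in_band lo hi (take ?n z) (z ! ?n))"
      unfolding in_band_def by (rule B.dp_conj B.dp_mem[OF D] lo hi B.dl_take B.dl_id | simp)+
    then have "D (Suc ?n) {z. length z = Suc ?n \<and> (take ?n z \<in> C' \<and> in_band lo hi (take ?n z) (z ! ?n))}" by (rule B.D_Collect)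
    moreover have "C = {z. length z = Suc ?n \<and> (take ?n z \<in> C' \<and> in_band lo hi (take ?n z) (z ! ?n))}"
      unfolding l(3) using band_over_iff[OF s] by blast
    ultimately show ?thesis by simp
  next
    case False
    then obtain f where f: "B.df ?n f" "C = graph_over C' f" using C'(2) unfolding cell_over_def PD_def by auto
    have "B.dp (Suc ?n) (\<lambda>z. take ?n z \<in> C' \<and> z ! ?n = f (take ?n z))"
      by (rule dintros B.dp_mem[OF D] B.df_comp[OF f(1)] | simp)+
    then have "D (Suc ?n) {z. length z = Suc ?n \<and> (take ?n z \<in> C' \<and> z ! ?n = f (take ?n z))}" by (rule B.D_Collect)
    moreover have "C = {z. length z = Suc ?n \<and> (take ?n z \<in> C' \<and> z ! ?n = f (take ?n z))}"
      unfolding f(2) using graph_over_iff[OF s] by blast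
    ultimately show ?thesis by simp
  qed
  then show ?case by simp
qed simp

lemma D_point: "D 0 {[]}"
  using B.D_pow[of 0] by (simp add: tuples_def)

lemma D_cellp: "cellp n C ==> D n C"
  unfolding cellp_def using D_rel_cell[OF _ D_point] by auto

lemma rel_cell_graph:
  assumes "rel_cell P r Z (bs2 @ False # bs1) C" "\<And>z. z \<in> Z ==> length z = r"
  shows "\<exists>\<phi> C1. P (r + length bs1) C1 \<phi> \<and> (\<forall>z\<in>C. z ! (r + length bs1) = \<phi> (take (r + length bs1) z))"
proof -
  let ?k = "r + length bs1"
  obtain C1 where C1: "rel_cell P r Z (False # bs1) C1" "rel_cell P (r + length (False # bs1)) C1 bs2 C"
    using rel_cell_split[OF assms(1)] by blast
  then obtain C0 f where f: "rel_cell P r Z bs1 C0" "P ?k C0 f" "C1 = graph_over C0 f" by (auto simp: cell_over_def)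
  have len: "length z = ?k" if "z \<in> C0" for z using rel_cell_length[OF f(1) assms(2) that] .
  have tk: "take (Suc ?k) z \<in> C1" if "z \<in> C" for z
    using rel_cell_base_into[OF C1(2) rel_cell_length[OF C1(1) assms(2)] that] by simp
  have "z ! ?k = f (take ?k z)" if zC: "z \<in> C" for z
  proof -
    obtain x where x: "take (Suc ?k) z = x @ [f x]" "x \<in> C0" using tk[OF zC] unfolding f(3) graph_over_def by auto
    have "take ?k z = take ?k (take (Suc ?k) z)" by simp
    also have "\<dots> = x" unfolding x(1) using len[OF x(2)] by simp
    finally have "take ?k z = x" .
    moreover have "z ! ?k = take (Suc ?k) z ! ?k" by simp
    then have "z ! ?k = f x" unfolding x(1) using len[OF x(2)] by (simp add: nth_append)
    ultimately show ?thesis by simp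
  qed
  then show ?thesis using f(2) by blast
qed

text \<open>Dropping a coordinate in which the cell is a graph loses nothing, as the map
  \<open>h\<close> restores it. This reduces cells with empty interior to one variable less.\<close>

lemma nonopen_cell:
  assumes "rel_cell PD 0 {[]} bs C" "False \<in> set bs"
  shows "\<exists>m I h. length bs = Suc m \<and> length I = m \<and> distinct I \<and> set I \<subseteq> {..<Suc m} \<and> B.dl m (Suc m) h \<and> (\<forall>x\<in>C. h (sel I x) = x)"
proof -
  obtain bs2 bs1 where bs: "bs = bs2 @ False # bs1" using assms(2) by (metis split_list)
  define i where "i = length bs1"
  define m where "m = length bs2 + length bs1"
  obtain \<phi> where \<phi>: "B.df i \<phi>" "\<And>z. z \<in> C ==> z ! i = \<phi> (take i z)"
    using rel_cell_graph[of PD 0 "{[]}" bs2 bs1 C] assms(1) unfolding bs i_def PD_def by auto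
  have lm: "length bs = Suc m" "i \<le> m" unfolding bs m_def i_def by auto
  define I where "I = [0..<i] @ [Suc i..<Suc m]"
  define h where "h x = take i x @ [\<phi> (take i x)] @ drop i x" for x
  have "B.dl m (Suc m) h" unfolding h_def
  proof (rule B.dl_append)
    show "B.dl m i (take i)" using lm by (rule_tac B.dl_take0)
    show "B.dl m (1 + (m - i)) (\<lambda>x. [\<phi> (take i x)] @ drop i x)"
      by (rule B.dl_append[OF B.dl_single[OF B.df_comp[OF \<phi>(1) B.dl_take0]] B.dl_drop[OF B.dl_id, of "m - i"]]) (use lm in auto)
  qed (use lm in auto)
  moreover have "h (sel I x) = x" if "x \<in> C" for x
  proof -
    have lx: "length x = Suc m" using rel_cell_length[OF assms(1) _ that] lm by simp
    have 1: "sel I x = take i x @ drop (Suc i) x"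
    proof -
      have "map ((!) x) [Suc i..<Suc m] = drop (Suc i) x" by (rule nth_equalityI) (use lx in \<open>auto simp del: upt_Suc\<close>)
      moreover have "map ((!) x) [0..<i] = take i x" by (rule map_nth_upt_take) (use lx lm in auto)
      ultimately show ?thesis unfolding sel_def I_def by simp
    qed
    have 2: "take i (sel I x) = take i x" "drop i (sel I x) = drop (Suc i) x" unfolding 1 using lx lm by auto
    show ?thesis unfolding h_def 2 using \<phi>(2)[OF that] lx lm id_take_nth_drop[of i x] by simp
  qed
  moreover have "distinct I" "length I = m" "set I \<subseteq> {..<Suc m}" unfolding I_def using lm by auto
  ultimately show ?thesis using lm(1) by blast
qed

lemma open_cell_interior:
  assumes "rel_cell PD 0 {[]} bs C" "set bs \<subseteq> {True}" "x \<in> C"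
  shows "\<exists>e>0. \<forall>y. near e x y --> y \<in> C"
  using rel_cell_open[OF assms(1) PD_cont_on _ assms(2,3)] by simp

lemma cellp_nonempty: "cellp n C ==> C \<noteq> {}"
  unfolding cellp_def using rel_cell_base_onto[of PD 0 "{[]}" _ C "[]"] by auto

text \<open>By \<open>interval_connected\<close> the predicate is constant on the fibres over the
  first coordinates, so it descends to a predicate on a cell with one coordinate less. That
  predicate is again locally constant, since a height in the fibre over \<open>x\<close> also lies
  in the fibres over all nearby points.\<close>

lemma open_cell_connected:
  assumes "rel_cell PD 0 {[]} bs C" "set bs \<subseteq> {True}" "M.dp (length bs) S"
    "\<And>x. x \<in> C ==> \<exists>e>0. \<forall>y\<in>C. near e x y --> (S x \<longleftrightarrow> S y)" "x \<in> C" "y \<in> C"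
  shows "S x \<longleftrightarrow> S y"
  using assms
proof (induction bs arbitrary: C S x y)
  case (Cons b bs)
  let ?n = "length bs"
  obtain C' where C': "rel_cell PD 0 {[]} bs C'" and cov: "cell_over PD ?n True C' C"
    using Cons.prems(1,2) by auto
  then obtain lo hi where l: "\<forall>f. lo = Some f --> PD ?n C' f" "\<forall>g. hi = Some g --> PD ?n C' g"
    "C = band_over C' lo hi" unfolding cell_over_def by auto
  have lC': "length x = ?n" if "x \<in> C'" for x using rel_cell_length[OF C' _ that] by simp
  have D: "D (Suc ?n) C" using D_rel_cell[OF Cons.prems(1) D_point] by simp
  have dS: "M.dp (Suc ?n) S" using Cons.prems(3) by simp
  have fib: "S (x @ [s]) \<longleftrightarrow> S (x @ [t])" if x: "x \<in> C'" and st: "in_band lo hi x s" "in_band lo hi x t" for x s t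
  proof -
    have *: "S (x @ [s]) \<longleftrightarrow> S (x @ [t])" if st: "in_band lo hi x s" "in_band lo hi x t" "s \<le> t" for s t
    proof -
      have d: "M.d1 (\<lambda>u. S (x @ [u]))" unfolding M.d1_def
        by (rule M.dp_comp[OF dS] dintros lC'[OF x] | simp add: lC'[OF x])+
      have cv: "in_band lo hi x u" if "s \<le> u" "u \<le> t" for u
        unfolding in_band_def by (intro conjI allI impI) (use that st in \<open>force simp: in_band_def\<close>)+
      show ?thesis
      proof (rule M.interval_connected[OF d st(3)])
        fix u assume u: "s \<le> u" "u \<le> t"
        then have "x @ [u] \<in> C" using x cv unfolding l(3) band_over_def by blast
        then obtain e where e: "0 < e" "\<And>y. y \<in> C ==> near e (x @ [u]) y ==> S (x @ [u]) = S y" using Cons.prems(4) by blast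
        have "\<exists>e>0. \<forall>x'\<in>C'. \<forall>y'. near e x x' \<and> \<bar>y' - u\<bar> < e --> in_band lo hi x' y'"
          using in_band_near[of lo C' hi x u] l(1,2) PD_cont_on x cv[OF u] by blast
        then obtain e' where e': "0 < e'" "\<And>y'. \<bar>y' - u\<bar> < e' ==> in_band lo hi x y'" using x near_refl by blast
        show "\<exists>e>0. \<forall>v. \<bar>v - u\<bar> < e --> S (x @ [v]) = S (x @ [u])"
        proof (intro exI[of _ "min e e'"] conjI allI impI)
          fix v assume v: "\<bar>v - u\<bar> < min e e'"
          then have "x @ [v] \<in> C" using x e' unfolding l(3) band_over_def by auto
          moreover have "near e (x @ [u]) (x @ [v])" using v e(1) by (simp add: abs_minus_commute)
          ultimately show "S (x @ [v]) = S (x @ [u])" using e(2) by blast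
        qed (use e e' in auto)
      qed
    qed
    show ?thesis using *[OF st] *[OF st(2,1)] by (metis linear)
  qed
  define S' where "S' x \<longleftrightarrow> (\<exists>y. x @ [y] \<in> C \<and> S (x @ [y]))" for x
  have inC: "x @ [y] \<in> C \<longleftrightarrow> x \<in> C' \<and> in_band lo hi x y" for x y unfolding l(3) band_over_def by auto
  have S': "S' x \<longleftrightarrow> S (x @ [y])" if "x @ [y] \<in> C" for x y
    using that fib[of x] unfolding S'_def inC by blast
  have dS': "M.dp ?n S'" unfolding S'_def
    by (rule dintros M.dp_mem[OF sub[OF D]] M.dp_comp[OF dS] | simp)+
  have loc: "\<exists>e>0. \<forall>y\<in>C'. near e x y --> (S' x \<longleftrightarrow> S' y)" if x: "x \<in> C'" for x
  proof -
    obtain y where y: "x @ [y] \<in> C" using cell_over_ex[OF cov x] by blast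
    then obtain e where e: "0 < e" "\<And>z. z \<in> C ==> near e (x @ [y]) z ==> S (x @ [y]) = S z" using Cons.prems(4) by blast
    have "\<exists>e>0. \<forall>x'\<in>C'. \<forall>y'. near e x x' \<and> \<bar>y' - y\<bar> < e --> in_band lo hi x' y'"
      using in_band_near[of lo C' hi x y] l(1,2) PD_cont_on x y unfolding inC by blast
    then obtain e' where e': "0 < e'" "\<And>x'. x' \<in> C' ==> near e' x x' ==> in_band lo hi x' y" by auto
    show ?thesis
    proof (intro exI[of _ "min e e'"] conjI ballI impI)
      fix x' assume x': "x' \<in> C'" "near (min e e') x x'"
      then have "x' @ [y] \<in> C" using e' unfolding inC by auto
      moreover have "near e (x @ [y]) (x' @ [y])" using x' e(1) lC'[OF x] lC'[OF x'(1)] by simp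
      ultimately show "S' x = S' x'" using e(2) S'[OF y] S' by blast
    qed (use e e' in auto)
  qed
  obtain x1 y1 x2 y2 where xy: "x = x1 @ [y1]" "y = x2 @ [y2]" "x1 \<in> C'" "x2 \<in> C'"
    using Cons.prems(5,6) unfolding l(3) band_over_def by blast
  have "S' x1 = S' x2" by (rule Cons.IH[OF C' _ dS' loc xy(3,4)]) (use Cons.prems(2) in auto)
  then show ?case using S' Cons.prems(5,6) unfolding xy by blast
qed simp

section \<open>Simultaneous induction for cell decomposition and uniform finiteness\<close>

definition "decomp n \<A> \<C> \<longleftrightarrow> finite \<C> \<and> disjoint \<C> \<and> \<Union>\<C> = pow n \<and> (\<forall>C\<in>\<C>. cellp n C) \<and>
   (\<forall>A\<in>\<A>. \<forall>C\<in>\<C>. C \<subseteq> A \<or> C \<inter> A = {})"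
text \<open>\<open>decomposable n\<close> yields \<open>piecewise n\<close> and
  \<open>unif_fin n\<close>, cells with empty interior being handled by the same statement for one
  variable less; these two yield \<open>decomposable (Suc n)\<close>.\<close>

definition "decomposable n \<longleftrightarrow> (\<forall>\<A>. finite \<A> \<and> (\<forall>A\<in>\<A>. D n A) --> (\<exists>\<C>. decomp n \<A> \<C>))"
definition "piecewise n \<longleftrightarrow> (\<forall>\<A> \<F>. finite \<A> \<and> (\<forall>A\<in>\<A>. D n A) \<and> finite \<F> \<and> (\<forall>f\<in>\<F>. B.df n f) -->
   (\<exists>\<C>. decomp n \<A> \<C> \<and> (\<forall>C\<in>\<C>. \<forall>f\<in>\<F>. CpX n C f)))"
definition "unif_fin n \<longleftrightarrow> (\<forall>Q. B.dp (Suc n) (\<lambda>z. Q (take n z) (z ! n)) \<and> (\<forall>x. length x = n --> finite {y. Q x y}) -->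
   (\<exists>N. \<forall>x. length x = n --> card {y. Q x y} \<le> N))"

text \<open>An open cell contains a box, so a generic condition that is decided on the cell cannot
  be false there.\<close>

lemma gen_open_cell:
  assumes "M.gen n P" "rel_cell PD 0 {[]} bs C" "length bs = n" "set bs \<subseteq> {True}"
    "C \<subseteq> {x. length x = n \<and> P x} \<or> C \<inter> {x. length x = n \<and> P x} = {}"
  shows "C \<subseteq> {x. length x = n \<and> P x}"
proof (rule ccontr)
  assume "\<not> ?thesis"
  then have e: "C \<inter> {x. length x = n \<and> P x} = {}" using assms(5) by blast
  have "C \<noteq> {}" using cellp_nonempty[of n C] assms(2,3) unfolding cellp_def by blast
  then obtain x where x: "x \<in> C" by blast
  have lC: "length y = n" if "y \<in> C" for y using rel_cell_length[OF assms(2) _ that] assms(3) by simp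
  obtain d where "0 < d" "\<And>y. near d x y ==> y \<in> C" using open_cell_interior[OF assms(2,4) x] by blast
  then have "fat n (\<lambda>x. \<not> P x)" using e lC x by (intro fatI[of x n d]) auto
  then show False using assms(1) unfolding M.gen_def by blast
qed

text \<open>On open cells compatible with \<open>good\<close> the size of the fibres is locally
  constant, hence constant by connectedness; on the other cells a coordinate is dropped, and the
  uniform bound for one variable less applies.\<close>

lemma unif_fin_step:
  assumes I: "decomposable n" and U: "\<And>m. n = Suc m ==> unif_fin m"
  shows "unif_fin n"
  unfolding unif_fin_def
proof (intro allI impI, elim conjE)
  fix Q assume Q: "B.dp (Suc n) (\<lambda>z. Q (take n z) (z ! n))" and fin: "\<forall>x. length x = n --> finite {y. Q x y}"
  define G where "G = {x. length x = n \<and> good Q x}"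
  have "D n G" unfolding G_def by (rule B.D_Collect[OF B.dp_good[OF Q]])
  then obtain \<C> where C: "decomp n {G} \<C>" using I unfolding decomposable_def by (metis finite.emptyI finite_insert singletonD)
  have "\<exists>N. \<forall>x\<in>C. card {y. Q x y} \<le> N" if CC: "C \<in> \<C>" for C
  proof -
    obtain bs where bs: "length bs = n" "rel_cell PD 0 {[]} bs C" using C CC unfolding decomp_def cellp_def by blast
    have lC: "length y = n" if "y \<in> C" for y using rel_cell_length[OF bs(2) _ that] bs(1) by simp
    show ?thesis
    proof (cases "False \<in> set bs")
      case False
      have T: "set bs \<subseteq> {True}"
      proof
        fix b assume "b \<in> set bs"
        then have "b \<noteq> False" using False by metis
        then show "b \<in> {True}" by simp
      qed
      have "C \<subseteq> G" unfolding G_def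
        by (rule gen_open_cell[OF M.gen_good[OF dp_sub[OF Q]] bs(2,1) T]) (use fin C CC in \<open>auto simp: decomp_def G_def\<close>)
      obtain x0 where x0: "x0 \<in> C" using cellp_nonempty[of n C] bs unfolding cellp_def by blast
      have "card {y. Q x y} = card {y. Q x0 y}" if x: "x \<in> C" for x
      proof -
        have "card {y. Q x0 y} = card {y. Q x0 y} \<longleftrightarrow> card {y. Q x y} = card {y. Q x0 y}"
        proof (rule open_cell_connected[OF bs(2) T _ _ x0 x])
          show "M.dp (length bs) (\<lambda>x. card {y. Q x y} = card {y. Q x0 y})"
            unfolding bs(1) by (rule M.dp_card_eq[OF dp_sub[OF Q]]) (simp add: fin)
          fix x assume "x \<in> C"
          then have "good Q x" "length x = n" using \<open>C \<subseteq> G\<close> unfolding G_def by auto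
          then have "\<exists>e>0. \<forall>x'. near e x x' --> card {y. Q x' y} = card {y. Q x y}"
            using M.good_locally_const[OF dp_sub[OF Q], of x] fin by simp
          then obtain e where "0 < e" "\<forall>x'. near e x x' --> card {y. Q x' y} = card {y. Q x y}" by blast
          then show "\<exists>e>0. \<forall>y\<in>C. near e x y --> (card {y. Q x y} = card {y. Q x0 y}) = (card {ya. Q y ya} = card {y. Q x0 y})"
          proof (intro exI[of _ e] conjI ballI impI)
            show "0 < e" by fact
            fix y assume "near e x y"
            then have "card {z. Q y z} = card {z. Q x z}" using \<open>\<forall>x'. near e x x' --> card {y. Q x' y} = card {y. Q x y}\<close> by blast
            then show "(card {y. Q x y} = card {y. Q x0 y}) = (card {ya. Q y ya} = card {y. Q x0 y})" by simp
          qed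
        qed
        then show ?thesis by simp
      qed
      then show ?thesis by (intro exI[of _ "card {y. Q x0 y}"]) auto
    next
      case True
      obtain m I h where h: "length bs = Suc m" "length I = m" "distinct I" "set I \<subseteq> {..<Suc m}" "B.dl m (Suc m) h" "\<And>x. x \<in> C ==> h (sel I x) = x"
        using nonopen_cell[OF bs(2) True] by blast
      have n: "n = Suc m" using h(1) bs(1) by simp
      define Q' where "Q' x y \<longleftrightarrow> h x \<in> C \<and> Q (h x) y" for x y
      have DC: "D n C" using D_cellp bs unfolding cellp_def by blast
      have h': "B.dl N n (\<lambda>z. h (l z))" if "B.dl N m l" for N l using B.dl_comp[OF h(5) that] n by simp
      have "B.dp (Suc m) (\<lambda>z. Q' (take m z) (z ! m))" unfolding Q'_def
        by (rule dintros B.dp_mem[OF DC] B.dp_rel[OF Q] h' | simp)+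
      moreover have "finite {y. Q' x y}" if "length x = m" for x
        using fin B.dl_length[OF h(5) that] n unfolding Q'_def by (cases "h x \<in> C") auto
      ultimately obtain N where N: "\<And>x. length x = m ==> card {y. Q' x y} \<le> N"
        using U[OF n] unfolding unif_fin_def by blast
      have "card {y. Q x y} \<le> N" if "x \<in> C" for x
        using N[of "sel I x"] h(2) h(6)[OF that] that unfolding Q'_def by simp
      then show ?thesis by blast
    qed
  qed
  then obtain N where N: "\<And>C x. C \<in> \<C> ==> x \<in> C ==> card {y. Q x y} \<le> N C" by metis
  have fC: "finite \<C>" and cov: "\<Union>\<C> = pow n" using C unfolding decomp_def by auto
  have "card {y. Q x y} \<le> Max (N ` \<C>)" if "length x = n" for x
  proof -
    have "x \<in> \<Union>\<C>" unfolding cov using that by simp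
    then obtain C where "C \<in> \<C>" "x \<in> C" by blast
    then show ?thesis using N[of C x] fC by (meson Max_ge finite_imageI imageI le_trans)
  qed
  then show "\<exists>N. \<forall>x. length x = n --> card {y. Q x y} \<le> N" by blast
qed

text \<open>On an open cell \<open>C^p\<close>-smoothness is generic and decided, hence it holds.
  The other cells are cut into pieces by a decomposition in one variable less for the functions
  \<open>f (h x)\<close>.\<close>

lemma piecewise_step:
  assumes I: "decomposable n" and U: "\<And>m. n = Suc m ==> piecewise m"
  shows "piecewise n"
  unfolding piecewise_def
proof (intro allI impI, elim conjE)
  fix \<A> \<F> assume A: "finite \<A>" "\<forall>A\<in>\<A>. D n A" and F: "finite \<F>" "\<forall>f\<in>\<F>. B.df n f"
  define G where "G f = {x. length x = n \<and> Gp n p f x}" for f :: "'a list => 'a"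
  have DG: "D n (G f)" if "f \<in> \<F>" for f
    unfolding G_def using F(2) that by (intro B.D_Collect B.dp_Gp) auto
  then have "finite (G ` \<F>) \<and> (\<forall>A\<in>G ` \<F>. D n A)" using F(1) by auto
  from I[unfolded decomposable_def, rule_format, OF this] obtain \<C> where C: "decomp n (G ` \<F>) \<C>" ..
  have "\<exists>\<P>. finite \<P> \<and> C \<subseteq> \<Union>\<P> \<and> (\<forall>P\<in>\<P>. D n P \<and> (\<forall>f\<in>\<F>. CpX n P f))" if CC: "C \<in> \<C>" for C
  proof -
    obtain bs where bs: "length bs = n" "rel_cell PD 0 {[]} bs C" using C CC unfolding decomp_def cellp_def by blast
    have lC: "length y = n" if "y \<in> C" for y using rel_cell_length[OF bs(2) _ that] bs(1) by simp
    have DC: "D n C" using D_cellp bs unfolding cellp_def by blast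
    show ?thesis
    proof (cases "False \<in> set bs")
      case False
      have T: "set bs \<subseteq> {True}"
      proof
        fix b assume "b \<in> set bs"
        then have "b \<noteq> False" using False by metis
        then show "b \<in> {True}" by simp
      qed
      have "CpX n C f" if f: "f \<in> \<F>" for f
      proof (rule CpX_Gp)
        show df: "M.df n f" using F(2) f df_sub by blast
        show "C \<subseteq> {x. length x = n \<and> Gp n p f x}"
          by (rule gen_open_cell[OF M.gen_Gp[OF df] bs(2,1) T]) (use C CC f in \<open>auto simp: decomp_def G_def\<close>)
      qed
      then show ?thesis using DC by (intro exI[of _ "{C}"]) auto
    next
      case True
      obtain m I h where h: "length bs = Suc m" "length I = m" "distinct I" "set I \<subseteq> {..<Suc m}" "B.dl m (Suc m) h" "\<And>x. x \<in> C ==> h (sel I x) = x"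
        using nonopen_cell[OF bs(2) True] by blast
      have n: "n = Suc m" using h(1) bs(1) by simp
      have "B.df m (\<lambda>x. f (h x))" if "f \<in> \<F>" for f
        by (rule B.df_comp[of n f]) (use F(2) that h(5) n in auto)
      then have "\<forall>f\<in>(\<lambda>f x. f (h x)) ` \<F>. B.df m f" by auto
      moreover have "finite ((\<lambda>f x. f (h x)) ` \<F>)" using F(1) by simp
      ultimately obtain \<E> where E0: "decomp m {} \<E>" "\<forall>E\<in>\<E>. \<forall>g\<in>(\<lambda>f x. f (h x)) ` \<F>. CpX m E g"
        using U[OF n, unfolded piecewise_def, rule_format, of "{}" "(\<lambda>f x. f (h x)) ` \<F>"] by blast
      then have E: "decomp m {} \<E>" "\<And>E f. E \<in> \<E> ==> f \<in> \<F> ==> CpX m E (\<lambda>x. f (h x))" by auto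
      define \<P> where "\<P> = (\<lambda>E. {x \<in> C. sel I x \<in> E}) ` \<E>"
      have "finite \<P>" unfolding \<P>_def using E(1) unfolding decomp_def by simp
      moreover have "C \<subseteq> \<Union>\<P>"
      proof
        fix x assume x: "x \<in> C"
        have "sel I x \<in> \<Union>\<E>" using E(1) h(2) unfolding decomp_def by simp
        then show "x \<in> \<Union>\<P>" unfolding \<P>_def using x by auto
      qed
      moreover have "D n P \<and> (\<forall>f\<in>\<F>. CpX n P f)" if PP: "P \<in> \<P>" for P
      proof -
        obtain E' where E': "P = {x \<in> C. sel I x \<in> E'}" "E' \<in> \<E>" using PP unfolding \<P>_def by blast
        have "D m E'" using E(1) E'(2) D_cellp unfolding decomp_def by blast
        have "B.dp n (\<lambda>x. x \<in> C \<and> sel I x \<in> E')"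
          by (rule dintros B.dp_mem[OF DC] B.dp_mem[OF \<open>D m E'\<close>] | simp add: h n)+
        moreover have "P \<subseteq> pow n" "(\<lambda>x. x \<in> P) = (\<lambda>x. x \<in> C \<and> sel I x \<in> E')" using E'(1) lC by auto
        ultimately have "D n P" using B.D_eq_dp[of P n] by simp
        moreover have "CpX n P f" if f: "f \<in> \<F>" for f
        proof (rule CpX_cong)
          show "CpX n P (\<lambda>x. f (h (sel I x)))"
            by (rule CpX_sel[OF E(2)[OF E'(2) f] h(3,2)]) (use h(4) n E'(1) lC in auto)
        qed (use h(6) E'(1) in auto)
        ultimately show ?thesis by blast
      qed
      ultimately show ?thesis by blast
    qed
  qed
  then have "\<forall>C\<in>\<C>. \<exists>\<P>. finite \<P> \<and> C \<subseteq> \<Union>\<P> \<and> (\<forall>P\<in>\<P>. D n P \<and> (\<forall>f\<in>\<F>. CpX n P f))" by blast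
  from bchoice[OF this] obtain \<P> where P: "\<forall>C\<in>\<C>. finite (\<P> C) \<and> C \<subseteq> \<Union>(\<P> C) \<and> (\<forall>P\<in>\<P> C. D n P \<and> (\<forall>f\<in>\<F>. CpX n P f))"
    by (elim exE)
  have "finite \<C>" using C unfolding decomp_def by blast
  then have "finite (\<Union>(\<P> ` \<C>))" by (rule finite_UN_I) (use P in blast)
  then have "finite (\<A> \<union> \<Union>(\<P> ` \<C>))" using A(1) by simp
  moreover have "\<forall>A\<in>\<A> \<union> \<Union>(\<P> ` \<C>). D n A"
  proof
    fix Y assume "Y \<in> \<A> \<union> \<Union>(\<P> ` \<C>)"
    then consider "Y \<in> \<A>" | C where "C \<in> \<C>" "Y \<in> \<P> C" by blast
    then show "D n Y"
    proof cases
      case 1 then show ?thesis using A(2) by blast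
    next
      case 2 then show ?thesis using bspec[OF P 2(1)] by blast
    qed
  qed
  \<comment> \<open>The pieces are definable but need not be cells; a second decomposition,
    compatible with all of them, repairs this.\<close>
  ultimately have "\<exists>\<D>. decomp n (\<A> \<union> \<Union>(\<P> ` \<C>)) \<D>"
    using I[unfolded decomposable_def, rule_format, of "\<A> \<union> \<Union>(\<P> ` \<C>)"] by simp
  then obtain \<D> where D: "decomp n (\<A> \<union> \<Union>(\<P> ` \<C>)) \<D>" ..
  have "decomp n \<A> \<D>" using D unfolding decomp_def by simp
  moreover have "CpX n E f" if EE: "E \<in> \<D>" and ff: "f \<in> \<F>" for E f
  proof -
    have "cellp n E" using D EE unfolding decomp_def by simp
    then obtain x where x: "x \<in> E" using cellp_nonempty by blast
    then have "x \<in> \<Union>\<D>" using EE by blast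
    then have "x \<in> \<Union>\<C>" using D C unfolding decomp_def by simp
    then obtain C where CC: "C \<in> \<C>" "x \<in> C" by blast
    note PC = bspec[OF P CC(1)]
    have "C \<subseteq> \<Union>(\<P> C)" using PC by blast
    then obtain P' where CP: "P' \<in> \<P> C" "x \<in> P'" using CC(2) by blast
    then have "E \<subseteq> P' \<or> E \<inter> P' = {}" using D EE CC(1) unfolding decomp_def by (meson UN_I UnI2)
    then have "E \<subseteq> P'" using x CP(2) by blast
    moreover have "CpX n P' f" using PC CP(1) ff by blast
    ultimately show ?thesis using CpX_mono by blast
  qed
  ultimately show "\<exists>\<C>. decomp n \<A> \<C> \<and> (\<forall>C\<in>\<C>. \<forall>f\<in>\<F>. CpX n C f)" by (intro exI[of _ \<D>] conjI ballI)
qed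

end

context omin_pair
begin

text \<open>The boundary points of the fibres over x. Between consecutive ones membership in each of
  the sets is constant.\<close>

definition "bd \<A> x y \<longleftrightarrow> (\<exists>A\<in>\<A>. \<forall>\<epsilon>>0. (\<exists>t. \<bar>t - y\<bar> < \<epsilon> \<and> x @ [t] \<in> A) \<and> (\<exists>t. \<bar>t - y\<bar> < \<epsilon> \<and> \<not> x @ [t] \<in> (A::'a list set)))"

lemma dp_bd:
  assumes "finite \<A>" "\<And>A. A \<in> \<A> ==> D (Suc n) A"
  shows "B.dp (Suc n) (\<lambda>z. bd \<A> (take n z) (z ! n))"
  unfolding bd_def by (rule B.dp_finite_Bex assms | assumption | rule dintros B.dp_mem assms | simp)+

text \<open>Infinitely many boundary points would fill an interval, whereas membership is constant
  just to the right of any point.\<close>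

lemma finite_bd:
  assumes A: "finite \<A>" "\<And>A. A \<in> \<A> ==> D (Suc n) A" and x: "length x = n"
  shows "finite {y. bd \<A> x y}"
proof -
  have "finite {y. bd {A} x y}" if AA: "A \<in> \<A>" for A
  proof (rule ccontr)
    assume inf: "infinite {y. bd {A} x y}"
    have "M.dp (Suc n) (\<lambda>z. bd {A} (take n z) (z ! n))" by (rule dp_sub[OF dp_bd]) (use assms AA in auto)
    from M.d1_rel[OF this x] M.infinite_interval inf
    obtain a b where ab: "a < b" "\<And>t. a < t ==> t < b ==> bd {A} x t" by blast
    have "M.dp (Suc n) (\<lambda>z. take n z @ [z ! n] \<in> A)"
      by (rule dintros M.dp_mem[OF sub[OF A(2)[OF AA]]] | simp)+
    from M.d1_rel[where Q = "\<lambda>x t. x @ [t] \<in> A", OF this x] M.germ_right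
    obtain e where e: "e > 0" "(\<forall>t. a < t \<and> t < a + e --> x @ [t] \<in> A) \<or> (\<forall>t. a < t \<and> t < a + e --> x @ [t] \<notin> A)" by blast
    obtain y where y: "a < y" "y < min b (a + e)" using dense[of a "min b (a + e)"] ab(1) e(1) by auto
    define d where "d = min (y - a) (a + e - y)"
    have d: "d > 0" unfolding d_def using y by simp
    have near: "a < t \<and> t < a + e" if "\<bar>t - y\<bar> < d" for t using that unfolding d_def by (auto simp: abs_if split: if_splits)
    have "bd {A} x y" using ab(2) y by simp
    then show False using d e(2) near unfolding bd_def by blast
  qed
  moreover have "{y. bd \<A> x y} = (\<Union>A\<in>\<A>. {y. bd {A} x y})" unfolding bd_def by auto
  ultimately show ?thesis using A(1) by simp
qed

lemma not_bd: "\<not> bd \<A> x y ==> A \<in> \<A> ==> \<exists>e>0. \<forall>u. \<bar>u - y\<bar> < e --> (x @ [u] \<in> A \<longleftrightarrow> x @ [y] \<in> A)"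
proof -
  assume "\<not> bd \<A> x y" "A \<in> \<A>"
  then obtain e where e: "0 < e" "(\<forall>t. \<bar>t - y\<bar> < e --> x @ [t] \<notin> A) \<or> (\<forall>t. \<bar>t - y\<bar> < e --> x @ [t] \<in> A)" unfolding bd_def by blast
  have "\<bar>y - y\<bar> < e" using e(1) by simp
  then show ?thesis using e by (intro exI[of _ e]) blast
qed

text \<open>The sorted boundary points of the fibres are given by finitely many functions, by
  uniform finiteness. Over the cells of a decomposition of M^n on which their number is constant and
  they are smooth, their graphs and the bands between them are the new cells.\<close>

lemma decomposable_Suc:
  assumes P: "piecewise n" and U: "unif_fin n"
  shows "decomposable (Suc n)"
  unfolding decomposable_def
proof (intro allI impI, elim conjE)
  fix \<A> assume A: "finite \<A>" "\<forall>A\<in>\<A>. D (Suc n) A"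
  define S where "S x = {y. bd \<A> x y}" for x
  have dQ: "B.dp (Suc n) (\<lambda>z. bd \<A> (take n z) (z ! n))" by (rule dp_bd) (use A in auto)
  have dQS: "B.dp (Suc n) (\<lambda>z. z ! n \<in> S (take n z))" using dQ unfolding S_def by simp
  have fin: "finite (S x)" if "length x = n" for x unfolding S_def by (rule finite_bd[OF A(1) _ that]) (use A in auto)
  obtain N where N: "\<And>x. length x = n ==> card (S x) \<le> N"
    using U dQ fin unfolding unif_fin_def S_def by blast
  define rk where "rk x y = rank_in (S x) y" for x y
  have drk: "B.dp (Suc n) (\<lambda>z. rk (take n z) (z ! n) = j)" for j
  proof -
    have "B.dp (Suc (Suc n)) (\<lambda>z. z ! Suc n \<in> S (take n z) \<and> z ! Suc n < z ! n)"
      by (rule dintros B.dp_rel[OF dQS, of _ "take n"] | simp)+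
    then have "B.dp (Suc (Suc n)) (\<lambda>z. z ! Suc n \<in> S (take n (take (Suc n) z)) \<and> z ! Suc n < take (Suc n) z ! n)"
      by (simp add: min_def)
    from B.dp_card_eq[OF this] fin show ?thesis unfolding rk_def rank_in_def by simp
  qed
  \<comment> \<open>The boundary point of rank \<open>j\<close>; counting the smaller ones makes it
    definable. The value is 0 where there is none.\<close>
  define f where "f j x = the1 (\<lambda>y. y \<in> S x \<and> rk x y = j)" for j x
  have df: "B.df n (f j)" for j unfolding f_def
    by (rule dintros B.dp_rel[OF dQS] B.dp_rel[OF drk] | simp)+
  have f: "f j x \<in> S x \<and> rk x (f j x) = j" if x: "length x = n" "j < card (S x)" for j x
  proof -
    have bij: "bij_betw (rk x) (S x) {..<card (S x)}" unfolding rk_def by (rule rank_in_bij[OF fin[OF x(1)]])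
    then obtain y where y: "y \<in> S x" "rk x y = j" using x(2) unfolding bij_betw_def by (metis imageE lessThan_iff)
    have "f j x = y" unfolding f_def using y bij unfolding bij_betw_def by (intro the1_eq) (auto dest: inj_onD)
    then show ?thesis using y by simp
  qed
  have f_eq: "y = f j x \<longleftrightarrow> y \<in> S x \<and> rk x y = j" if x: "length x = n" "j < card (S x)" for j x y
  proof
    show "y = f j x ==> y \<in> S x \<and> rk x y = j" using f[OF x] by simp
    assume "y \<in> S x \<and> rk x y = j"
    then show "y = f j x" using f[OF x] rank_in_bij[OF fin[OF x(1)]] unfolding rk_def bij_betw_def by (auto dest: inj_onD)
  qed
  have f_less: "f i x < y \<longleftrightarrow> i < rk x y" if x: "length x = n" "i < card (S x)" for i x y
    using f[OF x] rank_in_less[OF fin[OF x(1)], of "f i x" y] unfolding rk_def by auto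
  have rk_le: "rk x y \<le> card (S x)" if "length x = n" for x y unfolding rk_def by (rule rank_in_le_card[OF fin[OF that]])
  have rk_S: "rk x y < card (S x)" if "length x = n" "y \<in> S x" for x y
    using rank_in_bij[OF fin[OF that(1)]] that(2) unfolding rk_def bij_betw_def by auto
  \<comment> \<open>Band \<open>j\<close> runs from boundary point \<open>j - 1\<close> to boundary
    point \<open>j\<close>; \<open>c\<close> is the number of boundary points, so that band 0 is
    unbounded below and band \<open>c\<close> above.\<close>
  define lo where "lo j = (if j = 0 then None else Some (f (j - 1)))" for j :: nat
  define hi where "hi c j = (if j = c then None else Some (f j))" for c j :: nat
  have band: "in_band (lo j) (hi (card (S x)) j) x y \<longleftrightarrow> y \<notin> S x \<and> rk x y = j" if x: "length x = n" "j \<le> card (S x)" for j x y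
  proof -
    have "in_band (lo j) (hi (card (S x)) j) x y \<longleftrightarrow> (0 < j --> f (j - 1) x < y) \<and> (j < card (S x) --> y < f j x)"
      unfolding in_band_def lo_def hi_def using x(2) by auto
    also have "(0 < j --> f (j - 1) x < y) \<longleftrightarrow> j \<le> rk x y" using f_less[OF x(1), of "j - 1" y] x(2) by (cases j) auto
    also have "(j < card (S x) --> y < f j x) \<longleftrightarrow> (j < card (S x) --> rk x y \<le> j \<and> y \<noteq> f j x)"
      using f_less[OF x(1), of j y] by (auto simp: not_less_iff_gr_or_eq not_less)
    also have "j \<le> rk x y \<and> (j < card (S x) --> rk x y \<le> j \<and> y \<noteq> f j x) \<longleftrightarrow> y \<notin> S x \<and> rk x y = j"
      using rk_le[OF x(1), of y] rk_S[OF x(1), of y] f_eq[OF x(1), of j y] x(2) by (cases "j < card (S x)") auto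
    finally show ?thesis .
  qed
  \<comment> \<open>A definable sample point of band \<open>j\<close>: as the band contains no
    boundary points, the sample decides membership for the whole fibre of the band over
    \<open>x\<close>.\<close>
  define mid where "mid c j x = (if c = 0 then 0 else if j = 0 then f 0 x - 1 else if j = c then f (c - 1) x + 1
     else (f (j - 1) x + f j x) / 2)" for c j :: nat and x
  have mid: "in_band (lo j) (hi (card (S x)) j) x (mid (card (S x)) j x)" if x: "length x = n" "j \<le> card (S x)" for j x
  proof -
    have "f (j - 1) x < f j x" if "0 < j" "j < card (S x)"
      using f_less[OF x(1), of "j - 1" "f j x"] f[OF x(1) that(2)] that by simp
    then show ?thesis unfolding in_band_def lo_def hi_def mid_def using x(2) by (auto simp: field_simps)
  qed
  have dmid: "B.df n (mid c j)" for c j unfolding mid_def by (rule dintros df | simp)+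
  \<comment> \<open>On cells compatible with \<open>XX\<close> the number of boundary points is
    fixed; compatibility with \<open>YY\<close> and \<open>ZZ\<close> decides whether the graphs and
    the sample points belong to the given sets.\<close>
  define XX where "XX = (\<lambda>c. {x. length x = n \<and> card (S x) = c}) ` {..N}"
  define YY where "YY = (\<lambda>(j, A). {x. length x = n \<and> x @ [f j x] \<in> A}) ` ({..N} \<times> \<A>)"
  define ZZ where "ZZ = (\<lambda>(c, j, A). {x. length x = n \<and> x @ [mid c j x] \<in> A}) ` ({..N} \<times> {..N} \<times> \<A>)"
  have "finite (XX \<union> YY \<union> ZZ)" unfolding XX_def YY_def ZZ_def using A(1) by simp
  moreover have "D n Z" if "Z \<in> XX \<union> YY \<union> ZZ" for Z
  proof -
    have "D n {x. length x = n \<and> card (S x) = c}" for c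
      using B.D_Collect[OF B.dp_card_eq[OF dQ]] fin unfolding S_def by blast
    moreover have "D n {x. length x = n \<and> x @ [g x] \<in> A}" if "A \<in> \<A>" "B.df n g" for g A
      by (rule B.D_Collect, rule B.dp_mem[of "Suc n" A]) (use A that in \<open>auto intro!: B.dl_append[OF B.dl_id B.dl_single]\<close>)
    ultimately show ?thesis using that df dmid unfolding XX_def YY_def ZZ_def by auto
  qed
  moreover have "finite (f ` {..N})" "\<forall>g\<in>f ` {..N}. B.df n g" using df by auto
  ultimately have "\<exists>\<C>. decomp n (XX \<union> YY \<union> ZZ) \<C> \<and> (\<forall>C\<in>\<C>. \<forall>g\<in>f ` {..N}. CpX n C g)"
    using P[unfolded piecewise_def, rule_format, of "XX \<union> YY \<union> ZZ" "f ` {..N}"] by simp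
  then obtain \<C> where C: "decomp n (XX \<union> YY \<union> ZZ) \<C>" "\<forall>C\<in>\<C>. \<forall>g\<in>f ` {..N}. CpX n C g" by blast
  have Cd: "finite \<C>" "disjoint \<C>" "\<Union>\<C> = pow n" "\<And>C. C \<in> \<C> ==> cellp n C"
    "\<And>A C. A \<in> XX \<union> YY \<union> ZZ ==> C \<in> \<C> ==> C \<subseteq> A \<or> C \<inter> A = {}"
    using C(1) unfolding decomp_def by meson+
  have Cn: "length x = n" if "C \<in> \<C>" "x \<in> C" for C x
  proof -
    have "x \<in> \<Union>\<C>" using that by blast
    then show ?thesis using Cd(3) by simp
  qed
  have cC: "\<exists>c\<le>N. \<forall>x\<in>C. card (S x) = c" if CC: "C \<in> \<C>" for C
  proof -
    obtain x where x: "x \<in> C" using cellp_nonempty[OF Cd(4)[OF CC]] by blast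
    let ?Z = "{y. length y = n \<and> card (S y) = card (S x)}"
    have le: "card (S x) \<le> N" using N Cn[OF CC x] by blast
    then have "?Z \<in> XX" unfolding XX_def by auto
    then have "C \<subseteq> ?Z \<or> C \<inter> ?Z = {}" using Cd(5)[OF _ CC, of ?Z] by simp
    then have "C \<subseteq> ?Z" using x Cn[OF CC x] by blast
    then show ?thesis using le by blast
  qed
  define piece where "piece C j b = {z. length z = Suc n \<and> take n z \<in> C \<and> (z ! n \<in> S (take n z) \<longleftrightarrow> b) \<and> rk (take n z) (z ! n) = j}" for C j b
  \<comment> \<open>For ranks beyond the number of boundary points over \<open>C\<close> the pieces
    are empty, so empty sets are removed.\<close>
  define \<D> where "\<D> = (\<lambda>(C, j, b). piece C j b) ` (\<C> \<times> {..N} \<times> UNIV) - {{}}"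
  have cellpiece: "cellp (Suc n) (piece C j b) \<and> (\<forall>A\<in>\<A>. piece C j b \<subseteq> A \<or> piece C j b \<inter> A = {})"
    if CC: "C \<in> \<C>" and ne: "piece C j b \<noteq> {}" for C j b
  proof -
    obtain c where c: "c \<le> N" "\<And>x. x \<in> C ==> card (S x) = c" using cC[OF CC] by blast
    obtain z where z: "z \<in> piece C j b" using ne by blast
    then have z': "take n z \<in> C" "z ! n \<in> S (take n z) \<longleftrightarrow> b" "rk (take n z) (z ! n) = j" unfolding piece_def by auto
    have lz: "length (take n z) = n" using Cn[OF CC z'(1)] .
    have jb: "j \<le> c" "b ==> j < c" using rk_le[OF lz, of "z ! n"] rk_S[OF lz, of "z ! n"] z' c(2)[OF z'(1)] by auto
    have sC: "C \<subseteq> pow n" using Cn[OF CC] by auto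
    obtain bs where bs: "length bs = n" "rel_cell PD 0 {[]} bs C" using Cd(4)[OF CC] unfolding cellp_def by blast
    have PDf: "PD n C (f i)" if "i \<le> N" for i unfolding PD_def using df C(2) CC that by auto
    show ?thesis
    proof (cases b)
      case True
      have eq: "piece C j b = graph_over C (f j)"
      proof (rule Set.set_eqI)
        fix w
        have "w ! n = f j (take n w) \<longleftrightarrow> w ! n \<in> S (take n w) \<and> rk (take n w) (w ! n) = j" if "take n w \<in> C"
          by (rule f_eq) (use Cn[OF CC that] c(2)[OF that] jb(2) True in auto)
        then show "w \<in> piece C j b \<longleftrightarrow> w \<in> graph_over C (f j)"
          unfolding graph_over_iff[OF sC] piece_def using True by auto
      qed
      have "cell_over PD n False C (graph_over C (f j))" unfolding cell_over_def if_False
        by (intro exI[of _ "f j"] conjI PDf refl) (use jb True c(1) in simp)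
      then have "rel_cell PD 0 {[]} (False # bs) (piece C j b)" unfolding eq using bs by auto
      then have "cellp (Suc n) (piece C j b)" unfolding cellp_def using bs(1) by (intro exI[of _ "False # bs"]) simp
      moreover have "piece C j b \<subseteq> A \<or> piece C j b \<inter> A = {}" if "A \<in> \<A>" for A
      proof -
        have "{x. length x = n \<and> x @ [f j x] \<in> A} \<in> YY" unfolding YY_def using that jb(1) c(1) by auto
        then have "C \<subseteq> {x. length x = n \<and> x @ [f j x] \<in> A} \<or> C \<inter> {x. length x = n \<and> x @ [f j x] \<in> A} = {}"
          using Cd(5)[OF _ CC, of "{x. length x = n \<and> x @ [f j x] \<in> A}"] by simp
        then show ?thesis unfolding eq graph_over_def using Cn[OF CC] by auto
      qed
      ultimately show ?thesis by blast
    next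
      case False
      have ib: "in_band (lo j) (hi c j) x y \<longleftrightarrow> y \<notin> S x \<and> rk x y = j" if "x \<in> C" for x y
        using band[of x j y] Cn[OF CC that] c(2)[OF that] jb(1) by simp
      have eq: "piece C j b = band_over C (lo j) (hi c j)"
        by (rule Set.set_eqI) (use ib False in \<open>auto simp: band_over_iff[OF sC] piece_def\<close>)
      have "cell_over PD n True C (band_over C (lo j) (hi c j))" unfolding cell_over_def if_True
      proof (rule exI[of _ "lo j"], rule exI[of _ "hi c j"], intro conjI allI impI)
        show "PD n C g" if "lo j = Some g" for g using that PDf jb c(1) unfolding lo_def by (auto split: if_splits)
        show "PD n C g" if "hi c j = Some g" for g using that PDf jb c(1) unfolding hi_def by (auto split: if_splits)
        show "g x < h x" if "lo j = Some g \<and> hi c j = Some h \<and> x \<in> C" for g h x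
        proof -
          have x: "x \<in> C" "length x = n" "card (S x) = c" using that Cn[OF CC] c(2) by auto
          have g: "0 < j" "j < c" "g = f (j - 1)" "h = f j" using that jb unfolding lo_def hi_def by (auto split: if_splits)
          then show ?thesis using f_less[OF x(2), of "j - 1" "f j x"] f[OF x(2), of j] x(3) by simp
        qed
      qed simp
      then have "rel_cell PD 0 {[]} (True # bs) (piece C j b)" unfolding eq using bs by auto
      then have "cellp (Suc n) (piece C j b)" unfolding cellp_def using bs(1) by (intro exI[of _ "True # bs"]) simp
      moreover have "piece C j b \<subseteq> A \<or> piece C j b \<inter> A = {}" if AA: "A \<in> \<A>" for A
      proof -
        have DA: "D (Suc n) A" using A AA by blast
        have same: "x @ [s] \<in> A \<longleftrightarrow> x @ [t] \<in> A" if x: "x \<in> C" and st: "in_band (lo j) (hi c j) x s" "in_band (lo j) (hi c j) x t" for x s t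
        proof -
          have lx: "length x = n" using Cn[OF CC x] .
          have d: "M.d1 (\<lambda>u. x @ [u] \<in> A)" unfolding M.d1_def
            by (rule M.dp_mem[OF sub[OF DA]] dintros lx | simp add: lx)+
          have *: "x @ [s] \<in> A \<longleftrightarrow> x @ [t] \<in> A" if st: "in_band (lo j) (hi c j) x s" "in_band (lo j) (hi c j) x t" "s \<le> t" for s t
          proof (rule M.interval_connected[OF d st(3)])
            fix u assume u: "s \<le> u" "u \<le> t"
            have "in_band (lo j) (hi c j) x u"
              unfolding in_band_def by (intro conjI allI impI) (use u st in \<open>force simp: in_band_def\<close>)+
            then have "u \<notin> S x" using ib[OF x] by blast
            then show "\<exists>e>0. \<forall>v. \<bar>v - u\<bar> < e --> (x @ [v] \<in> A) = (x @ [u] \<in> A)" using not_bd AA unfolding S_def by blast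
          qed
          show ?thesis using *[OF st] *[OF st(2,1)] by (metis linear)
        qed
        have "{x. length x = n \<and> x @ [mid c j x] \<in> A} \<in> ZZ" unfolding ZZ_def using AA jb(1) c(1)
          by (intro image_eqI[of _ _ "(c, j, A)"]) auto
        then have "C \<subseteq> {x. length x = n \<and> x @ [mid c j x] \<in> A} \<or> C \<inter> {x. length x = n \<and> x @ [mid c j x] \<in> A} = {}"
          using Cd(5)[OF _ CC, of "{x. length x = n \<and> x @ [mid c j x] \<in> A}"] by simp
        moreover have "x @ [y] \<in> A \<longleftrightarrow> x @ [mid c j x] \<in> A" if "x \<in> C" "in_band (lo j) (hi c j) x y" for x y
          by (rule same[OF that]) (use mid[of x j] Cn[OF CC that(1)] c(2)[OF that(1)] jb(1) in simp)
        ultimately show ?thesis unfolding eq band_over_def using Cn[OF CC] by auto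
      qed
      ultimately show ?thesis by blast
    qed
  qed
  have "decomp (Suc n) \<A> \<D>" unfolding decomp_def
  proof (intro conjI ballI)
    show "finite \<D>" unfolding \<D>_def using Cd(1) by auto
    show "disjoint \<D>"
    proof (rule disjointI)
      fix E1 E2 assume "E1 \<in> \<D>" "E2 \<in> \<D>" "E1 \<noteq> E2"
      obtain C1 j1 b1 where E1: "E1 = piece C1 j1 b1" "C1 \<in> \<C>" using \<open>E1 \<in> \<D>\<close> unfolding \<D>_def by auto
      obtain C2 j2 b2 where E2: "E2 = piece C2 j2 b2" "C2 \<in> \<C>" using \<open>E2 \<in> \<D>\<close> unfolding \<D>_def by auto
      note E = E1(1) E2(1) E1(2) E2(2)
      show "E1 \<inter> E2 = {}"
      proof (rule ccontr)
        assume "E1 \<inter> E2 \<noteq> {}"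
        then obtain z where "z \<in> E1" "z \<in> E2" by blast
        then have "j1 = j2" "b1 = b2" "take n z \<in> C1 \<inter> C2" unfolding E piece_def by auto
        moreover have "C1 = C2" using \<open>take n z \<in> C1 \<inter> C2\<close> disjointD[OF Cd(2) E(3,4)] by blast
        ultimately show False using E \<open>E1 \<noteq> E2\<close> by simp
      qed
    qed
    show "\<Union>\<D> = pow (Suc n)"
    proof (intro equalityI subsetI)
      fix z assume "z \<in> \<Union>\<D>" then show "z \<in> pow (Suc n)" unfolding \<D>_def piece_def by auto
    next
      fix z :: "'a list" assume z: "z \<in> pow (Suc n)"
      then have "take n z \<in> \<Union>\<C>" using Cd(3) by simp
      then obtain C' where C': "C' \<in> \<C>" "take n z \<in> C'" by blast
      have "rk (take n z) (z ! n) \<le> N" using rk_le[of "take n z" "z ! n"] N[of "take n z"] z by simp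
      moreover have "z \<in> piece C' (rk (take n z) (z ! n)) (z ! n \<in> S (take n z))" using z C' unfolding piece_def by simp
      ultimately show "z \<in> \<Union>\<D>" unfolding \<D>_def using C'(1)
        by (intro UnionI[of "piece C' (rk (take n z) (z ! n)) (z ! n \<in> S (take n z))"]) (auto intro!: image_eqI[of _ _ "(C', rk (take n z) (z ! n), z ! n \<in> S (take n z))"])
    qed
    fix E assume "E \<in> \<D>" then show "cellp (Suc n) E" using cellpiece unfolding \<D>_def by auto
  next
    fix A E assume AE: "A \<in> \<A>" "E \<in> \<D>"
    obtain C' j b where E: "E = piece C' j b" "C' \<in> \<C>" "piece C' j b \<noteq> {}" using AE(2) unfolding \<D>_def by auto
    show "E \<subseteq> A \<or> E \<inter> A = {}" using bspec[OF conjunct2[OF cellpiece[OF E(2,3)]] AE(1)] unfolding E(1) .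
  qed
  then show "\<exists>\<C>. decomp (Suc n) \<A> \<C>" by blast
qed

theorem cell_decomposition: "piecewise n"
proof -
  have "decomposable n \<and> piecewise n \<and> unif_fin n"
  proof (induction n)
    case 0
    have "decomp 0 \<A> {{[]}}" for \<A>
    proof -
      have "cellp 0 {[]}" unfolding cellp_def by simp
      moreover have "pow 0 = {[]}" by auto
      ultimately show ?thesis unfolding decomp_def by auto
    qed
    then have "decomposable 0" unfolding decomposable_def by blast
    then show ?case using piecewise_step[of 0] unif_fin_step[of 0] by simp
  next
    case (Suc n)
    then have "decomposable (Suc n)" using decomposable_Suc by blast
    then show ?case using piecewise_step[of "Suc n"] unif_fin_step[of "Suc n"] Suc by simp
  qed
  then show ?thesis by blast
qed

end

section \<open>Jet coordinates\<close>

text \<open>The pair (variable, order of derivative) at each position of a jet, so that passing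
  between jet spaces becomes a selection from this list.\<close>

definition coords :: "nat list => (nat \<times> nat) list" where
  "coords ns = concat (map (\<lambda>i. map (Pair i) [0..<Suc (ns ! i)]) [0..<length ns])"

abbreviation tot :: "nat list => nat" where "tot ns \<equiv> sum_list (map Suc ns)"

definition jl :: "('a => 'a) => nat => 'a => 'a list" where
  "jl \<delta> m a = map (\<lambda>j. (\<delta> ^^ j) a) [0..<m]"

definition idx :: "nat list => (nat \<times> nat) list => nat list" where
  "idx ns cs = map (\<lambda>(i, j). jet_index ns i j) cs"

definition jcut :: "nat list => nat list => nat list" where "jcut ns ns' = idx ns' (coords ns)"

text \<open>The derivative of the coordinate (i, j) is the coordinate (i, j + 1) of the jet space in
  which all orders are raised by one.\<close>

definition jdcut :: "nat list => nat list" where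
  "jdcut ns = idx (map Suc ns) (map (\<lambda>(i, j). (i, Suc j)) (coords ns))"

abbreviation le_ord :: "nat list => nat list => bool" where "le_ord \<equiv> list_all2 (\<le>)"

lemma length_jl [simp]: "length (jl \<delta> m a) = m"
  by (simp add: jl_def)

lemma coords_snoc: "coords (ns @ [N]) = coords ns @ map (Pair (length ns)) [0..<Suc N]"
proof -
  have 1: "map (\<lambda>i. map (Pair i) [0..<Suc ((ns @ [N]) ! i)]) [0..<length ns] = map (\<lambda>i. map (Pair i) [0..<Suc (ns ! i)]) [0..<length ns]"
    by (rule map_cong[OF refl]) (simp add: nth_append del: upt_Suc)
  have 2: "[0..<length (ns @ [N])] = [0..<length ns] @ [length ns]" by simp
  show ?thesis unfolding coords_def 2 map_append 1 by (simp del: upt_Suc)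
qed

lemma coords_Nil [simp]: "coords [] = []"
  by (simp add: coords_def)

lemma length_coords [simp]: "length (coords ns) = tot ns"
  by (induction ns rule: rev_induct) (simp_all add: coords_snoc del: upt_Suc)

lemma set_coords: "(i, j) \<in> set (coords ns) \<longleftrightarrow> i < length ns \<and> j \<le> ns ! i"
  unfolding coords_def by (auto simp: image_iff simp del: upt_Suc)

lemma jet_index_snoc: "i < length ns ==> jet_index (ns @ [N]) i j = jet_index ns i j"
  unfolding jet_index_def by (simp add: nth_append)

lemma jet_index_last: "jet_index (ns @ [N]) (length ns) j = tot ns + j"
proof -
  have "(\<Sum>l<length ns. Suc ((ns @ [N]) ! l)) = (\<Sum>l<length ns. Suc (ns ! l))" by (simp add: nth_append)
  also have "\<dots> = tot ns" by (simp add: sum_list_sum_nth atLeast0LessThan)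
  finally show ?thesis unfolding jet_index_def by simp
qed

lemma coords_jet_index:
  "i < length ns ==> j \<le> ns ! i ==> jet_index ns i j < tot ns \<and> coords ns ! jet_index ns i j = (i, j)"
proof (induction ns rule: rev_induct)
  case (snoc N ns)
  show ?case
  proof (cases "i < length ns")
    case True
    then show ?thesis using snoc by (simp add: jet_index_snoc coords_snoc nth_append del: upt_Suc)
  next
    case False
    then have "i = length ns" using snoc by simp
    then show ?thesis using snoc.prems by (simp add: jet_index_last coords_snoc nth_append del: upt_Suc)
  qed
qed simp

lemma jet_coords: "length x = length ns ==> jet \<delta> ns x = map (\<lambda>(i, j). (\<delta> ^^ j) (x ! i)) (coords ns)"
  unfolding jet_def coords_def by (simp add: map_concat comp_def del: upt_Suc)

lemma length_jet [simp]: "length (jet \<delta> ns x) = tot ns"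
  unfolding jet_def by (simp add: length_concat comp_def sum_list_sum_nth atLeast0LessThan del: upt_Suc)

lemma jet_snoc: "length y = length ns ==> jet \<delta> (ns @ [N]) (y @ [a]) = jet \<delta> ns y @ jl \<delta> (Suc N) a"
proof -
  assume l: "length y = length ns"
  have "map (\<lambda>(i, j). (\<delta> ^^ j) ((y @ [a]) ! i)) (coords ns) = map (\<lambda>(i, j). (\<delta> ^^ j) (y ! i)) (coords ns)"
    using l by (auto simp: set_coords nth_append)
  then show ?thesis using l by (simp add: jet_coords coords_snoc jl_def nth_append comp_def del: upt_Suc)
qed

lemma jet_Nil [simp]: "jet \<delta> [] x = []"
  by (simp add: jet_def)

lemma sel_idx_jet:
  assumes "set cs \<subseteq> set (coords ns)" "length x = length ns"
  shows "sel (idx ns cs) (jet \<delta> ns x) = map (\<lambda>(i, j). (\<delta> ^^ j) (x ! i)) cs"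
  unfolding sel_def idx_def map_map
proof (rule map_cong[OF refl])
  fix c assume c: "c \<in> set cs"
  obtain i j where ij: "c = (i, j)" by fastforce
  then have "(i, j) \<in> set (coords ns)" using assms(1) c by blast
  then show "((!) (jet \<delta> ns x) \<circ> (\<lambda>(i, j). jet_index ns i j)) c = (case c of (i, j) => (\<delta> ^^ j) (x ! i))"
    using coords_jet_index[of i ns j] assms(2) unfolding ij by (simp add: set_coords jet_coords)
qed

lemma set_idx: "set cs \<subseteq> set (coords ns) ==> set (idx ns cs) \<subseteq> {..<tot ns}"
  unfolding idx_def using coords_jet_index[of _ ns] by (fastforce simp: set_coords)

lemma distinct_idx: "set cs \<subseteq> set (coords ns) ==> distinct cs ==> distinct (idx ns cs)"
  unfolding idx_def distinct_map
proof (intro conjI inj_onI)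
  fix c d assume a: "set cs \<subseteq> set (coords ns)" "c \<in> set cs" "d \<in> set cs"
    "(case c of (i, j) => jet_index ns i j) = (case d of (i, j) => jet_index ns i j)"
  have *: "coords ns ! (case c of (i, j) => jet_index ns i j) = c" if "c \<in> set (coords ns)" for c
  proof -
    obtain i j where "c = (i, j)" by fastforce
    then show ?thesis using that coords_jet_index[of i ns j] by (simp add: set_coords)
  qed
  show "c = d" using *[of c] *[of d] a by auto
qed

lemma le_ord_coords: "le_ord ns ns' ==> set (coords ns) \<subseteq> set (coords ns')"
proof
  fix c assume a: "le_ord ns ns'" "c \<in> set (coords ns)"
  obtain i j where c: "c = (i, j)" by fastforce
  then show "c \<in> set (coords ns')" using a list_all2_nthD[OF a(1), of i] list_all2_lengthD[OF a(1)]
    by (auto simp: set_coords)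
qed

lemma distinct_coords: "distinct (coords ns)"
  by (induction ns rule: rev_induct) (auto simp: coords_snoc distinct_map inj_on_def set_coords simp del: upt_Suc)

lemma jcut_props:
  assumes "le_ord ns ns'"
  shows "length (jcut ns ns') = tot ns" "set (jcut ns ns') \<subseteq> {..<tot ns'}" "distinct (jcut ns ns')"
  using set_idx[OF le_ord_coords[OF assms]] distinct_idx[OF le_ord_coords[OF assms] distinct_coords]
  unfolding jcut_def by (auto simp: idx_def)

lemma sel_jcut_jet: "le_ord ns ns' ==> length x = length ns ==> sel (jcut ns ns') (jet \<delta> ns' x) = jet \<delta> ns x"
  unfolding jcut_def using sel_idx_jet[OF le_ord_coords, of ns ns' x \<delta>] list_all2_lengthD[of "(\<le>)" ns ns']
  by (simp add: jet_coords)

lemma sel_jcut_jcut: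
  assumes "le_ord ns ns1" "le_ord ns1 ns2"
  shows "sel (jcut ns ns1) (sel (jcut ns1 ns2) u) = sel (jcut ns ns2) u"
proof (rule nth_equalityI)
  fix k assume "k < length (sel (jcut ns ns1) (sel (jcut ns1 ns2) u))"
  then have k: "k < tot ns" using jcut_props(1)[OF assms(1)] by simp
  obtain i j where c: "coords ns ! k = (i, j)" by fastforce
  have "(i, j) \<in> set (coords ns)" using nth_mem[of k "coords ns"] k c by simp
  then have ij: "(i, j) \<in> set (coords ns1)" using le_ord_coords[OF assms(1)] by blast
  then have J: "jet_index ns1 i j < tot ns1" "coords ns1 ! jet_index ns1 i j = (i, j)"
    using coords_jet_index by (auto simp: set_coords)
  show "sel (jcut ns ns1) (sel (jcut ns1 ns2) u) ! k = sel (jcut ns ns2) u ! k"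
    using k c J unfolding sel_def jcut_def idx_def by simp
qed (simp add: jcut_def idx_def)

lemma sel_jcut_same: "length u = tot ns ==> sel (jcut ns ns) u = u"
proof (rule nth_equalityI)
  fix k assume "length u = tot ns" "k < length (sel (jcut ns ns) u)"
  then have k: "k < tot ns" by (simp add: jcut_def idx_def)
  obtain i j where c: "coords ns ! k = (i, j)" by fastforce
  have "(i, j) \<in> set (coords ns)" using nth_mem[of k "coords ns"] k c by simp
  then have J: "jet_index ns i j < tot ns" "coords ns ! jet_index ns i j = coords ns ! k"
    using coords_jet_index[of i ns j] c by (auto simp: set_coords)
  then have "jet_index ns i j = k" using distinct_coords[of ns] k nth_eq_iff_index_eq[of "coords ns"] by simp
  then show "sel (jcut ns ns) u ! k = u ! k" using k c unfolding sel_def jcut_def idx_def by simp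
qed (simp add: jcut_def idx_def)

lemma le_ord_map_Suc: "le_ord ns (map Suc ns)"
  by (simp add: list_all2_conv_all_nth)

lemma le_ord_refl: "le_ord ns ns"
  by (simp add: list_all2_conv_all_nth)

lemma le_ord_trans: "le_ord a b ==> le_ord b c ==> le_ord a c"
  by (rule list_all2_trans[of "(\<le>)" "(\<le>)" "(\<le>)"]) auto

lemma jdcut_props: "length (jdcut ns) = tot ns" "set (jdcut ns) \<subseteq> {..<tot (map Suc ns)}"
  and sel_jdcut_jet: "length x = length ns ==> sel (jdcut ns) (jet \<delta> (map Suc ns) x) = map \<delta> (jet \<delta> ns x)"
proof -
  have s: "set (map (\<lambda>(i, j). (i, Suc j)) (coords ns)) \<subseteq> set (coords (map Suc ns))" by (auto simp: set_coords)
  show "length (jdcut ns) = tot ns" unfolding jdcut_def by (simp add: idx_def)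
  show "set (jdcut ns) \<subseteq> {..<tot (map Suc ns)}" unfolding jdcut_def by (rule set_idx[OF s])
  show "sel (jdcut ns) (jet \<delta> (map Suc ns) x) = map \<delta> (jet \<delta> ns x)" if "length x = length ns"
    unfolding jdcut_def using sel_idx_jet[OF s, of x \<delta>] that by (simp add: jet_coords split_def)
qed

lemma le_ord_bound:
  assumes "finite S" "\<And>s. s \<in> S ==> length s = k"
  shows "\<exists>t. length t = k \<and> (\<forall>s\<in>S. le_ord s t)"
  using assms
proof (induction S rule: finite_induct)
  case empty
  show ?case by (intro exI[of _ "replicate k 0"]) simp
next
  case (insert s S)
  then obtain t where t: "length t = k" "\<forall>s\<in>S. le_ord s t" by auto
  define t' where "t' = map (\<lambda>i. max (s ! i) (t ! i)) [0..<k]"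
  have "length s = k" using insert.prems by simp
  then have "le_ord s t'" "le_ord t t'" unfolding t'_def using t(1) by (auto simp: list_all2_conv_all_nth)
  then show ?case using t(2) le_ord_trans[of _ t t'] by (intro exI[of _ t']) (auto simp: t'_def)
qed

lemma jl_add: "jl \<delta> (m + n) a = jl \<delta> m a @ map (\<lambda>j. (\<delta> ^^ (m + j)) a) [0..<n]"
  unfolding jl_def by (induction n) auto

lemma map_delta_jl: "map \<delta> (jl \<delta> m a) = drop 1 (jl \<delta> m a @ [(\<delta> ^^ m) a])"
proof -
  have "jl \<delta> m a @ [(\<delta> ^^ m) a] = jl \<delta> (Suc m) a" unfolding jl_def by simp
  moreover have "map \<delta> (jl \<delta> m a) = drop 1 (jl \<delta> (Suc m) a)"
    unfolding jl_def by (rule nth_equalityI) (auto simp del: upt_Suc)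
  ultimately show ?thesis by simp
qed

section \<open>Derivations of definable functions\<close>

text \<open>\<open>D0\<close> stands for the sets definable without parameters, as the rule for
  T-derivations is about such functions; parameters are added in \<open>derivative_Df\<close>. The
  smoothness is 1 because the rule concerns first derivatives.\<close>

locale omin_derivation = omin_pair D0 DM 1 for D0 DM :: "nat => 'a::linordered_field list set => bool" +
  fixes \<delta> :: "'a => 'a"
  assumes T_der: "euclidean_open n U ==> D0 (Suc n) {x @ [f x] | x. x \<in> U} ==> Cp_open n 1 U f ==> u \<in> U ==>
     (\<And>i. i < n ==> has_partial f i u (J i)) ==> \<delta> (f u) = (\<Sum>i<n. J i * \<delta> (u ! i))"
begin

lemma df_sum: "(\<And>i. i < k ==> B.df n (f i)) ==> B.df n (\<lambda>x. \<Sum>i<k::nat. f i x)"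
  by (induction k) (auto intro!: B.df_zero B.df_add)

lemma glue_functions:
  assumes "finite \<C>" "\<And>C. C \<in> \<C> ==> D0 n C" "\<And>C. C \<in> \<C> ==> \<exists>G. B.df (n + n) G \<and> (\<forall>u\<in>C. R u = G (u @ map \<delta> u))"
  shows "\<exists>G. B.df (n + n) G \<and> (\<forall>u\<in>\<Union>\<C>. R u = G (u @ map \<delta> u))"
  using assms
proof (induction \<C> rule: finite_induct)
  case empty
  show ?case using B.df_zero by auto
next
  case (insert C \<C>)
  then obtain G1 G2 where G: "B.df (n + n) G1" "\<forall>u\<in>\<Union>\<C>. R u = G1 (u @ map \<delta> u)" "B.df (n + n) G2" "\<forall>u\<in>C. R u = G2 (u @ map \<delta> u)"
    by (metis insert_iff)
  have DC: "D0 n C" using insert by blast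
  have "B.df (n + n) (\<lambda>w. if take n w \<in> C then G2 w else G1 w)"
    by (rule B.df_if G B.dp_mem[OF DC] B.dl_take B.dl_id | simp)+
  moreover have "R u = (if take n (u @ map \<delta> u) \<in> C then G2 (u @ map \<delta> u) else G1 (u @ map \<delta> u))" if u: "u \<in> \<Union>(insert C \<C>)" for u
  proof -
    have "length u = n" using u insert.prems(1) B.D_length by blast
    then show ?thesis using u G(2,4) by (cases "u \<in> C") auto
  qed
  ultimately show ?case by (intro exI[of _ "\<lambda>w. if take n w \<in> C then G2 w else G1 w"]) simp
qed

text \<open>On an open cell, which lies in the set of \<open>C^1\<close>-points, the rule applies
  and \<open>G\<close> is the differential. On any other cell \<open>F\<close> is a function of
  fewer variables, the dropped coordinate being recovered by \<open>h\<close>; the induction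
  hypothesis covers \<open>F (h v)\<close>, and \<open>\<delta>\<close> commutes with the selection
  of coordinates.\<close>

lemma derivative_of_definable:
  "B.df n F ==> \<exists>G. B.df (n + n) G \<and> (\<forall>u. length u = n --> \<delta> (F u) = G (u @ map \<delta> u))"
proof (induction n arbitrary: F rule: less_induct)
  case (less n)
  define U where "U = {x. length x = n \<and> Gp n 1 F x}"
  have DU: "D0 n U" unfolding U_def by (rule B.D_Collect[OF B.dp_Gp[OF less.prems]])
  obtain \<C> where C: "decomp n {U} \<C>"
    using cell_decomposition[unfolded piecewise_def, rule_format, of "{U}" n "{}"] DU by auto
  have Cd: "finite \<C>" "\<Union>\<C> = pow n" "\<And>C. C \<in> \<C> ==> cellp n C" "\<And>C. C \<in> \<C> ==> C \<subseteq> U \<or> C \<inter> U = {}"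
    using C unfolding decomp_def by auto
  have "\<exists>G. B.df (n + n) G \<and> (\<forall>u\<in>C. \<delta> (F u) = G (u @ map \<delta> u))" if CC: "C \<in> \<C>" for C
  proof -
    obtain bs where bs: "length bs = n" "rel_cell PD 0 {[]} bs C" using Cd(3)[OF CC] unfolding cellp_def by blast
    have lC: "length y = n" if "y \<in> C" for y using rel_cell_length[OF bs(2) _ that] bs(1) by simp
    show ?thesis
    proof (cases "False \<in> set bs")
      case False
      have T: "set bs \<subseteq> {True}"
      proof
        fix b assume "b \<in> set bs"
        then have "b \<noteq> False" using False by metis
        then show "b \<in> {True}" by simp
      qed
      have CU: "C \<subseteq> U" unfolding U_def
        by (rule gen_open_cell[OF M.gen_Gp[OF df_sub[OF less.prems]] bs(2,1) T]) (use Cd(4)[OF CC] in \<open>simp add: U_def\<close>)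
      define G where "G w = (\<Sum>i<n. pd F i (take n w) * (drop n w ! i))" for w
      have "B.df (n + n) G" unfolding G_def
        by (rule df_sum dintros B.df_comp[OF B.df_pd[OF less.prems]] | simp)+
      moreover have "\<delta> (F u) = G (u @ map \<delta> u)" if u: "u \<in> C" for u
      proof -
        have "\<delta> (F u) = (\<Sum>i<n. pd F i u * \<delta> (u ! i))"
        proof (rule T_der)
          show "euclidean_open n U" unfolding U_def by (rule euclidean_open_Gp)
          have "{x @ [F x] | x. x \<in> U} = graph_over U F" unfolding graph_over_def ..
          also have "\<dots> = {z. length z = Suc n \<and> (take n z \<in> U \<and> z ! n = F (take n z))}"
            using graph_over_iff[of U n _ F] B.D_sub[OF DU] by blast
          finally have eq: "{x @ [F x] | x. x \<in> U} = {z. length z = Suc n \<and> (take n z \<in> U \<and> z ! n = F (take n z))}" .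
          show "D0 (Suc n) {x @ [F x] | x. x \<in> U}" unfolding eq
            by (rule B.D_Collect) (rule dintros B.dp_mem[OF DU] B.df_comp[OF less.prems] | simp)+
          show "Cp_open n 1 U F" unfolding U_def by (rule Gp_Cp_open)
          show "u \<in> U" using CU u by blast
          then obtain e where "0 < e" "\<forall>y. near e u y --> (\<forall>i<n. \<exists>d. has_partial F i y d)" unfolding U_def by auto
          then show "has_partial F i u (pd F i u)" if "i < n" for i using that pd_eq near_refl[of e u] by metis
        qed
        then show ?thesis unfolding G_def using lC[OF u] by simp
      qed
      ultimately show ?thesis by blast
    next
      case True
      obtain m I h where h: "length bs = Suc m" "length I = m" "distinct I" "set I \<subseteq> {..<Suc m}" "B.dl m (Suc m) h" "\<And>x. x \<in> C ==> h (sel I x) = x"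
        using nonopen_cell[OF bs(2) True] by blast
      have n: "n = Suc m" using h(1) bs(1) by simp
      have "B.df m (\<lambda>x. F (h x))" by (rule B.df_comp[OF less.prems]) (use h(5) n in simp)
      then obtain G where G: "B.df (m + m) G" "\<And>v. length v = m ==> \<delta> (F (h v)) = G (v @ map \<delta> v)"
        using less.IH[of m] n by auto
      have "B.df (n + n) (\<lambda>w. G (sel I (take n w) @ sel I (drop n w)))"
        by (rule B.df_comp[OF G(1)] dintros | simp add: h n)+
      moreover have "\<delta> (F u) = G (sel I (take n (u @ map \<delta> u)) @ sel I (drop n (u @ map \<delta> u)))" if u: "u \<in> C" for u
      proof -
        have "map \<delta> (sel I u) = sel I (map \<delta> u)" unfolding sel_def using h(4) lC[OF u] n by (auto simp: subset_iff)
        then show ?thesis using G(2)[of "sel I u"] h(2) h(6)[OF u] lC[OF u] by simp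
      qed
      ultimately show ?thesis by (intro exI[of _ "\<lambda>w. G (sel I (take n w) @ sel I (drop n w))"]) simp
    qed
  qed
  from glue_functions[OF Cd(1) D_cellp[OF Cd(3)] this]
  obtain G where "B.df (n + n) G" "\<forall>u\<in>\<Union>\<C>. \<delta> (F u) = G (u @ map \<delta> u)" by blast
  then show ?case unfolding Cd(2) by (intro exI[of _ G]) simp
qed

end

section \<open>Jets\<close>

text \<open>\<open>derivative\<close> reflects that the parameters are closed under
  \<open>\<delta>\<close>. \<open>generic\<close> is genericity for the graph of \<open>h\<close>
  over \<open>V\<close>: the derivatives below order m are steered into \<open>V\<close> while the
  m-th one is prescribed. Both \<open>V\<close> and \<open>h\<close> may depend on a fixed jet of
  other variables, hence \<open>DM\<close>.\<close>

locale jets = omin_pair D DM p for D DM :: "nat => 'a::linordered_field list set => bool" and p +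
  fixes \<delta> :: "'a => 'a"
  assumes derivative: "B.df n F ==> \<exists>G. B.df (n + n) G \<and> (\<forall>u. length u = n --> \<delta> (F u) = G (u @ map \<delta> u))"
    and generic: "DM m V ==> fat m (\<lambda>x. x \<in> V) ==> M.df m h ==> \<exists>a. jl \<delta> m a \<in> V \<and> (\<delta> ^^ m) a = h (jl \<delta> m a)"
begin

lemma dl_jcut: "B.dl N (tot ns') l ==> le_ord ns ns' ==> n = tot ns ==> B.dl N n (\<lambda>z. sel (jcut ns ns') (l z))"
  by (rule B.dl_sel) (use jcut_props[of ns ns'] in auto)

lemma dl_jdcut: "B.dl N (tot (map Suc ns)) l ==> n = tot ns ==> B.dl N n (\<lambda>z. sel (jdcut ns) (l z))"
  by (rule B.dl_sel) (use jdcut_props[of ns] in auto)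

text \<open>Differentiating an equation for \<open>\<delta>^m a\<close> with the help of
  \<open>derivative\<close> expresses one more derivative of \<open>a\<close>. Wherever
  \<open>\<delta>^m a\<close> turns up it is replaced by \<open>f\<close>, and the derivatives of
  \<open>y\<close> raise its orders by one each time.\<close>

lemma forced_derivatives:
  assumes f: "B.df (tot ns + m) f"
  shows "\<exists>ns1 h. le_ord ns ns1 \<and> (\<forall>j\<le>d. B.df (tot ns1 + m) (h j)) \<and>
    (\<forall>y a. length y = length ns \<and> (\<delta> ^^ m) a = f (jet \<delta> ns y @ jl \<delta> m a) -->
       (\<forall>j\<le>d. (\<delta> ^^ (m + j)) a = h j (jet \<delta> ns1 y @ jl \<delta> m a)))"
proof (induction d)
  case 0
  show ?case using f by (intro exI[of _ ns] exI[of _ "\<lambda>_. f"]) (auto simp: le_ord_refl)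
next
  case (Suc d)
  then obtain ns1 h where h: "le_ord ns ns1" "\<And>j. j \<le> d ==> B.df (tot ns1 + m) (h j)"
    "\<And>y a j. length y = length ns ==> (\<delta> ^^ m) a = f (jet \<delta> ns y @ jl \<delta> m a) ==> j \<le> d ==>
       (\<delta> ^^ (m + j)) a = h j (jet \<delta> ns1 y @ jl \<delta> m a)" by blast
  let ?r1 = "tot ns1"
  define ns2 where "ns2 = map Suc ns1"
  let ?r2 = "tot ns2"
  have le: "le_ord ns1 ns2" "le_ord ns ns2" unfolding ns2_def using le_ord_map_Suc le_ord_trans h(1) by blast+
  obtain G where G: "B.df ((?r1 + m) + (?r1 + m)) G" "\<And>u. length u = ?r1 + m ==> \<delta> (h d u) = G (u @ map \<delta> u)"
    using derivative[OF h(2)[OF order.refl]] by blast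
  \<comment> \<open>\<open>G\<close> takes the coordinates and then their derivatives. The
    derivatives of the entries of \<open>jl \<delta> m a\<close> form the same list shifted by one,
    with the value of \<open>f\<close> as the new last entry; for m = 0 the list is empty, and
    \<open>drop 1\<close> removes that value again.\<close>
  define h' where "h' j w = (if j \<le> d then h j (sel (jcut ns1 ns2) (take ?r2 w) @ drop ?r2 w)
     else G ((sel (jcut ns1 ns2) (take ?r2 w) @ drop ?r2 w) @
       (sel (jdcut ns1) (take ?r2 w) @ drop 1 (drop ?r2 w @ [f (sel (jcut ns ns2) (take ?r2 w) @ drop ?r2 w)]))))" for j w
  have dcat: "B.dl (?r2 + m) (tot ms + m) (\<lambda>w. sel (jcut ms ns2) (take ?r2 w) @ drop ?r2 w)" if "le_ord ms ns2" for ms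
    by (rule B.dl_append[OF dl_jcut[OF B.dl_take[OF B.dl_id] that refl] B.dl_drop[OF B.dl_id, of m]]) auto
  have 1: "B.df (?r2 + m) (h' j)" for j
  proof (cases "j \<le> d")
    case True
    then show ?thesis unfolding h'_def using B.df_comp[OF h(2)[OF True] dcat[OF le(1)]] by simp
  next
    case False
    have "B.dl (?r2 + m) m (\<lambda>w. drop ?r2 w)" by (rule B.dl_drop[OF B.dl_id]) simp
    then have "B.dl (?r2 + m) m (\<lambda>w. drop 1 (drop ?r2 w @ [f (sel (jcut ns ns2) (take ?r2 w) @ drop ?r2 w)]))"
      by (rule_tac B.dl_drop[of _ "m + 1"], rule_tac B.dl_append[OF _ B.dl_single[OF B.df_comp[OF f dcat[OF le(2)]]]]) auto
    moreover have "B.dl (?r2 + m) ?r1 (\<lambda>w. sel (jdcut ns1) (take ?r2 w))"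
      unfolding ns2_def by (rule dl_jdcut[OF B.dl_take[OF B.dl_id]]) auto
    ultimately have "B.df (?r2 + m) (\<lambda>w. G ((sel (jcut ns1 ns2) (take ?r2 w) @ drop ?r2 w) @
       (sel (jdcut ns1) (take ?r2 w) @ drop 1 (drop ?r2 w @ [f (sel (jcut ns ns2) (take ?r2 w) @ drop ?r2 w)]))))"
      by (intro B.df_comp[OF G(1)] B.dl_append[OF dcat[OF le(1)] B.dl_append]) auto
    then show ?thesis unfolding h'_def using False by simp
  qed
  have 2: "(\<delta> ^^ (m + j)) a = h' j (jet \<delta> ns2 y @ jl \<delta> m a)"
    if y: "length y = length ns" and a: "(\<delta> ^^ m) a = f (jet \<delta> ns y @ jl \<delta> m a)" and j: "j \<le> Suc d" for y a j
  proof -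
    have ly: "length y = length ns1" using y list_all2_lengthD[OF h(1)] by simp
    have c1: "sel (jcut ns1 ns2) (jet \<delta> ns2 y) = jet \<delta> ns1 y" "sel (jcut ns ns2) (jet \<delta> ns2 y) = jet \<delta> ns y"
      by (rule sel_jcut_jet[OF le(1) ly], rule sel_jcut_jet[OF le(2) y])
    show ?thesis
    proof (cases "j \<le> d")
      case True
      then show ?thesis unfolding h'_def using h(3)[OF y a True] c1 by simp
    next
      case False
      then have jd: "j = Suc d" using j by simp
      have "(\<delta> ^^ (m + j)) a = \<delta> ((\<delta> ^^ (m + d)) a)" unfolding jd by simp
      also have "\<dots> = G ((jet \<delta> ns1 y @ jl \<delta> m a) @ map \<delta> (jet \<delta> ns1 y @ jl \<delta> m a))"
        unfolding h(3)[OF y a order.refl] by (rule G(2)) simp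
      also have "map \<delta> (jet \<delta> ns1 y @ jl \<delta> m a) = sel (jdcut ns1) (jet \<delta> ns2 y) @ drop 1 (jl \<delta> m a @ [f (jet \<delta> ns y @ jl \<delta> m a)])"
        using sel_jdcut_jet[OF ly, of \<delta>] map_delta_jl[of \<delta> m a] a unfolding ns2_def by simp
      finally show ?thesis unfolding h'_def using False c1 by simp
    qed
  qed
  show ?case by (rule exI[of _ ns2], rule exI[of _ h']) (use le(2) 1 2 in blast)
qed

end

section \<open>Sets in whose fibres jets are dense\<close>

context jets
begin

text \<open>Density is required only in fibres over points that are jets, since genericity provides
  \<open>a\<close> for a given \<open>y\<close> but says nothing about other base points. The base
  may be any definable set.\<close>

definition "good_set N ns F \<longleftrightarrow> (\<exists>bs Z. length bs = Suc N \<and> D (tot ns) Z \<and> rel_cell PD (tot ns) Z bs F \<and>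
   (\<forall>y. length y = length ns --> jet \<delta> ns y \<in> Z --> (\<forall>w. jet \<delta> ns y @ w \<in> F --> (\<forall>\<epsilon>>0. \<exists>a. jet \<delta> ns y @ jl \<delta> (Suc N) a \<in> F \<and> near \<epsilon> w (jl \<delta> (Suc N) a)))))"

definition "lift m ns ns' Y = {u @ w | u w. length u = tot ns' \<and> length w = m \<and> sel (jcut ns ns') u @ w \<in> Y}"

text \<open>The members cover only the jets in \<open>Y\<close>: points whose later coordinates
  violate the forced relations are discarded.\<close>

definition "good_family N ns Y ns' \<F> \<longleftrightarrow> le_ord ns ns' \<and> finite \<F> \<and> disjoint \<F> \<and>
   (\<forall>F\<in>\<F>. good_set N ns' F \<and> F \<subseteq> lift (Suc N) ns ns' Y) \<and>
   (\<forall>y a. length y = length ns \<and> jet \<delta> ns y @ jl \<delta> (Suc N) a \<in> Y --> jet \<delta> ns' y @ jl \<delta> (Suc N) a \<in> \<Union>\<F>)"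

lemma lift_iff: "length u = tot ns' ==> u @ w \<in> lift m ns ns' Y \<longleftrightarrow> length w = m \<and> sel (jcut ns ns') u @ w \<in> Y"
  unfolding lift_def by auto

lemma lift_jet:
  "le_ord ns ns' ==> length y = length ns ==> jet \<delta> ns' y @ w \<in> lift m ns ns' Y \<longleftrightarrow> length w = m \<and> jet \<delta> ns y @ w \<in> Y"
  by (simp add: lift_iff sel_jcut_jet)

lemma lift_lift:
  "le_ord ns ns1 ==> le_ord ns1 ns2 ==> lift m ns1 ns2 (lift m ns ns1 Y) = lift m ns ns2 Y"
proof -
  assume le: "le_ord ns ns1" "le_ord ns1 ns2"
  have "sel (jcut ns1 ns2) u @ w \<in> lift m ns ns1 Y \<longleftrightarrow> length w = m \<and> sel (jcut ns ns2) u @ w \<in> Y" for u w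
    using lift_iff[of "sel (jcut ns1 ns2) u" ns1 w m ns Y] jcut_props(1)[OF le(2)] sel_jcut_jcut[OF le, of u] by simp
  then show ?thesis unfolding lift_def[of m ns1 ns2] lift_def[of m ns ns2] by auto
qed

lemma lift_mono: "Y \<subseteq> Y' ==> lift m ns ns' Y \<subseteq> lift m ns ns' Y'"
  unfolding lift_def by blast

lemma PD_pull:
  assumes PD: "PD (r + m) C f" and I: "length I = r" "distinct I" "set I \<subseteq> {..<r1}"
    and Y: "Y \<subseteq> {u @ w | u w. length u = r1 \<and> length w = m \<and> sel I u @ w \<in> C}"
  shows "PD (r1 + m) Y (\<lambda>z. f (sel I (take r1 z) @ drop r1 z))"
proof -
  have f: "B.df (r + m) f" "CpX (r + m) C f" using PD unfolding PD_def by auto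
  have "B.df (r1 + m) (\<lambda>z. f (sel I (take r1 z) @ drop r1 z))"
    by (rule B.df_comp[OF f(1)], rule B.dl_append[OF B.dl_sel[OF B.dl_take[OF B.dl_id] I(3,1)] B.dl_drop[OF B.dl_id, of m]]) auto
  moreover have "CpX (r1 + m) Y (\<lambda>z. f (sel I (take r1 z) @ drop r1 z))"
  proof (rule CpX_cong)
    let ?J = "I @ [r1..<r1 + m]"
    have J: "sel ?J (u @ w) = sel I u @ w" if "length u = r1" "length w = m" for u w :: "'a list"
    proof -
      have "map ((!) (u @ w)) I = map ((!) u) I" using I(3) that(1) by (auto simp: nth_append subset_iff)
      moreover have "map ((!) (u @ w)) [r1..<r1 + m] = w" by (rule nth_equalityI) (use that in \<open>auto simp: nth_append\<close>)
      ultimately show ?thesis unfolding sel_def by simp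
    qed
    show "CpX (r1 + m) Y (\<lambda>z. f (sel ?J z))"
      by (rule CpX_sel[OF f(2)]) (use I Y J in \<open>auto simp: subset_iff\<close>)
    show "f (sel ?J z) = f (sel I (take r1 z) @ drop r1 z)" if "z \<in> Y" for z
      using Y that J by auto
  qed
  ultimately show ?thesis unfolding PD_def by blast
qed

text \<open>The fibre over a longer jet of \<open>y\<close> is the fibre over the shorter jet of the
  same \<open>y\<close>, so density is inherited.\<close>

lemma good_set_lift:
  assumes "good_set N ns F" "le_ord ns ns'"
  shows "good_set N ns' (lift (Suc N) ns ns' F)"
proof -
  obtain bs Z where F: "length bs = Suc N" "D (tot ns) Z" "rel_cell PD (tot ns) Z bs F"
    "\<And>y w \<epsilon>. length y = length ns ==> jet \<delta> ns y \<in> Z ==> jet \<delta> ns y @ w \<in> F ==> 0 < \<epsilon> ==>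
      \<exists>a. jet \<delta> ns y @ jl \<delta> (Suc N) a \<in> F \<and> near \<epsilon> w (jl \<delta> (Suc N) a)"
    using assms(1) unfolding good_set_def by blast
  define Z' where "Z' = {u. length u = tot ns' \<and> sel (jcut ns ns') u \<in> Z}"
  have D: "D (tot ns') Z'" unfolding Z'_def
    by (rule B.D_Collect, rule B.dp_mem[OF F(2)], rule dl_jcut[OF B.dl_id assms(2)]) simp
  have rc: "rel_cell PD (tot ns') Z' bs {u @ w | u w. u \<in> Z' \<and> length w = length bs \<and> sel (jcut ns ns') u @ w \<in> F}"
    by (rule rel_cell_pull[OF F(3) jcut_props(1)[OF assms(2)]], simp add: Z'_def)
      (rule PD_pull[OF _ jcut_props(1,3,2)[OF assms(2)]])
  have eq: "{u @ w | u w. u \<in> Z' \<and> length w = length bs \<and> sel (jcut ns ns') u @ w \<in> F} = lift (Suc N) ns ns' F"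
  proof -
    have "u \<in> Z'" if "length u = tot ns'" "length w = Suc N" "sel (jcut ns ns') u @ w \<in> F" for u w
    proof -
      have "take (tot ns) (sel (jcut ns ns') u @ w) \<in> Z"
        by (rule rel_cell_base_into[OF F(3) _ that(3)]) (use B.D_length[OF F(2)] in blast)
      then show ?thesis unfolding Z'_def using that(1) jcut_props(1)[OF assms(2)] by simp
    qed
    then show ?thesis unfolding lift_def F(1) Z'_def by blast
  qed
  have "\<exists>a. jet \<delta> ns' y @ jl \<delta> (Suc N) a \<in> lift (Suc N) ns ns' F \<and> near \<epsilon> w (jl \<delta> (Suc N) a)"
    if y: "length y = length ns'" "jet \<delta> ns' y \<in> Z'" "jet \<delta> ns' y @ w \<in> lift (Suc N) ns ns' F" "0 < \<epsilon>" for y w \<epsilon>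
  proof -
    have ly: "length y = length ns" using y(1) list_all2_lengthD[OF assms(2)] by simp
    have "jet \<delta> ns y \<in> Z" "jet \<delta> ns y @ w \<in> F"
      using y(2,3) lift_jet[OF assms(2) ly] sel_jcut_jet[OF assms(2) ly, of \<delta>] unfolding Z'_def by auto
    from F(4)[OF ly this y(4)] show ?thesis using lift_jet[OF assms(2) ly] by auto
  qed
  then show ?thesis unfolding good_set_def
    by (intro exI[of _ bs] exI[of _ Z'] conjI allI impI F(1) D rc[unfolded eq])
qed

lemma good_family_lift:
  assumes "good_family N ns Y ns1 \<F>" "le_ord ns1 ns2"
  shows "good_family N ns Y ns2 (lift (Suc N) ns1 ns2 ` \<F>)"
proof -
  have F: "le_ord ns ns1" "finite \<F>" "disjoint \<F>" "\<And>F. F \<in> \<F> ==> good_set N ns1 F" "\<And>F. F \<in> \<F> ==> F \<subseteq> lift (Suc N) ns ns1 Y"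
    "\<And>y a. length y = length ns ==> jet \<delta> ns y @ jl \<delta> (Suc N) a \<in> Y ==> jet \<delta> ns1 y @ jl \<delta> (Suc N) a \<in> \<Union>\<F>"
    using assms(1) unfolding good_family_def by auto
  have len: "length ns = length ns1" using list_all2_lengthD[OF F(1)] .
  have "disjoint (lift (Suc N) ns1 ns2 ` \<F>)"
  proof (rule disjointI)
    fix a b assume "a \<in> lift (Suc N) ns1 ns2 ` \<F>" "b \<in> lift (Suc N) ns1 ns2 ` \<F>" "a \<noteq> b"
    then obtain F1 F2 where ab: "a = lift (Suc N) ns1 ns2 F1" "b = lift (Suc N) ns1 ns2 F2" "F1 \<in> \<F>" "F2 \<in> \<F>" "F1 \<noteq> F2" by blast
    then have "F1 \<inter> F2 = {}" using disjointD[OF F(3)] by blast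
    then show "a \<inter> b = {}" unfolding ab by (auto simp: lift_def)
  qed
  moreover have "lift (Suc N) ns1 ns2 F \<subseteq> lift (Suc N) ns ns2 Y" if "F \<in> \<F>" for F
    using lift_mono[OF F(5)[OF that]] lift_lift[OF F(1) assms(2)] by blast
  moreover have "jet \<delta> ns2 y @ jl \<delta> (Suc N) a \<in> \<Union>(lift (Suc N) ns1 ns2 ` \<F>)"
    if y: "length y = length ns" "jet \<delta> ns y @ jl \<delta> (Suc N) a \<in> Y" for y a
  proof -
    obtain F where "F \<in> \<F>" "jet \<delta> ns1 y @ jl \<delta> (Suc N) a \<in> F" using F(6)[OF y] by blast
    then show ?thesis using lift_jet[OF assms(2), of y] y(1) len by auto
  qed
  ultimately show ?thesis unfolding good_family_def
    using le_ord_trans[OF F(1) assms(2)] F(2) good_set_lift[OF F(4) assms(2)] by auto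
qed

text \<open>Each part of \<open>Y\<close> may need its own increase of the orders; afterwards all of
  them are raised to a common bound.\<close>

lemma good_family_Union:
  assumes le: "le_ord ns ns1" and fin: "finite \<Y>" and dis: "disjoint \<Y>"
    and sub: "\<And>Z. Z \<in> \<Y> ==> Z \<subseteq> lift (Suc N) ns ns1 Y"
    and cov: "\<And>y a. length y = length ns ==> jet \<delta> ns y @ jl \<delta> (Suc N) a \<in> Y ==> jet \<delta> ns1 y @ jl \<delta> (Suc N) a \<in> \<Union>\<Y>"
    and ex: "\<And>Z. Z \<in> \<Y> ==> \<exists>ns' \<F>. good_family N ns1 Z ns' \<F>"
  shows "\<exists>ns' \<F>. good_family N ns Y ns' \<F> \<and> (\<forall>F\<in>\<F>. \<exists>Z\<in>\<Y>. F \<subseteq> lift (Suc N) ns1 ns' Z)"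
proof -
  have "\<forall>Z\<in>\<Y>. \<exists>q. good_family N ns1 Z (fst q) (snd q)" using ex by fastforce
  from bchoice[OF this] obtain q where q: "\<forall>Z\<in>\<Y>. good_family N ns1 Z (fst (q Z)) (snd (q Z))" ..
  have leq: "le_ord ns1 (fst (q Z))" if "Z \<in> \<Y>" for Z using q that unfolding good_family_def by blast
  have "length s = length ns1" if "s \<in> (\<lambda>Z. fst (q Z)) ` \<Y> \<union> {ns1}" for s
    using that leq list_all2_lengthD by fastforce
  moreover have "finite ((\<lambda>Z. fst (q Z)) ` \<Y> \<union> {ns1})" using fin by simp
  ultimately have "\<exists>t. length t = length ns1 \<and> (\<forall>s\<in>(\<lambda>Z. fst (q Z)) ` \<Y> \<union> {ns1}. le_ord s t)" by (intro le_ord_bound)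
  then obtain t where t: "length t = length ns1" "\<forall>s\<in>(\<lambda>Z. fst (q Z)) ` \<Y> \<union> {ns1}. le_ord s t" by blast
  have le1: "le_ord ns1 t" using t(2) by blast
  define \<G> where "\<G> Z = lift (Suc N) (fst (q Z)) t ` snd (q Z)" for Z
  have G: "good_family N ns1 Z t (\<G> Z)" if "Z \<in> \<Y>" for Z
    unfolding \<G>_def by (rule good_family_lift[OF q[rule_format, OF that]]) (use t(2) that in blast)
  have Gs: "F \<subseteq> lift (Suc N) ns1 t Z" "good_set N t F" if "Z \<in> \<Y>" "F \<in> \<G> Z" for Z F
    using G[OF that(1)] that(2) unfolding good_family_def by auto
  have len: "length ns = length ns1" using list_all2_lengthD[OF le] .
  define \<F> where "\<F> = \<Union>(\<G> ` \<Y>)"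
  have "good_family N ns Y t \<F>" unfolding good_family_def
  proof (intro conjI ballI allI impI)
    show "le_ord ns t" using le_ord_trans[OF le le1] .
    show "finite \<F>" unfolding \<F>_def using fin G unfolding good_family_def by auto
    show "disjoint \<F>"
    proof (rule disjointI)
      fix a b assume "a \<in> \<F>" "b \<in> \<F>" "a \<noteq> b"
      then obtain Z1 Z2 where ab: "Z1 \<in> \<Y>" "a \<in> \<G> Z1" "Z2 \<in> \<Y>" "b \<in> \<G> Z2" unfolding \<F>_def by blast
      show "a \<inter> b = {}"
      proof (cases "Z1 = Z2")
        case True
        then show ?thesis using G[OF ab(1)] ab \<open>a \<noteq> b\<close> disjointD[of "\<G> Z1" a b] unfolding good_family_def by blast
      next
        case False
        then have "Z1 \<inter> Z2 = {}" using disjointD[OF dis ab(1,3)] by blast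
        then have "lift (Suc N) ns1 t Z1 \<inter> lift (Suc N) ns1 t Z2 = {}" by (auto simp: lift_def)
        then show ?thesis using Gs(1)[OF ab(1,2)] Gs(1)[OF ab(3,4)] by blast
      qed
    qed
    fix F assume "F \<in> \<F>"
    then obtain Z where Z: "Z \<in> \<Y>" "F \<in> \<G> Z" unfolding \<F>_def by blast
    show "good_set N t F" using Gs(2)[OF Z] .
    show "F \<subseteq> lift (Suc N) ns t Y" using Gs(1)[OF Z] lift_mono[OF sub[OF Z(1)]] lift_lift[OF le le1] by blast
  next
    fix y a assume y: "length y = length ns \<and> jet \<delta> ns y @ jl \<delta> (Suc N) a \<in> Y"
    then obtain Z where Z: "Z \<in> \<Y>" "jet \<delta> ns1 y @ jl \<delta> (Suc N) a \<in> Z" using cov by blast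
    then have "jet \<delta> t y @ jl \<delta> (Suc N) a \<in> \<Union>(\<G> Z)" using G[OF Z(1)] y len unfolding good_family_def by auto
    then show "jet \<delta> t y @ jl \<delta> (Suc N) a \<in> \<Union>\<F>" unfolding \<F>_def using Z(1) by blast
  qed
  moreover have "\<forall>F\<in>\<F>. \<exists>Z\<in>\<Y>. F \<subseteq> lift (Suc N) ns1 t Z" unfolding \<F>_def using Gs(1) by blast
  ultimately show ?thesis by blast
qed

lemma good_family_self: "good_set N ns F ==> F \<subseteq> pow (tot ns + Suc N) ==> good_family N ns F ns {F}"
proof -
  assume F: "good_set N ns F" "F \<subseteq> pow (tot ns + Suc N)"
  have "F \<subseteq> lift (Suc N) ns ns F"
  proof
    fix z assume "z \<in> F"
    then have "length z = tot ns + Suc N" using F(2) by auto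
    then show "z \<in> lift (Suc N) ns ns F" unfolding lift_def using \<open>z \<in> F\<close>
      by (intro CollectI exI[of _ "take (tot ns) z"] exI[of _ "drop (tot ns) z"]) (simp add: sel_jcut_same)
  qed
  then show ?thesis unfolding good_family_def using F(1) by (simp add: le_ord_refl disjoint_def)
qed

text \<open>The prescribed coordinates are added as graphs of functions that read only the first
  \<open>r + m\<close> coordinates.\<close>

lemma rel_cell_extend:
  assumes C: "rel_cell PD r Z bs C" "length bs = m" "C \<subseteq> pow (r + m)"
    and h: "\<And>j. j < n ==> PD (r + m) C (h j)"
  shows "rel_cell PD r Z (replicate n False @ bs) {z @ map (\<lambda>j. h j z) [0..<n] | z. z \<in> C}"
  using h
proof (induction n)
  case 0
  then show ?case using C(1) by simp
next
  case (Suc n)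
  let ?E = "{z @ map (\<lambda>j. h j z) [0..<n] | z. z \<in> C}"
  let ?g = "\<lambda>w. h n (take (r + m) w)"
  have E: "rel_cell PD r Z (replicate n False @ bs) ?E" using Suc by simp
  have hn: "B.df (r + m) (h n)" "CpX (r + m) C (h n)" using Suc.prems[of n] unfolding PD_def by auto
  have tk: "sel [0..<r + m] w = take (r + m) w" if "r + m \<le> length w" for w :: "'a list"
    unfolding sel_def by (rule map_nth_upt_take[OF that])
  have lC: "length z = r + m" if "z \<in> C" for z using C(3) that by auto
  have "B.df (r + m + n) ?g" by (rule B.df_comp[OF hn(1) B.dl_take[OF B.dl_id]]) simp
  moreover have "CpX (r + m + n) ?E ?g"
  proof (rule CpX_cong)
    show "CpX (r + m + n) ?E (\<lambda>w. h n (sel [0..<r + m] w))"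
      by (rule CpX_sel[OF hn(2)]) (use lC tk in \<open>auto simp: subset_iff\<close>)
    show "h n (sel [0..<r + m] w) = ?g w" if "w \<in> ?E" for w using that lC tk[of w] by auto
  qed
  ultimately have "PD (r + length (replicate n False @ bs)) ?E ?g" unfolding PD_def using C(2) by (simp add: ac_simps)
  moreover have "{z @ map (\<lambda>j. h j z) [0..<Suc n] | z. z \<in> C} = graph_over ?E ?g"
  proof -
    have "z @ map (\<lambda>j. h j z) [0..<Suc n] = (z @ map (\<lambda>j. h j z) [0..<n]) @ [?g (z @ map (\<lambda>j. h j z) [0..<n])]" if "z \<in> C" for z
      using lC[OF that] by simp
    then have eq: "(\<lambda>z. z @ map (\<lambda>j. h j z) [0..<Suc n]) ` C = (\<lambda>z. (z @ map (\<lambda>j. h j z) [0..<n]) @ [?g (z @ map (\<lambda>j. h j z) [0..<n])]) ` C"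
      by (rule image_cong[OF refl])
    have "graph_over ?E ?g = (\<lambda>w. w @ [?g w]) ` (\<lambda>z. z @ map (\<lambda>j. h j z) [0..<n]) ` C"
      unfolding graph_over_def by (simp only: Setcompr_eq_image)
    also have "\<dots> = (\<lambda>z. z @ map (\<lambda>j. h j z) [0..<Suc n]) ` C" unfolding eq image_image ..
    finally show ?thesis by (simp only: Setcompr_eq_image)
  qed
  ultimately have "cell_over PD (r + length (replicate n False @ bs)) False ?E {z @ map (\<lambda>j. h j z) [0..<Suc n] | z. z \<in> C}"
    unfolding cell_over_def by auto
  then show ?case using E by auto
qed

lemma cont_finite:
  assumes "\<And>j. j < n ==> cont_on C (h j)" "z \<in> C" "0 < (e::'a)"
  shows "\<exists>\<eta>>0. \<forall>z'\<in>C. near \<eta> z z' --> (\<forall>j<n::nat. \<bar>h j z' - h j z\<bar> < e)"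
  using assms(1)
proof (induction n)
  case 0
  show ?case by (intro exI[of _ 1]) simp
next
  case (Suc n)
  then obtain \<eta>1 where 1: "\<eta>1 > 0" "\<And>z'. z' \<in> C ==> near \<eta>1 z z' ==> \<forall>j<n. \<bar>h j z' - h j z\<bar> < e" by auto
  obtain \<eta>2 where 2: "\<eta>2 > 0" "\<And>z'. z' \<in> C ==> near \<eta>2 z z' ==> \<bar>h n z' - h n z\<bar> < e"
    using Suc.prems[of n] assms(2,3) unfolding cont_on_def by blast
  show ?case by (intro exI[of _ "min \<eta>1 \<eta>2"]) (use 1 2 in \<open>auto simp: less_Suc_eq\<close>)
qed

text \<open>Over the jets of \<open>y\<close> the fibre of an open cell contains a point prescribed up to order \<open>m\<close>;
  if \<open>h 0\<close> prescribes \<open>\<delta>\<^sup>m a\<close>, the remaining coordinates are forced.\<close>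

lemma good_set_extension:
  assumes C: "rel_cell PD (tot ns) Z bs C" "length bs = m" "D (tot ns) Z" "set bs \<subseteq> {True}" "C \<subseteq> pow (tot ns + m)"
    and m: "m \<le> Suc N" and h: "\<And>j. j < Suc N - m ==> PD (tot ns + m) C (h j)"
    and g: "B.df (tot ns + m) g"
    and forced: "\<And>y a j. length y = length ns ==> (\<delta> ^^ m) a = g (jet \<delta> ns y @ jl \<delta> m a) ==> j < Suc N - m ==>
      (\<delta> ^^ (m + j)) a = h j (jet \<delta> ns y @ jl \<delta> m a)"
  shows "good_set N ns {z @ map (\<lambda>j. h j z) [0..<Suc N - m] | z. z \<in> C}"
proof -
  define E where "E = {z @ map (\<lambda>j. h j z) [0..<Suc N - m] | z. z \<in> C}"
  have E: "rel_cell PD (tot ns) Z (replicate (Suc N - m) False @ bs) E"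
    unfolding E_def by (rule rel_cell_extend[OF C(1,2,5) h])
  have lC: "length z = tot ns + m" if "z \<in> C" for z using C(5) that by auto
  have lZ: "length z = tot ns" if "z \<in> Z" for z using B.D_length[OF C(3) that] .
  have DC: "D (tot ns + m) C" using D_rel_cell[OF C(1,3)] C(2) by simp
  have "\<exists>a. jet \<delta> ns y @ jl \<delta> (Suc N) a \<in> E \<and> near \<epsilon> w (jl \<delta> (Suc N) a)"
    if y: "length y = length ns" "jet \<delta> ns y \<in> Z" "jet \<delta> ns y @ w \<in> E" "0 < \<epsilon>" for y w \<epsilon>
  proof -
    let ?u = "jet \<delta> ns y"
    obtain z where z: "?u @ w = z @ map (\<lambda>j. h j z) [0..<Suc N - m]" "z \<in> C" using y(3) unfolding E_def by blast
    define v where "v = drop (tot ns) z"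
    have zv: "z = ?u @ v" unfolding v_def using lC[OF z(2)] arg_cong[OF z(1), of "take (tot ns)"] by (simp add: append_eq_conv_conj)
    have w: "w = v @ map (\<lambda>j. h j z) [0..<Suc N - m]" using z(1) unfolding zv by simp
    have lv: "length v = m" using lC[OF z(2)] unfolding v_def by simp
    have "\<exists>\<eta>>0. \<forall>z'\<in>C. near \<eta> z z' --> (\<forall>j<Suc N - m. \<bar>h j z' - h j z\<bar> < \<epsilon>)"
      by (rule cont_finite[OF _ z(2) y(4)]) (use PD_cont_on h in blast)
    then obtain \<eta> where \<eta>: "0 < \<eta>" "\<And>z' j. z' \<in> C ==> near \<eta> z z' ==> j < Suc N - m ==> \<bar>h j z' - h j z\<bar> < \<epsilon>" by blast
    have "\<exists>e>0. \<forall>z'. near e z z' \<and> take (tot ns) z' \<in> Z --> z' \<in> C"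
      by (rule rel_cell_open[OF C(1) _ lZ C(4) z(2)]) (rule PD_cont_on)
    then obtain e where e: "0 < e" "\<And>z'. near e z z' ==> take (tot ns) z' \<in> Z ==> z' \<in> C" by blast
    \<comment> \<open>The part near \<open>v\<close> of the fibre of \<open>C\<close> over the jet
      of \<open>y\<close>. It has interior because \<open>C\<close> is open in its last m
      coordinates, and it is so small that the prescribed coordinates change by less than
      \<open>\<epsilon>\<close>. Fixing the jet brings in new parameters, hence
      \<open>DM\<close>.\<close>
    define V where "V = {v'. length v' = m \<and> (?u @ v' \<in> C \<and> near (min \<eta> \<epsilon>) v v')}"
    have dl: "M.dl m (tot ns + m) (\<lambda>v'. ?u @ v')"
      by (rule M.dl_append[OF M.dl_const M.dl_id]) simp_all
    have "DM m V" unfolding V_def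
      by (rule M.D_Collect M.dp_conj M.dp_mem[OF sub[OF DC] dl] M.dp_near M.df_const M.dl_const M.dl_id lv)+
    moreover have "fat m (\<lambda>v'. v' \<in> V)"
    proof (rule fatI[of v _ "min e (min \<eta> \<epsilon>)"])
      fix v' assume v': "near (min e (min \<eta> \<epsilon>)) v v'"
      then have "near e z (?u @ v')" unfolding zv using e(1) by simp
      then have "?u @ v' \<in> C" using e(2) y(2) by simp
      then show "v' \<in> V" unfolding V_def using v' lv near_length[OF v'] by simp
    qed (use lv e \<eta> y(4) in auto)
    moreover have "M.df m (\<lambda>v'. g (?u @ v'))" by (rule M.df_comp[OF df_sub[OF g] dl])
    ultimately obtain a where a: "jl \<delta> m a \<in> V" "(\<delta> ^^ m) a = g (?u @ jl \<delta> m a)" using generic by blast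
    have f: "(\<delta> ^^ (m + j)) a = h j (?u @ jl \<delta> m a)" if "j < Suc N - m" for j by (rule forced[OF y(1) a(2) that])
    have "jl \<delta> (Suc N) a = jl \<delta> m a @ map (\<lambda>j. (\<delta> ^^ (m + j)) a) [0..<Suc N - m]" using jl_add[of \<delta> m "Suc N - m" a] m by simp
    also have "map (\<lambda>j. (\<delta> ^^ (m + j)) a) [0..<Suc N - m] = map (\<lambda>j. h j (?u @ jl \<delta> m a)) [0..<Suc N - m]" using f by simp
    finally have j: "jl \<delta> (Suc N) a = jl \<delta> m a @ map (\<lambda>j. h j (?u @ jl \<delta> m a)) [0..<Suc N - m]" .
    have aC: "?u @ jl \<delta> m a \<in> C" "near \<eta> v (jl \<delta> m a)" "near \<epsilon> v (jl \<delta> m a)" using a(1) unfolding V_def by auto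
    then have "?u @ jl \<delta> (Suc N) a \<in> E" unfolding E_def j by (intro CollectI exI[of _ "?u @ jl \<delta> m a"]) simp
    moreover have "near \<eta> z (?u @ jl \<delta> m a)" unfolding zv using aC(2) \<eta>(1) by simp
    then have "near \<epsilon> (map (\<lambda>j. h j z) [0..<Suc N - m]) (map (\<lambda>j. h j (?u @ jl \<delta> m a)) [0..<Suc N - m])"
      using \<eta>(2)[OF aC(1)] unfolding near_def by (simp add: abs_minus_commute)
    then have "near \<epsilon> w (jl \<delta> (Suc N) a)" unfolding w j using aC(3) lv by simp
    ultimately show ?thesis by blast
  qed
  moreover have "length (replicate (Suc N - m) False @ bs) = Suc N" using m C(2) by simp
  ultimately show ?thesis using E C(3) unfolding good_set_def E_def by (metis (no_types, lifting))
qed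

text \<open>Induction on the place m of the coordinate in which \<open>Y\<close> is known to be a
  graph. The forced derivatives determine all coordinates of the block from m on, and the set of
  possible initial parts is cut into cells. Over a cell that is open in its last m coordinates
  genericity applies; any other cell is a graph in a coordinate m' < m of the block, and the
  induction hypothesis takes over.\<close>

lemma good_family_exists_aux:
  "D (tot ns + Suc N) Y ==> m \<le> Suc N ==> B.df (tot ns + m) f ==>
   (m \<le> N ==> \<forall>z\<in>Y. z ! (tot ns + m) = f (take (tot ns + m) z)) ==> \<exists>ns' \<F>. good_family N ns Y ns' \<F>"
proof (induction m arbitrary: ns Y f rule: less_induct)
  case (less m)
  obtain ns1 h where h: "le_ord ns ns1" "\<And>j. j \<le> N - m ==> B.df (tot ns1 + m) (h j)"
    "\<And>y a j. length y = length ns ==> (\<delta> ^^ m) a = f (jet \<delta> ns y @ jl \<delta> m a) ==> j \<le> N - m ==>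
       (\<delta> ^^ (m + j)) a = h j (jet \<delta> ns1 y @ jl \<delta> m a)"
    using forced_derivatives[OF less.prems(3), of "N - m"] by blast
  let ?r = "tot ns1"
  let ?d = "Suc N - m"
  have dN: "j \<le> N - m" if "j < ?d" for j using that by simp
  have len: "length ns = length ns1" using list_all2_lengthD[OF h(1)] .
  define H where "H z = map (\<lambda>j. h j z) [0..<?d]" for z
  have dH: "B.dl (?r + m) ?d H" unfolding H_def by (rule B.dl_map) (use h(2) dN in auto)
  have lY: "length z = tot ns + Suc N" if "z \<in> Y" for z using B.D_length[OF less.prems(1) that] .
  \<comment> \<open>The initial parts, over the enlarged jet space, whose completion by the forced
    values lies in \<open>Y\<close>.\<close>
  define Q where "Q = {z. length z = ?r + m \<and> (sel (jcut ns ns1) (take ?r z) @ drop ?r z) @ H z \<in> Y}"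
  have dcat: "B.dl (?r + m) (tot ns + m) (\<lambda>w. sel (jcut ns ns1) (take ?r w) @ drop ?r w)"
    by (rule B.dl_append[OF dl_jcut[OF B.dl_take[OF B.dl_id] h(1) refl] B.dl_drop[OF B.dl_id, of m]]) auto
  have DQ: "D (?r + m) Q" unfolding Q_def
    by (rule B.D_Collect, rule B.dp_mem[OF less.prems(1)], rule B.dl_append[OF dcat dH]) (use less.prems(2) in simp)
  have "\<exists>\<C>. decomp (?r + m) {Q} \<C> \<and> (\<forall>C\<in>\<C>. \<forall>g\<in>h ` {..<?d}. CpX (?r + m) C g)"
    using cell_decomposition[unfolded piecewise_def, rule_format, of "{Q}" "?r + m" "h ` {..<?d}"] DQ h(2) dN by auto
  then obtain \<C> where C: "decomp (?r + m) {Q} \<C>" "\<forall>C\<in>\<C>. \<forall>g\<in>h ` {..<?d}. CpX (?r + m) C g" by blast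
  have Cd: "finite \<C>" "disjoint \<C>" "\<Union>\<C> = pow (?r + m)" "\<And>C. C \<in> \<C> ==> cellp (?r + m) C" "\<And>C. C \<in> \<C> ==> C \<subseteq> Q \<or> C \<inter> Q = {}"
    using C(1) unfolding decomp_def by auto
  have lC: "length z = ?r + m" if "C \<in> \<C>" "z \<in> C" for C z
  proof -
    have "z \<in> \<Union>\<C>" using that by blast
    then show ?thesis using Cd(3) by simp
  qed
  define ext where "ext C = {z @ H z | z. z \<in> C}" for C
  define \<Y> where "\<Y> = ext ` {C \<in> \<C>. C \<subseteq> Q}"
  have lH: "length (H z) = ?d" for z unfolding H_def by simp
  have "\<exists>ns' \<F>. good_family N ns Y ns' \<F> \<and> (\<forall>F\<in>\<F>. \<exists>Z\<in>\<Y>. F \<subseteq> lift (Suc N) ns1 ns' Z)"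
  proof (rule good_family_Union[OF h(1)])
    show "finite \<Y>" unfolding \<Y>_def using Cd(1) by simp
    show "disjoint \<Y>"
    proof (rule disjointI)
      fix a b assume "a \<in> \<Y>" "b \<in> \<Y>" "a \<noteq> b"
      then obtain C1 C2 where ab: "a = ext C1" "b = ext C2" "C1 \<in> \<C>" "C2 \<in> \<C>" "C1 \<noteq> C2" unfolding \<Y>_def by blast
      then have "C1 \<inter> C2 = {}" using disjointD[OF Cd(2)] by blast
      then show "a \<inter> b = {}" unfolding ab ext_def using lC[OF ab(3)] lC[OF ab(4)] by (auto simp: append_eq_append_conv)
    qed
    show "Z \<subseteq> lift (Suc N) ns ns1 Y" if ZZ: "Z \<in> \<Y>" for Z
    proof
      fix w assume "w \<in> Z"
      then obtain C z where w: "w = z @ H z" "z \<in> C" "C \<in> \<C>" "C \<subseteq> Q" using ZZ unfolding \<Y>_def ext_def by blast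
      then have z: "length z = ?r + m" "(sel (jcut ns ns1) (take ?r z) @ drop ?r z) @ H z \<in> Y" unfolding Q_def by auto
      have "w = take ?r z @ (drop ?r z @ H z)" unfolding w(1) by simp
      then show "w \<in> lift (Suc N) ns ns1 Y" unfolding lift_def
        using z less.prems(2) lH by (intro CollectI exI[of _ "take ?r z"] exI[of _ "drop ?r z @ H z"]) simp
    qed
    show "jet \<delta> ns1 y @ jl \<delta> (Suc N) a \<in> \<Union>\<Y>" if ya: "length y = length ns" "jet \<delta> ns y @ jl \<delta> (Suc N) a \<in> Y" for y a
    proof -
      let ?z = "jet \<delta> ns1 y @ jl \<delta> m a"
      have j: "jl \<delta> (Suc N) a = jl \<delta> m a @ map (\<lambda>j. (\<delta> ^^ (m + j)) a) [0..<?d]" using jl_add[of \<delta> m ?d a] less.prems(2) by simp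
      have "map (\<lambda>j. (\<delta> ^^ (m + j)) a) [0..<?d] = H ?z"
      proof (cases "m \<le> N")
        case True
        have "(jet \<delta> ns y @ jl \<delta> (Suc N) a) ! (tot ns + m) = (\<delta> ^^ m) a"
          using True by (simp add: nth_append jl_def del: upt_Suc)
        moreover have "take (tot ns + m) (jet \<delta> ns y @ jl \<delta> (Suc N) a) = jet \<delta> ns y @ jl \<delta> m a" unfolding j by simp
        ultimately have "(\<delta> ^^ m) a = f (jet \<delta> ns y @ jl \<delta> m a)" using less.prems(4)[OF True] ya(2) by metis
        then show ?thesis unfolding H_def using h(3)[OF ya(1)] dN by simp
      next
        case False
        then have "?d = 0" by simp
        then show ?thesis unfolding H_def by simp
      qed
      then have j': "jl \<delta> (Suc N) a = jl \<delta> m a @ H ?z" using j by simp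
      have "?z \<in> Q" unfolding Q_def using ya(2) sel_jcut_jet[OF h(1) ya(1), of \<delta>] j' by simp
      have "?z \<in> \<Union>\<C>" unfolding Cd(3) by simp
      then obtain C' where C': "C' \<in> \<C>" "?z \<in> C'" by blast
      then have "C' \<subseteq> Q" using Cd(5)[OF C'(1)] \<open>?z \<in> Q\<close> by blast
      moreover have "?z @ H ?z \<in> ext C'" unfolding ext_def using C'(2) by blast
      ultimately show ?thesis unfolding \<Y>_def j' using C'(1) by auto
    qed
    show "\<exists>ns' \<F>. good_family N ns1 Z ns' \<F>" if ZZ: "Z \<in> \<Y>" for Z
    proof -
      obtain C where CC: "Z = ext C" "C \<in> \<C>" "C \<subseteq> Q" using ZZ unfolding \<Y>_def by blast
      obtain bs where bs: "length bs = ?r + m" "rel_cell PD 0 {[]} bs C" using Cd(4)[OF CC(2)] unfolding cellp_def by blast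
      define bs1 where "bs1 = drop m bs"
      define bs2 where "bs2 = take m bs"
      have b: "bs = bs2 @ bs1" "length bs2 = m" "length bs1 = ?r" unfolding bs1_def bs2_def using bs(1) by auto
      have DC: "D (?r + m) C" using D_cellp[OF Cd(4)[OF CC(2)]] .
      have sC: "C \<subseteq> pow (?r + m)" using B.D_sub[OF DC] .
      show ?thesis
      proof (cases "False \<in> set bs2")
        case True
        \<comment> \<open>Any graph coordinate among the last m will do: the \<open>m'\<close>
          coordinates of the block before it are fewer than m.\<close>
        then obtain c2 c1 where c: "bs2 = c2 @ False # c1" by (metis split_list)
        define m' where "m' = length c1"
        have mm: "m' < m" unfolding m'_def using b(2) c by simp
        obtain \<phi> C1 where \<phi>: "PD (0 + length (c1 @ bs1)) C1 \<phi>" "\<forall>z\<in>C. z ! (0 + length (c1 @ bs1)) = \<phi> (take (0 + length (c1 @ bs1)) z)"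
          using rel_cell_graph[of PD 0 "{[]}" c2 "c1 @ bs1" C] bs(2) unfolding b(1) c by auto
        have k: "0 + length (c1 @ bs1) = ?r + m'" unfolding m'_def using b(3) by simp
        note \<phi> = \<phi>[unfolded k]
        have extD: "ext C = {w. length w = ?r + Suc N \<and> (take (?r + m) w \<in> C \<and> drop (?r + m) w = H (take (?r + m) w))}"
        proof (intro equalityI subsetI)
          fix w assume "w \<in> {w. length w = ?r + Suc N \<and> (take (?r + m) w \<in> C \<and> drop (?r + m) w = H (take (?r + m) w))}"
          then show "w \<in> ext C" unfolding ext_def by (intro CollectI exI[of _ "take (?r + m) w"]) (auto, metis append_take_drop_id)
        next
          fix w assume "w \<in> ext C"
          then obtain z where "w = z @ H z" "z \<in> C" unfolding ext_def by blast
          then show "w \<in> {w. length w = ?r + Suc N \<and> (take (?r + m) w \<in> C \<and> drop (?r + m) w = H (take (?r + m) w))}"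
            using lC[OF CC(2)] lH less.prems(2) by simp
        qed
        have "B.dp (?r + Suc N) (\<lambda>w. take (?r + m) w \<in> C \<and> (\<forall>j<?d. w ! (?r + m + j) = h j (take (?r + m) w)))"
        proof (intro B.dp_conj B.dp_all_less B.dp_eq)
          show "B.dp (?r + Suc N) (\<lambda>w. take (?r + m) w \<in> C)"
            by (rule B.dp_mem[OF DC B.dl_take[OF B.dl_id]]) (use less.prems(2) in simp)
          fix j assume jd: "j < ?d"
          show "B.df (?r + Suc N) (\<lambda>w. w ! (?r + m + j))" by (rule B.df_nth0) (use jd in simp)
          show "B.df (?r + Suc N) (\<lambda>w. h j (take (?r + m) w))"
            by (rule B.df_comp[OF h(2)[OF dN[OF jd]] B.dl_take[OF B.dl_id]]) (use less.prems(2) in simp)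
        qed
        then have "D (?r + Suc N) {w. length w = ?r + Suc N \<and> (take (?r + m) w \<in> C \<and> (\<forall>j<?d. w ! (?r + m + j) = h j (take (?r + m) w)))}"
          by (rule B.D_Collect)
        moreover have "ext C = {w. length w = ?r + Suc N \<and> (take (?r + m) w \<in> C \<and> (\<forall>j<?d. w ! (?r + m + j) = h j (take (?r + m) w)))}"
          unfolding extD using less.prems(2) by (intro Collect_cong conj_cong refl) (simp add: list_eq_iff_nth_eq H_def)
        ultimately have DZ: "D (?r + Suc N) Z" unfolding CC(1) by simp
        have "\<forall>z\<in>Z. z ! (?r + m') = \<phi> (take (?r + m') z)"
        proof
          fix w assume "w \<in> Z"
          then obtain z where z: "w = z @ H z" "z \<in> C" unfolding CC(1) ext_def by blast
          then show "w ! (?r + m') = \<phi> (take (?r + m') w)" using \<phi>(2) lC[OF CC(2) z(2)] mm by (simp add: nth_append)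
        qed
        moreover have "B.df (?r + m') \<phi>" using \<phi>(1) unfolding PD_def by blast
        ultimately show ?thesis using less.IH[OF mm DZ] mm less.prems(2) by simp
      next
        case False
        have T: "set bs2 \<subseteq> {True}"
        proof
          fix b assume "b \<in> set bs2"
          then have "b \<noteq> False" using False by metis
          then show "b \<in> {True}" by simp
        qed
        obtain Z0 where Z0: "rel_cell PD 0 {[]} bs1 Z0" "rel_cell PD ?r Z0 bs2 C"
          using rel_cell_split[of PD 0 "{[]}" bs2 bs1 C] bs(2) b by auto
        have DZ0: "D ?r Z0" using D_rel_cell[OF Z0(1) D_point] b(3) by simp
        have "good_set N ns1 (ext C)" unfolding ext_def H_def
        proof (rule good_set_extension[OF Z0(2) b(2) DZ0 T sC less.prems(2)])
          show "PD (?r + m) C (h j)" if "j < ?d" for j unfolding PD_def using h(2)[OF dN[OF that]] C(2) CC(2) that by blast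
          show "B.df (?r + m) (\<lambda>w. f (sel (jcut ns ns1) (take ?r w) @ drop ?r w))" by (rule B.df_comp[OF less.prems(3) dcat])
          show "(\<delta> ^^ (m + j)) a = h j (jet \<delta> ns1 y @ jl \<delta> m a)"
            if "length y = length ns1" "(\<delta> ^^ m) a = f (sel (jcut ns ns1) (take ?r (jet \<delta> ns1 y @ jl \<delta> m a)) @ drop ?r (jet \<delta> ns1 y @ jl \<delta> m a))" "j < ?d" for y a j
          proof -
            have y: "length y = length ns" using that(1) len by simp
            show ?thesis by (rule h(3)[OF y _ dN[OF that(3)]]) (use that(2) sel_jcut_jet[OF h(1) y, of \<delta>] in simp)
          qed
        qed
        moreover have "ext C \<subseteq> pow (?r + Suc N)" unfolding ext_def using lC[OF CC(2)] lH less.prems(2) by auto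
        ultimately show ?thesis unfolding CC(1) using good_family_self by blast
      qed
    qed
  qed
  then show ?case by blast
qed

text \<open>At m = N + 1 no coordinate of the block is prescribed, so the induction can start with
  an arbitrary \<open>Y\<close>, with the zero function as \<open>f\<close>.\<close>

lemma good_family_exists: "D (tot ns + Suc N) Y ==> \<exists>ns' \<F>. good_family N ns Y ns' \<F>"
  by (rule good_family_exists_aux[OF _ order.refl B.df_zero]) auto

end

lemma near_triangle:
  assumes "near a x y" "near b y z" shows "near (a + b) x z"
  unfolding near_def
proof (intro conjI allI impI)
  show "length x = length z" using assms near_length by metis
  fix i assume i: "i < length x"
  then have "\<bar>x ! i - y ! i\<bar> < a" "\<bar>y ! i - z ! i\<bar> < b" using assms unfolding near_def by auto
  then have "\<bar>x ! i - y ! i\<bar> + \<bar>y ! i - z ! i\<bar> < a + b" by (rule add_strict_mono)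
  then show "\<bar>x ! i - z ! i\<bar> < a + b" using abs_triangle_ineq[of "x ! i - y ! i" "y ! i - z ! i"] by simp
qed

lemma jcut_snoc:
  assumes "le_ord ns ns'" shows "jcut (ns @ [N]) (ns' @ [N]) = jcut ns ns' @ [tot ns'..<tot ns' + Suc N]"
proof -
  have l: "length ns = length ns'" using list_all2_lengthD[OF assms] .
  have "map (\<lambda>(i, j). jet_index (ns' @ [N]) i j) (coords ns) = map (\<lambda>(i, j). jet_index ns' i j) (coords ns)"
    using l by (auto simp: set_coords jet_index_snoc)
  moreover have "map (\<lambda>j. jet_index (ns' @ [N]) (length ns) j) [0..<Suc N] = [tot ns'..<tot ns' + Suc N]"
    unfolding l jet_index_last by (rule nth_equalityI) (auto simp del: upt_Suc)
  ultimately show ?thesis unfolding jcut_def idx_def coords_snoc by (simp add: comp_def del: upt_Suc)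
qed

lemma sel_jcut_snoc:
  assumes "le_ord ns ns'" "length u = tot ns'" "length w = Suc N"
  shows "sel (jcut (ns @ [N]) (ns' @ [N])) (u @ w) = sel (jcut ns ns') u @ w"
proof -
  have "map ((!) (u @ w)) (jcut ns ns') = map ((!) u) (jcut ns ns')"
    using jcut_props(2)[OF assms(1)] assms(2) by (auto simp: nth_append subset_iff)
  moreover have "map ((!) (u @ w)) [tot ns'..<tot ns' + Suc N] = w"
    by (rule nth_equalityI) (use assms(2,3) in \<open>auto simp: nth_append simp del: upt_Suc\<close>)
  ultimately show ?thesis unfolding jcut_snoc[OF assms(1)] sel_def by (simp del: upt_Suc)
qed

context jets
begin

lemma good_setD:
  assumes "good_set N ns F"
  shows "D (tot ns) (take (tot ns) ` F)" "\<exists>bs. length bs = Suc N \<and> rel_cell PD (tot ns) (take (tot ns) ` F) bs F"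
    "\<And>y w \<epsilon>. length y = length ns ==> jet \<delta> ns y @ w \<in> F ==> 0 < \<epsilon> ==> \<exists>a. jet \<delta> ns y @ jl \<delta> (Suc N) a \<in> F \<and> near \<epsilon> w (jl \<delta> (Suc N) a)"
    "\<And>y. length y = length ns ==> jet \<delta> ns y \<in> take (tot ns) ` F ==> \<exists>a. jet \<delta> ns y @ jl \<delta> (Suc N) a \<in> F"
proof -
  obtain bs Z where F: "length bs = Suc N" "D (tot ns) Z" "rel_cell PD (tot ns) Z bs F"
    "\<And>y w \<epsilon>. length y = length ns ==> jet \<delta> ns y \<in> Z ==> jet \<delta> ns y @ w \<in> F ==> 0 < \<epsilon> ==>
      \<exists>a. jet \<delta> ns y @ jl \<delta> (Suc N) a \<in> F \<and> near \<epsilon> w (jl \<delta> (Suc N) a)"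
    using assms unfolding good_set_def by blast
  have lZ: "length z = tot ns" if "z \<in> Z" for z using B.D_length[OF F(2) that] .
  have Z: "take (tot ns) ` F = Z" using rel_cell_base[OF F(3) lZ] .
  show "D (tot ns) (take (tot ns) ` F)" "\<exists>bs. length bs = Suc N \<and> rel_cell PD (tot ns) (take (tot ns) ` F) bs F"
    unfolding Z using F(1-3) by auto
  show 3: "\<exists>a. jet \<delta> ns y @ jl \<delta> (Suc N) a \<in> F \<and> near \<epsilon> w (jl \<delta> (Suc N) a)"
    if "length y = length ns" "jet \<delta> ns y @ w \<in> F" "0 < \<epsilon>" for y w \<epsilon>
    using F(4)[OF that(1) _ that(2,3)] rel_cell_base_into[OF F(3) lZ that(2)] by simp
  show "\<exists>a. jet \<delta> ns y @ jl \<delta> (Suc N) a \<in> F" if "length y = length ns" "jet \<delta> ns y \<in> take (tot ns) ` F" for y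
    using rel_cell_base_onto[OF F(3), of "jet \<delta> ns y"] that(2) 3[OF that(1) _ zero_less_one] unfolding Z by blast
qed

text \<open>Over every jet in its base a good set has a nonempty fibre, which by density contains a
  jet; so the bases cut out the projection as a condition on longer jets of \<open>y\<close>. This
  eliminates one quantifier.\<close>

lemma projection_definable:
  assumes "D (tot ns + Suc N) Y"
  shows "\<exists>ns' W. le_ord ns ns' \<and> D (tot ns') W \<and>
    (\<forall>y. length y = length ns --> (jet \<delta> ns' y \<in> W \<longleftrightarrow> (\<exists>a. jet \<delta> ns y @ jl \<delta> (Suc N) a \<in> Y)))"
proof -
  obtain ns' \<F> where "good_family N ns Y ns' \<F>" using good_family_exists[OF assms] by blast
  then have F: "le_ord ns ns'" "finite \<F>" "\<And>F. F \<in> \<F> ==> good_set N ns' F" "\<And>F. F \<in> \<F> ==> F \<subseteq> lift (Suc N) ns ns' Y"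
    "\<And>y a. length y = length ns ==> jet \<delta> ns y @ jl \<delta> (Suc N) a \<in> Y ==> jet \<delta> ns' y @ jl \<delta> (Suc N) a \<in> \<Union>\<F>"
    unfolding good_family_def by auto
  define W where "W = \<Union>((\<lambda>F. take (tot ns') ` F) ` \<F>)"
  have "D (tot ns') W" unfolding W_def by (rule B.D_Union) (use F(2) good_setD(1)[OF F(3)] in auto)
  moreover have "jet \<delta> ns' y \<in> W \<longleftrightarrow> (\<exists>a. jet \<delta> ns y @ jl \<delta> (Suc N) a \<in> Y)" if y: "length y = length ns" for y
  proof
    assume "jet \<delta> ns' y \<in> W"
    then obtain F where FF: "F \<in> \<F>" "jet \<delta> ns' y \<in> take (tot ns') ` F" unfolding W_def by blast
    have "length y = length ns'" using y list_all2_lengthD[OF F(1)] by simp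
    then obtain a where "jet \<delta> ns' y @ jl \<delta> (Suc N) a \<in> F" using good_setD(4)[OF F(3)[OF FF(1)] _ FF(2)] by blast
    then have "jet \<delta> ns' y @ jl \<delta> (Suc N) a \<in> lift (Suc N) ns ns' Y" using F(4)[OF FF(1)] by blast
    then show "\<exists>a. jet \<delta> ns y @ jl \<delta> (Suc N) a \<in> Y" unfolding lift_jet[OF F(1) y] by blast
  next
    assume "\<exists>a. jet \<delta> ns y @ jl \<delta> (Suc N) a \<in> Y"
    then obtain a F where "F \<in> \<F>" "jet \<delta> ns' y @ jl \<delta> (Suc N) a \<in> F" using F(5)[OF y] by blast
    then show "jet \<delta> ns' y \<in> W" unfolding W_def by (intro UnionI[OF imageI]) (auto intro!: image_eqI[of _ _ "jet \<delta> ns' y @ jl \<delta> (Suc N) a"])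
  qed
  ultimately show ?thesis using F(1) by blast
qed

section \<open>Decompositions of M^k by jets\<close>

definition "dense_jets k ns K \<longleftrightarrow> (\<forall>u\<in>K. \<forall>\<epsilon>>0. \<exists>x. length x = k \<and> jet \<delta> ns x \<in> K \<and> near \<epsilon> u (jet \<delta> ns x))"

text \<open>Only the jets have to be covered, as good families leave gaps elsewhere. Cells in which
  jets are dense have nonempty realizations, so the realizations partition M^k.\<close>

definition "jet_family k ns \<K> \<longleftrightarrow> length ns = k \<and> finite \<K> \<and> disjoint \<K> \<and>
   (\<forall>K\<in>\<K>. cellp (tot ns) K \<and> dense_jets k ns K) \<and> (\<forall>x. length x = k --> jet \<delta> ns x \<in> \<Union>\<K>)"

definition "realize k ns K = {x. length x = k \<and> jet \<delta> ns x \<in> K}"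

text \<open>Each number of variables has its own orders and its own cells. Nothing is asked of M^0,
  since \<open>delta_decomposition\<close> descends to k = 1 only.\<close>

primrec jet_decomposition :: "nat => 'a list set set => bool" where
  "jet_decomposition 0 \<D> \<longleftrightarrow> True"
| "jet_decomposition (Suc k) \<D> \<longleftrightarrow> (\<exists>ns \<K>. jet_family (Suc k) ns \<K> \<and> \<D> = realize (Suc k) ns ` \<K>) \<and>
     jet_decomposition k ((\<lambda>E. take k ` E) ` \<D>)"

definition "pull ns ns' A = {u. length u = tot ns' \<and> sel (jcut ns ns') u \<in> A}"

text \<open>The last block is treated first, uniformly in the other variables, by good families.
  Their bases are conditions on jets of the other variables, to which the induction hypothesis is
  applied. A good set restricted to a smaller cell of its base is again a cell, and jets are dense
  in it because they are dense in the base and in the fibres over jets.\<close>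

lemma jet_decomposition_exists:
  "length ns = k ==> finite \<A> ==> (\<And>A. A \<in> \<A> ==> D (tot ns) A) ==>
   \<exists>ns' \<K>. le_ord ns ns' \<and> jet_family k ns' \<K> \<and> (\<forall>K\<in>\<K>. \<forall>A\<in>\<A>. K \<subseteq> pull ns ns' A \<or> K \<inter> pull ns ns' A = {}) \<and>
     jet_decomposition k (realize k ns' ` \<K>)"
proof (induction k arbitrary: ns \<A>)
  case 0
  then have ns: "ns = []" by simp
  have c: "cellp 0 {[]}" unfolding cellp_def by simp
  have "jet_family 0 [] {{[]}}" unfolding jet_family_def dense_jets_def using c by auto
  moreover have "{[]} \<subseteq> pull [] [] A \<or> {[]} \<inter> pull [] [] A = {}" for A by auto
  ultimately show ?case unfolding ns by (intro exI[of _ "[]"] exI[of _ "{{[]}}"]) simp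
next
  case (Suc k)
  obtain ns0 N where ns: "ns = ns0 @ [N]" "length ns0 = k" using Suc.prems(1) by (metis length_Suc_conv_rev)
  have tot: "tot ns = tot ns0 + Suc N" unfolding ns by simp
  have DA: "D (tot ns0 + Suc N) A" if "A \<in> \<A>" for A using Suc.prems(3)[OF that] unfolding tot .
  \<comment> \<open>The atoms of the Boolean algebra generated by \<open>\<A>\<close>, so that a
    good set inside the lift of one atom is compatible with every member of
    \<open>\<A>\<close>.\<close>
  define atom where "atom S = {z. length z = tot ns0 + Suc N \<and> (\<forall>A\<in>\<A>. z \<in> A \<longleftrightarrow> A \<in> S)}" for S
  have Datom: "D (tot ns0 + Suc N) (atom S)" for S unfolding atom_def
    by (rule B.D_Collect, rule B.dp_finite_Ball[OF Suc.prems(2)], rule B.dp_iff, rule B.dp_memI[OF DA]) (auto intro: B.dp_const)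
  define \<Y> where "\<Y> = atom ` Pow \<A>"
  have "\<exists>ns1 \<F>. good_family N ns0 (pow (tot ns0 + Suc N)) ns1 \<F> \<and> (\<forall>F\<in>\<F>. \<exists>Z\<in>\<Y>. F \<subseteq> lift (Suc N) ns0 ns1 Z)"
  proof (rule good_family_Union[OF le_ord_refl])
    show "finite \<Y>" unfolding \<Y>_def using Suc.prems(2) by simp
    show "disjoint \<Y>"
    proof (rule disjointI)
      fix a b assume "a \<in> \<Y>" "b \<in> \<Y>" "a \<noteq> b"
      then obtain S1 S2 where ab: "a = atom S1" "b = atom S2" "S1 \<subseteq> \<A>" "S2 \<subseteq> \<A>" "S1 \<noteq> S2" unfolding \<Y>_def by (elim imageE) auto
      have "S1 = S2" if zz: "z \<in> atom S1" "z \<in> atom S2" for z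
      proof -
        have "A \<in> S1 \<longleftrightarrow> A \<in> S2" for A
        proof (cases "A \<in> \<A>")
          case True
          then have "z \<in> A \<longleftrightarrow> A \<in> S1" "z \<in> A \<longleftrightarrow> A \<in> S2" using zz unfolding atom_def by auto
          then show ?thesis by simp
        qed (use ab in auto)
        then show ?thesis by auto
      qed
      then show "a \<inter> b = {}" using ab by auto
    qed
    show "Z \<subseteq> lift (Suc N) ns0 ns0 (pow (tot ns0 + Suc N))" if "Z \<in> \<Y>" for Z
    proof
      fix z assume "z \<in> Z"
      then have "length z = tot ns0 + Suc N" using that unfolding \<Y>_def atom_def by auto
      then show "z \<in> lift (Suc N) ns0 ns0 (pow (tot ns0 + Suc N))" unfolding lift_def
        by (intro CollectI exI[of _ "take (tot ns0) z"] exI[of _ "drop (tot ns0) z"]) (simp add: sel_jcut_same)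
    qed
    show "jet \<delta> ns0 y @ jl \<delta> (Suc N) a \<in> \<Union>\<Y>" for y a
    proof -
      let ?z = "jet \<delta> ns0 y @ jl \<delta> (Suc N) a"
      have "?z \<in> atom {A \<in> \<A>. ?z \<in> A}" unfolding atom_def by simp
      moreover have "atom {A \<in> \<A>. ?z \<in> A} \<in> \<Y>" unfolding \<Y>_def by (rule imageI) simp
      ultimately show ?thesis by (rule UnionI[rotated])
    qed
    show "\<exists>ns' \<F>. good_family N ns0 Z ns' \<F>" if "Z \<in> \<Y>" for Z
    proof -
      have "D (tot ns0 + Suc N) Z" using that Datom unfolding \<Y>_def by (elim imageE) simp
      then show ?thesis by (rule good_family_exists)
    qed
  qed
  then obtain ns1 \<F> where GF: "good_family N ns0 (pow (tot ns0 + Suc N)) ns1 \<F>" "\<forall>F\<in>\<F>. \<exists>Z\<in>\<Y>. F \<subseteq> lift (Suc N) ns0 ns1 Z" by blast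
  then have F: "le_ord ns0 ns1" "finite \<F>" "disjoint \<F>" "\<And>F. F \<in> \<F> ==> good_set N ns1 F"
    "\<And>y a. length y = k ==> jet \<delta> ns1 y @ jl \<delta> (Suc N) a \<in> \<Union>\<F>"
    unfolding good_family_def using ns(2) by auto
  define base where "base F = take (tot ns1) ` F" for F :: "'a list set"
  have l1: "length ns1 = k" using list_all2_lengthD[OF F(1)] ns(2) by simp
  have "\<exists>ns2 \<K>. le_ord ns1 ns2 \<and> jet_family k ns2 \<K> \<and> (\<forall>K\<in>\<K>. \<forall>A\<in>base ` \<F>. K \<subseteq> pull ns1 ns2 A \<or> K \<inter> pull ns1 ns2 A = {}) \<and>
     jet_decomposition k (realize k ns2 ` \<K>)"
    by (rule Suc.IH[OF l1]) (use F(2) good_setD(1)[OF F(4)] in \<open>auto simp: base_def\<close>)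
  then obtain ns2 \<K>' where K: "le_ord ns1 ns2" "jet_family k ns2 \<K>'"
    "\<And>K F. K \<in> \<K>' ==> F \<in> \<F> ==> K \<subseteq> pull ns1 ns2 (base F) \<or> K \<inter> pull ns1 ns2 (base F) = {}"
    "jet_decomposition k (realize k ns2 ` \<K>')" by blast
  have Kd: "finite \<K>'" "disjoint \<K>'" "\<And>K. K \<in> \<K>' ==> cellp (tot ns2) K" "\<And>K. K \<in> \<K>' ==> dense_jets k ns2 K"
    "\<And>x. length x = k ==> jet \<delta> ns2 x \<in> \<Union>\<K>'" and l2: "length ns2 = k"
    using K(2) unfolding jet_family_def by auto
  have lK: "length u = tot ns2" if "K \<in> \<K>'" "u \<in> K" for K u
    using B.D_length[OF D_cellp[OF Kd(3)[OF that(1)]] that(2)] .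
  \<comment> \<open>The good set \<open>F\<close> over the cell \<open>K\<close>, rewritten in the
    larger jet space \<open>ns2\<close> in which \<open>K\<close> lives.\<close>
  define KF where "KF = (\<lambda>(K :: 'a list set, F). {u @ w | u w. u \<in> K \<and> length w = Suc N \<and> sel (jcut ns1 ns2) u @ w \<in> F})"
  define \<K> where "\<K> = KF ` {(K, F). K \<in> \<K>' \<and> F \<in> \<F> \<and> K \<subseteq> pull ns1 ns2 (base F)}"
  let ?ns = "ns2 @ [N]"
  have le02: "le_ord ns0 ns2" using le_ord_trans[OF F(1) K(1)] .
  have le: "le_ord ns ?ns" unfolding ns(1) using le02 by (simp add: list_all2_appendI)
  have j2: "sel (jcut ns1 ns2) (jet \<delta> ns2 y) = jet \<delta> ns1 y" if "length y = k" for y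
    by (rule sel_jcut_jet[OF K(1)]) (use that l1 in simp)
  have KF_iff: "u @ w \<in> KF (K, F) \<longleftrightarrow> u \<in> K \<and> length w = Suc N \<and> sel (jcut ns1 ns2) u @ w \<in> F"
    if "K \<in> \<K>'" "length u = tot ns2" for u w K F
    unfolding KF_def using lK[OF that(1)] that(2) by auto
  have jet_KF: "jet \<delta> ns2 y @ w \<in> KF (K, F) \<longleftrightarrow> jet \<delta> ns2 y \<in> K \<and> length w = Suc N \<and> jet \<delta> ns1 y @ w \<in> F"
    if "K \<in> \<K>'" "length y = k" for y w K F
    using KF_iff[OF that(1), of "jet \<delta> ns2 y"] j2[OF that(2)] by simp
  have ext: "\<exists>a. jet \<delta> ns2 y @ jl \<delta> (Suc N) a \<in> KF (K, F)"
    if TT: "K \<in> \<K>'" "F \<in> \<F>" "K \<subseteq> pull ns1 ns2 (base F)" "length y = k" "jet \<delta> ns2 y \<in> K" for K F y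
  proof -
    have "jet \<delta> ns1 y \<in> take (tot ns1) ` F" using subsetD[OF TT(3,5)] j2[OF TT(4)] unfolding pull_def base_def by simp
    then obtain a where "jet \<delta> ns1 y @ jl \<delta> (Suc N) a \<in> F" using good_setD(4)[OF F(4)[OF TT(2)]] TT(4) l1 by auto
    then show ?thesis using jet_KF[OF TT(1,4)] TT(5) by auto
  qed
  have cover: "\<exists>F\<in>\<F>. K \<subseteq> pull ns1 ns2 (base F) \<and> jet \<delta> ns2 y @ jl \<delta> (Suc N) a \<in> KF (K, F)"
    if TT: "K \<in> \<K>'" "length y = k" "jet \<delta> ns2 y \<in> K" for K y a
  proof -
    obtain F0 where F0: "F0 \<in> \<F>" "jet \<delta> ns1 y @ jl \<delta> (Suc N) a \<in> F0" using F(5)[OF TT(2)] by blast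
    then have "jet \<delta> ns1 y \<in> base F0" unfolding base_def by (intro image_eqI[OF _ F0(2)]) simp
    then have "jet \<delta> ns2 y \<in> pull ns1 ns2 (base F0)" unfolding pull_def using j2[OF TT(2)] by simp
    then have "K \<subseteq> pull ns1 ns2 (base F0)" using K(3)[OF TT(1) F0(1)] TT(3) by blast
    then show ?thesis using F0 jet_KF[OF TT(1,2)] TT(3) by auto
  qed
  have proj: "take k ` realize (Suc k) ?ns (KF (K, F)) = realize k ns2 K"
    if KK: "K \<in> \<K>'" "F \<in> \<F>" "K \<subseteq> pull ns1 ns2 (base F)" for K F
  proof (intro equalityI subsetI)
    fix y assume "y \<in> take k ` realize (Suc k) ?ns (KF (K, F))"
    then obtain x where x: "y = take k x" "length x = Suc k" "jet \<delta> ?ns x \<in> KF (K, F)" unfolding realize_def by blast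
    then obtain a where xa: "x = y @ [a]" "length y = k" using take_snoc_nth[OF x(2)] by (metis length_take lessI less_imp_le_nat min.absorb2)
    have "jet \<delta> ?ns x = jet \<delta> ns2 y @ jl \<delta> (Suc N) a" unfolding xa by (rule jet_snoc) (simp add: xa l2)
    then show "y \<in> realize k ns2 K" unfolding realize_def using x(3) jet_KF[OF KK(1) xa(2)] xa(2) by simp
  next
    fix y assume "y \<in> realize k ns2 K"
    then have y: "length y = k" "jet \<delta> ns2 y \<in> K" unfolding realize_def by auto
    obtain a where a: "jet \<delta> ns2 y @ jl \<delta> (Suc N) a \<in> KF (K, F)" using ext[OF KK y] by blast
    then have "y @ [a] \<in> realize (Suc k) ?ns (KF (K, F))" unfolding realize_def using jet_snoc[of y ns2 \<delta> N a] y(1) l2 by simp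
    then show "y \<in> take k ` realize (Suc k) ?ns (KF (K, F))" by (rule image_eqI[rotated]) (simp add: y)
  qed
  have fam: "jet_family (Suc k) ?ns \<K>" unfolding jet_family_def
  proof (intro conjI ballI allI impI)
    show "length ?ns = Suc k" using l2 by simp
    show "finite \<K>" unfolding \<K>_def
      by (rule finite_imageI, rule finite_subset[of _ "\<K>' \<times> \<F>"]) (use Kd(1) F(2) in auto)
    show "disjoint \<K>"
    proof (rule disjointI, rule ccontr)
      fix a b assume "a \<in> \<K>" "b \<in> \<K>" "a \<noteq> b" "a \<inter> b \<noteq> {}"
      then obtain K1 F1 K2 F2 where ab: "a = KF (K1, F1)" "b = KF (K2, F2)" "K1 \<in> \<K>'" "F1 \<in> \<F>" "K2 \<in> \<K>'" "F2 \<in> \<F>"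
        unfolding \<K>_def by auto
      obtain z where z: "z \<in> a" "z \<in> b" using \<open>a \<inter> b \<noteq> {}\<close> by blast
      then obtain u w where uw: "z = u @ w" "u \<in> K1" "sel (jcut ns1 ns2) u @ w \<in> F1" unfolding ab KF_def by auto
      then have "u \<in> K2" "sel (jcut ns1 ns2) u @ w \<in> F2" using z(2) KF_iff[OF ab(5) lK[OF ab(3) uw(2)]] unfolding ab by auto
      then have "K1 = K2" "F1 = F2" using disjointD[OF Kd(2) ab(3,5)] disjointD[OF F(3) ab(4,6)] uw by blast+
      then show False using \<open>a \<noteq> b\<close> ab by simp
    qed
    fix E assume "E \<in> \<K>"
    then obtain K F where E: "E = KF (K, F)" "K \<in> \<K>'" "F \<in> \<F>" "K \<subseteq> pull ns1 ns2 (base F)" unfolding \<K>_def by auto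
    obtain bs where bs: "length bs = Suc N" "rel_cell PD (tot ns1) (base F) bs F" using good_setD(2)[OF F(4)[OF E(3)]] unfolding base_def by blast
    have sK: "K \<subseteq> {u. length u = tot ns2 \<and> sel (jcut ns1 ns2) u \<in> base F}" using E(4) unfolding pull_def .
    have "rel_cell PD (tot ns2) K bs {u @ w | u w. u \<in> K \<and> length w = length bs \<and> sel (jcut ns1 ns2) u @ w \<in> F}"
      by (rule rel_cell_pull[OF bs(2) jcut_props(1)[OF K(1)] sK]) (rule PD_pull[OF _ jcut_props(1,3,2)[OF K(1)]])
    then have rc: "rel_cell PD (tot ns2) K bs E" unfolding E(1) KF_def bs(1) by simp
    obtain bs' where bs': "length bs' = tot ns2" "rel_cell PD 0 {[]} bs' K" using Kd(3)[OF E(2)] unfolding cellp_def by blast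
    have "rel_cell PD 0 {[]} (bs @ bs') E" by (rule rel_cell_join[OF bs'(2)]) (use rc bs'(1) in simp)
    then show "cellp (tot ?ns) E" unfolding cellp_def using bs(1) bs'(1) by (intro exI[of _ "bs @ bs'"]) simp
    show "dense_jets (Suc k) ?ns E" unfolding dense_jets_def
    proof (intro ballI allI impI)
      fix z and \<epsilon> :: 'a assume z: "z \<in> E" "0 < \<epsilon>"
      then obtain u w where uw: "z = u @ w" "u \<in> K" unfolding E(1) KF_def by auto
      have e2: "0 < \<epsilon> / 2" using z(2) by simp
      \<comment> \<open>A jet near \<open>u\<close> is found in \<open>K\<close>, the fibre
        coordinates following within \<open>\<epsilon> / 2\<close>; density in the fibre over that
        jet costs the other half.\<close>
      have "\<exists>\<eta>>0. \<forall>u'\<in>K. near \<eta> u u' --> (\<exists>w'. u' @ w' \<in> E \<and> near (\<epsilon> / 2) w w')"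
        by (rule rel_cell_near_base[OF rc _ lK[OF E(2)] uw(2) _ e2]) (use z(1) uw(1) PD_cont_on in auto)
      then obtain \<eta> where \<eta>: "0 < \<eta>" "\<And>u'. u' \<in> K ==> near \<eta> u u' ==> \<exists>w'. u' @ w' \<in> E \<and> near (\<epsilon> / 2) w w'" by blast
      obtain y where y: "length y = k" "jet \<delta> ns2 y \<in> K" "near (min \<eta> \<epsilon>) u (jet \<delta> ns2 y)"
        using Kd(4)[OF E(2)] uw(2) \<eta>(1) z(2) unfolding dense_jets_def by (meson min_less_iff_conj)
      obtain w' where w': "jet \<delta> ns2 y @ w' \<in> E" "near (\<epsilon> / 2) w w'" using \<eta>(2)[OF y(2)] y(3) by auto
      have "jet \<delta> ns1 y @ w' \<in> F" using w'(1) jet_KF[OF E(2) y(1)] unfolding E(1) by blast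
      then obtain a where a: "jet \<delta> ns1 y @ jl \<delta> (Suc N) a \<in> F" "near (\<epsilon> / 2) w' (jl \<delta> (Suc N) a)"
        using good_setD(3)[OF F(4)[OF E(3)], of y w' "\<epsilon> / 2"] y(1) l1 e2 by auto
      have j: "jet \<delta> ?ns (y @ [a]) = jet \<delta> ns2 y @ jl \<delta> (Suc N) a" by (rule jet_snoc) (simp add: y l2)
      have "jet \<delta> ?ns (y @ [a]) \<in> E" unfolding j E(1) using jet_KF[OF E(2) y(1)] y(2) a(1) by simp
      moreover have "near \<epsilon> w (jl \<delta> (Suc N) a)" using near_triangle[OF w'(2) a(2)] by simp
      then have "near \<epsilon> z (jet \<delta> ?ns (y @ [a]))" unfolding j uw(1) using y(3) lK[OF E(2) uw(2)] by simp
      ultimately show "\<exists>x. length x = Suc k \<and> jet \<delta> ?ns x \<in> E \<and> near \<epsilon> z (jet \<delta> ?ns x)" using y(1) by (intro exI[of _ "y @ [a]"]) simp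
    qed
  next
    fix x :: "'a list" assume "length x = Suc k"
    then obtain y a where x: "x = y @ [a]" "length y = k" by (metis length_Suc_conv_rev)
    have j: "jet \<delta> ?ns x = jet \<delta> ns2 y @ jl \<delta> (Suc N) a" unfolding x by (rule jet_snoc) (simp add: x l2)
    obtain K where KK: "K \<in> \<K>'" "jet \<delta> ns2 y \<in> K" using Kd(5)[OF x(2)] by blast
    obtain F where "F \<in> \<F>" "K \<subseteq> pull ns1 ns2 (base F)" "jet \<delta> ns2 y @ jl \<delta> (Suc N) a \<in> KF (K, F)" using cover[OF KK(1) x(2) KK(2)] by blast
    then show "jet \<delta> ?ns x \<in> \<Union>\<K>" unfolding \<K>_def j using KK(1) by auto
  qed
  have compat: "E \<subseteq> pull ns ?ns A \<or> E \<inter> pull ns ?ns A = {}" if EA: "E \<in> \<K>" "A \<in> \<A>" for E A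
  proof -
    obtain K F where E: "E = KF (K, F)" "K \<in> \<K>'" "F \<in> \<F>" using EA(1) unfolding \<K>_def by auto
    obtain S where S: "F \<subseteq> lift (Suc N) ns0 ns1 (atom S)" using GF(2) E(3) unfolding \<Y>_def by blast
    have "z \<in> pull ns ?ns A \<longleftrightarrow> A \<in> S" if ZE: "z \<in> E" for z
    proof -
      obtain u w where z: "z = u @ w" "u \<in> K" "length w = Suc N" "sel (jcut ns1 ns2) u @ w \<in> F" using ZE unfolding E(1) KF_def by auto
      have lu: "length u = tot ns2" using lK[OF E(2) z(2)] .
      have "sel (jcut ns ?ns) z = sel (jcut ns0 ns2) u @ w" unfolding ns(1) z(1) by (rule sel_jcut_snoc[OF le02 lu z(3)])
      moreover have "sel (jcut ns1 ns2) u @ w \<in> lift (Suc N) ns0 ns1 (atom S)" using S z(4) by blast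
      then have "sel (jcut ns0 ns2) u @ w \<in> atom S"
        using lift_iff[of "sel (jcut ns1 ns2) u" ns1 w "Suc N" ns0 "atom S"] jcut_props(1)[OF K(1)] sel_jcut_jcut[OF F(1) K(1), of u] by simp
      ultimately show ?thesis unfolding pull_def atom_def using EA(2) lu z(1,3) by simp
    qed
    then show ?thesis by blast
  qed
  have "(\<lambda>E. take k ` E) ` realize (Suc k) ?ns ` \<K> = realize k ns2 ` \<K>'"
  proof (intro equalityI subsetI)
    fix E assume "E \<in> (\<lambda>E. take k ` E) ` realize (Suc k) ?ns ` \<K>"
    then obtain K F where "E = take k ` realize (Suc k) ?ns (KF (K, F))" "K \<in> \<K>'" "F \<in> \<F>" "K \<subseteq> pull ns1 ns2 (base F)" unfolding \<K>_def by auto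
    then show "E \<in> realize k ns2 ` \<K>'" using proj[of K F] by blast
  next
    fix E assume "E \<in> realize k ns2 ` \<K>'"
    then obtain K where KK: "K \<in> \<K>'" "E = realize k ns2 K" by blast
    obtain u where "u \<in> K" using cellp_nonempty[OF Kd(3)[OF KK(1)]] by blast
    then obtain y where y: "length y = k" "jet \<delta> ns2 y \<in> K" using Kd(4)[OF KK(1)] zero_less_one unfolding dense_jets_def by blast
    \<comment> \<open>Any value of \<open>a\<close> serves here: it shows that the base of some good
      set contains \<open>K\<close>, hence that the realization of \<open>K\<close> is a
      projection.\<close>
    obtain F where F0: "F \<in> \<F>" "K \<subseteq> pull ns1 ns2 (base F)" using cover[OF KK(1) y, of 0] by blast
    then have "KF (K, F) \<in> \<K>" unfolding \<K>_def using KK(1) by auto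
    then show "E \<in> (\<lambda>E. take k ` E) ` realize (Suc k) ?ns ` \<K>" unfolding KK(2) proj[OF KK(1) F0, symmetric] by blast
  qed
  then have "jet_decomposition (Suc k) (realize (Suc k) ?ns ` \<K>)" using fam K(4) by auto
  then show ?case using le fam compat by blast
qed

end

section \<open>Quantifier elimination with parameters\<close>

primrec tr_tm :: "('f => 'g tm list => 'g tm) => (nat => 'g tm) => 'f tm => 'g tm" where
  "tr_tm g \<sigma> (Var i) = \<sigma> i"
| "tr_tm g \<sigma> (Fn f ts) = g f (map (tr_tm g \<sigma>) ts)"

text \<open>Only applied to quantifier-free formulas.\<close>

primrec tr_fm :: "('f => 'g tm list => 'g tm) => (nat => 'g tm) => ('f, 'r) fm => ('g, 'r) fm" where
  "tr_fm g \<sigma> (Eq s t) = Eq (tr_tm g \<sigma> s) (tr_tm g \<sigma> t)"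
| "tr_fm g \<sigma> (Rel r ts) = Rel r (map (tr_tm g \<sigma>) ts)"
| "tr_fm g \<sigma> (Neg \<phi>) = Neg (tr_fm g \<sigma> \<phi>)"
| "tr_fm g \<sigma> (Conj \<phi> \<psi>) = Conj (tr_fm g \<sigma> \<phi>) (tr_fm g \<sigma> \<psi>)"
| "tr_fm g \<sigma> (All v \<phi>) = All v (tr_fm g \<sigma> \<phi>)"

lemma tr_tm_pred:
  assumes "wf_tm L t" "\<And>i. i \<in> fv_tm t ==> Q (\<sigma> i)"
    "\<And>f ts. f \<in> syms_tm t ==> length ts = farity L f ==> (\<And>t. t \<in> set ts ==> Q t) ==> Q (g f ts)"
  shows "Q (tr_tm g \<sigma> t)"
  using assms
proof (induction t)
  case (Fn f ts)
  have "Q (tr_tm g \<sigma> t)" if "t \<in> set ts" for t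
  proof (rule Fn.IH[OF that])
    fix f' ts' assume "f' \<in> syms_tm t" "length ts' = farity L f'" "\<And>t. t \<in> set ts' ==> Q t"
    then show "Q (g f' ts')" using that by (intro Fn.prems(3)) auto
  qed (use Fn.prems(1,2) that in auto)
  then have "Q (g f (map (tr_tm g \<sigma>) ts))" by (intro Fn.prems(3)) (use Fn.prems(1) in auto)
  then show ?case by simp
qed simp

lemma eval_tr_tm:
  assumes "\<And>i. i \<in> fv_tm t ==> eval_tm S2 e2 (\<sigma> i) = h (e1 i)"
    "\<And>f ts xs. f \<in> syms_tm t ==> map (eval_tm S2 e2) ts = map h xs ==> eval_tm S2 e2 (g f ts) = h (fint S1 f xs)"
  shows "eval_tm S2 e2 (tr_tm g \<sigma> t) = h (eval_tm S1 e1 t)"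
  using assms
proof (induction t)
  case (Fn f ts)
  have "eval_tm S2 e2 (tr_tm g \<sigma> t) = h (eval_tm S1 e1 t)" if "t \<in> set ts" for t
  proof (rule Fn.IH[OF that])
    fix f' ts' xs assume "f' \<in> syms_tm t" "map (eval_tm S2 e2) ts' = map h xs"
    then show "eval_tm S2 e2 (g f' ts') = h (fint S1 f' xs)" using that by (intro Fn.prems(2)) auto
  qed (use Fn.prems(1) that in auto)
  then have "map (eval_tm S2 e2) (map (tr_tm g \<sigma>) ts) = map h (map (eval_tm S1 e1) ts)" by simp
  then have "eval_tm S2 e2 (g f (map (tr_tm g \<sigma>) ts)) = h (fint S1 f (map (eval_tm S1 e1) ts))"
    by (intro Fn.prems(2)) auto
  then show ?case by simp
qed simp

text \<open>One substitution lemma for all translations below: \<open>g\<close> translates symbols,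
  \<open>\<sigma>\<close> variables, and \<open>h\<close> maps the universes, being the identity or
  \<open>Inl\<close>. Quantifier-free formulas leave no room for capture of variables.\<close>

lemma sat_tr_fm:
  assumes "quantifier_free \<phi>" "inj h" "\<And>r xs. rint S2 r (map h xs) = rint S1 r xs"
    "\<And>i. i \<in> fv_fm \<phi> ==> eval_tm S2 e2 (\<sigma> i) = h (e1 i)"
    "\<And>f ts xs. f \<in> syms_fm \<phi> ==> map (eval_tm S2 e2) ts = map h xs ==> eval_tm S2 e2 (g f ts) = h (fint S1 f xs)"
  shows "sat S2 e2 (tr_fm g \<sigma> \<phi>) \<longleftrightarrow> sat S1 e1 \<phi>"
  using assms
proof (induction \<phi>)
  case (Eq s t)
  have "eval_tm S2 e2 (tr_tm g \<sigma> s) = h (eval_tm S1 e1 s)" by (rule eval_tr_tm) (use Eq.prems in auto)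
  moreover have "eval_tm S2 e2 (tr_tm g \<sigma> t) = h (eval_tm S1 e1 t)" by (rule eval_tr_tm) (use Eq.prems in auto)
  ultimately show ?case using Eq.prems(2) by (simp add: inj_eq)
next
  case (Rel r ts)
  have "eval_tm S2 e2 (tr_tm g \<sigma> t) = h (eval_tm S1 e1 t)" if "t \<in> set ts" for t
  proof (rule eval_tr_tm)
    fix f ts' xs assume "f \<in> syms_tm t" "map (eval_tm S2 e2) ts' = map h xs"
    then show "eval_tm S2 e2 (g f ts') = h (fint S1 f xs)" using that by (intro Rel.prems(5)) auto
  qed (use Rel.prems(4) that in auto)
  then have "map (eval_tm S2 e2) (map (tr_tm g \<sigma>) ts) = map h (map (eval_tm S1 e1) ts)" by simp
  then show ?case using Rel.prems(3)[of r "map (eval_tm S1 e1) ts"] by (simp del: map_map)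
next
  case (Neg \<phi>)
  have "sat S2 e2 (tr_fm g \<sigma> \<phi>) \<longleftrightarrow> sat S1 e1 \<phi>"
    by (rule Neg.IH[OF _ Neg.prems(2,3)]) (use Neg.prems(1,4,5) in simp_all)
  then show ?case by simp
next
  case (Conj \<phi> \<psi>)
  have "sat S2 e2 (tr_fm g \<sigma> \<phi>) \<longleftrightarrow> sat S1 e1 \<phi>"
    by (rule Conj.IH(1)[OF _ Conj.prems(2,3)]) (use Conj.prems(1,4,5) in simp_all)
  moreover have "sat S2 e2 (tr_fm g \<sigma> \<psi>) \<longleftrightarrow> sat S1 e1 \<psi>"
    by (rule Conj.IH(2)[OF _ Conj.prems(2,3)]) (use Conj.prems(1,4,5) in simp_all)
  ultimately show ?case by simp
qed simp

lemma tr_tm_Var [simp]: "tr_tm Fn Var t = t"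
  by (induction t) (simp_all cong: map_cong add: map_idI)

lemma eval_tm_cong: "(\<And>i. i \<in> fv_tm t ==> e i = e' i) ==> eval_tm S e t = eval_tm S e' t"
proof (induction t)
  case (Fn f ts)
  have "eval_tm S e t = eval_tm S e' t" if "t \<in> set ts" for t
    by (rule Fn.IH[OF that]) (use Fn.prems that in auto)
  then show ?case by (simp cong: map_cong)
qed simp

lemma sat_cong: "(\<And>i. i \<in> fv_fm \<phi> ==> e i = e' i) ==> sat S e \<phi> \<longleftrightarrow> sat S e' \<phi>"
proof (induction \<phi> arbitrary: e e')
  case (Eq s t)
  then show ?case using eval_tm_cong[of s e e' S] eval_tm_cong[of t e e' S] by auto
next
  case (Rel r ts)
  have "eval_tm S e t = eval_tm S e' t" if "t \<in> set ts" for t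
    by (rule eval_tm_cong) (use Rel that in auto)
  then show ?case by (simp cong: map_cong)
next
  case (Neg \<phi>)
  have "sat S e \<phi> = sat S e' \<phi>" by (rule Neg.IH) (use Neg.prems in simp)
  then show ?case by simp
next
  case (Conj \<phi> \<psi>)
  have "sat S e \<phi> = sat S e' \<phi>" "sat S e \<psi> = sat S e' \<psi>" by (rule Conj.IH, use Conj.prems in simp)+
  then show ?case by simp
next
  case (All v \<phi>)
  have "sat S (e(v := a)) \<phi> = sat S (e'(v := a)) \<phi>" for a by (rule All.IH) (use All.prems in auto)
  then show ?case by simp
qed

lemma atom_terms_tr_fm: "atom_terms (tr_fm g \<sigma> \<phi>) = tr_tm g \<sigma> ` atom_terms \<phi>"
  by (induction \<phi>) auto

lemma quantifier_free_tr_fm [simp]: "quantifier_free (tr_fm g \<sigma> \<phi>) = quantifier_free \<phi>"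
  by (induction \<phi>) auto

lemma fv_atom_terms: "quantifier_free \<phi> ==> fv_fm \<phi> = \<Union> (fv_tm ` atom_terms \<phi>)"
  by (induction \<phi>) auto

lemma syms_atom_terms: "syms_fm \<phi> = \<Union> (syms_tm ` atom_terms \<phi>)"
  by (induction \<phi>) auto

lemma wf_atom_terms: "wf_fm L \<phi> ==> t \<in> atom_terms \<phi> ==> wf_tm L t"
  by (induction \<phi>) auto

lemma wf_tr_fm:
  assumes "wf_fm L1 \<phi>" "\<And>r. rarity L2 r = rarity L1 r" "\<And>t. t \<in> atom_terms (tr_fm g \<sigma> \<phi>) ==> wf_tm L2 t"
  shows "wf_fm L2 (tr_fm g \<sigma> \<phi>)"
  using assms by (induction \<phi>) auto

lemma atom_terms_tr_pred:
  assumes "wf_fm L \<phi>" "quantifier_free \<phi>" "\<And>i. i \<in> fv_fm \<phi> ==> Q (\<sigma> i)"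
    "\<And>f ts. f \<in> syms_fm \<phi> ==> length ts = farity L f ==> (\<And>t. t \<in> set ts ==> Q t) ==> Q (g f ts)"
    "t \<in> atom_terms (tr_fm g \<sigma> \<phi>)"
  shows "Q t"
proof -
  obtain s where s: "s \<in> atom_terms \<phi>" "t = tr_tm g \<sigma> s" using assms(5) unfolding atom_terms_tr_fm by blast
  have "fv_tm s \<subseteq> fv_fm \<phi>" "syms_tm s \<subseteq> syms_fm \<phi>"
    using s(1) unfolding fv_atom_terms[OF assms(2)] syms_atom_terms by auto
  then have s': "\<And>i. i \<in> fv_tm s ==> i \<in> fv_fm \<phi>" "\<And>f. f \<in> syms_tm s ==> f \<in> syms_fm \<phi>" by auto
  have "Q (tr_tm g \<sigma> s)"
    by (rule tr_tm_pred[OF wf_atom_terms[OF assms(1) s(1)] assms(3)[OF s'(1)] assms(4)[OF s'(2)]])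
  then show ?thesis using s by simp
qed

lemma fv_tm_finite [simp]: "finite (fv_tm t)"
  by (induction t) auto

lemma fv_fm_finite [simp]: "finite (fv_fm \<phi>)"
  by (induction \<phi>) auto

lemma params_finite [simp]: "finite (params \<phi>)"
proof -
  have "params \<phi> = Par -` syms_fm \<phi>" unfolding params_def by auto
  then show ?thesis by (simp add: finite_vimageI inj_def)
qed

text \<open>The hypotheses on T speak of models inside the larger type
  \<open>'a + ('f, 'r) fm\<close>; this is the copy of the given structure there.\<close>

definition emb_struct :: "('u, 'f, 'r) struct => ('u + 'v, 'f, 'r) struct" where
  "emb_struct S = \<lparr>univ = Inl ` univ S, fint = (\<lambda>f xs. Inl (fint S f (map projl xs))),
     rint = (\<lambda>r xs. rint S r (map projl xs))\<rparr>"

lemma emb_struct_simps [simp]: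
  "univ (emb_struct S) = Inl ` univ S" "fint (emb_struct S) f xs = Inl (fint S f (map projl xs))"
  "rint (emb_struct S) r xs = rint S r (map projl xs)"
  by (simp_all add: emb_struct_def)

lemma sat_emb:
  fixes S :: "('u, 'f, 'r) struct"
  assumes "univ S = UNIV" shows "sat (emb_struct S :: ('u + 'v, 'f, 'r) struct) (Inl \<circ> e) \<phi> \<longleftrightarrow> sat S e \<phi>"
proof -
  let ?S = "emb_struct S :: ('u + 'v, 'f, 'r) struct"
  have t: "eval_tm ?S (Inl \<circ> e) t = Inl (eval_tm S e t)" for e t
    using eval_tr_tm[of t ?S "Inl \<circ> e" Var Inl e Fn S] tr_tm_Var[of t] by (simp add: comp_def)
  have u: "(\<lambda>i. Inl (e i))(v := Inl a) = (\<lambda>i. Inl ((e(v := a)) i))" for e :: "nat => 'u" and v a by auto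
  show ?thesis
  proof (induction \<phi> arbitrary: e)
    case (Rel r ts)
    have "map (eval_tm ?S (Inl \<circ> e)) ts = map (Inl \<circ> eval_tm S e) ts" using t by simp
    then have "map projl (map (eval_tm ?S (Inl \<circ> e)) ts) = map (eval_tm S e) ts" by simp
    then have "map projl (map (eval_tm ?S (\<lambda>i. Inl (e i))) ts) = map (eval_tm S e) ts" unfolding comp_def .
    then show ?case by (simp del: map_map)
  next
    case (All v \<phi>)
    have "univ ?S = range Inl" using assms by (simp add: emb_struct_def)
    then show ?case using All assms by (simp add: u del: fun_upd_apply)
  qed (auto simp: t)
qed

lemma range_Inl: "range e \<subseteq> range Inl ==> e = Inl \<circ> (projl \<circ> e)"
proof
  fix i assume "range e \<subseteq> range Inl"
  then have "e i \<in> range Inl" by blast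
  then show "e i = (Inl \<circ> (projl \<circ> e)) i" by auto
qed

lemma is_model_emb:
  fixes S :: "('u, 'f, 'r) struct"
  assumes "is_model L T S" "univ S = UNIV" shows "is_model L T (emb_struct S :: ('u + 'v, 'f, 'r) struct)"
proof -
  let ?S = "emb_struct S :: ('u + 'v, 'f, 'r) struct"
  have "is_struct L ?S" using assms(2) unfolding is_struct_def emb_struct_def by simp
  moreover have "valid ?S \<phi>" if "valid S \<phi>" for \<phi>
    unfolding valid_def
  proof (intro allI impI)
    fix e :: "nat => 'u + 'v" assume "range e \<subseteq> univ ?S"
    then have "e = Inl \<circ> (projl \<circ> e)" using assms(2) by (intro range_Inl) (simp add: emb_struct_def)
    moreover have "sat S (projl \<circ> e) \<phi>" using that assms(2) unfolding valid_def by simp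
    ultimately show "sat ?S e \<phi>" using sat_emb[OF assms(2)] by metis
  qed
  ultimately show ?thesis using assms(1) unfolding is_model_def by auto
qed

lemma has_QE_UNIV:
  fixes S :: "('u, 'f, 'r) struct"
  assumes "has_QE TYPE('u + 'v) L T" "is_model L T S" "univ S = UNIV" "wf_fm L \<phi>"
  shows "\<exists>\<psi>. wf_fm L \<psi> \<and> quantifier_free \<psi> \<and> fv_fm \<psi> \<subseteq> fv_fm \<phi> \<and> (\<forall>e. sat S e \<phi> \<longleftrightarrow> sat S e \<psi>)"
proof -
  have m: "is_model L T (emb_struct S :: ('u + 'v, 'f, 'r) struct)" by (rule is_model_emb[OF assms(2,3)])
  obtain \<psi> where \<psi>: "wf_fm L \<psi>" "quantifier_free \<psi>" "fv_fm \<psi> \<subseteq> fv_fm \<phi>"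
    "\<forall>S :: ('u + 'v, 'f, 'r) struct. is_model L T S --> (\<forall>e. range e \<subseteq> univ S --> (sat S e \<phi> \<longleftrightarrow> sat S e \<psi>))"
    using assms(1,4) unfolding has_QE_def by blast
  have "sat S e \<phi> \<longleftrightarrow> sat S e \<psi>" for e
  proof -
    have "range (Inl \<circ> e) \<subseteq> univ (emb_struct S :: ('u + 'v, 'f, 'r) struct)" using assms(3) by (auto simp: emb_struct_def)
    then have "sat (emb_struct S :: ('u + 'v, 'f, 'r) struct) (Inl \<circ> e) \<phi> \<longleftrightarrow> sat (emb_struct S :: ('u + 'v, 'f, 'r) struct) (Inl \<circ> e) \<psi>"
      using \<psi>(4) m by blast
    then show ?thesis using sat_emb[OF assms(3)] by blast
  qed
  then show ?thesis using \<psi> by blast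
qed

lemma param_struct_simps [simp]:
  "univ (param_struct S) = univ S" "fint (param_struct S) (Sym f) xs = fint S f xs"
  "fint (param_struct S) (Par a) xs = a" "rint (param_struct S) = rint S"
  by (simp_all add: param_struct_def)

lemma param_lang_simps [simp]:
  "farity (param_lang L) (Sym f) = farity L f" "farity (param_lang L) (Par a) = 0" "rarity (param_lang L) = rarity L"
  by (simp_all add: param_lang_def)

section \<open>Parameters as variables\<close>

primrec var_of_par :: "('u => nat) => ('f, 'u) psym => 'f tm list => 'f tm" where
  "var_of_par N (Sym f) ts = Fn f ts"
| "var_of_par N (Par a) ts = Var (N a)"

lemma par_to_var:
  fixes S :: "('u, 'f, 'r) struct" and \<psi> :: "(('f, 'u) psym, 'r) fm" and M :: "nat => nat" and N :: "'u => nat"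
  assumes "wf_fm (param_lang L :: (('f, 'u) psym, 'r) lang) \<psi>" "quantifier_free \<psi>"
  defines "\<psi>0 \<equiv> tr_fm (var_of_par N) (\<lambda>i. Var (M i)) \<psi>"
  shows "wf_fm L \<psi>0" "fv_fm \<psi>0 \<subseteq> M ` fv_fm \<psi> \<union> N ` params \<psi>"
    "(\<And>a. a \<in> params \<psi> ==> e (N a) = a) ==> sat S e \<psi>0 \<longleftrightarrow> sat (param_struct S) (\<lambda>i. e (M i)) \<psi>"
proof -
  have "wf_tm L t \<and> fv_tm t \<subseteq> M ` fv_fm \<psi> \<union> N ` params \<psi>" if "t \<in> atom_terms \<psi>0" for t
  proof (rule atom_terms_tr_pred[where Q = "\<lambda>t. wf_tm L t \<and> fv_tm t \<subseteq> M ` fv_fm \<psi> \<union> N ` params \<psi>", OF assms(1,2) _ _ that[unfolded \<psi>0_def]])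
    fix f and ts :: "'f tm list"
    assume "f \<in> syms_fm \<psi>" "length ts = farity (param_lang L :: (('f, 'u) psym, 'r) lang) f"
      "\<And>t. t \<in> set ts ==> wf_tm L t \<and> fv_tm t \<subseteq> M ` fv_fm \<psi> \<union> N ` params \<psi>"
    note A = this
    show "wf_tm L (var_of_par N f ts) \<and> fv_tm (var_of_par N f ts) \<subseteq> M ` fv_fm \<psi> \<union> N ` params \<psi>"
    proof (cases f)
      case (Par a)
      then have "a \<in> params \<psi>" using \<open>f \<in> syms_fm \<psi>\<close> by (simp add: params_def)
      then show ?thesis using Par by simp
    next
      case (Sym f')
      have "wf_tm L (Fn f' ts)" using A(2,3) Sym by simp
      moreover have "fv_tm (Fn f' ts) \<subseteq> M ` fv_fm \<psi> \<union> N ` params \<psi>" using A(3) by (simp add: UN_subset_iff)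
      ultimately show ?thesis using Sym by simp
    qed
  qed simp
  moreover have "quantifier_free \<psi>0" unfolding \<psi>0_def using assms(2) by simp
  ultimately show "wf_fm L \<psi>0" "fv_fm \<psi>0 \<subseteq> M ` fv_fm \<psi> \<union> N ` params \<psi>"
    using wf_tr_fm[OF assms(1), of L] unfolding \<psi>0_def by (auto simp: fv_atom_terms)
  assume a: "\<And>a. a \<in> params \<psi> ==> e (N a) = a"
  show "sat S e \<psi>0 \<longleftrightarrow> sat (param_struct S) (\<lambda>i. e (M i)) \<psi>"
    unfolding \<psi>0_def
  proof (rule sat_tr_fm[OF assms(2), of id])
    fix f ts xs assume "f \<in> syms_fm \<psi>" "map (eval_tm S e) ts = map id xs"
    note A = this
    show "eval_tm S e (var_of_par N f ts) = id (fint (param_struct S) f xs)"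
    proof (cases f)
      case (Par b)
      then have "b \<in> params \<psi>" using \<open>f \<in> syms_fm \<psi>\<close> by (simp add: params_def)
      then show ?thesis using Par a by simp
    qed (use A(2) in simp)
  qed auto
qed

lemma var_to_par:
  fixes S :: "('u, 'f, 'r) struct" and \<psi> :: "('f, 'r) fm" and M :: "nat => nat" and p :: "nat => 'u option"
  assumes "wf_fm L \<psi>" "quantifier_free \<psi>"
  defines "\<psi>1 \<equiv> tr_fm (\<lambda>f. Fn (Sym f)) (\<lambda>i. case p i of None => Var (M i) | Some a => Fn (Par a) []) \<psi>"
  shows "wf_fm (param_lang L :: (('f, 'u) psym, 'r) lang) \<psi>1" "fv_fm \<psi>1 \<subseteq> M ` {i \<in> fv_fm \<psi>. p i = None}"
    "params \<psi>1 \<subseteq> {a. \<exists>i\<in>fv_fm \<psi>. p i = Some a}"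
    "sat (param_struct S) e \<psi>1 \<longleftrightarrow> sat S (\<lambda>i. case p i of None => e (M i) | Some a => a) \<psi>"
proof -
  let ?Q = "\<lambda>t. wf_tm (param_lang L :: (('f, 'u) psym, 'r) lang) t \<and> fv_tm t \<subseteq> M ` {i \<in> fv_fm \<psi>. p i = None} \<and>
    {a. Par a \<in> syms_tm t} \<subseteq> {a. \<exists>i\<in>fv_fm \<psi>. p i = Some a}"
  have "?Q t" if "t \<in> atom_terms \<psi>1" for t
  proof (rule atom_terms_tr_pred[where Q = ?Q, OF assms(1,2) _ _ that[unfolded \<psi>1_def]])
    fix i assume "i \<in> fv_fm \<psi>"
    then show "?Q (case p i of None => Var (M i) | Some a => Fn (Par a) [])" by (cases "p i") auto
  next
    fix f and ts :: "('f, 'u) psym tm list"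
    assume l: "length ts = farity L f" and Q: "\<And>t. t \<in> set ts ==> ?Q t"
    have "wf_tm (param_lang L :: (('f, 'u) psym, 'r) lang) (Fn (Sym f) ts)" using l Q by simp
    moreover have "fv_tm (Fn (Sym f) ts) \<subseteq> M ` {i \<in> fv_fm \<psi>. p i = None}" using Q by (simp add: UN_subset_iff)
    moreover have "{a. Par a \<in> syms_tm (Fn (Sym f) ts)} \<subseteq> {a. \<exists>i\<in>fv_fm \<psi>. p i = Some a}"
    proof
      fix a assume "a \<in> {a. Par a \<in> syms_tm (Fn (Sym f) ts)}"
      then obtain t where "t \<in> set ts" "Par a \<in> syms_tm t" by auto
      then show "a \<in> {a. \<exists>i\<in>fv_fm \<psi>. p i = Some a}" using Q[of t] by blast
    qed
    ultimately show "?Q (Fn (Sym f) ts)" by blast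
  qed
  then have Q: "\<And>t. t \<in> atom_terms \<psi>1 ==> wf_tm (param_lang L :: (('f, 'u) psym, 'r) lang) t"
    "\<And>t. t \<in> atom_terms \<psi>1 ==> fv_tm t \<subseteq> M ` {i \<in> fv_fm \<psi>. p i = None}"
    "\<And>t a. t \<in> atom_terms \<psi>1 ==> Par a \<in> syms_tm t ==> \<exists>i\<in>fv_fm \<psi>. p i = Some a" by blast+
  have "quantifier_free \<psi>1" unfolding \<psi>1_def using assms(2) by simp
  then show "fv_fm \<psi>1 \<subseteq> M ` {i \<in> fv_fm \<psi>. p i = None}" using Q(2) fv_atom_terms by blast
  show "params \<psi>1 \<subseteq> {a. \<exists>i\<in>fv_fm \<psi>. p i = Some a}" using Q(3) unfolding params_def syms_atom_terms[of \<psi>1] by blast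
  show "wf_fm (param_lang L :: (('f, 'u) psym, 'r) lang) \<psi>1"
    unfolding \<psi>1_def by (rule wf_tr_fm[OF assms(1)]) (use Q(1) in \<open>simp_all add: \<psi>1_def\<close>)
  show "sat (param_struct S) e \<psi>1 \<longleftrightarrow> sat S (\<lambda>i. case p i of None => e (M i) | Some a => a) \<psi>"
    unfolding \<psi>1_def by (rule sat_tr_fm[OF assms(2), of id]) (auto split: option.splits)
qed

text \<open>Quantifier elimination is given for formulas without parameters. At a quantifier, the
  parameters of the matrix become fresh variables by \<open>par_to_var\<close>, the quantifier is
  eliminated, and \<open>var_to_par\<close> restores the parameters.\<close>

lemma QE_params:
  fixes S :: "('u, 'f, 'r) struct" and L :: "('f, 'r, 'z) lang_scheme"
  assumes qe: "\<And>\<phi>. wf_fm L \<phi> ==> \<exists>\<psi>. wf_fm L \<psi> \<and> quantifier_free \<psi> \<and> fv_fm \<psi> \<subseteq> fv_fm \<phi> \<and> (\<forall>e. sat S e \<phi> \<longleftrightarrow> sat S e \<psi>)"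
    and "wf_fm (param_lang L :: (('f, 'u) psym, 'r) lang) \<phi>"
  shows "\<exists>\<psi>. wf_fm (param_lang L :: (('f, 'u) psym, 'r) lang) \<psi> \<and> quantifier_free \<psi> \<and> fv_fm \<psi> \<subseteq> fv_fm \<phi> \<and>
     params \<psi> \<subseteq> params \<phi> \<and> (\<forall>e. sat (param_struct S) e \<phi> \<longleftrightarrow> sat (param_struct S) e \<psi>)"
  using assms(2)
proof (induction \<phi>)
  case (Eq s t)
  then show ?case by (intro exI[of _ "Eq s t"]) simp
next
  case (Rel r ts)
  then show ?case by (intro exI[of _ "Rel r ts"]) simp
next
  case (Neg \<phi>)
  then obtain \<psi> where "wf_fm (param_lang L :: (('f, 'u) psym, 'r) lang) \<psi>" "quantifier_free \<psi>" "fv_fm \<psi> \<subseteq> fv_fm \<phi>"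
    "params \<psi> \<subseteq> params \<phi>" "\<forall>e. sat (param_struct S) e \<phi> \<longleftrightarrow> sat (param_struct S) e \<psi>" by auto
  then show ?case by (intro exI[of _ "Neg \<psi>"]) (auto simp: params_def)
next
  case (Conj \<phi>1 \<phi>2)
  obtain \<psi>1 where "wf_fm (param_lang L :: (('f, 'u) psym, 'r) lang) \<psi>1" "quantifier_free \<psi>1" "fv_fm \<psi>1 \<subseteq> fv_fm \<phi>1"
    "params \<psi>1 \<subseteq> params \<phi>1" "\<forall>e. sat (param_struct S) e \<phi>1 \<longleftrightarrow> sat (param_struct S) e \<psi>1"
    using Conj.IH(1) Conj.prems by auto
  moreover obtain \<psi>2 where "wf_fm (param_lang L :: (('f, 'u) psym, 'r) lang) \<psi>2" "quantifier_free \<psi>2" "fv_fm \<psi>2 \<subseteq> fv_fm \<phi>2"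
    "params \<psi>2 \<subseteq> params \<phi>2" "\<forall>e. sat (param_struct S) e \<phi>2 \<longleftrightarrow> sat (param_struct S) e \<psi>2"
    using Conj.IH(2) Conj.prems by auto
  ultimately show ?case by (intro exI[of _ "Conj \<psi>1 \<psi>2"]) (auto simp: params_def)
next
  case (All v \<phi>)
  then obtain \<psi> where \<psi>: "wf_fm (param_lang L :: (('f, 'u) psym, 'r) lang) \<psi>" "quantifier_free \<psi>" "fv_fm \<psi> \<subseteq> fv_fm \<phi>"
    "params \<psi> \<subseteq> params \<phi>" "\<And>e. sat (param_struct S) e \<phi> \<longleftrightarrow> sat (param_struct S) e \<psi>" by auto
  have "finite (insert v (fv_fm \<psi>))" by simp
  \<comment> \<open>The variables from \<open>m\<close> on are fresh and can stand for the
    parameters.\<close>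
  then obtain m where m: "\<And>i. i \<in> insert v (fv_fm \<psi>) ==> i < m" using finite_nat_set_iff_bounded by auto
  obtain N0 :: "'u => nat" where N0: "inj_on N0 (params \<psi>)" using finite_imp_inj_to_nat_seg[OF params_finite] by metis
  define N where "N a = m + N0 a" for a
  have N: "inj_on N (params \<psi>)" using N0 unfolding N_def inj_on_def by simp
  define q where "q i = (if i \<in> N ` params \<psi> then Some (inv_into (params \<psi>) N i) else None)" for i
  have qN: "q (N a) = Some a" if "a \<in> params \<psi>" for a unfolding q_def using that N by simp
  have qm: "q i = None" if "i < m" for i unfolding q_def N_def using that by auto
  have qS: "a \<in> params \<psi>" if "q i = Some a" for a i using that unfolding q_def by (auto split: if_splits intro: inv_into_into)
  define \<psi>0 where "\<psi>0 = tr_fm (var_of_par N) (\<lambda>i. Var (id i)) \<psi>"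
  note P = par_to_var[OF \<psi>(1,2), where N = N and M = id, folded \<psi>0_def]
  obtain \<chi> where \<chi>: "wf_fm L \<chi>" "quantifier_free \<chi>" "fv_fm \<chi> \<subseteq> fv_fm \<psi>0 - {v}" "\<And>e. sat S e (All v \<psi>0) \<longleftrightarrow> sat S e \<chi>"
    using qe[of "All v \<psi>0"] P(1) by auto
  define \<chi>1 :: "(('f, 'u) psym, 'r) fm" where
    "\<chi>1 = tr_fm (\<lambda>f. Fn (Sym f)) (\<lambda>i. case q i of None => Var (id i) | Some a => Fn (Par a) []) \<chi>"
  note V = var_to_par[OF \<chi>(1,2), where p = q and M = id, folded \<chi>1_def]
  have "sat (param_struct S) e (All v \<phi>) \<longleftrightarrow> sat (param_struct S) e \<chi>1" for e
  proof -
    define e1 where "e1 i = (case q i of None => e (id i) | Some a => a)" for i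
    have "sat (param_struct S) (e(v := a)) \<psi> \<longleftrightarrow> sat S (e1(v := a)) \<psi>0" for a
    proof -
      have "sat S (e1(v := a)) \<psi>0 \<longleftrightarrow> sat (param_struct S) (\<lambda>i. (e1(v := a)) (id i)) \<psi>"
        by (rule P(3)) (use qN m[of v] in \<open>auto simp: e1_def N_def\<close>)
      also have "\<dots> \<longleftrightarrow> sat (param_struct S) (e(v := a)) \<psi>"
        by (rule sat_cong) (use m qm in \<open>auto simp: e1_def\<close>)
      finally show ?thesis ..
    qed
    then have "sat (param_struct S) e (All v \<phi>) \<longleftrightarrow> sat S e1 (All v \<psi>0)" using \<psi>(5) by simp
    also have "\<dots> \<longleftrightarrow> sat (param_struct S) e \<chi>1" unfolding \<chi>(4) V(4) e1_def ..
    finally show ?thesis .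
  qed
  moreover have "fv_fm \<chi>1 \<subseteq> fv_fm (All v \<phi>)"
  proof
    fix i assume "i \<in> fv_fm \<chi>1"
    then have i: "i \<in> fv_fm \<psi>0" "i \<noteq> v" "q i = None" using V(2) \<chi>(3) by auto
    then have "i \<in> fv_fm \<psi>" using P(2) qN by fastforce
    then show "i \<in> fv_fm (All v \<phi>)" using \<psi>(3) i(2) by auto
  qed
  moreover have "params \<chi>1 \<subseteq> params (All v \<phi>)"
  proof
    fix a assume "a \<in> params \<chi>1"
    then have "a \<in> params \<psi>" using V(3) qS by blast
    then show "a \<in> params (All v \<phi>)" using \<psi>(4) by (auto simp: params_def)
  qed
  moreover have "quantifier_free \<chi>1" unfolding \<chi>1_def using \<chi>(2) by simp
  ultimately show ?case using V(1) by blast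
qed

text \<open>A quantifier-free definition is moved along the embedding \<open>Inl\<close>, which
  preserves its truth; the points and intervals found in the copy are pulled back by
  \<open>projl\<close>.\<close>

lemma o_minimal_emb:
  fixes S :: "('u, 'f, 'r) struct" and L :: "('f, 'r, 'z) ord_ring_lang_scheme"
  assumes qe: "\<And>\<phi>. wf_fm L \<phi> ==> \<exists>\<psi>. wf_fm L \<psi> \<and> quantifier_free \<psi> \<and> fv_fm \<psi> \<subseteq> fv_fm \<phi> \<and> (\<forall>e. sat S e \<phi> \<longleftrightarrow> sat S e \<psi>)"
    and "o_minimal L (emb_struct S :: ('u + 'v, 'f, 'r) struct)" "univ S = UNIV"
  shows "o_minimal L S"
  unfolding o_minimal_def
proof (intro allI impI)
  fix Z assume "Z \<subseteq> univ S \<and> definable L S (univ S) 1 {[x] | x. x \<in> Z}"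
  then obtain \<phi> where \<phi>: "wf_fm (param_lang L :: (('f, 'u) psym, 'r) lang) \<phi>" "fv_fm \<phi> \<subseteq> {..<1}" "{[x] | x. x \<in> Z} = defined_set S 1 \<phi>"
    unfolding definable_def by blast
  obtain \<psi> where \<psi>: "wf_fm (param_lang L :: (('f, 'u) psym, 'r) lang) \<psi>" "quantifier_free \<psi>" "fv_fm \<psi> \<subseteq> fv_fm \<phi>"
    "\<And>e. sat (param_struct S) e \<phi> \<longleftrightarrow> sat (param_struct S) e \<psi>" using QE_params[OF qe \<phi>(1)] by blast
  let ?S = "emb_struct S :: ('u + 'v, 'f, 'r) struct"
  define g :: "('f, 'u) psym => ('f, 'u + 'v) psym tm list => ('f, 'u + 'v) psym tm" where
    "g f ts = (case f of Sym f => Fn (Sym f) ts | Par a => Fn (Par (Inl a)) [])" for f ts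
  let ?\<psi> = "tr_fm g Var \<psi>"
  let ?Q = "\<lambda>t. wf_tm (param_lang L :: (('f, 'u + 'v) psym, 'r) lang) t \<and> fv_tm t \<subseteq> {..<1} \<and> {a. Par a \<in> syms_tm t} \<subseteq> univ ?S"
  have "?Q t" if "t \<in> atom_terms ?\<psi>" for t
  proof (rule atom_terms_tr_pred[where Q = ?Q, OF \<psi>(1,2) _ _ that])
    fix f and ts :: "('f, 'u + 'v) psym tm list"
    assume "length ts = farity (param_lang L :: (('f, 'u) psym, 'r) lang) f" "\<And>t. t \<in> set ts ==> ?Q t"
    then show "?Q (g f ts)" using assms(3) by (cases f) (fastforce simp: g_def emb_struct_def)+
  qed (use \<psi>(3) \<phi>(2) in auto)
  then have W: "wf_fm (param_lang L :: (('f, 'u + 'v) psym, 'r) lang) ?\<psi>" "fv_fm ?\<psi> \<subseteq> {..<1}" "params ?\<psi> \<subseteq> univ ?S"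
    using wf_tr_fm[OF \<psi>(1), of "param_lang L :: (('f, 'u + 'v) psym, 'r) lang"] fv_atom_terms[of ?\<psi>] \<psi>(2)
    by (auto simp: params_def syms_atom_terms)
  have s: "sat (param_struct ?S) ((!) [Inl a]) ?\<psi> \<longleftrightarrow> a \<in> Z" for a
  proof -
    have "sat (param_struct ?S) ((!) [Inl a]) ?\<psi> \<longleftrightarrow> sat (param_struct S) ((!) [a]) \<psi>"
    proof (rule sat_tr_fm[OF \<psi>(2), of Inl])
      fix i assume "i \<in> fv_fm \<psi>"
      then have "i = 0" using \<psi>(3) \<phi>(2) by auto
      then show "eval_tm (param_struct ?S) ((!) [Inl a]) (Var i) = Inl ([a] ! i)" by simp
    next
      fix f ts xs assume "map (eval_tm (param_struct ?S) ((!) [Inl a])) ts = map Inl xs"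
      then show "eval_tm (param_struct ?S) ((!) [Inl a]) (g f ts) = Inl (fint (param_struct S) f xs)"
        by (cases f) (simp_all add: g_def emb_struct_def comp_def)
    qed (simp_all add: emb_struct_def comp_def)
    also have "\<dots> \<longleftrightarrow> [a] \<in> defined_set S 1 \<phi>" using \<psi>(4) assms(3) by (simp add: defined_set_def tuples_def)
    finally show ?thesis unfolding \<phi>(3)[symmetric] by simp
  qed
  have "{[x] | x. x \<in> Inl ` Z} = defined_set ?S 1 ?\<psi>"
  proof (intro equalityI subsetI)
    fix xs :: "('u + 'v) list" assume "xs \<in> {[x] | x. x \<in> Inl ` Z}"
    then show "xs \<in> defined_set ?S 1 ?\<psi>" using s assms(3) by (auto simp: defined_set_def tuples_def emb_struct_def)
  next
    fix xs :: "('u + 'v) list" assume a: "xs \<in> defined_set ?S 1 ?\<psi>"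
    then have "length xs = 1" "set xs \<subseteq> range Inl" using assms(3) by (auto simp: defined_set_def tuples_def emb_struct_def)
    then obtain a where "xs = [Inl a]" by (cases xs) auto
    then show "xs \<in> {[x] | x. x \<in> Inl ` Z}" using a s by (auto simp: defined_set_def)
  qed
  then have "definable L ?S (univ ?S) 1 {[x] | x. x \<in> Inl ` Z}" unfolding definable_def using W by blast
  moreover have "Inl ` Z \<subseteq> univ ?S" using assms(3) by (auto simp: emb_struct_def)
  ultimately obtain I where I: "finite I" "Inl ` Z = \<Union>I" "\<And>J. J \<in> I ==> (\<exists>a \<in> univ ?S. J = {a}) \<or>
      (\<exists>lo hi. set_option lo \<subseteq> univ ?S \<and> set_option hi \<subseteq> univ ?S \<and> J = open_interval L ?S lo hi)"
    using assms(2) unfolding o_minimal_def by meson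
  have "Z = \<Union> ((`) projl ` I)"
  proof -
    have "Z = projl ` (Inl ` Z)" by (simp add: image_image)
    then show ?thesis using I(2) by (metis image_Union)
  qed
  moreover have "(\<exists>a \<in> univ S. projl ` J = {a}) \<or>
      (\<exists>lo hi. set_option lo \<subseteq> univ S \<and> set_option hi \<subseteq> univ S \<and> projl ` J = open_interval L S lo hi)" if "J \<in> I" for J
    using I(3)[OF that]
  proof (elim disjE exE conjE bexE)
    fix lo hi assume lh: "set_option lo \<subseteq> univ ?S" "set_option hi \<subseteq> univ ?S" "J = open_interval L ?S lo hi"
    obtain lo' where lo': "lo = map_option Inl lo'" using lh(1) by (cases lo) (auto simp: emb_struct_def intro: that[of None] that[of "Some _"])
    obtain hi' where hi': "hi = map_option Inl hi'" using lh(2) by (cases hi) (auto simp: emb_struct_def intro: that[of None] that[of "Some _"])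
    have "J = Inl ` open_interval L S lo' hi'"
      unfolding lh(3) lo' hi' open_interval_def less_in_def emb_struct_def using assms(3) by auto
    then have "projl ` J = open_interval L S lo' hi'" by (simp add: image_image)
    then show ?thesis using assms(3) by auto
  qed (use assms(3) in auto)
  ultimately show "\<exists>I. finite I \<and> Z = \<Union> I \<and> (\<forall>J\<in>I. (\<exists>a \<in> univ S. J = {a}) \<or>
      (\<exists>lo hi. set_option lo \<subseteq> univ S \<and> set_option hi \<subseteq> univ S \<and> J = open_interval L S lo hi))"
    using I(1) by (intro exI[of _ "(`) projl ` I"]) auto
qed

section \<open>Definable sets of a model\<close>

lemma (in dstruct) D_graph_on:
  assumes "D n U" "df n F" shows "D (Suc n) {x @ [F x] | x. x \<in> U}"
proof -
  have "dp (Suc n) (\<lambda>z. take n z \<in> U \<and> z ! n = F (take n z))"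
    by (rule dintros dp_mem[OF assms(1)] df_comp[OF assms(2)] | simp)+
  then have "D (Suc n) {z. length z = Suc n \<and> (take n z \<in> U \<and> z ! n = F (take n z))}" by (rule D_Collect)
  moreover have "{z. length z = Suc n \<and> (take n z \<in> U \<and> z ! n = F (take n z))} = {x @ [F x] | x. x \<in> U}"
  proof (intro equalityI subsetI)
    fix z assume "z \<in> {z. length z = Suc n \<and> (take n z \<in> U \<and> z ! n = F (take n z))}"
    then show "z \<in> {x @ [F x] | x. x \<in> U}" using take_snoc_nth[of z n] by (intro CollectI exI[of _ "take n z"]) auto
  next
    fix z assume "z \<in> {x @ [F x] | x. x \<in> U}"
    then obtain x where x: "z = x @ [F x]" "x \<in> U" by blast
    then show "z \<in> {z. length z = Suc n \<and> (take n z \<in> U \<and> z ! n = F (take n z))}" using D_length[OF assms(1) x(2)] by (auto simp: nth_append)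
  qed
  ultimately show ?thesis by simp
qed

lemma gen_cell_dim_le: "gen_cell P n d C ==> d \<le> n"
  by (induction rule: gen_cell.induct) auto

locale tame =
  fixes L :: "('f, 'r, 'z) ord_ring_lang_scheme" and S :: "('a::linordered_field, 'f, 'r) struct"
  assumes lang: "expands_ord_ring_lang L" and of_S: "on_ordered_field L S"
    and qe: "\<And>\<phi>. wf_fm L \<phi> ==> \<exists>\<psi>. wf_fm L \<psi> \<and> quantifier_free \<psi> \<and> fv_fm \<psi> \<subseteq> fv_fm \<phi> \<and> (\<forall>e. sat S e \<phi> \<longleftrightarrow> sat S e \<psi>)"
    and omin: "o_minimal L S"
begin

abbreviation "PL \<equiv> param_lang L :: (('f, 'a) psym, 'r) lang"
abbreviation "PS \<equiv> param_struct S"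
abbreviation "Df \<equiv> definable L S"

lemma univ_S [simp]: "univ S = UNIV"
  using of_S unfolding on_ordered_field_def by blast

lemma sym_arity [simp]:
  "farity L (zero_sym L) = 0" "farity L (plus_sym L) = 2" "farity L (times_sym L) = 2" "rarity L (less_sym L) = 2"
  using lang unfolding expands_ord_ring_lang_def by auto

lemma sym_int [simp]:
  "fint S (plus_sym L) [x, y] = x + y" "fint S (times_sym L) [x, y] = x * y" "rint S (less_sym L) [x, y] \<longleftrightarrow> x < y"
  using of_S unfolding on_ordered_field_def by auto

text \<open>With quantifier-free formulas, variables and symbols can be substituted by
  \<open>tr_fm\<close> without capture.\<close>

lemma definable_qfE:
  assumes "Df V n Z"
  obtains \<phi> where "wf_fm PL \<phi>" "params \<phi> \<subseteq> V" "fv_fm \<phi> \<subseteq> {..<n}" "quantifier_free \<phi>"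
    "\<And>u. length u = n ==> sat PS ((!) u) \<phi> \<longleftrightarrow> u \<in> Z" "Z \<subseteq> pow n"
proof -
  obtain \<phi> where \<phi>: "wf_fm PL \<phi>" "params \<phi> \<subseteq> V" "fv_fm \<phi> \<subseteq> {..<n}" "Z = defined_set S n \<phi>"
    using assms unfolding definable_def by blast
  obtain \<psi> where \<psi>: "wf_fm PL \<psi>" "quantifier_free \<psi>" "fv_fm \<psi> \<subseteq> fv_fm \<phi>" "params \<psi> \<subseteq> params \<phi>"
    "\<forall>e. sat PS e \<phi> \<longleftrightarrow> sat PS e \<psi>" using QE_params[OF qe \<phi>(1)] by blast
  have "params \<psi> \<subseteq> V" "fv_fm \<psi> \<subseteq> {..<n}" using \<psi>(3,4) \<phi>(2,3) by blast+
  moreover have "\<And>u. length u = n ==> sat PS ((!) u) \<psi> \<longleftrightarrow> u \<in> Z" "Z \<subseteq> pow n"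
    unfolding \<phi>(4) defined_set_def using \<psi>(5) by auto
  ultimately show thesis using that[OF \<psi>(1) _ _ \<psi>(2)] by blast
qed

lemma definableI:
  assumes "wf_fm PL \<phi>" "params \<phi> \<subseteq> V" "fv_fm \<phi> \<subseteq> {..<n}"
    "\<And>u. length u = n ==> sat PS ((!) u) \<phi> \<longleftrightarrow> u \<in> Z" "Z \<subseteq> pow n"
  shows "Df V n Z"
proof -
  have "Z = defined_set S n \<phi>"
  proof (intro equalityI subsetI)
    fix u assume "u \<in> Z"
    moreover then have "length u = n" using assms(5) by auto
    ultimately show "u \<in> defined_set S n \<phi>" using assms(4) by (simp add: defined_set_def)
  next
    fix u assume "u \<in> defined_set S n \<phi>"
    then show "u \<in> Z" using assms(4)[of u] by (simp add: defined_set_def)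
  qed
  then show ?thesis unfolding definable_def using assms(1-3) by (intro exI[of _ \<phi>]) simp
qed

lemma Df_mono: "Df V n Z ==> V \<subseteq> W ==> Df W n Z"
  unfolding definable_def by blast

lemma rename_variables:
  fixes J :: "nat => nat"
  assumes "wf_fm PL \<phi>" "quantifier_free \<phi>"
  defines "\<phi>' \<equiv> tr_fm Fn (\<lambda>i. Var (J i)) \<phi>"
  shows "wf_fm PL \<phi>'" "params \<phi>' \<subseteq> params \<phi>" "fv_fm \<phi>' \<subseteq> J ` fv_fm \<phi>"
    "sat PS e \<phi>' \<longleftrightarrow> sat PS (\<lambda>i. e (J i)) \<phi>"
proof -
  let ?Q = "\<lambda>t. wf_tm PL t \<and> fv_tm t \<subseteq> J ` fv_fm \<phi> \<and> syms_tm t \<subseteq> syms_fm \<phi>"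
  have "?Q t" if "t \<in> atom_terms \<phi>'" for t
  proof (rule atom_terms_tr_pred[where Q = ?Q, OF assms(1,2) _ _ that[unfolded \<phi>'_def]])
    fix f and ts :: "('f, 'a) psym tm list"
    assume "f \<in> syms_fm \<phi>" "length ts = farity PL f" "\<And>t. t \<in> set ts ==> ?Q t"
    then show "?Q (Fn f ts)" by (simp add: UN_subset_iff)
  qed simp
  then have Q: "\<And>t. t \<in> atom_terms \<phi>' ==> wf_tm PL t" "\<And>t. t \<in> atom_terms \<phi>' ==> fv_tm t \<subseteq> J ` fv_fm \<phi>"
    "\<And>t. t \<in> atom_terms \<phi>' ==> syms_tm t \<subseteq> syms_fm \<phi>" by blast+
  have "quantifier_free \<phi>'" unfolding \<phi>'_def using assms(2) by simp
  then show "fv_fm \<phi>' \<subseteq> J ` fv_fm \<phi>" using Q(2) by (simp add: fv_atom_terms[of \<phi>'] UN_subset_iff)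
  have "syms_fm \<phi>' \<subseteq> syms_fm \<phi>" using Q(3) unfolding syms_atom_terms[of \<phi>'] by (simp only: UN_subset_iff) blast
  then show "params \<phi>' \<subseteq> params \<phi>" unfolding params_def by blast
  show "wf_fm PL \<phi>'" unfolding \<phi>'_def by (rule wf_tr_fm[OF assms(1)]) (use Q(1) in \<open>simp_all add: \<phi>'_def\<close>)
  show "sat PS e \<phi>' \<longleftrightarrow> sat PS (\<lambda>i. e (J i)) \<phi>"
    unfolding \<phi>'_def by (rule sat_tr_fm[OF assms(2), of id]) simp_all
qed

lemma dstruct_Df: "dstruct (Df V)"
proof
  fix n and Z Y :: "'a list set"
  show Z: "Z \<subseteq> pow n" if "Df V n Z" for Z by (rule definable_qfE[OF that])
  show "Df V n (pow n)"
    by (rule definableI[of "Eq (Fn (Sym (zero_sym L)) []) (Fn (Sym (zero_sym L)) [])"]) (simp_all add: params_def)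
  show "Df V n (Z \<inter> Y)" if ZY: "Df V n Z" "Df V n Y"
  proof -
    obtain \<phi> where \<phi>: "wf_fm PL \<phi>" "params \<phi> \<subseteq> V" "fv_fm \<phi> \<subseteq> {..<n}" "quantifier_free \<phi>"
      "\<And>u. length u = n ==> sat PS ((!) u) \<phi> \<longleftrightarrow> u \<in> Z" "Z \<subseteq> pow n" by (rule definable_qfE[OF ZY(1)]) (rule that)
    obtain \<psi> where \<psi>: "wf_fm PL \<psi>" "params \<psi> \<subseteq> V" "fv_fm \<psi> \<subseteq> {..<n}" "quantifier_free \<psi>"
      "\<And>u. length u = n ==> sat PS ((!) u) \<psi> \<longleftrightarrow> u \<in> Y" "Y \<subseteq> pow n" by (rule definable_qfE[OF ZY(2)]) (rule that)
    have "params (Conj \<phi> \<psi>) = params \<phi> \<union> params \<psi>" by (auto simp: params_def)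
    then have pr: "params (Conj \<phi> \<psi>) \<subseteq> V" using \<phi>(2) \<psi>(2) by blast
    show ?thesis
    proof (rule definableI[of "Conj \<phi> \<psi>", OF _ pr])
      show "Z \<inter> Y \<subseteq> pow n" using \<phi>(6) by blast
    qed (use \<phi>(1,3,5) \<psi>(1,3,5) in simp_all)
  qed
  show "Df V n (pow n - Z)" if ZZ: "Df V n Z"
  proof -
    obtain \<phi> where \<phi>: "wf_fm PL \<phi>" "params \<phi> \<subseteq> V" "fv_fm \<phi> \<subseteq> {..<n}" "quantifier_free \<phi>"
      "\<And>u. length u = n ==> sat PS ((!) u) \<phi> \<longleftrightarrow> u \<in> Z" "Z \<subseteq> pow n" by (rule definable_qfE[OF ZZ(1)]) (rule that)
    have "params (Neg \<phi>) = params \<phi>" by (auto simp: params_def)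
    then show ?thesis by (intro definableI[of "Neg \<phi>"]) (use \<phi>(1,2,3,5) in simp_all)
  qed
  show "Df V N {x \<in> pow N. map ((!) x) I \<in> Z}" if Z: "Df V n Z" and I: "set I \<subseteq> {..<N}" "length I = n" for N I
  proof -
    obtain \<phi> where \<phi>: "wf_fm PL \<phi>" "params \<phi> \<subseteq> V" "fv_fm \<phi> \<subseteq> {..<n}" "quantifier_free \<phi>"
      "\<And>u. length u = n ==> sat PS ((!) u) \<phi> \<longleftrightarrow> u \<in> Z" "Z \<subseteq> pow n" by (rule definable_qfE[OF Z]) (rule that)
    let ?\<phi> = "tr_fm Fn (\<lambda>i. Var (I ! i)) \<phi>"
    note R = rename_variables[OF \<phi>(1,4), where J = "(!) I"]
    have "(!) I ` fv_fm \<phi> \<subseteq> {..<N}"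
    proof (rule image_subsetI)
      fix i assume "i \<in> fv_fm \<phi>"
      then have "i < n" using \<phi>(3) by blast
      then have "I ! i \<in> set I" using I(2) by simp
      then show "I ! i \<in> {..<N}" using I(1) by blast
    qed
    then have "fv_fm ?\<phi> \<subseteq> {..<N}" using R(3) by blast
    moreover have "sat PS ((!) x) ?\<phi> \<longleftrightarrow> x \<in> {x \<in> pow N. map ((!) x) I \<in> Z}" if "length x = N" for x
    proof -
      have "sat PS ((!) x) ?\<phi> \<longleftrightarrow> sat PS ((!) (map ((!) x) I)) \<phi>"
        unfolding R(4) by (rule sat_cong) (use \<phi>(3) I(2) in auto)
      then show ?thesis using \<phi>(5) I(2) that by simp
    qed
    ultimately show ?thesis using R(1,2) \<phi>(2) by (intro definableI[of ?\<phi>]) auto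
  qed
  show "Df V n {x \<in> pow n. \<exists>y. x @ [y] \<in> Z}" if Z: "Df V (Suc n) Z"
  proof -
    obtain \<phi> where \<phi>: "wf_fm PL \<phi>" "params \<phi> \<subseteq> V" "fv_fm \<phi> \<subseteq> {..<Suc n}" "quantifier_free \<phi>"
      "\<And>u. length u = Suc n ==> sat PS ((!) u) \<phi> \<longleftrightarrow> u \<in> Z" "Z \<subseteq> pow (Suc n)" by (rule definable_qfE[OF Z]) (rule that)
    let ?\<phi> = "Neg (All n (Neg \<phi>))"
    have "sat PS ((!) x) ?\<phi> \<longleftrightarrow> x \<in> {x \<in> pow n. \<exists>y. x @ [y] \<in> Z}" if l: "length x = n" for x
    proof -
      have "sat PS (((!) x)(n := y)) \<phi> \<longleftrightarrow> x @ [y] \<in> Z" for y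
      proof -
        have "sat PS (((!) x)(n := y)) \<phi> \<longleftrightarrow> sat PS ((!) (x @ [y])) \<phi>"
          by (rule sat_cong) (use \<phi>(3) l in \<open>auto simp: nth_append less_Suc_eq\<close>)
        then show ?thesis using \<phi>(5)[of "x @ [y]"] l by simp
      qed
      then show ?thesis using l by simp
    qed
    moreover have "params ?\<phi> = params \<phi>" by (auto simp: params_def)
    moreover have "fv_fm ?\<phi> \<subseteq> {..<n}" using \<phi>(3) by (auto simp: less_Suc_eq)
    ultimately show ?thesis using \<phi>(1,2) by (intro definableI[of ?\<phi>]) auto
  qed
  have l2: "\<exists>a b. u = [a, b]" if "length u = 2" for u :: "'a list"
    using that by (auto simp: numeral_eq_Suc length_Suc_conv)
  have l3: "\<exists>a b c. u = [a, b, c]" if "length u = 3" for u :: "'a list"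
    using that by (auto simp: numeral_eq_Suc length_Suc_conv)
  show "Df V 2 {[x, y] | x y. x < y}"
  proof (rule definableI[of "Rel (less_sym L) [Var 0, Var 1]"])
    fix u :: "'a list" assume "length u = 2"
    then obtain a b where "u = [a, b]" using l2 by blast
    then show "sat PS ((!) u) (Rel (less_sym L) [Var 0, Var 1]) \<longleftrightarrow> u \<in> {[x, y] | x y. x < y}" by simp
  qed (auto simp: params_def)
  show "Df V 3 {[x, y, x + y] | x y. True}"
  proof (rule definableI[of "Eq (Var 2) (Fn (Sym (plus_sym L)) [Var 0, Var 1])"])
    fix u :: "'a list" assume "length u = 3"
    then obtain a b c where "u = [a, b, c]" using l3 by blast
    then show "sat PS ((!) u) (Eq (Var 2) (Fn (Sym (plus_sym L)) [Var 0, Var 1])) \<longleftrightarrow> u \<in> {[x, y, x + y] | x y. True}" by simp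
  qed (auto simp: params_def)
  show "Df V 3 {[x, y, x * y] | x y. True}"
  proof (rule definableI[of "Eq (Var 2) (Fn (Sym (times_sym L)) [Var 0, Var 1])"])
    fix u :: "'a list" assume "length u = 3"
    then obtain a b c where "u = [a, b, c]" using l3 by blast
    then show "sat PS ((!) u) (Eq (Var 2) (Fn (Sym (times_sym L)) [Var 0, Var 1])) \<longleftrightarrow> u \<in> {[x, y, x * y] | x y. True}" by simp
  qed (auto simp: params_def)
qed

lemma Df_const: "b \<in> V ==> Df V 1 {[b]}"
proof (rule definableI[of "Eq (Var 0) (Fn (Par b) [])"])
  fix u :: "'a list" assume "length u = 1"
  then obtain a where "u = [a]" by (auto simp: length_Suc_conv)
  then show "sat PS ((!) u) (Eq (Var 0) (Fn (Par b) [])) \<longleftrightarrow> u \<in> {[b]}" by simp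
qed (auto simp: params_def)

lemma omin_Df: "omin (Df UNIV)"
proof (intro omin.intro omin_axioms.intro dstruct_Df)
  show "Df UNIV 1 {[a]}" for a by (rule Df_const) simp
  show "\<exists>I. finite I \<and> Z = \<Union>I \<and> (\<forall>J\<in>I. (\<exists>a. J = {a}) \<or>
        (\<exists>lo hi. J = {x. (\<forall>a. lo = Some a --> a < x) \<and> (\<forall>b. hi = Some b --> x < b)}))"
    if Z: "Df UNIV 1 {[x] | x. x \<in> Z}" for Z
  proof -
    have "\<exists>I. finite I \<and> Z = \<Union>I \<and> (\<forall>J\<in>I. (\<exists>a. J = {a}) \<or> (\<exists>lo hi. J = open_interval L S lo hi))"
      using omin[unfolded o_minimal_def, rule_format, of Z] Z by simp
    moreover have o: "open_interval L S lo hi = {x. (\<forall>a. lo = Some a --> a < x) \<and> (\<forall>b. hi = Some b --> x < b)}" for lo hi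
      unfolding open_interval_def less_in_def by simp
    ultimately show ?thesis by (simp only:)
  qed
qed

lemma omin_pair_Df: "omin_pair (Df V) (Df UNIV)"
  by (intro omin_pair.intro dstruct_Df omin_Df omin_pair_axioms.intro) (rule Df_mono, auto)

lemma df_const_Df:
  assumes "b \<in> V" shows "dstruct.df (Df V) n (\<lambda>x. b)"
proof -
  interpret dstruct "Df V" by (rule dstruct_Df)
  have "dp (Suc n) (\<lambda>z. [z ! n] \<in> {[b]})"
    by (rule dp_mem[OF Df_const[OF assms]]) (intro dl_single df_last)
  then show ?thesis unfolding df_def by simp
qed

lemma dl_const_Df:
  assumes "set bs \<subseteq> V" "m = length bs" shows "dstruct.dl (Df V) n m (\<lambda>x. bs)"
proof -
  have "bs ! i \<in> V" if "i < m" for i using assms that nth_mem[of i bs] by blast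
  then show ?thesis unfolding dstruct.dl_def[OF dstruct_Df] using assms(2) by (simp add: df_const_Df)
qed

text \<open>Turning the finitely many parameters of a formula into additional leading variables
  exhibits the set as a fibre of one that is definable without parameters.\<close>

lemma definable_fiberE:
  assumes "Df V n Z"
  obtains bs Z0 where "set bs \<subseteq> V" "Df {} (length bs + n) Z0" "\<And>x. length x = n ==> x \<in> Z \<longleftrightarrow> bs @ x \<in> Z0"
proof -
  obtain \<phi> where \<phi>: "wf_fm PL \<phi>" "params \<phi> \<subseteq> V" "fv_fm \<phi> \<subseteq> {..<n}" "quantifier_free \<phi>"
      "\<And>u. length u = n ==> sat PS ((!) u) \<phi> \<longleftrightarrow> u \<in> Z" "Z \<subseteq> pow n" by (rule definable_qfE[OF assms]) (rule that)
  obtain bs where bs: "set bs = params \<phi>" by (rule exE[OF finite_list[OF params_finite]]) (rule that)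
  have "\<forall>b\<in>params \<phi>. \<exists>i. i < length bs \<and> bs ! i = b"
  proof
    fix b assume "b \<in> params \<phi>"
    then have "b \<in> set bs" using bs by blast
    then show "\<exists>i. i < length bs \<and> bs ! i = b" unfolding in_set_conv_nth .
  qed
  then obtain N where N: "\<forall>b\<in>params \<phi>. N b < length bs \<and> bs ! N b = b" by (rule exE[OF bchoice]) (rule that)
  let ?\<phi> = "tr_fm (var_of_par N) (\<lambda>i. Var (length bs + i)) \<phi>"
  note P = par_to_var[OF \<phi>(1,4), where N = N and M = "\<lambda>i. length bs + i"]
  have qf: "quantifier_free ?\<phi>" using \<phi>(4) by simp
  define \<phi>1 :: "(('f, 'a) psym, 'r) fm" where
    "\<phi>1 = tr_fm (\<lambda>f. Fn (Sym f)) (\<lambda>i. case None of None => Var (id i) | Some a => Fn (Par a) []) ?\<phi>"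
  note Q = var_to_par[OF P(1) qf, where p = "\<lambda>i. None :: 'a option" and M = id, folded \<phi>1_def]
  define Z0 where "Z0 = {w. length w = length bs + n \<and> sat PS ((!) w) \<phi>1}"
  have "fv_fm ?\<phi> \<subseteq> {..<length bs + n}" using P(2) \<phi>(3) N by fastforce
  then have "Df {} (length bs + n) Z0"
    using Q(1-3) by (intro definableI[of \<phi>1]) (auto simp: Z0_def)
  moreover have "x \<in> Z \<longleftrightarrow> bs @ x \<in> Z0" if l: "length x = n" for x
  proof -
    have "sat PS ((!) (bs @ x)) \<phi>1 \<longleftrightarrow> sat S ((!) (bs @ x)) ?\<phi>" unfolding Q(4) by simp
    also have "\<dots> \<longleftrightarrow> sat PS (\<lambda>i. (bs @ x) ! (length bs + i)) \<phi>"
      by (rule P(3)) (use N in \<open>simp add: nth_append\<close>)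
    also have "\<dots> \<longleftrightarrow> x \<in> Z" using \<phi>(5)[OF l] by simp
    finally show ?thesis using l unfolding Z0_def by simp
  qed
  ultimately show thesis using that[of bs Z0] bs \<phi>(2) by simp
qed

lemma definable_funI:
  "Df UNIV n U ==> dstruct.df (Df UNIV) n F ==> definable_fun L S UNIV n U F"
  unfolding definable_fun_def
  using dstruct.D_sub[OF dstruct_Df] dstruct.D_graph_on[OF dstruct_Df] by simp

text \<open>Built coordinate by coordinate, with the constant bounds \<open>a - e\<close> and
  \<open>a + e\<close>.\<close>

lemma cube_cell:
  "length x = n ==> 0 < e ==> Df UNIV n {y. near e x y} \<and> cell_dim L S n n {y. near e x y}"
proof (induction n arbitrary: x)
  case 0
  then have "{y. near e x y} = {[]}" by auto
  then show ?case using gen_cell.point dstruct.D_pow[OF dstruct_Df, of UNIV 0] by (simp add: cell_dim_def tuples_def)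
next
  case (Suc n)
  interpret omin "Df UNIV" by (rule omin_Df)
  obtain x' a where x: "x = x' @ [a]" "length x' = n" using Suc.prems(1) by (metis length_Suc_conv_rev)
  have IH: "Df UNIV n {y. near e x' y}" "cell_dim L S n n {y. near e x' y}" using Suc.IH[OF x(2) Suc.prems(2)] by auto
  have "dp (Suc n) (\<lambda>y. near e x y)" by (rule dintros Suc.prems(1) | simp)+
  then have "Df UNIV (Suc n) {y. length y = Suc n \<and> near e x y}" by (rule D_Collect)
  moreover have "{y. length y = Suc n \<and> near e x y} = {y. near e x y}" using near_length[of e x] Suc.prems(1) by auto
  moreover have "cell_dim L S (Suc n) (Suc n) {y. near e x y}"
  proof -
    let ?lo = "Some (\<lambda>_ :: 'a list. a - e)" and ?hi = "Some (\<lambda>_ :: 'a list. a + e)"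
    have P: "definable_fun L S UNIV n {y. near e x' y} (\<lambda>_. c) \<and> cont_on {y. near e x' y} (\<lambda>_. c)" for c
      using definable_funI[OF IH(1) df_const] by (auto simp: cont_on_def intro: exI[of _ 1])
    have "cell_dim L S (Suc n) (Suc n) {z @ [y] | z y. z \<in> {y. near e x' y} \<and>
      (\<forall>f. ?lo = Some f --> f z < y) \<and> (\<forall>g. ?hi = Some g --> y < g z)}"
      unfolding cell_dim_def
      by (rule gen_cell.band[OF IH(2)[unfolded cell_dim_def]]) (use P Suc.prems(2) in auto)
    moreover have "{z @ [y] | z y. z \<in> {y. near e x' y} \<and> (\<forall>f. ?lo = Some f --> f z < y) \<and> (\<forall>g. ?hi = Some g --> y < g z)} = {y. near e x y}"
    proof (intro equalityI subsetI)
      fix w assume "w \<in> {z @ [y] | z y. z \<in> {y. near e x' y} \<and> (\<forall>f. ?lo = Some f --> f z < y) \<and> (\<forall>g. ?hi = Some g --> y < g z)}"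
      then obtain z y where w: "w = z @ [y]" "near e x' z" "a - e < y" "y < a + e" by auto
      then have "\<bar>a - y\<bar> < e" by (auto simp: abs_less_iff algebra_simps)
      then show "w \<in> {y. near e x y}" unfolding w(1) x(1) using w(2) near_length[OF w(2)] by simp
    next
      fix w assume "w \<in> {y. near e x y}"
      then have "near e (x' @ [a]) w" unfolding x(1) by simp
      then obtain z y where w: "w = z @ [y]" "near e x' z" "\<bar>a - y\<bar> < e" by (rule near_snocE)
      then have "a - e < y" "y < a + e" by (auto simp: abs_less_iff algebra_simps)
      then show "w \<in> {z @ [y] | z y. z \<in> {y. near e x' y} \<and> (\<forall>f. ?lo = Some f --> f z < y) \<and> (\<forall>g. ?hi = Some g --> y < g z)}"
        using w by auto
    qed
    ultimately show ?thesis by simp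
  qed
  ultimately show ?case by simp
qed

lemma fat_has_dim:
  assumes "fat n (\<lambda>x. x \<in> V)" shows "has_dim L S n V n"
proof -
  obtain x e where xe: "length x = n" "0 < e" "\<forall>y. near e x y --> y \<in> V" using assms unfolding fat_def by blast
  have "cell_dim L S n n {y. near e x y}" using cube_cell[OF xe(1,2)] by blast
  moreover have "{y. near e x y} \<subseteq> V" using xe(3) by blast
  moreover have "d \<le> n" if "cell_dim L S n d C" for d C using that gen_cell_dim_le unfolding cell_dim_def by blast
  ultimately show ?thesis unfolding has_dim_def by blast
qed

end

text \<open>The closure of \<open>B\<close> under \<open>\<delta>\<close>, the parameter set of all
  cells; its elements are available to source formulas as the constants
  \<open>\<delta>^j b\<close>.\<close>

definition orbits :: "('a => 'a) => 'a set => 'a set" where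
  "orbits \<delta> B = {(\<delta> ^^ j) b | j b. b \<in> B}"

lemma orbits_closed:
  assumes "b \<in> orbits \<delta> B" shows "\<delta> b \<in> orbits \<delta> B"
proof -
  obtain j c where "b = (\<delta> ^^ j) c" "c \<in> B" using assms unfolding orbits_def by blast
  then have "\<delta> b = (\<delta> ^^ Suc j) c" "c \<in> B" by simp_all
  then show ?thesis unfolding orbits_def by blast
qed

locale tame_derivation = tame L S for L :: "('f, 'r, 'z) ord_ring_lang_scheme" and S :: "('a::linordered_field, 'f, 'r) struct" +
  fixes \<delta> :: "'a => 'a"
  assumes der: "T_derivation L S \<delta>" and gen: "generic_derivation L S \<delta>"
begin

lemma omin_derivation_Df: "omin_derivation (Df {}) (Df UNIV) \<delta>"
proof (intro omin_derivation.intro omin_pair_Df omin_derivation_axioms.intro)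
  fix n U f u and J :: "nat => 'a"
  assume a: "euclidean_open n U" "Df {} (Suc n) {x @ [f x] | x. x \<in> U}" "Cp_open n 1 U f" "u \<in> U"
    "\<And>i. i < n ==> has_partial f i u (J i)"
  have "definable_fun L S {} n U f" using a(1,2) unfolding definable_fun_def euclidean_open_def by simp
  then show "\<delta> (f u) = (\<Sum>i<n. J i * \<delta> (u ! i))" using der a unfolding T_derivation_def by blast
qed

text \<open>As a function of no variables 0 is definable without parameters, and its derivative is
  the empty sum.\<close>

lemma derivation_zero: "\<delta> 0 = 0"
proof -
  interpret omin_derivation "Df {}" "Df UNIV" \<delta> by (rule omin_derivation_Df)
  have "Df {} (Suc 0) {x @ [0] | x. x \<in> {[]}}"
    by (rule B.D_graph_on[OF _ B.df_zero]) (use B.D_pow[of 0] in \<open>simp add: tuples_def\<close>)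
  moreover have "euclidean_open 0 {[] :: 'a list}" unfolding euclidean_open_def by (auto intro: exI[of _ 1])
  moreover have "Cp_open 0 1 {[] :: 'a list} (\<lambda>x. 0)" by (auto simp: cont_on_def intro: exI[of _ 1])
  ultimately show ?thesis using T_der[of 0 "{[]}" "\<lambda>x. 0" "[]"] by simp
qed

text \<open>With its parameters \<open>bs\<close> turned into arguments, \<open>F\<close> is covered
  by the parameter-free case; in the result \<open>bs\<close> and \<open>map \<delta> bs\<close> are
  constants from \<open>V\<close>.\<close>

lemma derivative_Df:
  assumes "\<And>b. b \<in> V ==> \<delta> b \<in> V" "dstruct.df (Df V) n F"
  shows "\<exists>G. dstruct.df (Df V) (n + n) G \<and> (\<forall>u. length u = n --> \<delta> (F u) = G (u @ map \<delta> u))"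
proof -
  interpret D0: omin_derivation "Df {}" "Df UNIV" \<delta> by (rule omin_derivation_Df)
  interpret V: dstruct "Df V" by (rule dstruct_Df)
  have "Df V (Suc n) {x @ [F x] | x. length x = n}" using assms(2) unfolding V.df_graph .
  then obtain bs Z0 where bs: "set bs \<subseteq> V" "Df {} (length bs + Suc n) Z0"
    "\<And>x. length x = Suc n ==> x \<in> {x @ [F x] | x. length x = n} \<longleftrightarrow> bs @ x \<in> Z0"
    by (rule definable_fiberE) (rule that)
  let ?m = "length bs + n"
  define F0 where "F0 w = the1 (\<lambda>y. w @ [y] \<in> Z0)" for w
  have F0: "D0.B.df ?m F0" unfolding F0_def
  proof (rule D0.B.df_the1)
    have "D0.B.dp (Suc ?m) (\<lambda>z. take ?m z @ [z ! ?m] \<in> Z0) = D0.B.dp (Suc ?m) (\<lambda>z. z \<in> Z0)"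
      by (rule D0.B.dp_cong) (simp add: take_snoc_nth)
    moreover have "D0.B.dp (Suc ?m) (\<lambda>z. z \<in> Z0)" by (rule D0.B.dp_memI) (use bs(2) in simp)
    ultimately show "D0.B.dp (Suc ?m) (\<lambda>z. take ?m z @ [z ! ?m] \<in> Z0)" by blast
  qed
  have FF: "F u = F0 (bs @ u)" if "length u = n" for u
  proof -
    have "(bs @ u) @ [y] \<in> Z0 \<longleftrightarrow> y = F u" for y using bs(3)[of "u @ [y]"] that by auto
    then show ?thesis unfolding F0_def by (simp add: the1_def)
  qed
  obtain G0 where G0: "D0.B.df (?m + ?m) G0" "\<And>u. length u = ?m ==> \<delta> (F0 u) = G0 (u @ map \<delta> u)"
    using D0.derivative_of_definable[OF F0] by blast
  have G0V: "V.df (?m + ?m) G0"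
    using G0(1) unfolding D0.B.df_graph V.df_graph by (rule Df_mono) simp
  define G where "G z = G0 ((bs @ take n z) @ (map \<delta> bs @ drop n z))" for z
  have "set (map \<delta> bs) \<subseteq> V" using bs(1) assms(1) by auto
  then have "V.df (n + n) G" unfolding G_def
    by (intro V.df_comp[OF G0V] V.dl_append[OF _ _ refl] V.dl_take[OF V.dl_id] V.dl_drop[OF V.dl_id] dl_const_Df bs(1)) simp_all
  moreover have "\<delta> (F u) = G (u @ map \<delta> u)" if "length u = n" for u
    using G0(2)[of "bs @ u"] FF[OF that] that unfolding G_def by simp
  ultimately show ?thesis by blast
qed

text \<open>Genericity is applied to the graph of \<open>h\<close> over \<open>V\<close>, whose
  projection \<open>V\<close> has full dimension because it contains a box.\<close>

lemma jets_Df: "jets (Df (orbits \<delta> B)) (Df UNIV) \<delta>"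
proof (intro jets.intro omin_pair_Df jets_axioms.intro)
  fix n F assume F: "dstruct.df (Df (orbits \<delta> B)) n F"
  show "\<exists>G. dstruct.df (Df (orbits \<delta> B)) (n + n) G \<and> (\<forall>u. length u = n --> \<delta> (F u) = G (u @ map \<delta> u))"
    by (rule derivative_Df[OF _ F]) (rule orbits_closed)
next
  fix m V h assume a: "Df UNIV m V" "fat m (\<lambda>x. x \<in> V)" "dstruct.df (Df UNIV) m h"
  let ?A = "{x @ [h x] | x. x \<in> V}"
  have DA: "Df UNIV (Suc m) ?A" by (rule dstruct.D_graph_on[OF dstruct_Df a(1,3)])
  have "take m ` ?A = V"
  proof -
    have "take m (x @ [h x]) = x" if "x \<in> V" for x using dstruct.D_length[OF dstruct_Df a(1) that] by simp
    then show ?thesis by (force simp: image_iff)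
  qed
  then have "has_dim L S m (take m ` ?A) m" using fat_has_dim[OF a(2)] by simp
  with DA have "\<exists>c. map (\<lambda>j. (\<delta> ^^ j) c) [0..<Suc m] \<in> ?A"
    by (intro gen[unfolded generic_derivation_def, rule_format] conjI)
  then obtain c where c: "map (\<lambda>j. (\<delta> ^^ j) c) [0..<Suc m] \<in> ?A" by (rule exE)
  then have "jl \<delta> m c @ [(\<delta> ^^ m) c] \<in> ?A" unfolding jl_def by simp
  then show "\<exists>a. jl \<delta> m a \<in> V \<and> (\<delta> ^^ m) a = h (jl \<delta> m a)" by (intro exI[of _ c]) auto
qed

end

section \<open>Formulas with a derivation\<close>

lemma delta_struct_simps [simp]:
  "univ (delta_struct S \<delta>) = univ S" "fint (delta_struct S \<delta>) (Base f) xs = fint S f xs"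
  "fint (delta_struct S \<delta>) Delta xs = \<delta> (hd xs)" "rint (delta_struct S \<delta>) = rint S"
  by (simp_all add: delta_struct_def)

lemma delta_lang_simps [simp]:
  "farity (delta_lang L) (Base f) = farity L f" "farity (delta_lang L) Delta = 1" "rarity (delta_lang L) = rarity L"
  by (simp_all add: delta_lang_def)

text \<open>Bound variables are included because every variable of a formula is to be a coordinate
  of one fixed M^K, in which a quantifier changes a single entry.\<close>

primrec all_vars :: "('f, 'r) fm => nat set" where
  "all_vars (Eq s t) = fv_tm s \<union> fv_tm t"
| "all_vars (Rel r ts) = (\<Union>t \<in> set ts. fv_tm t)"
| "all_vars (Neg \<phi>) = all_vars \<phi>"
| "all_vars (Conj \<phi> \<psi>) = all_vars \<phi> \<union> all_vars \<psi>"
| "all_vars (All v \<phi>) = insert v (all_vars \<phi>)"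

lemma finite_all_vars [simp]: "finite (all_vars \<phi>)"
  by (induction \<phi>) auto

lemma fv_all_vars: "fv_fm \<phi> \<subseteq> all_vars \<phi>"
  by (induction \<phi>) auto

lemma (in tame) fint_df:
  "dstruct.df (Df V) (farity L f) (fint S f)"
proof -
  let ?n = "farity L f" and ?\<phi> = "Eq (Var (farity L f)) (Fn (Sym f) (map Var [0..<farity L f])) :: (('f, 'a) psym, 'r) fm"
  have "Df V (Suc ?n) {x @ [fint S f x] | x. length x = ?n}"
  proof (rule definableI[of ?\<phi>])
    fix u :: "'a list" assume u: "length u = Suc ?n"
    have "map (eval_tm PS ((!) u)) (map Var [0..<?n]) = take ?n u"
      using map_nth_upt_take[of ?n u] u by (simp add: comp_def)
    then have "sat PS ((!) u) ?\<phi> \<longleftrightarrow> u ! ?n = fint S f (take ?n u)" by (simp del: map_map)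
    also have "\<dots> \<longleftrightarrow> u \<in> {x @ [fint S f x] | x. length x = ?n}"
    proof
      assume "u ! ?n = fint S f (take ?n u)"
      then have "u = take ?n u @ [fint S f (take ?n u)]" using take_snoc_nth[OF u] by simp
      then show "u \<in> {x @ [fint S f x] | x. length x = ?n}" using u by (intro CollectI exI[of _ "take ?n u"]) simp
    qed (auto simp: nth_append)
    finally show "sat PS ((!) u) ?\<phi> \<longleftrightarrow> u \<in> {x @ [fint S f x] | x. length x = ?n}" .
  qed (auto simp: params_def)
  then show ?thesis unfolding dstruct.df_graph[OF dstruct_Df] .
qed

lemma (in tame) rint_definable:
  "Df V (rarity L r) {u. length u = rarity L r \<and> rint S r u}"
proof (rule definableI[of "Rel r (map Var [0..<rarity L r])"])
  fix u :: "'a list" assume u: "length u = rarity L r"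
  have "map (eval_tm PS ((!) u)) (map Var [0..<rarity L r]) = u"
    using map_nth_upt_take[of "rarity L r" u] u by (simp add: comp_def)
  then show "sat PS ((!) u) (Rel r (map Var [0..<rarity L r])) \<longleftrightarrow> u \<in> {u. length u = rarity L r \<and> rint S r u}"
    using u by (simp del: map_map)
qed (auto simp: params_def)

locale tame_jets = tame_derivation L S \<delta> for L :: "('f, 'r, 'z) ord_ring_lang_scheme"
    and S :: "('a::linordered_field, 'f, 'r) struct" and \<delta> +
  fixes B :: "'a set" and p :: nat

sublocale tame_jets \<subseteq> J: jets "definable L S (orbits \<delta> B)" "definable L S UNIV" p \<delta>
  by (rule jets_Df)

context tame_jets
begin

abbreviation "DB \<equiv> definable L S (orbits \<delta> B)"
abbreviation "DL \<equiv> param_lang (delta_lang L) :: (('f dsym, 'a) psym, 'r) lang"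
abbreviation "DS \<equiv> param_struct (delta_struct S \<delta>)"

lemma D_pull: "DB (tot ns) A ==> le_ord ns ns' ==> DB (tot ns') (J.pull ns ns' A)"
  unfolding J.pull_def by (rule J.B.D_Collect, rule J.B.dp_mem, assumption, rule J.dl_jcut[OF J.B.dl_id]) auto

lemma jet_pull: "le_ord ns ns' ==> length x = length ns ==> jet \<delta> ns' x \<in> J.pull ns ns' A \<longleftrightarrow> jet \<delta> ns x \<in> A"
  unfolding J.pull_def using sel_jcut_jet[of ns ns' x \<delta>] list_all2_lengthD[of "(\<le>)" ns ns'] by simp

lemma df_pull: "J.B.df (tot ns) h ==> le_ord ns ns' ==> J.B.df (tot ns') (\<lambda>u. h (sel (jcut ns ns') u))"
  by (rule J.B.df_comp, assumption, rule J.dl_jcut[OF J.B.dl_id]) auto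

lemma jet_nth:
  assumes "length x = length ns" "i < length ns" "j \<le> ns ! i"
  shows "jet \<delta> ns x ! jet_index ns i j = (\<delta> ^^ j) (x ! i)"
  using coords_jet_index[OF assms(2,3)] assms(1) by (simp add: jet_coords)

section \<open>Quantifier elimination for the pair in terms of jets\<close>

definition "jet_fun K F \<longleftrightarrow> (\<exists>ns h. length ns = K \<and> J.B.df (tot ns) h \<and> (\<forall>x. length x = K --> F x = h (jet \<delta> ns x)))"

lemma jet_funs_common:
  assumes "\<And>t. t \<in> set ts ==> jet_fun K (F t)"
  shows "\<exists>ns h. length ns = K \<and> (\<forall>t\<in>set ts. J.B.df (tot ns) (h t)) \<and> (\<forall>t\<in>set ts. \<forall>x. length x = K --> F t x = h t (jet \<delta> ns x))"
proof -
  have "\<forall>t\<in>set ts. \<exists>ns. \<exists>h. length ns = K \<and> J.B.df (tot ns) h \<and> (\<forall>x. length x = K --> F t x = h (jet \<delta> ns x))"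
    using assms unfolding jet_fun_def by blast
  from bchoice[OF this] obtain m where m: "\<forall>t\<in>set ts. \<exists>h. length (m t) = K \<and> J.B.df (tot (m t)) h \<and> (\<forall>x. length x = K --> F t x = h (jet \<delta> (m t) x))"
    by (elim exE)
  from bchoice[OF this] obtain h where h: "\<forall>t\<in>set ts. length (m t) = K \<and> J.B.df (tot (m t)) (h t) \<and> (\<forall>x. length x = K --> F t x = h t (jet \<delta> (m t) x))"
    by (elim exE)
  have "\<exists>ns. length ns = K \<and> (\<forall>s\<in>m ` set ts. le_ord s ns)"
    by (rule le_ord_bound) (use h in auto)
  then obtain ns where ns: "length ns = K" "\<And>t. t \<in> set ts ==> le_ord (m t) ns" by auto
  have "J.B.df (tot ns) (\<lambda>u. h t (sel (jcut (m t) ns) u))" if "t \<in> set ts" for t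
    by (rule df_pull[OF _ ns(2)[OF that]]) (use h that in blast)
  moreover have "F t x = h t (sel (jcut (m t) ns) (jet \<delta> ns x))" if "t \<in> set ts" "length x = K" for t x
    using sel_jcut_jet[OF ns(2)[OF that(1)], of x \<delta>] h that by simp
  ultimately show ?thesis using ns(1) by (intro exI[of _ ns] exI[of _ "\<lambda>t u. h t (sel (jcut (m t) ns) u)"]) simp
qed

lemma jet_fun_comp:
  assumes "\<And>t. t \<in> set ts ==> jet_fun K (F t)" "J.B.df (length ts) f"
  shows "jet_fun K (\<lambda>x. f (map (\<lambda>t. F t x) ts))"
proof -
  have "\<exists>ns h. length ns = K \<and> (\<forall>t\<in>set ts. J.B.df (tot ns) (h t)) \<and> (\<forall>t\<in>set ts. \<forall>x. length x = K --> F t x = h t (jet \<delta> ns x))"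
    by (rule jet_funs_common) (rule assms(1))
  then obtain ns h where h: "length ns = K" "\<forall>t\<in>set ts. J.B.df (tot ns) (h t)" "\<forall>t\<in>set ts. \<forall>x. length x = K --> F t x = h t (jet \<delta> ns x)"
    by (elim exE conjE) (rule that)
  have "J.B.df (tot ns) (\<lambda>u. f (map (\<lambda>t. h t u) ts))"
    by (rule J.B.df_comp[OF assms(2)], rule J.B.dl_map[OF refl]) (use h(2) in blast)
  moreover have "f (map (\<lambda>t. F t x) ts) = f (map (\<lambda>t. h t (jet \<delta> ns x)) ts)" if "length x = K" for x
    by (rule arg_cong[where f = f], rule map_cong[OF refl]) (use h(3) that in blast)
  ultimately show ?thesis unfolding jet_fun_def using h(1)
    by (intro exI[of _ ns] exI[of _ "\<lambda>u. f (map (\<lambda>t. h t u) ts)"]) simp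
qed

lemma jet_fun_delta:
  assumes "jet_fun K F" shows "jet_fun K (\<lambda>x. \<delta> (F x))"
proof -
  obtain ns h where h: "length ns = K" "J.B.df (tot ns) h" "\<forall>x. length x = K --> F x = h (jet \<delta> ns x)"
    using assms unfolding jet_fun_def by (elim exE conjE) (rule that)
  obtain G where G: "J.B.df (tot ns + tot ns) G" "\<forall>u. length u = tot ns --> \<delta> (h u) = G (u @ map \<delta> u)"
    using J.derivative[OF h(2)] by (elim exE conjE) (rule that)
  let ?ns = "map Suc ns" and ?h = "\<lambda>v. G (sel (jcut ns (map Suc ns)) v @ sel (jdcut ns) v)"
  have "J.B.df (tot ?ns) ?h"
    by (rule J.B.df_comp[OF G(1)], rule J.B.dl_append[OF J.dl_jcut[OF J.B.dl_id le_ord_map_Suc refl] J.dl_jdcut[OF J.B.dl_id refl] refl])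
  moreover have "\<delta> (F x) = ?h (jet \<delta> ?ns x)" if x: "length x = K" for x
    using G(2) h(3) x sel_jcut_jet[OF le_ord_map_Suc, of x ns \<delta>] sel_jdcut_jet[of x ns \<delta>] h(1) by simp
  ultimately show ?thesis unfolding jet_fun_def using h(1) by (intro exI[of _ ?ns] exI[of _ ?h]) simp
qed

lemma jet_fun_tm:
  assumes "wf_tm DL t" "fv_tm t \<subseteq> {..<K}" "{a. Par a \<in> syms_tm t} \<subseteq> B"
  shows "jet_fun K (\<lambda>x. eval_tm DS ((!) x) t)"
  using assms
proof (induction t)
  case (Var i)
  then have i: "i < K" by simp
  let ?ns = "replicate K (0::nat)"
  have "jet_index ?ns i 0 < tot ?ns" using coords_jet_index[of i ?ns 0] i by simp
  then have "J.B.df (tot ?ns) (\<lambda>u. u ! jet_index ?ns i 0)" by (rule J.B.df_nth0)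
  moreover have "x ! i = jet \<delta> ?ns x ! jet_index ?ns i 0" if "length x = K" for x
    using jet_nth[of x ?ns i 0] that i by simp
  ultimately show ?case unfolding jet_fun_def
    by (intro exI[of _ ?ns] exI[of _ "\<lambda>u. u ! jet_index ?ns i 0"]) simp
next
  case (Fn f ts)
  have IH: "jet_fun K (\<lambda>x. eval_tm DS ((!) x) t)" if "t \<in> set ts" for t
  proof (rule Fn.IH[OF that])
    show "wf_tm DL t" using Fn.prems(1) that by simp
    show "fv_tm t \<subseteq> {..<K}" using Fn.prems(2) that by (simp add: UN_subset_iff)
    show "{a. Par a \<in> syms_tm t} \<subseteq> B" using Fn.prems(3) that by auto
  qed
  show ?case
  proof (cases f)
    case (Par b)
    then have b: "b \<in> orbits \<delta> B" using Fn.prems(3) by (auto simp: orbits_def intro!: exI[of _ 0] exI[of _ b])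
    let ?ns = "replicate K (0::nat)"
    have "J.B.df (tot ?ns) (\<lambda>u. b)" by (rule df_const_Df[OF b])
    then show ?thesis unfolding jet_fun_def Par by (intro exI[of _ ?ns] exI[of _ "\<lambda>u. b"]) simp
  next
    case (Sym s)
    show ?thesis
    proof (cases s)
      case (Base g)
      have l: "length ts = farity L g" using Fn.prems(1) Sym Base by simp
      have "jet_fun K (\<lambda>x. fint S g (map (\<lambda>t. eval_tm DS ((!) x) t) ts))"
        by (rule jet_fun_comp[OF IH]) (use fint_df[of "orbits \<delta> B" g] l in simp_all)
      then show ?thesis unfolding Sym Base by simp
    next
      case Delta
      then have "length ts = 1" using Fn.prems(1) Sym by simp
      then obtain t where t: "ts = [t]" by (auto simp: length_Suc_conv)
      show ?thesis unfolding Sym Delta t using jet_fun_delta[OF IH[of t]] t by simp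
    qed
  qed
qed

definition "jet_set K P \<longleftrightarrow> (\<exists>ns A. length ns = K \<and> DB (tot ns) A \<and> (\<forall>x. length x = K --> (P x \<longleftrightarrow> jet \<delta> ns x \<in> A)))"

lemma jet_set_comp:
  assumes "\<And>t. t \<in> set ts ==> jet_fun K (F t)" "DB (length ts) Z"
  shows "jet_set K (\<lambda>x. map (\<lambda>t. F t x) ts \<in> Z)"
proof -
  have "\<exists>ns h. length ns = K \<and> (\<forall>t\<in>set ts. J.B.df (tot ns) (h t)) \<and> (\<forall>t\<in>set ts. \<forall>x. length x = K --> F t x = h t (jet \<delta> ns x))"
    by (rule jet_funs_common) (rule assms(1))
  then obtain ns h where h: "length ns = K" "\<forall>t\<in>set ts. J.B.df (tot ns) (h t)" "\<forall>t\<in>set ts. \<forall>x. length x = K --> F t x = h t (jet \<delta> ns x)"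
    by (elim exE conjE) (rule that)
  let ?A = "{u. length u = tot ns \<and> map (\<lambda>t. h t u) ts \<in> Z}"
  have "DB (tot ns) ?A"
    by (rule J.B.D_Collect, rule J.B.dp_mem[OF assms(2)], rule J.B.dl_map[OF refl]) (use h(2) in blast)
  moreover have "map (\<lambda>t. F t x) ts \<in> Z \<longleftrightarrow> jet \<delta> ns x \<in> ?A" if x: "length x = K" for x
  proof -
    have "map (\<lambda>t. F t x) ts = map (\<lambda>t. h t (jet \<delta> ns x)) ts"
      by (rule map_cong[OF refl]) (use h(3) x in blast)
    then have "map (\<lambda>t. F t x) ts \<in> Z \<longleftrightarrow> map (\<lambda>t. h t (jet \<delta> ns x)) ts \<in> Z" by (rule arg_cong[where f = "\<lambda>w. w \<in> Z"])
    then show ?thesis by (simp only: mem_Collect_eq length_jet simp_thms)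
  qed
  ultimately show ?thesis unfolding jet_set_def using h(1) by (intro exI[of _ ns] exI[of _ ?A] conjI allI impI)
qed

lemma jet_set_not:
  assumes "jet_set K P" shows "jet_set K (\<lambda>x. \<not> P x)"
proof -
  obtain ns A where A: "length ns = K" "DB (tot ns) A" "\<forall>x. length x = K --> (P x \<longleftrightarrow> jet \<delta> ns x \<in> A)"
    using assms unfolding jet_set_def by (elim exE conjE) (rule that)
  show ?thesis unfolding jet_set_def
    by (intro exI[of _ ns] exI[of _ "pow (tot ns) - A"] conjI J.B.D_compl A) (use A(3) in simp)
qed

lemma jet_set_conj:
  assumes "jet_set K P" "jet_set K Q" shows "jet_set K (\<lambda>x. P x \<and> Q x)"
proof -
  obtain n1 A1 where A1: "length n1 = K" "DB (tot n1) A1" "\<forall>x. length x = K --> (P x \<longleftrightarrow> jet \<delta> n1 x \<in> A1)"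
    using assms(1) unfolding jet_set_def by (elim exE conjE) (rule that)
  obtain n2 A2 where A2: "length n2 = K" "DB (tot n2) A2" "\<forall>x. length x = K --> (Q x \<longleftrightarrow> jet \<delta> n2 x \<in> A2)"
    using assms(2) unfolding jet_set_def by (elim exE conjE) (rule that)
  have "\<exists>ns. length ns = K \<and> (\<forall>s\<in>{n1, n2}. le_ord s ns)" by (rule le_ord_bound) (use A1(1) A2(1) in auto)
  then obtain ns where ns: "length ns = K" "le_ord n1 ns" "le_ord n2 ns" by auto
  have "DB (tot ns) (J.pull n1 ns A1 \<inter> J.pull n2 ns A2)" by (intro J.B.D_Int D_pull A1 A2 ns)
  moreover have "P x \<and> Q x \<longleftrightarrow> jet \<delta> ns x \<in> J.pull n1 ns A1 \<inter> J.pull n2 ns A2" if "length x = K" for x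
    using A1(3) A2(3) jet_pull[OF ns(2), of x A1] jet_pull[OF ns(3), of x A2] A1(1) A2(1) that by simp
  ultimately show ?thesis unfolding jet_set_def using ns(1) by blast
qed

text \<open>\<open>projection_definable\<close> quantifies over a new last block, while the
  quantified variable sits at position \<open>v\<close>. The selection \<open>I\<close> reads the
  coordinates of that variable from the new block instead of its old one.\<close>

lemma jet_set_ex:
  assumes "jet_set K P" "v < K" shows "jet_set K (\<lambda>x. \<exists>a. P (x[v := a]))"
proof -
  obtain ns A where A: "length ns = K" "DB (tot ns) A" "\<forall>x. length x = K --> (P x \<longleftrightarrow> jet \<delta> ns x \<in> A)"
    using assms(1) unfolding jet_set_def by (elim exE conjE) (rule that)
  let ?N = "ns ! v"
  define I where "I = map (\<lambda>(i, j). if i = v then tot ns + j else jet_index ns i j) (coords ns)"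
  have I: "length I = tot ns" "set I \<subseteq> {..<tot ns + Suc ?N}"
  proof -
    have "(if i = v then tot ns + j else jet_index ns i j) < tot ns + Suc ?N" if "(i, j) \<in> set (coords ns)" for i j
      using that coords_jet_index[of i ns j] by (auto simp: set_coords)
    then show "set I \<subseteq> {..<tot ns + Suc ?N}" unfolding I_def by auto
  qed (simp add: I_def)
  have DY: "DB (tot ns + Suc ?N) {z \<in> pow (tot ns + Suc ?N). map ((!) z) I \<in> A}"
    by (rule J.B.D_reindex[OF A(2) I(2,1)])
  have j: "map ((!) (jet \<delta> ns x @ jl \<delta> (Suc ?N) a)) I = jet \<delta> ns (x[v := a])" if x: "length x = K" for x a
  proof -
    have "(jet \<delta> ns x @ jl \<delta> (Suc ?N) a) ! (if i = v then tot ns + j else jet_index ns i j) = (\<delta> ^^ j) (x[v := a] ! i)"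
      if "(i, j) \<in> set (coords ns)" for i j
    proof -
      have ij: "i < K" "j \<le> ns ! i" using that A(1) by (auto simp: set_coords)
      show ?thesis
      proof (cases "i = v")
        case True
        then have "jl \<delta> (Suc ?N) a ! j = (\<delta> ^^ j) a" using ij(2) unfolding jl_def by (simp del: upt_Suc)
        then show ?thesis using True ij(1) x by (simp add: nth_append)
      next
        case False
        have "jet_index ns i j < tot ns" using coords_jet_index[of i ns j] ij A(1) by simp
        then show ?thesis using False ij x A(1) jet_nth[of x ns i j] by (simp add: nth_append)
      qed
    qed
    then have "map ((!) (jet \<delta> ns x @ jl \<delta> (Suc ?N) a)) I = map (\<lambda>(i, j). (\<delta> ^^ j) (x[v := a] ! i)) (coords ns)"
      unfolding I_def by auto
    then show ?thesis using jet_coords[of "x[v := a]" ns \<delta>] x A(1) by simp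
  qed
  obtain ns' W where W: "le_ord ns ns'" "DB (tot ns') W"
    "\<forall>y. length y = length ns --> (jet \<delta> ns' y \<in> W \<longleftrightarrow> (\<exists>a. jet \<delta> ns y @ jl \<delta> (Suc ?N) a \<in> {z \<in> pow (tot ns + Suc ?N). map ((!) z) I \<in> A}))"
    using J.projection_definable[OF DY] by (elim exE conjE) (rule that)
  have "(\<exists>a. P (x[v := a])) \<longleftrightarrow> jet \<delta> ns' x \<in> W" if x: "length x = K" for x
    using W(3)[rule_format, of x] A(1,3) j[OF x] x by simp
  moreover have "length ns' = K" using list_all2_lengthD[OF W(1)] A(1) by simp
  ultimately show ?thesis unfolding jet_set_def using W(2) by blast
qed

text \<open>Terms are definable functions of jets, since such functions are closed under
  \<open>\<delta>\<close>, and a quantifier is removed by projection. So truth of any formula of the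
  pair becomes a condition on a jet, with parameters in the orbits of \<open>B\<close>.\<close>

lemma jet_set_fm:
  assumes "wf_fm DL \<phi>" "all_vars \<phi> \<subseteq> {..<K}" "params \<phi> \<subseteq> B"
  shows "jet_set K (\<lambda>x. sat DS ((!) x) \<phi>)"
  using assms
proof (induction \<phi>)
  case (Eq s t)
  have st: "jet_fun K (\<lambda>x. eval_tm DS ((!) x) r)" if "r \<in> set [s, t]" for r
    by (rule jet_fun_tm) (use Eq.prems that in \<open>auto simp: params_def\<close>)
  have "J.B.dp 2 (\<lambda>u. u ! 0 = u ! 1)" by (rule J.B.dp_nth_eq) simp_all
  then have "DB (length [s, t]) {u. length u = 2 \<and> u ! 0 = u ! 1}" using J.B.D_Collect by (simp add: numeral_2_eq_2)
  from jet_set_comp[OF st this] show ?case by simp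
next
  case (Rel r ts)
  have st: "jet_fun K (\<lambda>x. eval_tm DS ((!) x) t)" if "t \<in> set ts" for t
    by (rule jet_fun_tm) (use Rel.prems that in \<open>auto simp: params_def\<close>)
  have l: "length ts = rarity L r" using Rel.prems(1) by simp
  have "jet_set K (\<lambda>x. map (\<lambda>t. eval_tm DS ((!) x) t) ts \<in> {u. length u = rarity L r \<and> rint S r u})"
    by (rule jet_set_comp[OF st]) (use rint_definable[of "orbits \<delta> B" r] l in simp_all)
  then show ?case using l by simp
next
  case (Neg \<phi>)
  have "jet_set K (\<lambda>x. sat DS ((!) x) \<phi>)" by (rule Neg.IH) (use Neg.prems in \<open>simp_all add: params_def\<close>)
  from jet_set_not[OF this] show ?case by simp
next
  case (Conj \<phi> \<psi>)
  have "jet_set K (\<lambda>x. sat DS ((!) x) \<phi>)" by (rule Conj.IH(1)) (use Conj.prems in \<open>auto simp: params_def\<close>)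
  moreover have "jet_set K (\<lambda>x. sat DS ((!) x) \<psi>)" by (rule Conj.IH(2)) (use Conj.prems in \<open>auto simp: params_def\<close>)
  ultimately show ?case using jet_set_conj by simp
next
  case (All v \<phi>)
  have IH: "jet_set K (\<lambda>x. sat DS ((!) x) \<phi>)" by (rule All.IH) (use All.prems in \<open>simp_all add: params_def\<close>)
  have v: "v < K" using All.prems(2) by simp
  have J: "jet_set K (\<lambda>x. \<not> (\<exists>a. \<not> sat DS ((!) (x[v := a])) \<phi>))"
    by (rule jet_set_not[OF jet_set_ex[OF jet_set_not[OF IH] v]])
  have "sat DS ((!) x) (All v \<phi>) \<longleftrightarrow> \<not> (\<exists>a. \<not> sat DS ((!) (x[v := a])) \<phi>)" if x: "length x = K" for x
  proof -
    have "sat DS (((!) x)(v := a)) \<phi> \<longleftrightarrow> sat DS ((!) (x[v := a])) \<phi>" for a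
    proof (rule sat_cong)
      fix i assume "i \<in> fv_fm \<phi>"
      then have "i < K" using fv_all_vars[of \<phi>] All.prems(2) by auto
      then show "(((!) x)(v := a)) i = x[v := a] ! i" using x by (simp add: nth_list_update)
    qed
    then show ?thesis by simp
  qed
  then show ?case using J unfolding jet_set_def by simp
qed

text \<open>The surplus variables are set to 0, whose derivatives are all 0, so that a jet of
  \<open>x\<close> determines the jet of the longer tuple.\<close>

lemma jet_set_restrict:
  assumes "jet_set K P" "k \<le> K"
  shows "jet_set k (\<lambda>x. P (x @ replicate (K - k) 0))"
proof -
  obtain ns A where A: "length ns = K" "DB (tot ns) A" "\<forall>x. length x = K --> (P x \<longleftrightarrow> jet \<delta> ns x \<in> A)"
    using assms(1) unfolding jet_set_def by (elim exE conjE) (rule that)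
  let ?ns = "take k ns"
  have l: "length ?ns = k" using A(1) assms(2) by simp
  define l where "l u = map (\<lambda>c. if fst c < k then u ! jet_index ?ns (fst c) (snd c) else 0) (coords ns)" for u :: "'a list"
  have "J.B.dl (tot ?ns) (tot ns) l" unfolding l_def
  proof (rule J.B.dl_map)
    fix c assume c: "c \<in> set (coords ns)"
    show "J.B.df (tot ?ns) (\<lambda>u. if fst c < k then u ! jet_index ?ns (fst c) (snd c) else 0)"
    proof (cases "fst c < k")
      case True
      have "(fst c, snd c) \<in> set (coords ns)" using c by simp
      then have "snd c \<le> ns ! fst c" unfolding set_coords by simp
      then have "jet_index ?ns (fst c) (snd c) < tot ?ns" using coords_jet_index[of "fst c" ?ns "snd c"] True l by simp
      then have "J.B.df (tot ?ns) (\<lambda>u. u ! jet_index ?ns (fst c) (snd c))" by (rule J.B.df_nth0)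
      then show ?thesis using True by simp
    qed (simp add: J.B.df_zero)
  qed simp
  then have "DB (tot ?ns) {u. length u = tot ?ns \<and> l u \<in> A}" by (intro J.B.D_Collect J.B.dp_mem[OF A(2)])
  moreover have "l (jet \<delta> ?ns x) = jet \<delta> ns (x @ replicate (K - k) 0)" if x: "length x = k" for x
  proof -
    have z: "(\<delta> ^^ j) 0 = 0" for j by (induction j) (simp_all add: derivation_zero)
    have "(if fst c < k then jet \<delta> ?ns x ! jet_index ?ns (fst c) (snd c) else 0) = (\<lambda>(i, j). (\<delta> ^^ j) ((x @ replicate (K - k) 0) ! i)) c"
      if "c \<in> set (coords ns)" for c
    proof -
      have c: "(fst c, snd c) \<in> set (coords ns)" using that by simp
      then have c': "fst c < K" "snd c \<le> ns ! fst c" unfolding set_coords using A(1) by auto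
      show ?thesis
      proof (cases "fst c < k")
        case True
        then show ?thesis using jet_nth[of x ?ns "fst c" "snd c"] c' l x by (simp add: nth_append case_prod_beta)
      next
        case False
        then show ?thesis using c' x z by (simp add: nth_append case_prod_beta)
      qed
    qed
    then have "l (jet \<delta> ?ns x) = map (\<lambda>(i, j). (\<delta> ^^ j) ((x @ replicate (K - k) 0) ! i)) (coords ns)"
      unfolding l_def by (rule map_cong[OF refl])
    then show ?thesis using jet_coords[of "x @ replicate (K - k) 0" ns \<delta>] x A(1) assms(2) by simp
  qed
  ultimately show ?thesis unfolding jet_set_def using l A(3) assms(2)
    by (intro exI[of _ ?ns] exI[of _ "{u. length u = tot ?ns \<and> l u \<in> A}"]) simp
qed

lemma delta_definable_jet_set:
  assumes "definable (delta_lang L) (delta_struct S \<delta>) B k Z"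
  shows "jet_set k (\<lambda>x. x \<in> Z)"
proof -
  obtain \<phi> where \<phi>: "wf_fm DL \<phi>" "params \<phi> \<subseteq> B" "fv_fm \<phi> \<subseteq> {..<k}" "Z = defined_set (delta_struct S \<delta>) k \<phi>"
    using assms unfolding definable_def by blast
  have "finite (all_vars \<phi> \<union> {..<k})" by simp
  then obtain K where K: "\<forall>i\<in>all_vars \<phi> \<union> {..<k}. i < K" unfolding finite_nat_set_iff_bounded by blast
  then have K': "all_vars \<phi> \<subseteq> {..<K}" "k \<le> K" by (auto intro: ccontr simp: not_le)
  have "jet_set k (\<lambda>x. sat DS ((!) (x @ replicate (K - k) 0)) \<phi>)"
    by (rule jet_set_restrict[OF jet_set_fm[OF \<phi>(1) K'(1) \<phi>(2)] K'(2)])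
  moreover have "sat DS ((!) (x @ replicate (K - k) 0)) \<phi> \<longleftrightarrow> x \<in> Z" if x: "length x = k" for x
  proof -
    have "sat DS ((!) (x @ replicate (K - k) 0)) \<phi> \<longleftrightarrow> sat DS ((!) x) \<phi>"
      by (rule sat_cong) (use \<phi>(3) x in \<open>auto simp: nth_append\<close>)
    then show ?thesis unfolding \<phi>(4) defined_set_def using x by simp
  qed
  ultimately show ?thesis unfolding jet_set_def by simp
qed

end

section \<open>Source formulas\<close>

lemma delta_pow_simps [simp]:
  "delta_pow 0 t = t" "delta_pow (Suc j) t = Fn (Sym Delta) [delta_pow j t]"
  by (simp_all add: delta_pow_def)

lemma fv_delta_pow [simp]: "fv_tm (delta_pow j t) = fv_tm t"
  by (induction j) auto

lemma wf_delta_pow [simp]: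
  "wf_tm (param_lang (delta_lang L) :: (('f dsym, 'a) psym, 'r) lang) (delta_pow j t) \<longleftrightarrow>
   wf_tm (param_lang (delta_lang L) :: (('f dsym, 'a) psym, 'r) lang) t"
  by (induction j) auto

lemma eval_delta_pow [simp]:
  "eval_tm (param_struct (delta_struct S \<delta>)) e (delta_pow j t) = (\<delta> ^^ j) (eval_tm (param_struct (delta_struct S \<delta>)) e t)"
  by (induction j) auto

lemma Par_delta_pow [simp]: "Par a \<in> syms_tm (delta_pow j t) \<longleftrightarrow> Par a \<in> syms_tm t"
  by (induction j) auto

lemma replace_delta_pow: "replace_tm \<delta> ns m (delta_pow j t) = replace_tm \<delta> ns (m + j) t"
  by (induction j arbitrary: m) auto

lemma subterms_self: "t \<in> subterms t"
  by (cases t) auto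

lemma delta_pow_Var_inj: "delta_pow j (Var i) = delta_pow j' (Var i') \<longleftrightarrow> j = j' \<and> i = i'"
proof (induction j arbitrary: j')
  case 0
  then show ?case by (cases j') auto
next
  case (Suc j)
  then show ?case by (cases j') auto
qed

text \<open>This bounds the maximum in \<open>delta_ord\<close>: the term
  \<open>\<delta>^j x_i\<close> contributes only to the order of its own variable, and no order
  above j.\<close>

lemma delta_pow_in_subterms_Var: "(delta_pow j (Var i) :: ('f dsym, 'a) psym tm) \<in> subterms (delta_pow j' (Var i')) ==> i = i' \<and> j \<le> j'"
proof (induction j')
  case 0
  then show ?case by (cases j) auto
next
  case (Suc j')
  show ?case
  proof (cases "(delta_pow j (Var i) :: ('f dsym, 'a) psym tm) = delta_pow (Suc j') (Var i')")
    case True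
    then show ?thesis unfolding delta_pow_Var_inj by simp
  next
    case False
    then have "(delta_pow j (Var i) :: ('f dsym, 'a) psym tm) \<in> subterms (delta_pow j' (Var i'))" using Suc.prems by simp
    then show ?thesis using Suc.IH by simp
  qed
qed

lemma delta_pow_notin_subterms_Par: "(delta_pow j (Var i) :: ('f dsym, 'a) psym tm) \<notin> subterms (delta_pow j' (Fn (Par b) []))"
proof (induction j' arbitrary: j)
  case 0
  then show ?case by (cases j) auto
next
  case (Suc j')
  have "(delta_pow j (Var i) :: ('f dsym, 'a) psym tm) \<noteq> delta_pow (Suc j') (Fn (Par b) [])"
  proof (cases j)
    case (Suc m)
    have "(delta_pow m (Var i) :: ('f dsym, 'a) psym tm) \<noteq> delta_pow j' (Fn (Par b) [])"
      using Suc.IH[of m] subterms_self[of "delta_pow j' (Fn (Par b) [])"] by metis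
    then show ?thesis using Suc by simp
  qed simp
  then show ?case using Suc.IH[of j] by simp
qed

lemma delta_pow_in_subterms_Base:
  "delta_pow j (Var i) \<in> subterms (Fn (Sym (Base f)) ts) \<longleftrightarrow> (\<exists>t\<in>set ts. delta_pow j (Var i) \<in> subterms t)"
  by (cases j) auto

text \<open>Trivial equations force each \<open>\<delta>\<^sup>n x\<^sub>i\<close> to occur, so that a source formula can be given any order.\<close>

definition pad :: "(nat => 'f tm) => nat list => ('f, 'r) fm => ('f, 'r) fm" where
  "pad T is \<chi> = foldr (\<lambda>i \<chi>. Conj (Eq (T i) (T i)) \<chi>) is \<chi>"

lemma pad_simps:
  "wf_fm L (pad T is \<chi>) \<longleftrightarrow> (\<forall>i\<in>set is. wf_tm L (T i)) \<and> wf_fm L \<chi>"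
  "atom_terms (pad T is \<chi>) = T ` set is \<union> atom_terms \<chi>"
  "quantifier_free (pad T is \<chi>) \<longleftrightarrow> quantifier_free \<chi>"
  "sat S e (pad T is \<chi>) \<longleftrightarrow> sat S e \<chi>"
  by (induction "is") (auto simp: pad_def)

lemma replace_pad: "replace_fm \<delta> ns (pad T is \<chi>) = pad (\<lambda>i. replace_tm \<delta> ns 0 (T i)) is (replace_fm \<delta> ns \<chi>)"
  by (induction "is") (auto simp: pad_def)

lemma replace_tr_fm:
  "(\<And>t. t \<in> atom_terms \<psi> ==> replace_tm \<delta> ns 0 (tr_tm g \<sigma> t) = t) ==> replace_fm \<delta> ns (tr_fm g \<sigma> \<psi>) = \<psi>"
  by (induction \<psi>) (simp_all add: map_idI)

context tame_jets
begin

text \<open>A quantifier-free definition of \<open>K\<close> is read backwards through the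
  translation: the coordinate of \<open>\<delta>^j x_i\<close> becomes that term, and a parameter
  from the orbits is written as \<open>\<delta>^j b\<close> with \<open>b\<close> in
  \<open>B\<close>. Padding makes the orders exactly \<open>ns\<close>.\<close>

lemma source_formulaE:
  assumes K: "DB (tot ns) K" and l: "length ns = k"
  obtains \<phi> where "wf_fm DL \<phi>" "params \<phi> \<subseteq> B" "fv_fm \<phi> \<subseteq> {..<k}" "quantifier_free \<phi>"
    "\<And>t. t \<in> atom_terms \<phi> ==> delta_normal_tm t" "delta_ord k \<phi> = ns" "source_set S \<delta> k \<phi> = K"
    "defined_set (delta_struct S \<delta>) k \<phi> = J.realize k ns K"
proof -
  obtain \<psi> where \<psi>: "wf_fm PL \<psi>" "params \<psi> \<subseteq> orbits \<delta> B" "fv_fm \<psi> \<subseteq> {..<tot ns}" "quantifier_free \<psi>"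
      "\<And>u. length u = tot ns ==> sat PS ((!) u) \<psi> \<longleftrightarrow> u \<in> K" "K \<subseteq> pow (tot ns)" by (rule definable_qfE[OF K]) (rule that)
  have "\<forall>c\<in>orbits \<delta> B. \<exists>q. (\<delta> ^^ fst q) (snd q) = c \<and> snd q \<in> B" unfolding orbits_def by force
  from bchoice[OF this] obtain q where q: "\<forall>c\<in>orbits \<delta> B. (\<delta> ^^ fst (q c)) (snd (q c)) = c \<and> snd (q c) \<in> B" by (elim exE)
  define g :: "('f, 'a) psym => ('f dsym, 'a) psym tm list => ('f dsym, 'a) psym tm" where
    "g f ts = (case f of Sym s => Fn (Sym (Base s)) ts | Par c => delta_pow (fst (q c)) (Fn (Par (snd (q c))) []))" for f ts
  define \<sigma> :: "nat => ('f dsym, 'a) psym tm" where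
    "\<sigma> n = delta_pow (snd (coords ns ! n)) (Var (fst (coords ns ! n)))" for n
  define T :: "nat => ('f dsym, 'a) psym tm" where "T i = delta_pow (ns ! i) (Var i)" for i
  have co: "fst (coords ns ! n) < k" "snd (coords ns ! n) \<le> ns ! fst (coords ns ! n)"
    "jet_index ns (fst (coords ns ! n)) (snd (coords ns ! n)) = n" if "n < tot ns" for n
  proof -
    obtain i j where ij: "coords ns ! n = (i, j)" by fastforce
    have "(i, j) \<in> set (coords ns)" using nth_mem[of n "coords ns"] that ij by simp
    then have a: "i < length ns" "j \<le> ns ! i" by (auto simp: set_coords)
    then have "jet_index ns i j < tot ns" "coords ns ! jet_index ns i j = coords ns ! n" using coords_jet_index[of i ns j] ij by auto
    then have "jet_index ns i j = n" using nth_eq_iff_index_eq[OF distinct_coords, of "jet_index ns i j" ns n] that by simp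
    then show "fst (coords ns ! n) < k" "snd (coords ns ! n) \<le> ns ! fst (coords ns ! n)"
      "jet_index ns (fst (coords ns ! n)) (snd (coords ns ! n)) = n" using a ij l by auto
  qed
  \<comment> \<open>The last clause bounds the orders from above; that they are attained comes from
    the padding.\<close>
  let ?Q = "\<lambda>t. wf_tm DL t \<and> fv_tm t \<subseteq> {..<k} \<and> (\<forall>a. Par a \<in> syms_tm t --> a \<in> B) \<and> delta_normal_tm t \<and>
    (\<forall>i j. delta_pow j (Var i) \<in> subterms t --> j \<le> ns ! i)"
  have QV: "?Q (delta_pow j (Var i))" if "i < k" "j \<le> ns ! i" for i j
    using that delta_pow_in_subterms_Var by (fastforce intro: delta_normal_tm.intros(1))
  have Q1: "?Q t" if "t \<in> atom_terms (tr_fm g \<sigma> \<psi>)" for t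
  proof (rule atom_terms_tr_pred[where Q = ?Q, OF \<psi>(1,4) _ _ that])
    fix n assume "n \<in> fv_fm \<psi>"
    then have "n < tot ns" using \<psi>(3) by blast
    then show "?Q (\<sigma> n)" unfolding \<sigma>_def by (intro QV co)
  next
    fix f and ts :: "('f dsym, 'a) psym tm list"
    assume f: "f \<in> syms_fm \<psi>" "length ts = farity PL f" and ts: "\<And>t. t \<in> set ts ==> ?Q t"
    show "?Q (g f ts)"
    proof (cases f)
      case (Sym s)
      have "wf_tm DL (Fn (Sym (Base s)) ts)" using f(2) ts Sym by simp
      moreover have "fv_tm (Fn (Sym (Base s)) ts :: ('f dsym, 'a) psym tm) \<subseteq> {..<k}" using ts by (simp add: UN_subset_iff)
      moreover have "\<forall>a. Par a \<in> syms_tm (Fn (Sym (Base s)) ts) --> a \<in> B"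
      proof (intro allI impI)
        fix a assume "Par a \<in> syms_tm (Fn (Sym (Base s)) ts)"
        then obtain t where "t \<in> set ts" "Par a \<in> syms_tm t" by auto
        then show "a \<in> B" using ts[of t] by blast
      qed
      moreover have "delta_normal_tm (Fn (Sym (Base s)) ts)" using ts by (intro delta_normal_tm.intros(3)) blast
      moreover have "\<forall>i j. delta_pow j (Var i) \<in> subterms (Fn (Sym (Base s)) ts) --> j \<le> ns ! i"
        unfolding delta_pow_in_subterms_Base using ts by blast
      ultimately show ?thesis unfolding g_def Sym psym.case by blast
    next
      case (Par c)
      then have "c \<in> orbits \<delta> B" using f(1) \<psi>(2) unfolding params_def by blast
      then have "snd (q c) \<in> B" using q by blast
      then show ?thesis unfolding g_def Par psym.case
        by (auto simp: delta_pow_notin_subterms_Par intro: delta_normal_tm.intros(2))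
    qed
  qed
  define \<phi> where "\<phi> = pad T [0..<k] (tr_fm g \<sigma> \<psi>)"
  have QT: "?Q (T i)" if "i < k" for i unfolding T_def by (rule QV) (use that in simp_all)
  have atoms: "atom_terms \<phi> = T ` {..<k} \<union> atom_terms (tr_fm g \<sigma> \<psi>)" unfolding \<phi>_def pad_simps by (simp add: atLeast0LessThan)
  have Q: "?Q t" if t: "t \<in> atom_terms \<phi>" for t
  proof -
    consider i where "i < k" "t = T i" | "t \<in> atom_terms (tr_fm g \<sigma> \<psi>)" using t unfolding atoms by auto
    then show ?thesis using QT Q1 by cases blast+
  qed
  have Qw: "wf_tm DL t" and Qf: "fv_tm t \<subseteq> {..<k}" and Qp: "Par a \<in> syms_tm t --> a \<in> B" and Qn: "delta_normal_tm t"
    and Qs: "delta_pow j (Var i) \<in> subterms t --> j \<le> ns ! i" if "t \<in> atom_terms \<phi>" for t a i j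
    using Q[OF that] by blast+
  have wf: "wf_fm DL \<phi>"
    unfolding \<phi>_def pad_simps
  proof (intro conjI ballI wf_tr_fm[OF \<psi>(1)])
    show "wf_tm DL (T i)" if "i \<in> set [0..<k]" for i using QT that by simp
  qed (use Q1 in simp_all)
  have qf: "quantifier_free \<phi>" unfolding \<phi>_def pad_simps using \<psi>(4) by simp
  have fv: "fv_fm \<phi> \<subseteq> {..<k}" using Qf by (simp add: fv_atom_terms[OF qf] UN_subset_iff)
  have pa: "params \<phi> \<subseteq> B" using Qp unfolding params_def syms_atom_terms[of \<phi>] by blast
  have ord: "delta_ord k \<phi> = ns"
  proof (rule nth_equalityI)
    show "length (delta_ord k \<phi>) = length ns" unfolding delta_ord_def using l by simp
    fix i assume "i < length (delta_ord k \<phi>)"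
    then have i: "i < k" unfolding delta_ord_def by simp
    let ?S = "{0} \<union> {j. \<exists>t \<in> atom_terms \<phi>. delta_pow j (Var i) \<in> subterms t}"
    have s: "?S \<subseteq> {..ns ! i}" using Qs by auto
    have "ns ! i \<in> ?S"
    proof -
      have "T i \<in> atom_terms \<phi>" unfolding atoms using i by blast
      moreover have "delta_pow (ns ! i) (Var i) \<in> subterms (T i)" unfolding T_def by (rule subterms_self)
      ultimately show ?thesis by blast
    qed
    then have "Max ?S = ns ! i" using s by (intro Max_eqI) (auto intro: finite_subset)
    then show "delta_ord k \<phi> ! i = ns ! i" unfolding delta_ord_def using i by simp
  qed
  \<comment> \<open>The translation of source formulas undoes \<open>g\<close> and
    \<open>\<sigma>\<close>: \<open>replace_tm\<close> counts the applications of
    \<open>\<delta>\<close> and returns the coordinate, or the element of the orbit, that they came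
    from.\<close>
  have rep: "replace_tm \<delta> ns 0 (tr_tm g \<sigma> t) = t" if "wf_tm PL t" "fv_tm t \<subseteq> {..<tot ns}" "{a. Par a \<in> syms_tm t} \<subseteq> orbits \<delta> B" for t
    using that
  proof (induction t)
    case (Var n)
    then show ?case using co(3)[of n] by (simp add: \<sigma>_def replace_delta_pow)
  next
    case (Fn f ts)
    show ?case
    proof (cases f)
      case (Sym s)
      have "replace_tm \<delta> ns 0 (tr_tm g \<sigma> t) = t" if "t \<in> set ts" for t
      proof (rule Fn.IH[OF that])
        show "wf_tm PL t" using Fn.prems(1) that by simp
        show "fv_tm t \<subseteq> {..<tot ns}" using Fn.prems(2) that by (simp add: UN_subset_iff)
        show "{a. Par a \<in> syms_tm t} \<subseteq> orbits \<delta> B" using Fn.prems(3) that by auto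
      qed
      then have "map (replace_tm \<delta> ns 0) (map (tr_tm g \<sigma>) ts) = ts" by (simp add: map_idI)
      moreover have "tr_tm g \<sigma> (Fn (Sym s) ts) = Fn (Sym (Base s)) (map (tr_tm g \<sigma>) ts)" by (simp add: g_def)
      ultimately show ?thesis unfolding Sym by (simp del: map_map)
    next
      case (Par c)
      then have "ts = []" "c \<in> orbits \<delta> B" using Fn.prems(1,3) by auto
      moreover have "tr_tm g \<sigma> (Fn (Par c) ts) = delta_pow (fst (q c)) (Fn (Par (snd (q c))) [])" by (simp add: g_def)
      ultimately show ?thesis unfolding Par using q by (simp add: replace_delta_pow)
    qed
  qed
  have "replace_fm \<delta> ns (tr_fm g \<sigma> \<psi>) = \<psi>"
  proof (rule replace_tr_fm, rule rep)
    fix t assume t: "t \<in> atom_terms \<psi>"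
    show "wf_tm PL t" by (rule wf_atom_terms[OF \<psi>(1) t])
    show "fv_tm t \<subseteq> {..<tot ns}" using \<psi>(3) t unfolding fv_atom_terms[OF \<psi>(4)] by blast
    show "{a. Par a \<in> syms_tm t} \<subseteq> orbits \<delta> B" using \<psi>(2) t unfolding params_def syms_atom_terms[of \<psi>] by blast
  qed
  then have "sat PS ((!) u) (replace_fm \<delta> ns \<phi>) \<longleftrightarrow> sat PS ((!) u) \<psi>" for u
    unfolding \<phi>_def replace_pad pad_simps by simp
  then have src: "source_set S \<delta> k \<phi> = K"
    unfolding source_set_def ord jet_space_def using \<psi>(5,6) by auto
  have "sat DS ((!) x) \<phi> \<longleftrightarrow> jet \<delta> ns x \<in> K" if x: "length x = k" for x
  proof -
    have "sat DS ((!) x) (tr_fm g \<sigma> \<psi>) \<longleftrightarrow> sat PS ((!) (jet \<delta> ns x)) \<psi>"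
    proof (rule sat_tr_fm[OF \<psi>(4), of id])
      fix n assume "n \<in> fv_fm \<psi>"
      then have "n < tot ns" using \<psi>(3) by blast
      then show "eval_tm DS ((!) x) (\<sigma> n) = id (jet \<delta> ns x ! n)"
        using x l by (simp add: \<sigma>_def jet_coords case_prod_beta)
    next
      fix f ts xs assume f: "f \<in> syms_fm \<psi>" and ts: "map (eval_tm DS ((!) x)) ts = map id xs"
      show "eval_tm DS ((!) x) (g f ts) = id (fint PS f xs)"
      proof (cases f)
        case (Par c)
        then have "c \<in> orbits \<delta> B" using f \<psi>(2) unfolding params_def by blast
        then show ?thesis unfolding Par g_def using q by simp
      qed (use ts in \<open>simp add: g_def\<close>)
    qed simp_all
    then show ?thesis unfolding \<phi>_def pad_simps using \<psi>(5)[of "jet \<delta> ns x"] by simp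
  qed
  then have "defined_set (delta_struct S \<delta>) k \<phi> = J.realize k ns K"
    unfolding defined_set_def J.realize_def by auto
  then show thesis using that[OF wf pa fv qf Qn ord src] by blast
qed

lemma PD_definable:
  assumes "DB n Z" "J.PD n Z f"
  shows "definable_fun L S UNIV n Z f \<and> cont_on Z f \<and> Cp_on L S p n Z f"
proof (intro conjI)
  have f: "J.B.df n f" "J.CpX n Z f" using assms(2) unfolding J.PD_def by auto
  show "definable_fun L S UNIV n Z f" by (rule definable_funI[OF J.sub[OF assms(1)] J.df_sub[OF f(1)]])
  show "cont_on Z f" by (rule J.PD_cont_on[OF assms(2)])
  obtain U F where "euclidean_open n U" "definable L S UNIV n U" "Z \<subseteq> U" "J.M.df n F" "Cp_open n p U F" "\<forall>x\<in>Z. F x = f x"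
    using f(2) unfolding J.CpX_def by (elim exE conjE) (rule that)
  then show "Cp_on L S p n Z f" unfolding Cp_on_def using definable_funI[of n U F] by blast
qed

lemma cellp_Cp_cell:
  assumes "J.cellp n K" shows "cell L S n K" "Cp_cell L S p n K"
proof -
  let ?P = "\<lambda>n Z f. definable_fun L S UNIV n Z f \<and> cont_on Z f \<and> Cp_on L S p n Z f"
  have *: "rel_cell ?P 0 {[]} bs C" if "rel_cell J.PD 0 {[]} bs C" for bs C
    using that
  proof (induction bs arbitrary: C)
    case (Cons b bs)
    then obtain C' where C': "rel_cell J.PD 0 {[]} bs C'" "cell_over J.PD (0 + length bs) b C' C" by auto
    have D: "DB (0 + length bs) C'" by (rule J.D_rel_cell[OF C'(1) J.D_point])
    have "cell_over ?P (0 + length bs) b C' C" by (rule cell_over_mono[OF C'(2)]) (rule PD_definable[OF D])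
    then show ?case using Cons.IH[OF C'(1)] by auto
  qed simp
  obtain bs where bs: "length bs = n" "rel_cell J.PD 0 {[]} bs K" using assms unfolding J.cellp_def by blast
  show "Cp_cell L S p n K" unfolding Cp_cell_def using rel_cell_gen_cell[OF *[OF bs(2)]] bs(1) by blast
  have "rel_cell (\<lambda>n Z f. definable_fun L S UNIV n Z f \<and> cont_on Z f) 0 {[]} bs K"
    by (rule rel_cell_mono[OF *[OF bs(2)]]) blast
  then show "cell L S n K" unfolding cell_def cell_dim_def using rel_cell_gen_cell bs(1) by blast
qed

lemma realize_source_formula:
  assumes "length ns = k" "J.cellp (tot ns) K" "J.dense_jets k ns K"
  shows "\<exists>\<phi>. source_formula L S \<delta> B k \<phi> (J.realize k ns K) \<and> Cp_cell L S p (source_dim k \<phi>) (source_set S \<delta> k \<phi>)"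
    "definable (delta_lang L) (delta_struct S \<delta>) B k (J.realize k ns K)"
proof -
  obtain \<phi> where \<phi>: "wf_fm DL \<phi>" "params \<phi> \<subseteq> B" "fv_fm \<phi> \<subseteq> {..<k}" "quantifier_free \<phi>"
    "\<And>t. t \<in> atom_terms \<phi> ==> delta_normal_tm t" "delta_ord k \<phi> = ns" "source_set S \<delta> k \<phi> = K"
    "defined_set (delta_struct S \<delta>) k \<phi> = J.realize k ns K"
    by (rule source_formulaE[OF J.D_cellp[OF assms(2)] assms(1)]) (rule that)
  have d: "source_dim k \<phi> = tot ns" unfolding source_dim_def \<phi>(6) ..
  have dense: "euclidean_dense (jet \<delta> ns ` J.realize k ns K) K"
    unfolding euclidean_dense_def
  proof (intro conjI ballI allI impI)
    show "jet \<delta> ns ` J.realize k ns K \<subseteq> K" unfolding J.realize_def by blast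
    fix u \<epsilon> assume "u \<in> K" "(0::'a) < \<epsilon>"
    then obtain x where "length x = k" "jet \<delta> ns x \<in> K" "near \<epsilon> u (jet \<delta> ns x)"
      using assms(3) unfolding J.dense_jets_def by blast
    then show "\<exists>y\<in>jet \<delta> ns ` J.realize k ns K. near \<epsilon> u y" unfolding J.realize_def by blast
  qed
  have "source_formula L S \<delta> B k \<phi> (J.realize k ns K)"
    unfolding source_formula_def \<phi>(6,7) d using \<phi>(1-5,8) dense cellp_Cp_cell(1)[OF assms(2)] by simp
  then show "\<exists>\<phi>. source_formula L S \<delta> B k \<phi> (J.realize k ns K) \<and> Cp_cell L S p (source_dim k \<phi>) (source_set S \<delta> k \<phi>)"
    using cellp_Cp_cell(2)[OF assms(2)] d \<phi>(7) by (intro exI[of _ \<phi>]) simp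
  show "definable (delta_lang L) (delta_struct S \<delta>) B k (J.realize k ns K)"
    unfolding definable_def using \<phi>(1,2,3,8) by (intro exI[of _ \<phi>]) simp
qed

lemma jet_family_partition:
  assumes "J.jet_decomposition (Suc k) \<D>"
  shows "finite \<D> \<and> (\<forall>E\<in>\<D>. delta_cell L S \<delta> B (Suc k) E) \<and> partition_on (pow (Suc k)) \<D>"
proof -
  obtain ns \<K> where K: "J.jet_family (Suc k) ns \<K>" "\<D> = J.realize (Suc k) ns ` \<K>"
    using assms unfolding J.jet_decomposition.simps by blast
  have F: "length ns = Suc k" "finite \<K>" "disjoint \<K>" "\<And>C. C \<in> \<K> ==> J.cellp (tot ns) C"
    "\<And>C. C \<in> \<K> ==> J.dense_jets (Suc k) ns C" "\<And>x. length x = Suc k ==> jet \<delta> ns x \<in> \<Union>\<K>"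
    using K(1) unfolding J.jet_family_def by auto
  have "delta_cell L S \<delta> B (Suc k) E" if ED: "E \<in> \<D>" for E
  proof -
    obtain C where C: "C \<in> \<K>" "E = J.realize (Suc k) ns C" using ED unfolding K(2) by blast
    show ?thesis unfolding delta_cell_def C(2)
      using realize_source_formula(1)[OF F(1) F(4)[OF C(1)] F(5)[OF C(1)]] by blast
  qed
  moreover have "partition_on (pow (Suc k)) \<D>"
    unfolding partition_on_def
  proof (intro conjI)
    show "\<Union>\<D> = pow (Suc k)"
    proof (intro equalityI subsetI)
      fix x :: "'a list" assume "x \<in> pow (Suc k)"
      then have x: "length x = Suc k" by simp
      then obtain C where "C \<in> \<K>" "jet \<delta> ns x \<in> C" using F(6)[OF x] by blast
      then show "x \<in> \<Union>\<D>" unfolding K(2) J.realize_def using x by blast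
    qed (auto simp: K(2) J.realize_def)
    show "disjoint \<D>"
    proof (rule disjointI, rule ccontr)
      fix a b assume ab: "a \<in> \<D>" "b \<in> \<D>" "a \<noteq> b" "a \<inter> b \<noteq> {}"
      obtain C1 C2 where C: "C1 \<in> \<K>" "a = J.realize (Suc k) ns C1" "C2 \<in> \<K>" "b = J.realize (Suc k) ns C2"
        using ab(1,2) unfolding K(2) by blast
      obtain x where "x \<in> a" "x \<in> b" using ab(4) by blast
      then have "jet \<delta> ns x \<in> C1" "jet \<delta> ns x \<in> C2" unfolding C(2,4) J.realize_def by auto
      then have "C1 = C2" using disjointD[OF F(3) C(1,3)] by blast
      then show False using ab(3) C(2,4) by simp
    qed
    show "{} \<notin> \<D>"
    proof
      assume "{} \<in> \<D>"
      then obtain C where C: "C \<in> \<K>" "J.realize (Suc k) ns C = {}" unfolding K(2) by force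
      obtain u where "u \<in> C" using J.cellp_nonempty[OF F(4)[OF C(1)]] by blast
      then obtain x where "length x = Suc k" "jet \<delta> ns x \<in> C"
        using F(5)[OF C(1)] zero_less_one unfolding J.dense_jets_def by blast
      then show False using C(2) unfolding J.realize_def by blast
    qed
  qed
  ultimately show ?thesis using F(2) unfolding K(2) by simp
qed

lemma jet_decomposition_delta:
  "J.jet_decomposition (Suc k) \<D> ==> delta_decomposition L S \<delta> B (Suc k) \<D>"
proof (induction k arbitrary: \<D>)
  case 0
  then show ?case using jet_family_partition[of 0] by (subst delta_decomposition.simps) simp
next
  case (Suc k)
  have "J.jet_decomposition (Suc k) ((\<lambda>E. take (Suc k) ` E) ` \<D>)"
    using Suc.prems unfolding J.jet_decomposition.simps(2)[of "Suc k"] by blast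
  from Suc.IH[OF this] show ?case using jet_family_partition[OF Suc.prems] by (subst delta_decomposition.simps) simp
qed

theorem delta_decomposition_exists:
  assumes "k \<ge> 1" "finite \<A>" "\<forall>A\<in>\<A>. definable (delta_lang L) (delta_struct S \<delta>) B k A"
  shows "\<exists>\<D>. delta_decomposition L S \<delta> B k \<D> \<and>
           (\<forall>D\<in>\<D>. definable (delta_lang L) (delta_struct S \<delta>) B k D) \<and>
           (\<forall>D\<in>\<D>. \<forall>A\<in>\<A>. D \<subseteq> A \<or> D \<inter> A = {}) \<and>
           (\<forall>D\<in>\<D>. \<exists>\<phi>. source_formula L S \<delta> B k \<phi> D \<and>
              Cp_cell L S p (source_dim k \<phi>) (source_set S \<delta> k \<phi>))"
proof -
  have "\<forall>A\<in>\<A>. \<exists>m. \<exists>A'. length m = k \<and> DB (tot m) A' \<and> (\<forall>x. length x = k --> (x \<in> A \<longleftrightarrow> jet \<delta> m x \<in> A'))"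
    using delta_definable_jet_set assms(3) unfolding jet_set_def by blast
  from bchoice[OF this] obtain m where "\<forall>A\<in>\<A>. \<exists>A'. length (m A) = k \<and> DB (tot (m A)) A' \<and> (\<forall>x. length x = k --> (x \<in> A \<longleftrightarrow> jet \<delta> (m A) x \<in> A'))"
    by (elim exE)
  from bchoice[OF this] obtain s where s: "\<forall>A\<in>\<A>. length (m A) = k \<and> DB (tot (m A)) (s A) \<and> (\<forall>x. length x = k --> (x \<in> A \<longleftrightarrow> jet \<delta> (m A) x \<in> s A))"
    by (elim exE)
  \<comment> \<open>The given sets are conditions on jets of different orders, which are first
    brought to common orders.\<close>
  have "\<exists>ns. length ns = k \<and> (\<forall>t\<in>m ` \<A>. le_ord t ns)" by (rule le_ord_bound) (use assms(2) s in auto)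
  then obtain ns where ns: "length ns = k" "\<And>A. A \<in> \<A> ==> le_ord (m A) ns" by auto
  let ?\<A> = "(\<lambda>A. J.pull (m A) ns (s A)) ` \<A>"
  have "\<exists>ns' \<K>. le_ord ns ns' \<and> J.jet_family k ns' \<K> \<and> (\<forall>K\<in>\<K>. \<forall>A\<in>?\<A>. K \<subseteq> J.pull ns ns' A \<or> K \<inter> J.pull ns ns' A = {}) \<and>
     J.jet_decomposition k (J.realize k ns' ` \<K>)"
  proof (rule J.jet_decomposition_exists[OF ns(1)])
    show "finite ?\<A>" using assms(2) by simp
    show "DB (tot ns) A'" if A': "A' \<in> ?\<A>" for A'
    proof -
      obtain A where A: "A \<in> \<A>" "A' = J.pull (m A) ns (s A)" using A' by blast
      show ?thesis unfolding A(2) by (rule D_pull[OF _ ns(2)[OF A(1)]]) (use s A(1) in blast)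
    qed
  qed
  then obtain ns' \<K> where K: "le_ord ns ns'" "J.jet_family k ns' \<K>"
    "\<forall>K\<in>\<K>. \<forall>A\<in>?\<A>. K \<subseteq> J.pull ns ns' A \<or> K \<inter> J.pull ns ns' A = {}" "J.jet_decomposition k (J.realize k ns' ` \<K>)"
    by (elim exE conjE) (rule that)
  have F: "length ns' = k" "\<And>C. C \<in> \<K> ==> J.cellp (tot ns') C" "\<And>C. C \<in> \<K> ==> J.dense_jets k ns' C"
    using K(2) unfolding J.jet_family_def by auto
  obtain k' where k': "k = Suc k'" using assms(1) by (cases k) auto
  have compat: "J.realize k ns' C \<subseteq> A \<or> J.realize k ns' C \<inter> A = {}" if CA: "C \<in> \<K>" "A \<in> \<A>" for C A
  proof -
    have x: "x \<in> A \<longleftrightarrow> jet \<delta> ns' x \<in> J.pull ns ns' (J.pull (m A) ns (s A))" if "length x = k" for x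
      using jet_pull[OF K(1), of x "J.pull (m A) ns (s A)"] jet_pull[OF ns(2)[OF CA(2)], of x "s A"] s CA(2) that ns(1) by simp
    have "C \<subseteq> J.pull ns ns' (J.pull (m A) ns (s A)) \<or> C \<inter> J.pull ns ns' (J.pull (m A) ns (s A)) = {}"
      using K(3) CA by blast
    then show ?thesis
    proof
      assume "C \<subseteq> J.pull ns ns' (J.pull (m A) ns (s A))"
      then have "J.realize k ns' C \<subseteq> A" unfolding J.realize_def using x by blast
      then show ?thesis ..
    next
      assume "C \<inter> J.pull ns ns' (J.pull (m A) ns (s A)) = {}"
      then have "J.realize k ns' C \<inter> A = {}" unfolding J.realize_def using x by blast
      then show ?thesis ..
    qed
  qed
  show ?thesis
  proof (intro exI[of _ "J.realize k ns' ` \<K>"] conjI ballI)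
    show "delta_decomposition L S \<delta> B k (J.realize k ns' ` \<K>)" using K(4) unfolding k' by (rule jet_decomposition_delta)
    fix E assume "E \<in> J.realize k ns' ` \<K>"
    then obtain C where C: "C \<in> \<K>" "E = J.realize k ns' C" by blast
    show "definable (delta_lang L) (delta_struct S \<delta>) B k E" unfolding C(2) by (rule realize_source_formula(2)[OF F(1) F(2)[OF C(1)] F(3)[OF C(1)]])
    show "\<exists>\<phi>. source_formula L S \<delta> B k \<phi> E \<and> Cp_cell L S p (source_dim k \<phi>) (source_set S \<delta> k \<phi>)"
      unfolding C(2) by (rule realize_source_formula(1)[OF F(1) F(2)[OF C(1)] F(3)[OF C(1)]])
    show "E \<subseteq> A \<or> E \<inter> A = {}" if "A \<in> \<A>" for A unfolding C(2) by (rule compat[OF C(1) that])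
  qed
qed

end

theorem theorem3p2:
  fixes L :: "('f, 'r) ord_ring_lang"
    and T :: "('f, 'r) fm set"
    and S :: "('a::linordered_field, 'f, 'r) struct"
    and \<delta> :: "'a \<Rightarrow> 'a"
    and B :: "'a set"
    and p k :: nat
    and \<A> :: "'a list set set"
  assumes "expands_ord_ring_lang L"
    and "complete_theory TYPE('a + ('f, 'r) fm) L T"
    and "o_minimal_rcf_theory TYPE('a + ('f, 'r) fm) L T"
    and "has_QE TYPE('a + ('f, 'r) fm) L T"
    and "universally_axiomatizable TYPE('a + ('f, 'r) fm) L T"
    and "model_Tg_delta L T S \<delta>"
    and "k \<ge> 1"
    and "finite \<A>"
    and "\<forall>A\<in>\<A>. definable (delta_lang L) (delta_struct S \<delta>) B k A"
  shows "\<exists>\<D>. delta_decomposition L S \<delta> B k \<D> \<and>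
           (\<forall>D\<in>\<D>. definable (delta_lang L) (delta_struct S \<delta>) B k D) \<and>
           (\<forall>D\<in>\<D>. \<forall>A\<in>\<A>. D \<subseteq> A \<or> D \<inter> A = {}) \<and>
           (\<forall>D\<in>\<D>. \<exists>\<phi>. source_formula L S \<delta> B k \<phi> D \<and>
              Cp_cell L S p (source_dim k \<phi>) (source_set S \<delta> k \<phi>))"
proof -
  have M: "is_model L T S" "on_ordered_field L S" "T_derivation L S \<delta>" "generic_derivation L S \<delta>"
    using assms(6) unfolding model_Tg_delta_def by auto
  have U: "univ S = UNIV" using M(2) unfolding on_ordered_field_def by blast
  have qe: "\<exists>\<psi>. wf_fm L \<psi> \<and> quantifier_free \<psi> \<and> fv_fm \<psi> \<subseteq> fv_fm \<phi> \<and> (\<forall>e. sat S e \<phi> \<longleftrightarrow> sat S e \<psi>)"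
    if "wf_fm L \<phi>" for \<phi> by (rule has_QE_UNIV[OF assms(4) M(1) U that])
  \<comment> \<open>O-minimality is assumed for models in the larger type, so it is first obtained
    for the copy of \<open>S\<close>.\<close>
  have "is_model L T (emb_struct S :: ('a + ('f, 'r) fm, 'f, 'r) struct)" by (rule is_model_emb[OF M(1) U])
  then have emb: "o_minimal L (emb_struct S :: ('a + ('f, 'r) fm, 'f, 'r) struct)"
    using assms(3) unfolding o_minimal_rcf_theory_def by blast
  have om: "o_minimal L S" by (rule o_minimal_emb[OF _ emb U]) (rule qe)
  interpret tame_jets L S \<delta> B p
    by (intro tame_jets.intro tame_derivation.intro tame.intro tame_derivation_axioms.intro assms(1) M qe om)
  show ?thesis by (rule delta_decomposition_exists[OF assms(7-9)])
qed

end
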